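(* Let $(\mathcal V,\mathcal E)$ be a finite connected directed graph with at least one boundary vertex ($\mathcal V_\partial\neq\emptyset$), with edge lengths $0<l^e<\infty$ for $e\in\mathcal E$, and let $a,b,c\in L^2(\mathcal E)$ satisfy $C_0\le a,b,c\le C_1$ a.e. on $\mathcal E$ for some constants $C_0,C_1>0$. There exist constants $C,\gamma>0$, with $C$ depending only on the network geometry and topology and on the bounds $C_0,C_1$, such that the following holds for every $T>0$. Let $V_h=P_1(T_h(\mathcal E))\cap H(\mathrm{div})$ and $Q_h=P_0(T_h(\mathcal E))$ be the finite element spaces over a mesh $T_h(\mathcal E)$ with global mesh size $h$. Let $(u,p)\in C^1([0,T];L^2\times L^2)\cap C([0,T];H(\mathrm{div})\times H^1_0)$ be the solution of $$c\,\partial_tu+\partial_x'p+au=f,\qquad b\,\partial_tp+\partial_x'u=g\qquad\text{on }\mathcal E,\ t>0,\qquad u(0)=u_0,\ p(0)=p_0,$$ with $u_0\in H(\mathrm{div})$, $p_0\in H^1_0$, $f,g\in W^{1,1}(0,T;L^2(\mathcal E))$, and let $(u_h,p_h)\in H^1(0,T;V_h\times Q_h)$ be the solution of the semi-discrete problem $(u_h(0),p_h(0))=\Pi_h(u_0,p_0)$, $$(c\partial_tu_h(t),v_h)_{\mathcal E}-(p_h(t),\partial_x'v_h)_{\mathcal E}+(au_h(t),v_h)_{\mathcal E}=(f(t),v_h)_{\mathcal E},\qquad(b\partial_tp_h(t),q_h)_{\mathcal E}+(\partial_x'u_h(t),q_h)_{\mathcal E}=(g(t),q_h)_{\mathcal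 E}$$ for all $v_h\in V_h$, $q_h\in Q_h$, $t\in[0,T]$. Then for $0\le m\le1$ and all $t\in[0,T]$ $$\|u(t)-u_h(t)\|_{L^2}+\|p(t)-p_h(t)\|_{L^2}\le Ch^m\Big(\|u(t)\|_{H^{m+1}(\mathcal E)}+\|p(t)\|_{H^m(\mathcal E)}+t\sup_{0\le s\le t}e^{-\gamma(t-s)/2}\big(\|\partial_tu(s)\|_{H^{m+1}(\mathcal E)}+\|\partial_tp(s)\|_{H^m(\mathcal E)}\big)\Big),$$ provided that the solution is sufficiently smooth, namely $(u,p)\in C^1([0,T];H^{m+1}(\mathcal E)\times H^m(\mathcal E))$.
   Context: Network notation: $\mathcal E\subset\mathcal V\times\mathcal V$, the two end vertices of each edge being distinct; connectedness ignores edge orientation. $\mathcal E(v)$ is the set of edges having $v$ as an end vertex; $\mathcal V_0=\{v:|\mathcal E(v)|\ge2\}$ are the interior vertices and $\mathcal V_\partial=\mathcal V\setminus\mathcal V_0$ the boundary vertices. For $e\in\mathcal E$: $n^e(v)=-1$ if $e=(v,\cdot)$, $n^e(v)=1$ if $e=(\cdot,v)$, and $n^e(v)=0$ otherwise. Each edge $e=(v_l,v_r)$ is identified with the interval $[0,l^e]$, $v_l$ with $0$ and $v_r$ with $l^e$; for a function $w$ on the network, $w^e=w|_e$ and $w^e(v)$ is the value (trace) of $w^e$ at the endpoint corresponding to $v$. Function spaces: $L^2=L^2(\mathcal E)=\{w: w^e\in L^2(e)\ \forall e\}$ with $(w,z)_{\mathcal E}=\sum_e(w^e,z^e)_{L^2(e)}$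 and norm $\|\cdot\|_{L^2}$; $H^s(\mathcal E)=\{w: w^e\in H^s(e)\ \forall e\}$ with the corresponding broken norm; $\partial_x' w$ is the edgewise derivative, $(\partial_x' w)|_e=\partial_x w^e$. $H^1_0=\{p\in H^1(\mathcal E): p^e(v)=p^{e'}(v)\ \forall e,e'\in\mathcal E(v),v\in\mathcal V_0;\ p^e(v)=0\ \forall v\in\mathcal V_\partial, e\in\mathcal E(v)\}$. $H(\mathrm{div})=\{u\in H^1(\mathcal E):\sum_{e\in\mathcal E(v)}n^e(v)u^e(v)=0\ \forall v\in\mathcal V_0\}$ with norm $\|u\|_{H(\mathrm{div})}^2=\|u\|_{L^2}^2+\|\partial_x'u\|_{L^2}^2$ (same norm on $H^1_0$). Mesh: each edge $e\cong[0,l^e]$ carries a uniform mesh $T_h(e)$ of subintervals of length $h^e$; $T_h(\mathcal E)=\{T_h(e):e\in\mathcal E\}$ and $h=\max_eh^e$. $P_k(T_h(\mathcal E))$ is the space of $w\in L^2(\mathcal E)$ whose restriction to every subinterval is a polynomial of degree $\le k$. Elliptic projection $\Pi_h:H(\mathrm{div})\times L^2\to V_h\times Q_h$: $\Pi_h(u,p)=(\hat u_h,\hat p_h)$ is the unique element of $V_h\times Q_h$ with $(a\hat u_h,v_h)_{\mathcal E}-(\hat p_h,\partial_x'v_h)_{\mathcal E}=(au,v_h)_{\mathcal E}-(p,\partial_x'v_h)_{\mathcal E}$ for all $v_h\in V_h$ and $(\partial_x'\hat u_h,q_h)_{\mathcal E}=(\partial_x'u,q_h)_{\mathcal E}$ for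 all $q_h\in Q_h$. *)

theory Defs
  imports
    "HOL-Analysis.Analysis"
    "HOL-Computational_Algebra.Polynomial"
    "Graph_Theory.Graph_Theory"
begin

section \<open>Metric networks\<close>

text \<open>The edge set is a set of ordered pairs of vertices, so a network is a finite loop-free
  \<^typ>\<open>'v pair_pre_digraph\<close> together with edge lengths. Connectedness in the graph library is strong
  connectedness of the symmetrised digraph, i.e. it ignores edge orientation.\<close>

definition metric_network :: "'v pair_pre_digraph \<Rightarrow> ('v \<times> 'v \<Rightarrow> real) \<Rightarrow> bool" where
  "metric_network G l \<longleftrightarrow>
     pair_digraph G \<and> Digraph_Component.connected (with_proj G) \<and> (\<forall>e\<in>parcs G. 0 < l e)"

definition incident_edges :: "'v pair_pre_digraph \<Rightarrow> 'v \<Rightarrow> ('v \<times> 'v) set" where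
  "incident_edges G v = {e \<in> parcs G. fst e = v \<or> snd e = v}"

definition interior_vertices :: "'v pair_pre_digraph \<Rightarrow> 'v set" where
  "interior_vertices G = {v \<in> pverts G. 2 \<le> card (incident_edges G v)}"

definition boundary_vertices :: "'v pair_pre_digraph \<Rightarrow> 'v set" where
  "boundary_vertices G = pverts G - interior_vertices G"

definition incidence :: "'v \<times> 'v \<Rightarrow> 'v \<Rightarrow> real" where
  "incidence e v = (if v = fst e then - 1 else if v = snd e then 1 else 0)"


section \<open>Sobolev spaces on an interval\<close>

text \<open>Elements of $L^2(0,r)$ are represented by Lebesgue measurable functions on the reals of which
  only the values on the interval matter. All notions below are invariant under changes on
  null sets, and equality of such functions is always meant almost everywhere.\<close>

definition L2_int :: "real \<Rightarrow> (real \<Rightarrow> real) set" where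
  "L2_int r = {w. w \<in> borel_measurable (lebesgue_on {0..r}) \<and>
                  integrable (lebesgue_on {0..r}) (\<lambda>x. (w x)\<^sup>2)}"

text \<open>Test functions in $C^1_c(0,r)$, paired with their derivative. Weak derivatives of locally
  integrable functions tested with $C^1_c$ and with $C^\infty_c$ coincide.\<close>

definition test_function :: "real \<Rightarrow> (real \<Rightarrow> real) \<Rightarrow> (real \<Rightarrow> real) \<Rightarrow> bool" where
  "test_function r \<phi> \<phi>' \<longleftrightarrow>
     (\<forall>x. (\<phi> has_real_derivative \<phi>' x) (at x)) \<and> continuous_on UNIV \<phi>' \<and>
     (\<exists>K. compact K \<and> K \<subseteq> {0<..<r} \<and> (\<forall>x. x \<notin> K \<longrightarrow> \<phi> x = 0))"

definition has_weak_deriv :: "real \<Rightarrow> (real \<Rightarrow> real) \<Rightarrow> (real \<Rightarrow> real) \<Rightarrow> bool" where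
  "has_weak_deriv r w g \<longleftrightarrow> g \<in> L2_int r \<and>
     (\<forall>\<phi> \<phi>'. test_function r \<phi> \<phi>' \<longrightarrow>
        (LINT x|lebesgue_on {0..r}. w x * \<phi>' x) = - (LINT x|lebesgue_on {0..r}. g x * \<phi> x))"

text \<open>A representative of the weak derivative, which is unique up to null sets.\<close>

definition weak_deriv :: "real \<Rightarrow> (real \<Rightarrow> real) \<Rightarrow> real \<Rightarrow> real" where
  "weak_deriv r w = (SOME g. has_weak_deriv r w g)"

text \<open>Squared Sobolev--Slobodeckij (Gagliardo) seminorm of order $0 < \sigma < 1$.\<close>

definition slob_integrand :: "real \<Rightarrow> (real \<Rightarrow> real) \<Rightarrow> real \<times> real \<Rightarrow> real" where
  "slob_integrand \<sigma> w = (\<lambda>(x, y). (w x - w y)\<^sup>2 / \<bar>x - y\<bar> powr (1 + 2 * \<sigma>))"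

definition slob_integrable :: "real \<Rightarrow> real \<Rightarrow> (real \<Rightarrow> real) \<Rightarrow> bool" where
  "slob_integrable \<sigma> r w \<longleftrightarrow>
     integrable (lebesgue_on {0..r} \<Otimes>\<^sub>M lebesgue_on {0..r}) (slob_integrand \<sigma> w)"

definition slob_sq :: "real \<Rightarrow> real \<Rightarrow> (real \<Rightarrow> real) \<Rightarrow> real" where
  "slob_sq \<sigma> r w =
     (LINT z|(lebesgue_on {0..r} \<Otimes>\<^sub>M lebesgue_on {0..r}). slob_integrand \<sigma> w z)"

text \<open>$H^{k+\sigma}(0,r)$ for an integer $k$ and $0 \le \sigma < 1$, with its squared norm
  $\sum_{j \le k} \|w^{(j)}\|^2 + |w^{(k)}|_\sigma^2$, the last term being absent for $\sigma = 0$.\<close>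

fun Hks :: "nat \<Rightarrow> real \<Rightarrow> real \<Rightarrow> (real \<Rightarrow> real) set" where
  "Hks 0 \<sigma> r = {w \<in> L2_int r. 0 < \<sigma> \<longrightarrow> slob_integrable \<sigma> r w}"
| "Hks (Suc k) \<sigma> r = {w \<in> L2_int r. (\<exists>g. has_weak_deriv r w g) \<and> weak_deriv r w \<in> Hks k \<sigma> r}"

fun Hks_sq :: "nat \<Rightarrow> real \<Rightarrow> real \<Rightarrow> (real \<Rightarrow> real) \<Rightarrow> real" where
  "Hks_sq 0 \<sigma> r w = (LINT x|lebesgue_on {0..r}. (w x)\<^sup>2) + (if 0 < \<sigma> then slob_sq \<sigma> r w else 0)"
| "Hks_sq (Suc k) \<sigma> r w = (LINT x|lebesgue_on {0..r}. (w x)\<^sup>2) + Hks_sq k \<sigma> r (weak_deriv r w)"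

definition Hs_int :: "real \<Rightarrow> real \<Rightarrow> (real \<Rightarrow> real) set" where
  "Hs_int s r = Hks (nat \<lfloor>s\<rfloor>) (frac s) r"

definition Hs_int_sq :: "real \<Rightarrow> real \<Rightarrow> (real \<Rightarrow> real) \<Rightarrow> real" where
  "Hs_int_sq s r w = Hks_sq (nat \<lfloor>s\<rfloor>) (frac s) r w"

text \<open>Point value at \<open>x\<close> of the continuous representative of \<open>w\<close>.\<close>

definition trace_at :: "real \<Rightarrow> (real \<Rightarrow> real) \<Rightarrow> real \<Rightarrow> real" where
  "trace_at r w x = (THE y. \<exists>w'. continuous_on {0..r} w' \<and>
     (AE z in lebesgue_on {0..r}. w z = w' z) \<and> y = w' x)"


section \<open>Function spaces on a network\<close>

type_synonym 'v netfun = "'v \<times> 'v \<Rightarrow> real \<Rightarrow> real"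

definition net_diff :: "'v netfun \<Rightarrow> 'v netfun \<Rightarrow> 'v netfun" where
  "net_diff w z = (\<lambda>e x. w e x - z e x)"

definition net_mult :: "'v netfun \<Rightarrow> 'v netfun \<Rightarrow> 'v netfun" where
  "net_mult w z = (\<lambda>e x. w e x * z e x)"

definition net_scale :: "real \<Rightarrow> 'v netfun \<Rightarrow> 'v netfun" where
  "net_scale r w = (\<lambda>e x. r * w e x)"

definition net_deriv :: "('v \<times> 'v \<Rightarrow> real) \<Rightarrow> 'v netfun \<Rightarrow> 'v netfun" where
  "net_deriv l w = (\<lambda>e. weak_deriv (l e) (w e))"

definition net_eq :: "'v pair_pre_digraph \<Rightarrow> ('v \<times> 'v \<Rightarrow> real) \<Rightarrow> 'v netfun \<Rightarrow> 'v netfun \<Rightarrow> bool" where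
  "net_eq G l w z \<longleftrightarrow> (\<forall>e\<in>parcs G. AE x in lebesgue_on {0..l e}. w e x = z e x)"

definition L2_net :: "'v pair_pre_digraph \<Rightarrow> ('v \<times> 'v \<Rightarrow> real) \<Rightarrow> 'v netfun set" where
  "L2_net G l = {w. \<forall>e\<in>parcs G. w e \<in> L2_int (l e)}"

definition ip_net :: "'v pair_pre_digraph \<Rightarrow> ('v \<times> 'v \<Rightarrow> real) \<Rightarrow> 'v netfun \<Rightarrow> 'v netfun \<Rightarrow> real" where
  "ip_net G l w z = (\<Sum>e\<in>parcs G. LINT x|lebesgue_on {0..l e}. w e x * z e x)"

definition L2_norm :: "'v pair_pre_digraph \<Rightarrow> ('v \<times> 'v \<Rightarrow> real) \<Rightarrow> 'v netfun \<Rightarrow> real" where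
  "L2_norm G l w = sqrt (ip_net G l w w)"

definition Hs_net :: "real \<Rightarrow> 'v pair_pre_digraph \<Rightarrow> ('v \<times> 'v \<Rightarrow> real) \<Rightarrow> 'v netfun set" where
  "Hs_net s G l = {w. \<forall>e\<in>parcs G. w e \<in> Hs_int s (l e)}"

definition Hs_norm :: "real \<Rightarrow> 'v pair_pre_digraph \<Rightarrow> ('v \<times> 'v \<Rightarrow> real) \<Rightarrow> 'v netfun \<Rightarrow> real" where
  "Hs_norm s G l w = sqrt (\<Sum>e\<in>parcs G. Hs_int_sq s (l e) (w e))"

text \<open>The edge $e = (v_l, v_r)$ is $[0, l^e]$ with $v_l$ at $0$ and $v_r$ at $l^e$; only used for
  end vertices \<open>v\<close> of \<open>e\<close>.\<close>

definition end_value :: "('v \<times> 'v \<Rightarrow> real) \<Rightarrow> 'v netfun \<Rightarrow> 'v \<times> 'v \<Rightarrow> 'v \<Rightarrow> real" where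
  "end_value l w e v = trace_at (l e) (w e) (if v = fst e then 0 else l e)"

definition H10_net :: "'v pair_pre_digraph \<Rightarrow> ('v \<times> 'v \<Rightarrow> real) \<Rightarrow> 'v netfun set" where
  "H10_net G l = {p \<in> Hs_net 1 G l.
     (\<forall>v\<in>interior_vertices G. \<forall>e\<in>incident_edges G v. \<forall>e'\<in>incident_edges G v.
        end_value l p e v = end_value l p e' v) \<and>
     (\<forall>v\<in>boundary_vertices G. \<forall>e\<in>incident_edges G v. end_value l p e v = 0)}"

definition Hdiv_net :: "'v pair_pre_digraph \<Rightarrow> ('v \<times> 'v \<Rightarrow> real) \<Rightarrow> 'v netfun set" where
  "Hdiv_net G l = {u \<in> Hs_net 1 G l.
     \<forall>v\<in>interior_vertices G. (\<Sum>e\<in>incident_edges G v. incidence e v * end_value l u e v) = 0}"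

definition Hdiv_norm :: "'v pair_pre_digraph \<Rightarrow> ('v \<times> 'v \<Rightarrow> real) \<Rightarrow> 'v netfun \<Rightarrow> real" where
  "Hdiv_norm G l u = sqrt ((L2_norm G l u)\<^sup>2 + (L2_norm G l (net_deriv l u))\<^sup>2)"

definition bounded_coeff ::
  "'v pair_pre_digraph \<Rightarrow> ('v \<times> 'v \<Rightarrow> real) \<Rightarrow> real \<Rightarrow> real \<Rightarrow> 'v netfun \<Rightarrow> bool" where
  "bounded_coeff G l C0 C1 a \<longleftrightarrow> a \<in> L2_net G l \<and>
     (\<forall>e\<in>parcs G. AE x in lebesgue_on {0..l e}. C0 \<le> a e x \<and> a e x \<le> C1)"


section \<open>Time-dependent functions\<close>

text \<open>In this section \<open>X\<close> is a space of network functions and \<open>nrm\<close> its norm.\<close>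

definition C0_time :: "real \<Rightarrow> 'v netfun set \<Rightarrow> ('v netfun \<Rightarrow> real) \<Rightarrow> (real \<Rightarrow> 'v netfun) \<Rightarrow> bool" where
  "C0_time T X nrm u \<longleftrightarrow> (\<forall>t\<in>{0..T}. u t \<in> X \<and>
     ((\<lambda>s. nrm (net_diff (u s) (u t))) \<longlongrightarrow> 0) (at t within {0..T}))"

text \<open>$u \in C^1([0,T];X)$ with time derivative \<open>du\<close> (one-sided at the end points).\<close>

definition C1_time :: "real \<Rightarrow> 'v netfun set \<Rightarrow> ('v netfun \<Rightarrow> real) \<Rightarrow>
    (real \<Rightarrow> 'v netfun) \<Rightarrow> (real \<Rightarrow> 'v netfun) \<Rightarrow> bool" where
  "C1_time T X nrm u du \<longleftrightarrow> C0_time T X nrm u \<and> C0_time T X nrm du \<and>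
     (\<forall>t\<in>{0..T}. ((\<lambda>s. nrm (net_diff (net_scale (1 / (s - t)) (net_diff (u s) (u t))) (du t)))
        \<longlongrightarrow> 0) (at t within {0..T}))"

text \<open>Bochner integral over $(0,T)$: \<open>f\<close> is approximated in $L^1(0,T;X)$ by \<open>X\<close>-valued simple functions
  $s_k = \sum_{i<n_k} 1_{A_{k,i}} w_{k,i}$, whose integrals $\sum_{i<n_k} |A_{k,i}| w_{k,i}$ converge
  to \<open>I\<close>.\<close>

definition simple_time :: "nat \<Rightarrow> (nat \<Rightarrow> real set) \<Rightarrow> (nat \<Rightarrow> 'v netfun) \<Rightarrow> real \<Rightarrow> 'v netfun" where
  "simple_time n A w t = (\<lambda>e x. \<Sum>i<n. indicat_real (A i) t * w i e x)"

definition simple_time_integral :: "nat \<Rightarrow> (nat \<Rightarrow> real set) \<Rightarrow> (nat \<Rightarrow> 'v netfun) \<Rightarrow> 'v netfun" where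
  "simple_time_integral n A w = (\<lambda>e x. \<Sum>i<n. measure lebesgue (A i) * w i e x)"

definition has_time_integral :: "real \<Rightarrow> 'v netfun set \<Rightarrow> ('v netfun \<Rightarrow> real) \<Rightarrow>
    (real \<Rightarrow> 'v netfun) \<Rightarrow> 'v netfun \<Rightarrow> bool" where
  "has_time_integral T X nrm f I \<longleftrightarrow> I \<in> X \<and> (\<forall>t\<in>{0..T}. f t \<in> X) \<and>
     (\<exists>n A w.
        (\<forall>k. \<forall>i<n k. A k i \<in> sets lebesgue \<and> A k i \<subseteq> {0..T} \<and> w k i \<in> X) \<and>
        (\<forall>k. (\<lambda>t. nrm (net_diff (f t) (simple_time (n k) (A k) (w k) t)))
               \<in> borel_measurable (lebesgue_on {0..T})) \<and>
        (\<lambda>k. \<integral>\<^sup>+t. ennreal (nrm (net_diff (f t) (simple_time (n k) (A k) (w k) t)))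
               \<partial>lebesgue_on {0..T}) \<longlonglongrightarrow> 0 \<and>
        (\<lambda>k. nrm (net_diff (simple_time_integral (n k) (A k) (w k)) I)) \<longlonglongrightarrow> 0)"

text \<open>$L^q(0,T;X)$ for $1 \le q < \infty$; since the interval is bounded, its elements are the
  Bochner integrable functions whose norm is $q$-integrable.\<close>

definition Lq_time :: "nat \<Rightarrow> real \<Rightarrow> 'v netfun set \<Rightarrow> ('v netfun \<Rightarrow> real) \<Rightarrow>
    (real \<Rightarrow> 'v netfun) \<Rightarrow> bool" where
  "Lq_time q T X nrm f \<longleftrightarrow> (\<exists>I. has_time_integral T X nrm f I) \<and>
     integrable (lebesgue_on {0..T}) (\<lambda>t. nrm (f t) ^ q)"

text \<open>$f \in W^{1,q}(0,T;X)$ with weak time derivative \<open>df\<close>. As point values in time are used, such a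
  function is identified with its continuous representative.\<close>

definition W1q_time :: "nat \<Rightarrow> real \<Rightarrow> 'v netfun set \<Rightarrow> ('v netfun \<Rightarrow> real) \<Rightarrow>
    (real \<Rightarrow> 'v netfun) \<Rightarrow> (real \<Rightarrow> 'v netfun) \<Rightarrow> bool" where
  "W1q_time q T X nrm f df \<longleftrightarrow> C0_time T X nrm f \<and> Lq_time q T X nrm f \<and> Lq_time q T X nrm df \<and>
     (\<forall>\<phi> \<phi>'. test_function T \<phi> \<phi>' \<longrightarrow>
        (\<exists>I. has_time_integral T X nrm (\<lambda>t. net_scale (\<phi>' t) (f t)) I \<and>
             has_time_integral T X nrm (\<lambda>t. net_scale (\<phi> t) (df t)) (net_scale (- 1) I)))"


section \<open>Finite element spaces and the elliptic projection\<close>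

text \<open>A uniform mesh is given by the number \<open>N e\<close> of subintervals on each edge \<open>e\<close>.\<close>

definition network_mesh :: "'v pair_pre_digraph \<Rightarrow> ('v \<times> 'v \<Rightarrow> nat) \<Rightarrow> bool" where
  "network_mesh G N \<longleftrightarrow> (\<forall>e\<in>parcs G. 0 < N e)"

definition edge_mesh_size :: "('v \<times> 'v \<Rightarrow> real) \<Rightarrow> ('v \<times> 'v \<Rightarrow> nat) \<Rightarrow> 'v \<times> 'v \<Rightarrow> real" where
  "edge_mesh_size l N e = l e / real (N e)"

definition mesh_size ::
  "'v pair_pre_digraph \<Rightarrow> ('v \<times> 'v \<Rightarrow> real) \<Rightarrow> ('v \<times> 'v \<Rightarrow> nat) \<Rightarrow> real" where
  "mesh_size G l N = Max (edge_mesh_size l N ` parcs G)"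

definition Pk_mesh :: "nat \<Rightarrow> 'v pair_pre_digraph \<Rightarrow> ('v \<times> 'v \<Rightarrow> real) \<Rightarrow> ('v \<times> 'v \<Rightarrow> nat)
    \<Rightarrow> 'v netfun set" where
  "Pk_mesh k G l N = {w \<in> L2_net G l. \<forall>e\<in>parcs G. \<forall>i<N e. \<exists>q :: real poly. degree q \<le> k \<and>
     (AE x in lebesgue_on {real i * edge_mesh_size l N e .. real (Suc i) * edge_mesh_size l N e}.
        w e x = poly q x)}"

definition Vh :: "'v pair_pre_digraph \<Rightarrow> ('v \<times> 'v \<Rightarrow> real) \<Rightarrow> ('v \<times> 'v \<Rightarrow> nat) \<Rightarrow> 'v netfun set" where
  "Vh G l N = Pk_mesh 1 G l N \<inter> Hdiv_net G l"

definition Qh :: "'v pair_pre_digraph \<Rightarrow> ('v \<times> 'v \<Rightarrow> real) \<Rightarrow> ('v \<times> 'v \<Rightarrow> nat) \<Rightarrow> 'v netfun set" where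
  "Qh G l N = Pk_mesh 0 G l N"

text \<open>$(\hat u, \hat p) = \Pi_h(u,p)$, where the defining equations determine the pair up to null sets.\<close>

definition elliptic_projection :: "'v pair_pre_digraph \<Rightarrow> ('v \<times> 'v \<Rightarrow> real) \<Rightarrow> ('v \<times> 'v \<Rightarrow> nat) \<Rightarrow>
    'v netfun \<Rightarrow> 'v netfun \<Rightarrow> 'v netfun \<Rightarrow> 'v netfun \<Rightarrow> 'v netfun \<Rightarrow> bool" where
  "elliptic_projection G l N a u p uhat phat \<longleftrightarrow> uhat \<in> Vh G l N \<and> phat \<in> Qh G l N \<and>
     (\<forall>v\<in>Vh G l N.
        ip_net G l (net_mult a uhat) v - ip_net G l phat (net_deriv l v)
        = ip_net G l (net_mult a u) v - ip_net G l p (net_deriv l v)) \<and>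
     (\<forall>q\<in>Qh G l N. ip_net G l (net_deriv l uhat) q = ip_net G l (net_deriv l u) q)"


section \<open>The damped wave system and its semi-discretisation\<close>

text \<open>\<open>du\<close> and \<open>dp\<close> are the time derivatives of \<open>u\<close> and \<open>p\<close>.\<close>

definition wave_solution :: "'v pair_pre_digraph \<Rightarrow> ('v \<times> 'v \<Rightarrow> real) \<Rightarrow>
    'v netfun \<Rightarrow> 'v netfun \<Rightarrow> 'v netfun \<Rightarrow> real \<Rightarrow> (real \<Rightarrow> 'v netfun) \<Rightarrow> (real \<Rightarrow> 'v netfun) \<Rightarrow>
    'v netfun \<Rightarrow> 'v netfun \<Rightarrow>
    (real \<Rightarrow> 'v netfun) \<Rightarrow> (real \<Rightarrow> 'v netfun) \<Rightarrow> (real \<Rightarrow> 'v netfun) \<Rightarrow> (real \<Rightarrow> 'v netfun) \<Rightarrow> bool" where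
  "wave_solution G l a b c T f g u0 p0 u du p dp \<longleftrightarrow>
     C1_time T (L2_net G l) (L2_norm G l) u du \<and>
     C1_time T (L2_net G l) (L2_norm G l) p dp \<and>
     C0_time T (Hdiv_net G l) (Hdiv_norm G l) u \<and>
     C0_time T (H10_net G l) (Hdiv_norm G l) p \<and>
     net_eq G l (u 0) u0 \<and> net_eq G l (p 0) p0 \<and>
     (\<forall>t\<in>{0<..T}.
        net_eq G l (\<lambda>e x. c e x * du t e x + net_deriv l (p t) e x + a e x * u t e x) (f t) \<and>
        net_eq G l (\<lambda>e x. b e x * dp t e x + net_deriv l (u t) e x) (g t))"

definition semidiscrete_solution :: "'v pair_pre_digraph \<Rightarrow> ('v \<times> 'v \<Rightarrow> real) \<Rightarrow> ('v \<times> 'v \<Rightarrow> nat) \<Rightarrow>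
    'v netfun \<Rightarrow> 'v netfun \<Rightarrow> 'v netfun \<Rightarrow> real \<Rightarrow> (real \<Rightarrow> 'v netfun) \<Rightarrow> (real \<Rightarrow> 'v netfun) \<Rightarrow>
    'v netfun \<Rightarrow> 'v netfun \<Rightarrow>
    (real \<Rightarrow> 'v netfun) \<Rightarrow> (real \<Rightarrow> 'v netfun) \<Rightarrow> (real \<Rightarrow> 'v netfun) \<Rightarrow> (real \<Rightarrow> 'v netfun) \<Rightarrow> bool" where
  "semidiscrete_solution G l N a b c T f g u0 p0 uh duh ph dph \<longleftrightarrow>
     W1q_time 2 T (Vh G l N) (L2_norm G l) uh duh \<and>
     W1q_time 2 T (Qh G l N) (L2_norm G l) ph dph \<and>
     elliptic_projection G l N a u0 p0 (uh 0) (ph 0) \<and>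
     (\<forall>t\<in>{0..T}.
        (\<forall>v\<in>Vh G l N.
           ip_net G l (net_mult c (duh t)) v - ip_net G l (ph t) (net_deriv l v)
           + ip_net G l (net_mult a (uh t)) v = ip_net G l (f t) v) \<and>
        (\<forall>q\<in>Qh G l N.
           ip_net G l (net_mult b (dph t)) q + ip_net G l (net_deriv l (uh t)) q
           = ip_net G l (g t) q))"

end

theory Submission
  imports Defs "HOL-Library.Function_Algebras"
begin

text \<open>Compare the semi-discrete solution with the nodal interpolant of \<open>u\<close> and the piecewise mean
  values of \<open>p\<close>. The difference \<open>(e, d)\<close> solves the semi-discrete system with a load of size \<open>h\<^sup>m\<close>
  times the norms of the solution and its time derivative, since interpolation and averaging drop out of
  all terms containing \<open>\<partial>\<^sub>x'\<close>; the choice of the initial values makes \<open>(e, d)\<close> of the same size at time 0.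

  A discrete damped wave system decays exponentially, uniformly in the mesh. Because there is a
  boundary vertex, \<open>\<partial>\<^sub>x' : V\<^sub>h \<rightarrow> Q\<^sub>h\<close> has a right inverse \<open>W\<close> that is bounded in \<open>L\<^sup>2\<close>, even after composition
  with \<open>\<partial>\<^sub>x'\<close>: integrate on each edge and route the imbalances at the interior vertices along
  unit flows to the boundary. The energy with a small multiple of \<open>(c e, W (b d))\<close> subtracted is equivalent to
  the squared norm, and the cross term turns the damping of \<open>e\<close> into a damping of \<open>d\<close>. Gronwall's lemma
  for the square root of this Lyapunov functional gives the bound, where norms of \<open>u\<close> at earlier times
  are estimated by \<open>u(t)\<close> and the integral of the time derivative.\<close>

text \<open>Function values matter only almost everywhere, so \<open>L2_norm\<close> is a seminorm
  on genuine functions. Instead of a quotient, network functions get the pointwise vector space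
  structure, and all Hilbert space arguments run over a semi-inner product. The cross term is
  \<open>W (b d)\<close> and not \<open>W d\<close>, because the second equation determines
  \<open>b\<close> times the time derivative of \<open>d\<close>, and only when tested against
  \<open>Qh\<close>; hence \<open>W\<close> must depend on cell averages alone. Inserting that
  equation produces \<open>W (D e)\<close>, which explains why \<open>W\<close> after the derivative
  has to be bounded uniformly in the mesh. The semi-discrete solution has only a weak time
  derivative; the equations and an inverse estimate make it a strong one before the energy is
  differentiated. The weight in the claim decays with half the rate \<gamma>, which leaves room: the
  residual at time s contains u(s), whose distance to u(t) costs a factor t - s, and the other half
  of the exponential absorbs it.\<close>

instantiation "fun" :: (type, scaleR) scaleR
begin
definition scaleR_fun :: "real \<Rightarrow> ('a \<Rightarrow> 'b) \<Rightarrow> 'a \<Rightarrow> 'b" where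
  "scaleR_fun r f = (\<lambda>x. r *\<^sub>R f x)"
instance ..
end
instance "fun" :: (type, real_vector) real_vector
  by standard (auto simp: scaleR_fun_def plus_fun_def scaleR_add_right scaleR_add_left)

section \<open>Weak derivatives on an interval\<close>

lemma integrable_subinterval0:
  fixes f :: "real \<Rightarrow> real"
  assumes "integrable (lebesgue_on {0..r}) f" "0 \<le> a" "b \<le> r"
  shows "integrable (lebesgue_on {a..b}) f" "f integrable_on {a..b}"
    "integral\<^sup>L (lebesgue_on {a..b}) f = integral {a..b} f"
proof -
  show "integrable (lebesgue_on {a..b}) f"
    by (rule Equivalence_Lebesgue_Henstock_Integration.integrable_subinterval[OF assms(1)])
      (use assms in auto)
  then show "f integrable_on {a..b}" "integral\<^sup>L (lebesgue_on {a..b}) f = integral {a..b} f"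
    by (simp_all add: integrable_on_lebesgue_on lebesgue_integral_eq_integral)
qed

lemma L2_int_mult_integrable:
  assumes "w \<in> L2_int r" "z \<in> L2_int r"
  shows "integrable (lebesgue_on {0..r}) (\<lambda>x. w x * z x)"
proof (rule Bochner_Integration.integrable_bound)
  show "integrable (lebesgue_on {0..r}) (\<lambda>x. (w x)\<^sup>2 + (z x)\<^sup>2)"
    using assms by (auto simp: L2_int_def)
  show "(\<lambda>x. w x * z x) \<in> borel_measurable (lebesgue_on {0..r})"
    using assms by (auto simp: L2_int_def)
  show "AE x in lebesgue_on {0..r}. norm (w x * z x) \<le> norm ((w x)\<^sup>2 + (z x)\<^sup>2)"
  proof (rule AE_I2)
    fix x
    have "2 * \<bar>w x * z x\<bar> \<le> (w x)\<^sup>2 + (z x)\<^sup>2"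
      using sum_squares_bound[of "\<bar>w x\<bar>" "\<bar>z x\<bar>"] by (simp add: abs_mult power2_eq_square)
    moreover have "0 \<le> \<bar>w x * z x\<bar>" by simp
    ultimately show "norm (w x * z x) \<le> norm ((w x)\<^sup>2 + (z x)\<^sup>2)"
      unfolding real_norm_def by linarith
  qed
qed

lemma L2_int_bounded:
  assumes "w \<in> borel_measurable (lebesgue_on {0..r})"
    and "AE x in lebesgue_on {0..r}. \<bar>w x\<bar> \<le> K"
  shows "w \<in> L2_int r"
proof -
  have "integrable (lebesgue_on {0..r}) (\<lambda>x. (w x)\<^sup>2)"
  proof (rule Bochner_Integration.integrable_bound)
    show "integrable (lebesgue_on {0..r}) (\<lambda>x. K\<^sup>2)" by simp
    show "(\<lambda>x. (w x)\<^sup>2) \<in> borel_measurable (lebesgue_on {0..r})" using assms(1) by simp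
    show "AE x in lebesgue_on {0..r}. norm ((w x)\<^sup>2) \<le> norm (K\<^sup>2)"
      using assms(2) by eventually_elim (simp add: abs_le_square_iff[symmetric])
  qed
  then show ?thesis using assms(1) by (simp add: L2_int_def)
qed

lemma L2_int_continuous:
  fixes w :: "real \<Rightarrow> real"
  assumes "continuous_on {0..r} w"
  shows "w \<in> L2_int r"
proof -
  have "bounded (w ` {0..r})"
    using compact_continuous_image[OF assms] compact_imp_bounded by blast
  then obtain K where "\<And>x. x \<in> {0..r} \<Longrightarrow> \<bar>w x\<bar> \<le> K"
    unfolding bounded_iff real_norm_def by blast
  moreover have "w \<in> borel_measurable (lebesgue_on {0..r})"
    by (rule continuous_imp_measurable_on_sets_lebesgue[OF assms]) simp
  ultimately show ?thesis
    by (intro L2_int_bounded[of _ _ K] AE_I2) auto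
qed

lemma L2_int_const [simp]: "(\<lambda>x. c) \<in> L2_int r"
  by (rule L2_int_continuous) simp

lemma L2_int_integrable:
  assumes "w \<in> L2_int r"
  shows "integrable (lebesgue_on {0..r}) w"
  using L2_int_mult_integrable[OF assms L2_int_const[of 1]] by simp

lemma L2_int_measurable: "w \<in> L2_int r \<Longrightarrow> w \<in> borel_measurable (lebesgue_on {0..r})"
  by (simp add: L2_int_def)

lemma L2_int_scale:
  assumes "w \<in> L2_int r"
  shows "(\<lambda>x. c * w x) \<in> L2_int r"
  using assms by (auto simp: L2_int_def power_mult_distrib)

lemma L2_int_add:
  assumes "w \<in> L2_int r" "z \<in> L2_int r"
  shows "(\<lambda>x. w x + z x) \<in> L2_int r"
proof -
  have "integrable (lebesgue_on {0..r}) (\<lambda>x. (w x)\<^sup>2 + (z x)\<^sup>2 + 2 * (w x * z x))"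
    using assms L2_int_mult_integrable[OF assms] by (auto simp: L2_int_def)
  then show ?thesis
    using assms by (auto simp: L2_int_def power2_sum mult.assoc)
qed

lemma L2_int_diff:
  assumes "w \<in> L2_int r" "z \<in> L2_int r"
  shows "(\<lambda>x. w x - z x) \<in> L2_int r"
  using L2_int_add[OF assms(1) L2_int_scale[OF assms(2), of "-1"]] by simp

lemma L2_int_mult_bounded:
  assumes w: "w \<in> L2_int r" and a: "a \<in> borel_measurable (lebesgue_on {0..r})"
    and K: "AE x in lebesgue_on {0..r}. \<bar>a x\<bar> \<le> K"
  shows "(\<lambda>x. a x * w x) \<in> L2_int r"
proof -
  have "integrable (lebesgue_on {0..r}) (\<lambda>x. (a x * w x)\<^sup>2)"
  proof (rule Bochner_Integration.integrable_bound)
    show "integrable (lebesgue_on {0..r}) (\<lambda>x. K\<^sup>2 * (w x)\<^sup>2)" using w by (simp add: L2_int_def)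
    show "(\<lambda>x. (a x * w x)\<^sup>2) \<in> borel_measurable (lebesgue_on {0..r})"
      using a L2_int_measurable[OF w] by measurable
    show "AE x in lebesgue_on {0..r}. norm ((a x * w x)\<^sup>2) \<le> norm (K\<^sup>2 * (w x)\<^sup>2)"
      using K by eventually_elim
        (auto simp: power_mult_distrib abs_le_square_iff[symmetric] intro!: mult_right_mono)
  qed
  moreover have "(\<lambda>x. a x * w x) \<in> borel_measurable (lebesgue_on {0..r})"
    using a L2_int_measurable[OF w] by measurable
  ultimately show ?thesis by (simp add: L2_int_def)
qed

lemma L2_int_cong_AE:
  assumes "w \<in> L2_int r" "z \<in> borel_measurable (lebesgue_on {0..r})"
    "AE x in lebesgue_on {0..r}. w x = z x"
  shows "z \<in> L2_int r"
proof -
  have "integrable (lebesgue_on {0..r}) (\<lambda>x. (z x)\<^sup>2)"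
    by (rule integrable_cong_AE_imp[of _ "\<lambda>x. (w x)\<^sup>2"]) (use assms in \<open>auto simp: L2_int_def\<close>)
  with assms(2) show ?thesis by (simp add: L2_int_def)
qed

text \<open>Completeness of Lebesgue measure transfers measurability across null sets; extension by
  zero moves the question to the whole line.\<close>

lemma measurable_lebesgue_on_cong_AE:
  fixes w z :: "real \<Rightarrow> real"
  assumes "w \<in> borel_measurable (lebesgue_on {0..r})" "AE x in lebesgue_on {0..r}. w x = z x"
  shows "z \<in> borel_measurable (lebesgue_on {0..r})"
proof -
  let ?w = "\<lambda>x. if x \<in> {0..r} then w x else 0" and ?z = "\<lambda>x. if x \<in> {0..r} then z x else 0"
  have "?w \<in> borel_measurable lebesgue"
    using assms(1) by (rule borel_measurable_if_I) simp
  moreover have "AE x in lebesgue. ?w x = ?z x"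
    using assms(2) by (subst (asm) AE_restrict_space_iff) (auto elim: eventually_mono)
  ultimately have "?z \<in> borel_measurable lebesgue"
    by (rule borel_measurable_AE)
  then show ?thesis
    by (rule borel_measurable_if_D)
qed

text \<open>A primitive determines the integral over all half-open intervals, hence over all Borel sets.\<close>

lemma AE_zero_if_integral_zero:
  fixes z :: "real \<Rightarrow> real"
  assumes z: "integrable (lebesgue_on {0..r}) z"
    and zero: "\<And>x. x \<in> {0..r} \<Longrightarrow> integral {0..x} z = (0::real)"
  shows "AE x in lebesgue_on {0..r}. z x = 0"
proof -
  let ?z = "\<lambda>x. if x \<in> {0..r} then z x else 0"
  have int: "integrable lebesgue ?z"
    by (rule Lebesgue_Measure.integrable_restrict_UNIV[THEN iffD2, OF _ z]) simp
  \<comment> \<open>A Borel representative on the whole line, so that it suffices to compare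
    integrals over Borel sets.\<close>
  obtain z' where z': "z' \<in> borel_measurable lborel" and eq: "AE x in lborel. ?z x = z' x"
    using completion_ex_borel_measurable_real[of ?z lborel] int by auto
  have eq': "AE x in lebesgue. ?z x = z' x" using eq by (rule AE_completion)
  have z'l: "z' \<in> borel_measurable lebesgue" using z' by (rule measurable_completion)
  have int': "integrable lborel z'"
    using integrable_cong_AE_imp[OF int z'l eq'] z'
    by (simp add: integrable_completion)
  have ivl: "(LINT x:{a<..b}|lborel. z' x) = 0" for a b
  proof -
    have si: "set_integrable lborel {a..b} z'"
      unfolding set_integrable_def by (rule integrable_mult_indicator[OF _ int']) simp
    have "(LINT x:{a<..b}|lborel. z' x) = (LINT x:{a..b}|lborel. z' x)"
      unfolding set_lebesgue_integral_def
    proof (rule integral_cong_AE)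
      have "AE x in lborel. x \<noteq> a" by (rule AE_lborel_singleton)
      then show "AE x in lborel. indicat_real {a<..b} x *\<^sub>R z' x = indicat_real {a..b} x *\<^sub>R z' x"
        by eventually_elim (auto simp: indicator_def)
    qed (use z' in auto)
    also have "\<dots> = integral {a..b} z'"
      using si by (rule set_borel_integral_eq_integral(2))
    also have "\<dots> = integral {a..b} ?z"
    proof -
      have "(z' has_integral y) {a..b} = (?z has_integral y) {a..b}" for y
        by (rule has_integral_AE) (use eq in \<open>eventually_elim, simp\<close>)
      then show ?thesis unfolding integral_def integrable_on_def by presburger
    qed
    also have "\<dots> = integral ({0..r} \<inter> {a..b}) z"
      by (rule integral_restrict_Int)
    also have "\<dots> = 0"
    proof (cases "{0..r} \<inter> {a..b} = {}")
      case False
      then have *: "{0..r} \<inter> {a..b} = {max 0 a..min r b}" "max 0 a \<le> min r b" by auto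
      have "integral {0..max 0 a} z + integral {max 0 a..min r b} z = integral {0..min r b} z"
        using * integrable_subinterval0[OF z] by (intro Henstock_Kurzweil_Integration.integral_combine) auto
      moreover have "max 0 a \<in> {0..r}" "min r b \<in> {0..r}" using * by auto
      ultimately show ?thesis unfolding * using zero[of "max 0 a"] zero[of "min r b"] by simp
    qed simp
    finally show ?thesis .
  qed
  \<comment> \<open>The integral over the whole line handles complements in the induction over the
    Borel sets below.\<close>
  have total: "(LINT x|lborel. z' x) = 0"
  proof -
    have "(LINT x|lborel. z' x) = (LINT x|lebesgue. z' x)"
      by (rule integral_completion[OF z', symmetric])
    also have "\<dots> = (LINT x|lebesgue. ?z x)"
      by (rule integral_cong_AE) (use z'l int AE_symmetric[OF eq'] in auto)
    also have "\<dots> = (LINT x|lebesgue_on {0..r}. z x)"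
      by (rule Lebesgue_Measure.integral_restrict_UNIV) simp
    also have "\<dots> = integral {0..r} z" using z by (simp add: lebesgue_integral_eq_integral)
    also have "\<dots> = 0" by (cases "0 \<le> r") (auto simp: zero)
    finally show ?thesis .
  qed
  have "AE x in lborel. z' x = 0"
  proof (rule density_unique_real[OF int'])
    show "integrable lborel (\<lambda>x::real. 0::real)" by simp
    fix A :: "real set" assume A: "A \<in> sets lborel"
    let ?G = "range (\<lambda>(a, b). {a<..b::real})"
    have borel: "sigma_sets UNIV ?G = sets borel"
      by (simp add: borel_sigma_sets_Ioc)
    have si: "set_integrable lborel B z'" if "B \<in> sets borel" for B
      unfolding set_integrable_def by (rule integrable_mult_indicator[OF _ int']) (use that in simp)
    have "Int_stable ?G" by (auto simp: Int_stable_def)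
    moreover have "?G \<subseteq> Pow UNIV" by simp
    moreover from A have "A \<in> sigma_sets UNIV ?G" by (simp add: borel)
    ultimately have "(LINT x:A|lborel. z' x) = 0"
    proof (induction rule: sigma_sets_induct_disjoint)
      case (basic A)
      then show ?case using ivl by auto
    next
      case empty then show ?case by (simp add: set_lebesgue_integral_def)
    next
      case (compl A)
      then have "A \<in> sets borel" by (simp add: borel)
      then have "(LINT x:(A \<union> (UNIV - A))|lborel. z' x)
          = (LINT x:A|lborel. z' x) + (LINT x:(UNIV - A)|lborel. z' x)"
        by (intro set_integral_Un si) auto
      with compl total show ?case by (simp add: set_lebesgue_integral_def)
    next
      case (union A)
      then have m: "A i \<in> sets borel" for i using borel by auto
      have "(LINT x:(\<Union>i. A i)|lborel. z' x) = (\<Sum>i. (LINT x:(A i)|lborel. z' x))"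
        using union(1) m by (intro lebesgue_integral_countable_add si)
          (auto simp: disjoint_family_on_def)
      with union(3) show ?case by simp
    qed
    then show "(LINT x:A|lborel. z' x) = (LINT x:A|lborel. 0)"
      by (simp add: set_lebesgue_integral_def)
  qed
  then have "AE x in lborel. ?z x = 0" using eq by eventually_elim simp
  then have "AE x in lebesgue. ?z x = 0" by (rule AE_completion)
  then show ?thesis
    by (subst AE_restrict_space_iff) (auto elim: eventually_mono)
qed

text \<open>The integral of \<open>\<bar>f x - g x\<bar>\<close> vanishes, and a nonnegative
  continuous function with integral zero is identically zero.\<close>

lemma AE_const_imp_eq_continuous:
  fixes f g :: "real \<Rightarrow> real"
  assumes "a < b" and f: "continuous_on {a..b} f" and g: "continuous_on {a..b} g"
    and ae: "AE x in lebesgue_on {a..b}. f x = g x" and x: "x \<in> {a..b}"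
  shows "f x = g x"
proof -
  have "(LINT x|lebesgue_on {a..b}. \<bar>f x - g x\<bar>) = (LINT x|lebesgue_on {a..b}. 0)"
    using f g ae by (intro integral_cong_AE continuous_imp_measurable_on_sets_lebesgue)
      (auto intro!: continuous_intros)
  then have "\<forall>x\<in>{a..b}. \<bar>f x - g x\<bar> = 0"
    using f g \<open>a < b\<close> integralL_eq_0_iff[of a b "\<lambda>x. \<bar>f x - g x\<bar>"]
    by (simp add: continuous_on_diff continuous_on_rabs)
  with x show ?thesis by auto
qed

section \<open>Primitives and integration by parts\<close>

definition prim :: "(real \<Rightarrow> real) \<Rightarrow> real \<Rightarrow> real" where
  "prim g x = integral {0..x} g"

lemma prim_continuous:
  assumes "integrable (lebesgue_on {0..r}) g"
  shows "continuous_on {0..r} (prim g)"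
  unfolding prim_def
  by (rule indefinite_integral_continuous_1) (use integrable_subinterval0[OF assms] in auto)

lemma prim_diff:
  assumes "integrable (lebesgue_on {0..r}) g" "0 \<le> a" "a \<le> b" "b \<le> r"
  shows "prim g b - prim g a = integral {a..b} g"
proof -
  have "integral {0..a} g + integral {a..b} g = integral {0..b} g"
    using assms integrable_subinterval0[OF assms(1)]
    by (intro Henstock_Kurzweil_Integration.integral_combine) auto
  then show ?thesis by (simp add: prim_def)
qed

lemma prim_0 [simp]: "prim g 0 = 0"
  by (simp add: prim_def)

text \<open>Cauchy-Schwarz against the constant 1, read off from the nonnegative variance of
  \<open>g\<close> about its mean \<open>m\<close>.\<close>

lemma integral_square_le:
  assumes g: "g \<in> L2_int r" and ab: "0 \<le> a" "a \<le> b" "b \<le> r"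
  shows "(integral {a..b} g)\<^sup>2 \<le> (b - a) * integral {a..b} (\<lambda>x. (g x)\<^sup>2)"
proof (cases "a = b")
  case False
  define m where "m = integral {a..b} g / (b - a)"
  have i1: "g integrable_on {a..b}"
    using integrable_subinterval0(2)[OF L2_int_integrable[OF g]] ab by auto
  have i2: "(\<lambda>x. (g x)\<^sup>2) integrable_on {a..b}"
    using g ab by (intro integrable_subinterval0(2)[of r]) (auto simp: L2_int_def)
  have "0 \<le> integral {a..b} (\<lambda>x. (g x - m)\<^sup>2)"
  proof (rule integral_nonneg)
    have "(\<lambda>x. (g x)\<^sup>2 + m\<^sup>2 - (2 * m) * g x) integrable_on {a..b}"
      by (intro integrable_add integrable_diff i1 i2 integrable_on_mult_right integrable_const_ivl)
    then show "(\<lambda>x. (g x - m)\<^sup>2) integrable_on {a..b}"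
      by (simp add: power2_diff algebra_simps)
  qed simp
  also have "\<dots> = integral {a..b} (\<lambda>x. (g x)\<^sup>2 + (m\<^sup>2 - (2 * m) * g x))"
    by (rule integral_cong) (simp add: power2_diff algebra_simps)
  also have "\<dots> = integral {a..b} (\<lambda>x. (g x)\<^sup>2) + (m\<^sup>2 * (b - a) - 2 * m * integral {a..b} g)"
    using ab i1 i2 integral_mult_right[of "{a..b}" "2 * m" g]
    by (subst integral_add; (subst integral_diff)?)
      (auto intro!: integrable_diff integrable_on_mult_right simp: mult.commute[of "m\<^sup>2"])
  also have "\<dots> = integral {a..b} (\<lambda>x. (g x)\<^sup>2) - (integral {a..b} g)\<^sup>2 / (b - a)"
    using False by (simp add: m_def power2_eq_square)
  finally show ?thesis using False ab by (simp add: pos_divide_le_eq mult.commute)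
qed simp

lemma (in pair_sigma_finite) integrable_mult_prod:
  fixes f :: "'a \<Rightarrow> real" and g :: "'b \<Rightarrow> real"
  assumes "integrable M1 f" "integrable M2 g"
  shows "integrable (M1 \<Otimes>\<^sub>M M2) (\<lambda>(x, y). f x * g y)"
proof (rule Fubini_integrable)
  show "(\<lambda>(x, y). f x * g y) \<in> borel_measurable (M1 \<Otimes>\<^sub>M M2)"
    using assms by measurable
qed (use assms in \<open>auto simp: abs_mult\<close>)

lemma integrable_mult_continuous:
  fixes g k :: "real \<Rightarrow> real"
  assumes g: "integrable (lebesgue_on {0..r}) g" and k: "continuous_on {0..r} k"
  shows "integrable (lebesgue_on {0..r}) (\<lambda>x. g x * k x)"
proof -
  have "bounded (k ` {0..r})"
    using compact_continuous_image[OF k] compact_imp_bounded by blast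
  then obtain K where K: "\<And>x. x \<in> {0..r} \<Longrightarrow> \<bar>k x\<bar> \<le> K"
    unfolding bounded_iff real_norm_def by blast
  show ?thesis
  proof (rule Bochner_Integration.integrable_bound)
    show "integrable (lebesgue_on {0..r}) (\<lambda>x. K * g x)" using g by simp
    show "(\<lambda>x. g x * k x) \<in> borel_measurable (lebesgue_on {0..r})"
      using g continuous_imp_measurable_on_sets_lebesgue[OF k] by (intro borel_measurable_times) auto
    show "AE x in lebesgue_on {0..r}. norm (g x * k x) \<le> norm (K * g x)"
    proof (rule AE_I2)
      fix x assume "x \<in> space (lebesgue_on {0..r})"
      then have "\<bar>k x\<bar> \<le> \<bar>K\<bar>" using K[of x] by simp
      then have "\<bar>g x\<bar> * \<bar>k x\<bar> \<le> \<bar>g x\<bar> * \<bar>K\<bar>" by (rule mult_left_mono) simp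
      then show "norm (g x * k x) \<le> norm (K * g x)" by (simp add: abs_mult mult.commute)
    qed
  qed
qed

text \<open>Fubini for \<open>g y * k x\<close> on the triangle \<open>y \<le> x\<close>:
  integrating in \<open>y\<close> first gives \<open>prim g x * k x\<close>, integrating in
  \<open>x\<close> first gives \<open>g y * (prim k r - prim k y)\<close>. The argument covers
  integrands that are merely integrable, as weak derivatives are.\<close>

lemma prim_ibp:
  assumes g: "integrable (lebesgue_on {0..r}) g" and k: "integrable (lebesgue_on {0..r}) k"
  shows "(LINT x|lebesgue_on {0..r}. prim g x * k x) + (LINT x|lebesgue_on {0..r}. g x * prim k x)
    = prim g r * prim k r"
proof (cases "0 \<le> r")
  case True
  let ?M = "lebesgue_on {0..r}"
  interpret M: finite_measure ?M
    by (rule finite_measure_lebesgue_on) simp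
  interpret P: pair_sigma_finite ?M ?M ..
  have [measurable]: "g \<in> borel_measurable ?M" "k \<in> borel_measurable ?M"
    using g k by auto
  have [measurable]: "(\<lambda>x. x) \<in> borel_measurable ?M"
    by (rule continuous_imp_measurable_on_sets_lebesgue) auto
  let ?f = "\<lambda>x y. if y \<le> x then g y * k x else 0"
  have meas: "case_prod ?f \<in> borel_measurable (?M \<Otimes>\<^sub>M ?M)" by measurable
  have int: "integrable (?M \<Otimes>\<^sub>M ?M) (case_prod ?f)"
  proof (rule Bochner_Integration.integrable_bound[OF _ meas])
    show "integrable (?M \<Otimes>\<^sub>M ?M) (\<lambda>(x, y). k x * g y)"
      using k g by (rule P.integrable_mult_prod)
    show "AE z in ?M \<Otimes>\<^sub>M ?M. norm (case z of (x, y) \<Rightarrow> ?f x y) \<le> norm (case z of (x, y) \<Rightarrow> k x * g y)"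
      by (auto simp: mult.commute)
  qed
  have 1: "(LINT y|?M. ?f x y) = prim g x * k x" if "x \<in> {0..r}" for x
  proof -
    have "(LINT y|?M. ?f x y) = (LINT y|?M. (if y \<in> {0..x} then g y else 0) * k x)"
      by (rule Bochner_Integration.integral_cong) auto
    also have "\<dots> = (LINT y|?M. (if y \<in> {0..x} then g y else 0)) * k x"
      by simp
    also have "(LINT y|?M. (if y \<in> {0..x} then g y else 0)) = integral\<^sup>L (lebesgue_on {0..x}) g"
      using that by (intro integral_restrict) auto
    finally show ?thesis using integrable_subinterval0(3)[OF g, of 0 x] that by (simp add: prim_def)
  qed
  have 2: "(LINT x|?M. ?f x y) = g y * prim k r - g y * prim k y" if "y \<in> {0..r}" for y
  proof -
    have "(LINT x|?M. ?f x y) = (LINT x|?M. g y * (if x \<in> {y..r} then k x else 0))"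
      by (rule Bochner_Integration.integral_cong) auto
    also have "\<dots> = g y * (LINT x|?M. (if x \<in> {y..r} then k x else 0))"
      by simp
    also have "(LINT x|?M. (if x \<in> {y..r} then k x else 0)) = integral\<^sup>L (lebesgue_on {y..r}) k"
      using that by (intro integral_restrict) auto
    finally show ?thesis
      using integrable_subinterval0(3)[OF k, of y r] prim_diff[OF k, of y r] that
      by (simp add: algebra_simps)
  qed
  have gk: "integrable ?M (\<lambda>x. g x * prim k x)"
    by (rule integrable_mult_continuous[OF g prim_continuous[OF k]])
  have "(LINT x|?M. prim g x * k x) = (LINT x|?M. (LINT y|?M. ?f x y))"
    by (rule Bochner_Integration.integral_cong) (use 1 in auto)
  also have "\<dots> = (LINT y|?M. (LINT x|?M. ?f x y))"
    by (rule P.Fubini_integral[symmetric, OF int])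
  also have "\<dots> = (LINT y|?M. g y * prim k r - g y * prim k y)"
    by (rule Bochner_Integration.integral_cong) (use 2 in auto)
  also have "\<dots> = (LINT y|?M. g y) * prim k r - (LINT y|?M. g y * prim k y)"
    using g gk by simp
  also have "(LINT y|?M. g y) = prim g r"
    using g by (simp add: lebesgue_integral_eq_integral prim_def)
  finally show ?thesis by simp
qed (auto simp: prim_def)


lemma LINT_eq_integral:
  fixes f :: "real \<Rightarrow> real"
  assumes "integrable (lebesgue_on {0..r}) f"
  shows "(LINT x|lebesgue_on {0..r}. f x) = integral {0..r} f"
  using assms by (simp add: lebesgue_integral_eq_integral)

lemma test_function_prim:
  assumes "test_function r \<phi> \<phi>'" "0 < r"
  shows "continuous_on {0..r} \<phi>'" "\<And>x. x \<in> {0..r} \<Longrightarrow> prim \<phi>' x = \<phi> x" "\<phi> r = 0"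
proof -
  from assms obtain K where der: "\<And>x. (\<phi> has_real_derivative \<phi>' x) (at x)"
    and cont: "continuous_on UNIV \<phi>'" and K: "K \<subseteq> {0<..<r}" "\<And>x. x \<notin> K \<Longrightarrow> \<phi> x = 0"
    unfolding test_function_def by blast
  show "continuous_on {0..r} \<phi>'" using cont continuous_on_subset by blast
  have 0: "\<phi> 0 = 0" using K(1) by (intro K(2)) auto
  show "\<phi> r = 0" using K(1) by (intro K(2)) auto
  fix x assume "x \<in> {0..r}"
  then have "(\<phi>' has_integral \<phi> x - \<phi> 0) {0..x}"
    by (intro fundamental_theorem_of_calculus)
      (auto simp: has_real_derivative_iff_has_vector_derivative[symmetric] intro!: der DERIV_subset[OF der])
  then show "prim \<phi>' x = \<phi> x" unfolding prim_def 0 by (simp add: integral_unique)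
qed

text \<open>Integration by parts with \<open>k = \<phi>'\<close>: the boundary term contains
  \<open>prim \<phi>' r = \<phi> r = 0\<close>, and for the same reason the constant
  \<open>\<alpha>\<close> contributes nothing.\<close>

lemma prim_test:
  assumes r: "0 < r" and g: "integrable (lebesgue_on {0..r}) g" and t: "test_function r \<phi> \<phi>'"
  shows "(LINT x|lebesgue_on {0..r}. (\<alpha> + prim g x) * \<phi>' x) = - (LINT x|lebesgue_on {0..r}. g x * \<phi> x)"
proof -
  note p = test_function_prim[OF t r]
  have i: "integrable (lebesgue_on {0..r}) \<phi>'" using p(1) by (rule continuous_imp_integrable_real)
  have "(LINT x|lebesgue_on {0..r}. \<phi>' x) = 0"
    using LINT_eq_integral[OF i] p(2)[of r] p(3) r by (simp add: prim_def)
  moreover have "(LINT x|lebesgue_on {0..r}. g x * prim \<phi>' x) = (LINT x|lebesgue_on {0..r}. g x * \<phi> x)"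
    by (rule Bochner_Integration.integral_cong) (use p(2) in auto)
  moreover have "(LINT x|lebesgue_on {0..r}. prim g x * \<phi>' x) + (LINT x|lebesgue_on {0..r}. g x * prim \<phi>' x) = 0"
    using prim_ibp[OF g i] p(2)[of r] p(3) r by simp
  moreover have "(LINT x|lebesgue_on {0..r}. (\<alpha> + prim g x) * \<phi>' x)
      = \<alpha> * (LINT x|lebesgue_on {0..r}. \<phi>' x) + (LINT x|lebesgue_on {0..r}. prim g x * \<phi>' x)"
  proof -
    have "integrable (lebesgue_on {0..r}) (\<lambda>x. prim g x * \<phi>' x)"
      using prim_continuous[OF g] p(1) by (intro continuous_imp_integrable_real continuous_on_mult)
    then show ?thesis using i by (simp add: ring_distribs)
  qed
  ultimately show ?thesis by simp
qed

lemma has_weak_deriv_prim: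
  assumes r: "0 < r" and g: "g \<in> L2_int r"
  shows "has_weak_deriv r (\<lambda>x. \<alpha> + prim g x) g"
  unfolding has_weak_deriv_def using g prim_test[OF r L2_int_integrable[OF g]] by auto

text \<open>Trapezoidal bumps approximating the indicator of \<open>(a, b]\<close>, with their explicit primitives.\<close>

definition trap :: "real \<Rightarrow> real \<Rightarrow> real \<Rightarrow> real \<Rightarrow> real" where
  "trap a b \<epsilon> x = (max 0 (x - a) - max 0 (x - a - \<epsilon>) - max 0 (x - b) + max 0 (x - b - \<epsilon>)) / \<epsilon>"

definition trap_prim :: "real \<Rightarrow> real \<Rightarrow> real \<Rightarrow> real \<Rightarrow> real" where
  "trap_prim a b \<epsilon> x = ((max 0 (x - a))\<^sup>2 - (max 0 (x - a - \<epsilon>))\<^sup>2 - (max 0 (x - b))\<^sup>2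
     + (max 0 (x - b - \<epsilon>))\<^sup>2) / (2 * \<epsilon>)"

text \<open>The square of the positive part is differentiable across its corner with a continuous
  derivative; this makes \<open>trap_prim\<close> smooth enough to build test functions from
  it.\<close>

lemma DERIV_max_square: "((\<lambda>x. (max 0 (x - a))\<^sup>2) has_real_derivative 2 * max 0 (x - a)) (at (x::real))"
proof (cases x a rule: linorder_cases)
  case less
  have "((\<lambda>x. 0) has_real_derivative 0) (at x)" by simp
  then have "((\<lambda>x. (max 0 (x - a))\<^sup>2) has_real_derivative 0) (at x)"
    by (rule has_field_derivative_transform_within_open[of _ _ _ "{..<a}"]) (use less in auto)
  then show ?thesis using less by simp
next
  case equal
  have "((\<lambda>h. (max 0 h)\<^sup>2 / h) \<longlongrightarrow> 0) (at (0::real))"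
  proof (rule Lim_null_comparison)
    show "\<forall>\<^sub>F h in at 0. norm ((max 0 h)\<^sup>2 / h) \<le> \<bar>h::real\<bar>"
      by (rule always_eventually) (auto simp: max_def power2_eq_square)
    show "((\<lambda>h. \<bar>h::real\<bar>) \<longlongrightarrow> 0) (at 0)" by (rule tendsto_rabs_zero) (rule tendsto_ident_at)
  qed
  then show ?thesis using equal by (simp add: DERIV_def)
next
  case greater
  have "((\<lambda>x. (x - a)\<^sup>2) has_real_derivative 2 * (x - a)) (at x)"
    by (auto intro!: derivative_eq_intros)
  then have "((\<lambda>x. (max 0 (x - a))\<^sup>2) has_real_derivative 2 * (x - a)) (at x)"
    by (rule has_field_derivative_transform_within_open[of _ _ _ "{a<..}"]) (use greater in auto)
  then show ?thesis using greater by simp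
qed

lemma DERIV_trap_prim:
  assumes "0 < \<epsilon>"
  shows "(trap_prim a b \<epsilon> has_real_derivative trap a b \<epsilon> x) (at x)"
proof -
  have "((\<lambda>x. ((max 0 (x - a))\<^sup>2 - (max 0 (x - (a + \<epsilon>)))\<^sup>2 - (max 0 (x - b))\<^sup>2
     + (max 0 (x - (b + \<epsilon>)))\<^sup>2) / (2 * \<epsilon>)) has_real_derivative
     (2 * max 0 (x - a) - 2 * max 0 (x - (a + \<epsilon>)) - 2 * max 0 (x - b) + 2 * max 0 (x - (b + \<epsilon>))) / (2 * \<epsilon>)) (at x)"
    by (intro DERIV_cdivide DERIV_add DERIV_diff DERIV_max_square)
  moreover have "(2 * max 0 (x - a) - 2 * max 0 (x - (a + \<epsilon>)) - 2 * max 0 (x - b) + 2 * max 0 (x - (b + \<epsilon>))) / (2 * \<epsilon>)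
    = trap a b \<epsilon> x"
    using assms by (simp add: trap_def diff_diff_eq divide_simps)
  ultimately show ?thesis
    by (simp add: trap_prim_def[abs_def] diff_diff_eq)
qed

lemma trap_prim_right:
  assumes "0 < \<epsilon>" "a \<le> b" "b + \<epsilon> \<le> x"
  shows "trap_prim a b \<epsilon> x = b - a"
  using assms by (simp add: trap_prim_def max_def field_simps power2_eq_square)

lemma trap_prim_left:
  assumes "0 < \<epsilon>" "a \<le> b" "x \<le> a"
  shows "trap_prim a b \<epsilon> x = 0"
  using assms by (simp add: trap_prim_def max_def)

lemma trap_bounds:
  assumes "0 < \<epsilon>" "a \<le> b"
  shows "\<bar>trap a b \<epsilon> x\<bar> \<le> 1"
  using assms by (auto simp: trap_def max_def abs_le_iff divide_le_eq le_divide_eq)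

lemma trap_tendsto:
  assumes "a \<le> b" "e \<longlonglongrightarrow> 0" "\<And>n. 0 < e n"
  shows "(\<lambda>n. trap a b (e n) x) \<longlonglongrightarrow> indicator {a<..b} x"
proof (rule tendsto_eventually)
  have *: "\<forall>\<^sub>F n in sequentially. e n < y" if "0 < y" for y
    using assms(2) that by (rule order_tendstoD)
  consider "x \<le> a" | "a < x" "x \<le> b" | "b < x" by linarith
  then show "\<forall>\<^sub>F n in sequentially. trap a b (e n) x = indicator {a<..b} x"
  proof cases
    case 1
    have "trap a b (e n) x = indicator {a<..b} x" for n
      using assms(3)[of n] 1 assms(1) by (simp add: trap_def max_def)
    then show ?thesis by simp
  next
    case 2
    then have "0 < x - a" by simp
    from *[OF this] show ?thesis
    proof eventually_elim
      case (elim n) then show ?case using assms(3)[of n] 2 assms(1) by (simp add: trap_def max_def)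
    qed
  next
    case 3
    then have "0 < x - b" by simp
    from *[OF this] show ?thesis
    proof eventually_elim
      case (elim n) then show ?case using assms(3)[of n] 3 assms(1) by (simp add: trap_def max_def)
    qed
  qed
qed

lemma trap_continuous: "0 < \<epsilon> \<Longrightarrow> continuous_on A (trap a b \<epsilon>)"
  unfolding trap_def[abs_def] by (intro continuous_intros) auto

lemma trap_integral_tendsto:
  assumes z: "integrable (lebesgue_on {0..r}) z" and ab: "0 < a" "a \<le> b" "b < r"
    and e: "e \<longlonglongrightarrow> 0" "\<And>n. 0 < e n"
  shows "(\<lambda>n. LINT x|lebesgue_on {0..r}. z x * trap a b (e n) x) \<longlonglongrightarrow> integral {a..b} z"
proof -
  have sub: "{a<..b} \<in> sets (lebesgue_on {0..r})" "{a..b} \<in> sets (lebesgue_on {0..r})"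
    using ab by (auto simp: sets_restrict_space_iff)
  have indm: "indicat_real {a<..b} \<in> borel_measurable (lebesgue_on {0..r})"
    using sub(1) by (rule borel_measurable_indicator)
  have "(\<lambda>n. LINT x|lebesgue_on {0..r}. z x * trap a b (e n) x)
     \<longlonglongrightarrow> (LINT x|lebesgue_on {0..r}. z x * indicator {a<..b} x)"
  proof (rule integral_dominated_convergence[where w = "\<lambda>x. \<bar>z x\<bar>"])
    show "(\<lambda>x. z x * trap a b (e n) x) \<in> borel_measurable (lebesgue_on {0..r})" for n
      using z continuous_imp_measurable_on_sets_lebesgue[OF trap_continuous[OF e(2)], of "{0..r}" a b n]
      by (intro borel_measurable_times) auto
    show "AE x in lebesgue_on {0..r}. (\<lambda>n. z x * trap a b (e n) x) \<longlonglongrightarrow> z x * indicator {a<..b} x"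
      using trap_tendsto[OF ab(2) e] by (intro AE_I2 tendsto_mult_left) auto
    show "AE x in lebesgue_on {0..r}. norm (z x * trap a b (e n) x) \<le> \<bar>z x\<bar>" for n
      using mult_left_mono[OF trap_bounds[OF e(2) ab(2)], of "\<bar>z x\<bar>" for x] 
      by (intro AE_I2) (simp add: abs_mult)
    show "(\<lambda>x. z x * indicator {a<..b} x) \<in> borel_measurable (lebesgue_on {0..r})"
      using z by (intro borel_measurable_times indm) auto
  qed (use z in auto)
  also have "(LINT x|lebesgue_on {0..r}. z x * indicator {a<..b} x)
      = (LINT x|lebesgue_on {0..r}. (if x \<in> {a..b} then z x else 0))"
  proof (rule integral_cong_AE)
    have "AE x in lebesgue. x \<noteq> a" by (rule AE_completion) (rule AE_lborel_singleton)
    then show "AE x in lebesgue_on {0..r}. z x * indicator {a<..b} x = (if x \<in> {a..b} then z x else 0)"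
      by (subst AE_restrict_space_iff) (auto simp: indicator_def elim!: eventually_mono)
    show "(\<lambda>x. if x \<in> {a..b} then z x else 0) \<in> borel_measurable (lebesgue_on {0..r})"
      using borel_measurable_times[OF borel_measurable_indicator[OF sub(2)], of z] z
      by (auto simp: indicator_def of_bool_def if_distrib[of "\<lambda>x. x * _"] cong: if_cong)
  qed (use z indm in \<open>auto intro!: borel_measurable_times\<close>)
  also have "\<dots> = integral {a..b} z"
    using ab integrable_subinterval0(3)[OF z, of a b] by (subst integral_restrict) auto
  finally show ?thesis .
qed

text \<open>The derivative of a test function has mean zero, so a single trapezoid is not
  admissible, but the difference of two trapezoids scaled to equal mass is. In the limit of
  vanishing slopes the integral of \<open>z\<close> over every inner interval is proportional to its
  length, so \<open>z - \<kappa>\<close> has a vanishing primitive.\<close>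

lemma du_Bois_Reymond:
  assumes r: "0 < r" and z: "integrable (lebesgue_on {0..r}) z"
    and zero: "\<And>\<phi> \<phi>'. test_function r \<phi> \<phi>' \<Longrightarrow> (LINT x|lebesgue_on {0..r}. z x * \<phi>' x) = 0"
  obtains \<kappa> where "AE x in lebesgue_on {0..r}. z x = \<kappa>"
proof -
  \<comment> \<open>The middle third serves as reference interval, and \<open>\<kappa>\<close> is
    the mean of \<open>z\<close> over it.\<close>
  define a0 b0 where "a0 = r / 3" and "b0 = 2 * r / 3"
  have ab0: "0 < a0" "a0 < b0" "b0 < r" using r by (auto simp: a0_def b0_def)
  define \<kappa> where "\<kappa> = integral {a0..b0} z / (b0 - a0)"
  have lin: "integral {a..b} z = \<kappa> * (b - a)" if ab: "0 < a" "a \<le> b" "b < r" for a b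
  proof -
    \<comment> \<open>\<open>c\<close> gives both trapezoids the same mass, so the difference of
      their primitives vanishes to the right of both; \<open>d\<close> is the margin that keeps its
      support inside the open interval.\<close>
    define c where "c = (b - a) / (b0 - a0)"
    define d where "d = (r - max b b0) / 2"
    define e where "e n = d / real (Suc n)" for n
    have d: "0 < d" "max b b0 + d < r" using ab ab0 by (auto simp: d_def field_simps max_def)
    have e: "e \<longlonglongrightarrow> 0" "\<And>n. 0 < e n" "\<And>n. e n \<le> d"
      using LIMSEQ_Suc[OF lim_const_over_n[of d]] d by (auto simp: e_def[abs_def] field_simps)
    note trap_rules = DERIV_trap_prim[OF e(2)] trap_continuous[OF e(2)]
    have eq: "(LINT x|lebesgue_on {0..r}. z x * trap a b (e n) x)
        = c * (LINT x|lebesgue_on {0..r}. z x * trap a0 b0 (e n) x)" for n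
    proof -
      have "test_function r (\<lambda>x. trap_prim a b (e n) x - c * trap_prim a0 b0 (e n) x)
          (\<lambda>x. trap a b (e n) x - c * trap a0 b0 (e n) x)"
        unfolding test_function_def
      proof (intro conjI exI[of _ "{min a a0..max b b0 + d}"] allI impI)
        show "((\<lambda>x. trap_prim a b (e n) x - c * trap_prim a0 b0 (e n) x) has_real_derivative
              trap a b (e n) x - c * trap a0 b0 (e n) x) (at x)" for x
          by (intro DERIV_diff DERIV_cmult trap_rules)
        show "continuous_on UNIV (\<lambda>x. trap a b (e n) x - c * trap a0 b0 (e n) x)"
          by (intro continuous_on_diff continuous_on_mult_left trap_rules)
        show "{min a a0..max b b0 + d} \<subseteq> {0<..<r}" using ab ab0 d by auto
        fix x assume "x \<notin> {min a a0..max b b0 + d}"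
        then consider "x < min a a0" | "max b b0 + d < x" by fastforce
        then show "trap_prim a b (e n) x - c * trap_prim a0 b0 (e n) x = 0"
        proof cases
          case 1 then show ?thesis
            using trap_prim_left[OF e(2)] ab ab0 by simp
        next
          case 2
          then have "b + e n \<le> x" "b0 + e n \<le> x" using e(3)[of n] by auto
          then show ?thesis
            using trap_prim_right[OF e(2)] ab ab0 by (simp add: c_def)
        qed
      qed simp
      from zero[OF this]
      have "(LINT x|lebesgue_on {0..r}. z x * trap a b (e n) x - c * (z x * trap a0 b0 (e n) x)) = 0"
        by (simp add: right_diff_distrib mult.left_commute)
      moreover have "integrable (lebesgue_on {0..r}) (\<lambda>x. z x * trap a b (e n) x)" for a b
        by (intro integrable_mult_continuous[OF z] trap_rules)
      ultimately show ?thesis using ab ab0 by simp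
    qed
    have "(\<lambda>n. c * (LINT x|lebesgue_on {0..r}. z x * trap a0 b0 (e n) x)) \<longlonglongrightarrow> c * integral {a0..b0} z"
      by (intro tendsto_mult_left trap_integral_tendsto[OF z] e) (use ab0 in auto)
    moreover have "(\<lambda>n. LINT x|lebesgue_on {0..r}. z x * trap a b (e n) x) \<longlonglongrightarrow> integral {a..b} z"
      by (intro trap_integral_tendsto[OF z] e) (use ab in auto)
    ultimately have "integral {a..b} z = c * integral {a0..b0} z"
      unfolding eq by (rule LIMSEQ_unique[symmetric])
    then show ?thesis by (simp add: c_def \<kappa>_def)
  qed
  have const: "prim z x - \<kappa> * x = prim z a0 - \<kappa> * a0" if "x \<in> {0<..<r}" for x
  proof (cases "a0 \<le> x")
    case True
    then show ?thesis using lin[of a0 x] prim_diff[OF z, of a0 x] that ab0 by (simp add: algebra_simps)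
  next
    case False
    then show ?thesis using lin[of x a0] prim_diff[OF z, of x a0] that ab0 by (simp add: algebra_simps)
  qed
  have cont: "continuous_on {0..r} (\<lambda>x. prim z x - \<kappa> * x)"
    by (intro continuous_on_diff continuous_on_mult_left continuous_on_id prim_continuous z)
  \<comment> \<open>Continuity carries the identity to the end points; at 0 it shows that the
    right-hand constant is zero.\<close>
  have const': "prim z x - \<kappa> * x = prim z a0 - \<kappa> * a0" if "x \<in> {0..r}" for x
    using continuous_constant_on_closure[of "{0<..<r}" "\<lambda>x. prim z x - \<kappa> * x" _ x] cont const that r
    by simp
  have "AE x in lebesgue_on {0..r}. z x - \<kappa> = 0"
  proof (rule AE_zero_if_integral_zero)
    show "integrable (lebesgue_on {0..r}) (\<lambda>x. z x - \<kappa>)" using z by simp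
    fix x assume x: "x \<in> {0..r}"
    have "integral {0..x} (\<lambda>x. z x - \<kappa>) = prim z x - \<kappa> * x"
      using x integrable_subinterval0(2)[OF z, of 0 x]
      by (subst integral_diff) (auto simp: prim_def)
    with const'[OF x] const'[of 0] r show "integral {0..x} (\<lambda>x. z x - \<kappa>) = 0" by simp
  qed
  then have "AE x in lebesgue_on {0..r}. z x = \<kappa>" by simp
  then show ?thesis by (rule that)
qed

text \<open>The function \<open>w - prim g\<close> has weak derivative zero, so it is constant by
  \<open>du_Bois_Reymond\<close>.\<close>

lemma has_weak_deriv_imp_prim:
  assumes r: "0 < r" and w: "integrable (lebesgue_on {0..r}) w" and g: "has_weak_deriv r w g"
  obtains \<alpha> where "AE x in lebesgue_on {0..r}. w x = \<alpha> + prim g x"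
proof -
  have gL: "integrable (lebesgue_on {0..r}) g"
    using g L2_int_integrable by (auto simp: has_weak_deriv_def)
  have pi: "integrable (lebesgue_on {0..r}) (prim g)"
    by (rule continuous_imp_integrable_real[OF prim_continuous[OF gL]])
  have "\<exists>\<kappa>. AE x in lebesgue_on {0..r}. w x - prim g x = \<kappa>"
  proof (rule du_Bois_Reymond[OF r])
    show "integrable (lebesgue_on {0..r}) (\<lambda>x. w x - prim g x)" using w pi by simp
    fix \<phi> \<phi>' assume t: "test_function r \<phi> \<phi>'"
    have c: "continuous_on {0..r} \<phi>'" using test_function_prim[OF t r] by simp
    have "integrable (lebesgue_on {0..r}) (\<lambda>x. w x * \<phi>' x)"
      by (rule integrable_mult_continuous[OF w c])
    moreover have "integrable (lebesgue_on {0..r}) (\<lambda>x. prim g x * \<phi>' x)"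
      using prim_continuous[OF gL] c by (intro continuous_imp_integrable_real continuous_on_mult)
    ultimately have "(LINT x|lebesgue_on {0..r}. (w x - prim g x) * \<phi>' x)
        = (LINT x|lebesgue_on {0..r}. w x * \<phi>' x) - (LINT x|lebesgue_on {0..r}. (0 + prim g x) * \<phi>' x)"
      by (simp add: left_diff_distrib)
    also have "\<dots> = 0"
      using g t prim_test[OF r gL t, of 0] by (simp add: has_weak_deriv_def)
    finally show "(LINT x|lebesgue_on {0..r}. (w x - prim g x) * \<phi>' x) = 0" .
  qed blast
  then obtain \<kappa> where "AE x in lebesgue_on {0..r}. w x - prim g x = \<kappa>" by blast
  then have "AE x in lebesgue_on {0..r}. w x = \<kappa> + prim g x" by eventually_elim simp
  then show ?thesis by (rule that)
qed


lemma has_weak_deriv_lincomb: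
  assumes r: "0 < r" and w: "w \<in> L2_int r" "has_weak_deriv r w g" and z: "z \<in> L2_int r" "has_weak_deriv r z k"
  shows "has_weak_deriv r (\<lambda>x. w x + c * z x) (\<lambda>x. g x + c * k x)"
  unfolding has_weak_deriv_def
proof (intro conjI allI impI)
  have gk: "g \<in> L2_int r" "k \<in> L2_int r" using w z by (auto simp: has_weak_deriv_def)
  show "(\<lambda>x. g x + c * k x) \<in> L2_int r" by (intro L2_int_add L2_int_scale gk)
  fix \<phi> \<phi>' assume t: "test_function r \<phi> \<phi>'"
  have c': "continuous_on {0..r} \<phi>'" using test_function_prim[OF t r] by simp
  have c: "continuous_on {0..r} \<phi>"
    using t unfolding test_function_def
    by (meson DERIV_isCont continuous_at_imp_continuous_on)
  have i: "integrable (lebesgue_on {0..r}) (\<lambda>x. h x * \<psi> x)"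
    if "h \<in> L2_int r" "continuous_on {0..r} \<psi>" for h \<psi> :: "real \<Rightarrow> real"
    using that by (intro integrable_mult_continuous L2_int_integrable)
  have e: "(LINT x|lebesgue_on {0..r}. (h x + c * k x) * \<psi> x)
     = (LINT x|lebesgue_on {0..r}. h x * \<psi> x) + c * (LINT x|lebesgue_on {0..r}. k x * \<psi> x)"
    if "h \<in> L2_int r" "k \<in> L2_int r" "continuous_on {0..r} \<psi>" for h k \<psi> :: "real \<Rightarrow> real"
    using i[OF that(1,3)] i[OF that(2,3)] by (simp add: distrib_right mult.assoc)
  show "(LINT x|lebesgue_on {0..r}. (w x + c * z x) * \<phi>' x)
      = - (LINT x|lebesgue_on {0..r}. (g x + c * k x) * \<phi> x)"
    using w z t by (subst e[OF w(1) z(1) c'], subst e[OF gk c]) (simp add: has_weak_deriv_def)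
qed

text \<open>\<open>weak_deriv\<close> is a choice, so uniqueness has to be shown: the primitives of
  two candidates agree almost everywhere up to constants, hence everywhere by continuity, and the
  difference of the candidates then has a vanishing primitive.\<close>

lemma weak_deriv_AE:
  assumes r: "0 < r" and w: "integrable (lebesgue_on {0..r}) w" and g: "has_weak_deriv r w g"
  shows "has_weak_deriv r w (weak_deriv r w)" "AE x in lebesgue_on {0..r}. weak_deriv r w x = g x"
proof -
  show *: "has_weak_deriv r w (weak_deriv r w)"
    unfolding weak_deriv_def by (rule someI[of _ g]) (rule g)
  let ?g = "weak_deriv r w"
  have gL: "integrable (lebesgue_on {0..r}) g" "integrable (lebesgue_on {0..r}) ?g"
    using g * L2_int_integrable by (auto simp: has_weak_deriv_def)
  obtain \<alpha> where \<alpha>: "AE x in lebesgue_on {0..r}. w x = \<alpha> + prim g x"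
    using has_weak_deriv_imp_prim[OF r w g] .
  obtain \<beta> where \<beta>: "AE x in lebesgue_on {0..r}. w x = \<beta> + prim ?g x"
    using has_weak_deriv_imp_prim[OF r w *] .
  have eq: "\<alpha> + prim g x = \<beta> + prim ?g x" if "x \<in> {0..r}" for x
  proof (rule AE_const_imp_eq_continuous[OF r, of "\<lambda>x. \<alpha> + prim g x" "\<lambda>x. \<beta> + prim ?g x"])
    show "AE x in lebesgue_on {0..r}. \<alpha> + prim g x = \<beta> + prim ?g x"
      using \<alpha> \<beta> by eventually_elim simp
    show "continuous_on {0..r} (\<lambda>x. \<alpha> + prim g x)"
      by (intro continuous_on_add continuous_on_const prim_continuous gL)
    show "continuous_on {0..r} (\<lambda>x. \<beta> + prim ?g x)"
      by (intro continuous_on_add continuous_on_const prim_continuous gL)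
  qed (rule that)
  have "AE x in lebesgue_on {0..r}. ?g x - g x = 0"
  proof (rule AE_zero_if_integral_zero)
    fix x assume x: "x \<in> {0..r}"
    have "integral {0..x} (\<lambda>x. ?g x - g x) = prim ?g x - prim g x"
      unfolding prim_def using x gL by (intro integral_diff integrable_subinterval0(2)[of r]) auto
    also have "\<dots> = 0" using eq[OF x] eq[of 0] r by simp
    finally show "integral {0..x} (\<lambda>x. ?g x - g x) = 0" .
  qed (use gL in simp)
  then show "AE x in lebesgue_on {0..r}. ?g x = g x" by simp
qed

lemma has_weak_deriv_cong_AE:
  assumes w: "w \<in> borel_measurable (lebesgue_on {0..r})" and "AE x in lebesgue_on {0..r}. w x = z x"
  shows "has_weak_deriv r w = has_weak_deriv r z"
proof
  fix g
  have z: "z \<in> borel_measurable (lebesgue_on {0..r})"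
    using measurable_lebesgue_on_cong_AE[OF assms] .
  have "(LINT x|lebesgue_on {0..r}. w x * \<phi>' x) = (LINT x|lebesgue_on {0..r}. z x * \<phi>' x)"
    if "test_function r \<phi> \<phi>'" for \<phi> \<phi>'
  proof (rule integral_cong_AE)
    have "continuous_on {0..r} \<phi>'"
      using that continuous_on_subset unfolding test_function_def by blast
    then have m: "\<phi>' \<in> borel_measurable (lebesgue_on {0..r})"
      by (rule continuous_imp_measurable_on_sets_lebesgue) simp
    show "(\<lambda>x. w x * \<phi>' x) \<in> borel_measurable (lebesgue_on {0..r})"
      "(\<lambda>x. z x * \<phi>' x) \<in> borel_measurable (lebesgue_on {0..r})"
      using w z m by measurable
    show "AE x in lebesgue_on {0..r}. w x * \<phi>' x = z x * \<phi>' x"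
      using assms(2) by eventually_elim simp
  qed
  then show "has_weak_deriv r w g = has_weak_deriv r z g"
    unfolding has_weak_deriv_def
    by (intro conj_cong[OF refl] iff_allI imp_cong[OF refl]) simp
qed

text \<open>Functions that agree almost everywhere have the same predicate
  \<open>has_weak_deriv\<close>, so the choice operator returns the same representative, everywhere
  and not only almost everywhere.\<close>

lemma weak_deriv_cong_AE:
  assumes "w \<in> borel_measurable (lebesgue_on {0..r})" "AE x in lebesgue_on {0..r}. w x = z x"
  shows "weak_deriv r w = weak_deriv r z"
  unfolding weak_deriv_def has_weak_deriv_cong_AE[OF assms] ..

section \<open>Traces and the space of order one on an interval\<close>

lemma trace_at_eq:
  assumes r: "0 < r" and c: "continuous_on {0..r} w'" and ae: "AE x in lebesgue_on {0..r}. w x = w' x"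
    and x: "x \<in> {0..r}"
  shows "trace_at r w x = w' x"
  unfolding trace_at_def
proof (rule the_equality)
  show "\<exists>w''. continuous_on {0..r} w'' \<and> (AE z in lebesgue_on {0..r}. w z = w'' z) \<and> w' x = w'' x"
    using c ae by blast
  fix y assume "\<exists>w''. continuous_on {0..r} w'' \<and> (AE z in lebesgue_on {0..r}. w z = w'' z) \<and> y = w'' x"
  then obtain w'' where w'': "continuous_on {0..r} w''" "AE z in lebesgue_on {0..r}. w z = w'' z" "y = w'' x"
    by blast
  have "AE z in lebesgue_on {0..r}. w'' z = w' z" using ae w''(2) by eventually_elim simp
  with w'' show "y = w' x" using AE_const_imp_eq_continuous[OF r w''(1) c _ x] by simp
qed

lemma Hs_int_1: "w \<in> Hs_int 1 r \<longleftrightarrow> w \<in> L2_int r \<and> (\<exists>g. has_weak_deriv r w g)"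
proof -
  have "weak_deriv r w \<in> L2_int r" if "has_weak_deriv r w g" for g
    using someI[of "has_weak_deriv r w" g, OF that] unfolding weak_deriv_def has_weak_deriv_def[of r w "Eps _"] by blast
  then show ?thesis by (auto simp: Hs_int_def)
qed

lemma H1_deriv:
  assumes r: "0 < r" and w: "w \<in> Hs_int 1 r"
  shows "has_weak_deriv r w (weak_deriv r w)" "weak_deriv r w \<in> L2_int r" "w \<in> L2_int r"
proof -
  show *: "w \<in> L2_int r" using w by (simp add: Hs_int_1)
  obtain g where g: "has_weak_deriv r w g" using w by (auto simp: Hs_int_1)
  show "has_weak_deriv r w (weak_deriv r w)"
    using weak_deriv_AE(1)[OF r L2_int_integrable[OF *] g] .
  then show "weak_deriv r w \<in> L2_int r" by (simp add: has_weak_deriv_def)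
qed

text \<open>Reduces all later work with weakly differentiable functions to primitives; the constant
  of integration is the trace at 0.\<close>

lemma H1_prim:
  assumes r: "0 < r" and w: "w \<in> Hs_int 1 r"
  shows "AE x in lebesgue_on {0..r}. w x = trace_at r w 0 + prim (weak_deriv r w) x"
    and "x \<in> {0..r} \<Longrightarrow> trace_at r w x = trace_at r w 0 + prim (weak_deriv r w) x"
proof -
  note H = H1_deriv[OF r w]
  obtain \<alpha> where \<alpha>: "AE x in lebesgue_on {0..r}. w x = \<alpha> + prim (weak_deriv r w) x"
    using has_weak_deriv_imp_prim[OF r L2_int_integrable[OF H(3)] H(1)] .
  have c: "continuous_on {0..r} (\<lambda>x. \<alpha> + prim (weak_deriv r w) x)"
    by (intro continuous_on_add continuous_on_const prim_continuous L2_int_integrable H)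
  have t: "trace_at r w x = \<alpha> + prim (weak_deriv r w) x" if "x \<in> {0..r}" for x
    by (rule trace_at_eq[OF r c \<alpha> that])
  have "trace_at r w 0 = \<alpha>" using t[of 0] r by simp
  with \<alpha> t show "AE x in lebesgue_on {0..r}. w x = trace_at r w 0 + prim (weak_deriv r w) x"
    "x \<in> {0..r} \<Longrightarrow> trace_at r w x = trace_at r w 0 + prim (weak_deriv r w) x" by auto
qed

text \<open>Converse of \<open>H1_prim\<close>. The nodal interpolant and the right inverse
  \<open>lift\<close> are written as primitives and obtain their derivatives and traces from
  here.\<close>

lemma prim_H1:
  assumes r: "0 < r" and g: "g \<in> L2_int r" and w: "AE x in lebesgue_on {0..r}. w x = \<alpha> + prim g x"
  shows "w \<in> Hs_int 1 r" "AE x in lebesgue_on {0..r}. weak_deriv r w x = g x"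
    "x \<in> {0..r} \<Longrightarrow> trace_at r w x = \<alpha> + prim g x"
proof -
  let ?w = "\<lambda>x. \<alpha> + prim g x"
  have c: "continuous_on {0..r} ?w"
    by (intro continuous_on_add continuous_on_const prim_continuous L2_int_integrable g)
  have m: "?w \<in> borel_measurable (lebesgue_on {0..r})"
    by (rule continuous_imp_measurable_on_sets_lebesgue[OF c]) simp
  have w': "AE x in lebesgue_on {0..r}. ?w x = w x" using w by eventually_elim simp
  have "w \<in> borel_measurable (lebesgue_on {0..r})"
    by (rule measurable_lebesgue_on_cong_AE[OF m w'])
  then have L: "w \<in> L2_int r"
    by (rule L2_int_cong_AE[OF L2_int_continuous[OF c] _ w'])
  have d: "has_weak_deriv r w g"
    using has_weak_deriv_prim[OF r g, of \<alpha>] has_weak_deriv_cong_AE[OF m w'] by simp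
  show "w \<in> Hs_int 1 r" using L d by (auto simp: Hs_int_1)
  show "AE x in lebesgue_on {0..r}. weak_deriv r w x = g x"
    by (rule weak_deriv_AE(2)[OF r L2_int_integrable[OF L] d])
  show "x \<in> {0..r} \<Longrightarrow> trace_at r w x = \<alpha> + prim g x"
    by (rule trace_at_eq[OF r c w])
qed

lemma prim_lincomb:
  assumes "integrable (lebesgue_on {0..r}) g" "integrable (lebesgue_on {0..r}) k" "x \<in> {0..r}"
  shows "prim (\<lambda>x. g x + c * k x) x = prim g x + c * prim k x"
  using integrable_subinterval0(2)[OF assms(1), of 0 x] integrable_subinterval0(2)[OF assms(2), of 0 x] assms(3)
  by (simp add: prim_def integral_add integrable_on_mult_right)

lemma prim_cong_AE:
  assumes "integrable (lebesgue_on {0..r}) g" "integrable (lebesgue_on {0..r}) k"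
    "AE x in lebesgue_on {0..r}. g x = k x" "x \<in> {0..r}"
  shows "prim g x = prim k x"
proof -
  have "integral\<^sup>L (lebesgue_on {0..x}) g = integral\<^sup>L (lebesgue_on {0..x}) k"
  proof (rule integral_cong_AE)
    show "AE y in lebesgue_on {0..x}. g y = k y"
      using assms(3,4) by (auto simp: AE_restrict_space_iff elim!: eventually_mono)
  qed (use integrable_subinterval0(1)[OF assms(1), of 0 x] integrable_subinterval0(1)[OF assms(2), of 0 x] assms(4) in auto)
  then show ?thesis
    using integrable_subinterval0(3)[OF assms(1), of 0 x] integrable_subinterval0(3)[OF assms(2), of 0 x] assms(4)
    by (simp add: prim_def)
qed

lemma H1_lincomb:
  assumes r: "0 < r" and w: "w \<in> Hs_int 1 r" and z: "z \<in> Hs_int 1 r"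
  shows "(\<lambda>x. w x + c * z x) \<in> Hs_int 1 r"
    "AE x in lebesgue_on {0..r}. weak_deriv r (\<lambda>x. w x + c * z x) x = weak_deriv r w x + c * weak_deriv r z x"
    "x \<in> {0..r} \<Longrightarrow> trace_at r (\<lambda>x. w x + c * z x) x = trace_at r w x + c * trace_at r z x"
proof -
  note W = H1_deriv[OF r w] and Z = H1_deriv[OF r z]
  have L: "(\<lambda>x. w x + c * z x) \<in> L2_int r" by (intro L2_int_add L2_int_scale W Z)
  have d: "has_weak_deriv r (\<lambda>x. w x + c * z x) (\<lambda>x. weak_deriv r w x + c * weak_deriv r z x)"
    by (rule has_weak_deriv_lincomb[OF r W(3,1) Z(3,1)])
  show "(\<lambda>x. w x + c * z x) \<in> Hs_int 1 r" using L d by (auto simp: Hs_int_1)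
  show "AE x in lebesgue_on {0..r}. weak_deriv r (\<lambda>x. w x + c * z x) x = weak_deriv r w x + c * weak_deriv r z x"
    by (rule weak_deriv_AE(2)[OF r L2_int_integrable[OF L] d])
  \<comment> \<open>The function \<open>trace_at r w\<close> is itself the continuous representative
    of \<open>w\<close>, so traces combine like functions.\<close>
  have t: "continuous_on {0..r} (trace_at r w) \<and> (AE x in lebesgue_on {0..r}. w x = trace_at r w x)"
    if w: "w \<in> Hs_int 1 r" for w
  proof
    have "continuous_on {0..r} (\<lambda>x. trace_at r w 0 + prim (weak_deriv r w) x)"
      by (intro continuous_on_add continuous_on_const prim_continuous L2_int_integrable H1_deriv(2)[OF r w])
    then show "continuous_on {0..r} (trace_at r w)"
      by (rule continuous_on_eq) (rule H1_prim(2)[OF r w, symmetric])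
    have "AE x in lebesgue_on {0..r}. x \<in> {0..r}" by (rule AE_I2) simp
    with H1_prim(1)[OF r w] show "AE x in lebesgue_on {0..r}. w x = trace_at r w x"
    proof eventually_elim
      case (elim x)
      then show ?case using H1_prim(2)[OF r w, of x] by metis
    qed
  qed
  show "trace_at r (\<lambda>x. w x + c * z x) x = trace_at r w x + c * trace_at r z x" if "x \<in> {0..r}"
  proof (rule trace_at_eq[OF r, of "\<lambda>x. trace_at r w x + c * trace_at r z x"])
    show "AE x in lebesgue_on {0..r}. w x + c * z x = trace_at r w x + c * trace_at r z x"
      using t[OF w, THEN conjunct2] t[OF z, THEN conjunct2] by eventually_elim simp
    show "continuous_on {0..r} (\<lambda>x. trace_at r w x + c * trace_at r z x)"
      using t[OF w] t[OF z] by (intro continuous_on_add continuous_on_mult_left) auto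
  qed (rule that)
qed

text \<open>\<open>prim_ibp\<close> for the primitives, plus the terms produced by the two constants
  of integration.\<close>

lemma H1_ibp:
  assumes r: "0 < r" and w: "w \<in> Hs_int 1 r" and z: "z \<in> Hs_int 1 r"
  shows "(LINT x|lebesgue_on {0..r}. weak_deriv r w x * z x) + (LINT x|lebesgue_on {0..r}. w x * weak_deriv r z x)
    = trace_at r w r * trace_at r z r - trace_at r w 0 * trace_at r z 0"
proof -
  note W = H1_deriv[OF r w] and Z = H1_deriv[OF r z]
  let ?g = "weak_deriv r w" and ?k = "weak_deriv r z" and ?M = "lebesgue_on {0..r}"
  let ?a = "trace_at r w 0" and ?b = "trace_at r z 0"
  have gi: "integrable ?M ?g" and ki: "integrable ?M ?k" using W Z L2_int_integrable by auto
  have e1: "(LINT x|?M. ?g x * z x) = (LINT x|?M. ?g x * (?b + prim ?k x))"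
  proof (rule integral_cong_AE)
    show "AE x in ?M. ?g x * z x = ?g x * (?b + prim ?k x)"
      using H1_prim(1)[OF r z] by eventually_elim simp
    show "(\<lambda>x. ?g x * z x) \<in> borel_measurable ?M"
      using W Z L2_int_measurable by (intro borel_measurable_times) auto
    show "(\<lambda>x. ?g x * (?b + prim ?k x)) \<in> borel_measurable ?M"
      using L2_int_measurable[OF W(2)] continuous_imp_measurable_on_sets_lebesgue[OF prim_continuous[OF ki]]
      by (intro borel_measurable_times borel_measurable_add) auto
  qed
  have e2: "(LINT x|?M. w x * ?k x) = (LINT x|?M. (?a + prim ?g x) * ?k x)"
  proof (rule integral_cong_AE)
    show "AE x in ?M. w x * ?k x = (?a + prim ?g x) * ?k x"
      using H1_prim(1)[OF r w] by eventually_elim simp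
    show "(\<lambda>x. w x * ?k x) \<in> borel_measurable ?M"
      using W Z L2_int_measurable by (intro borel_measurable_times) auto
    show "(\<lambda>x. (?a + prim ?g x) * ?k x) \<in> borel_measurable ?M"
      using L2_int_measurable[OF Z(2)] continuous_imp_measurable_on_sets_lebesgue[OF prim_continuous[OF gi]]
      by (intro borel_measurable_times borel_measurable_add) auto
  qed
  have i1: "integrable ?M (\<lambda>x. ?g x * prim ?k x)"
    by (rule integrable_mult_continuous[OF gi prim_continuous[OF ki]])
  have i2: "integrable ?M (\<lambda>x. prim ?g x * ?k x)"
    using integrable_mult_continuous[OF ki prim_continuous[OF gi]] by (simp add: mult.commute)
  have "(LINT x|?M. ?g x) = prim ?g r" "(LINT x|?M. ?k x) = prim ?k r"
    using LINT_eq_integral[OF gi] LINT_eq_integral[OF ki] by (auto simp: prim_def)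
  moreover have "(LINT x|?M. ?g x * (?b + prim ?k x)) = (LINT x|?M. ?g x) * ?b + (LINT x|?M. ?g x * prim ?k x)"
    using gi i1 by (simp add: distrib_left)
  moreover have "(LINT x|?M. (?a + prim ?g x) * ?k x) = ?a * (LINT x|?M. ?k x) + (LINT x|?M. prim ?g x * ?k x)"
    using ki i2 by (simp add: distrib_right)
  moreover have "(LINT x|?M. prim ?g x * ?k x) + (LINT x|?M. ?g x * prim ?k x) = prim ?g r * prim ?k r"
    by (rule prim_ibp[OF gi ki])
  moreover have "trace_at r w r = ?a + prim ?g r" "trace_at r z r = ?b + prim ?k r"
    using H1_prim(2)[OF r w, of r] H1_prim(2)[OF r z, of r] r by auto
  ultimately show ?thesis unfolding e1 e2 by (simp add: algebra_simps)
qed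

section \<open>Differentiation in semi-inner product spaces\<close>

text \<open>Linearity is demanded on \<open>L\<close> only, since integrals of functions outside it
  take default values. Definiteness is not demanded: functions that vanish almost everywhere have
  norm zero.\<close>

locale semi_inner =
  fixes L :: "'a::real_vector set" and ip :: "'a \<Rightarrow> 'a \<Rightarrow> real" and nrm :: "'a \<Rightarrow> real"
  assumes subspace: "subspace L"
    and ip_commute: "ip x y = ip y x"
    and ip_add: "\<lbrakk>x \<in> L; y \<in> L; z \<in> L\<rbrakk> \<Longrightarrow> ip (x + y) z = ip x z + ip y z"
    and ip_scale: "\<lbrakk>x \<in> L; z \<in> L\<rbrakk> \<Longrightarrow> ip (r *\<^sub>R x) z = r * ip x z"
    and ip_nonneg: "x \<in> L \<Longrightarrow> 0 \<le> ip x x"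
    and nrm_eq: "nrm x = sqrt (ip x x)"
begin

lemmas closed = subspace_add[OF subspace] subspace_diff[OF subspace] subspace_scale[OF subspace] subspace_0[OF subspace]

lemma ip_diff: "\<lbrakk>x \<in> L; y \<in> L; z \<in> L\<rbrakk> \<Longrightarrow> ip (x - y) z = ip x z - ip y z"
  using ip_add[of "x - y" y z] by (simp add: closed)

lemma ip_add_right: "\<lbrakk>x \<in> L; y \<in> L; z \<in> L\<rbrakk> \<Longrightarrow> ip z (x + y) = ip z x + ip z y"
  using ip_add by (simp add: ip_commute[of z])

lemma ip_diff_right: "\<lbrakk>x \<in> L; y \<in> L; z \<in> L\<rbrakk> \<Longrightarrow> ip z (x - y) = ip z x - ip z y"
  using ip_diff by (simp add: ip_commute[of z])

lemma ip_scale_right: "\<lbrakk>x \<in> L; z \<in> L\<rbrakk> \<Longrightarrow> ip z (r *\<^sub>R x) = r * ip z x"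
  using ip_scale by (simp add: ip_commute[of z])

lemmas bilinear = ip_add ip_diff ip_scale ip_add_right ip_diff_right ip_scale_right

lemma nrm_nonneg: "x \<in> L \<Longrightarrow> 0 \<le> nrm x"
  by (simp add: nrm_eq ip_nonneg)

lemma nrm_sq: "x \<in> L \<Longrightarrow> (nrm x)\<^sup>2 = ip x x"
  by (simp add: nrm_eq ip_nonneg)

lemma Cauchy_Schwarz:
  assumes "x \<in> L" "y \<in> L"
  shows "\<bar>ip x y\<bar> \<le> nrm x * nrm y"
proof -
  have q: "0 \<le> ip x x - 2 * t * ip x y + t\<^sup>2 * ip y y" for t
  proof -
    have "0 \<le> ip (x - t *\<^sub>R y) (x - t *\<^sub>R y)" using assms by (intro ip_nonneg closed)
    also have "\<dots> = ip x x - 2 * t * ip x y + t\<^sup>2 * ip y y"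
      using assms by (simp add: bilinear closed ip_commute[of y x] power2_eq_square algebra_simps)
    finally show ?thesis .
  qed
  have "(ip x y)\<^sup>2 \<le> ip x x * ip y y"
  \<comment> \<open>Without definiteness this case does not force \<open>y = 0\<close>. If
    \<open>ip x y\<close> were nonzero, the witness for \<open>t\<close> below would give the
    quadratic the value -1.\<close>
  proof (cases "ip y y = 0")
    case True
    have "ip x y = 0"
    proof (rule ccontr)
      assume "ip x y \<noteq> 0"
      with q[of "(ip x x + 1) / (2 * ip x y)"] True show False by (simp add: field_simps)
    qed
    then show ?thesis using True by simp
  next
    case False
    then have "0 < ip y y" using ip_nonneg[OF assms(2)] by simp
    with q[of "ip x y / ip y y"] show ?thesis
      by (simp add: field_simps power2_eq_square)
  qed
  then have "sqrt ((ip x y)\<^sup>2) \<le> sqrt (ip x x * ip y y)" by (rule real_sqrt_le_mono)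
  then show ?thesis by (simp add: nrm_eq real_sqrt_mult)
qed

lemma nrm_triangle:
  assumes "x \<in> L" "y \<in> L"
  shows "nrm (x + y) \<le> nrm x + nrm y"
proof (rule power2_le_imp_le)
  have "(nrm (x + y))\<^sup>2 = (nrm x)\<^sup>2 + 2 * ip x y + (nrm y)\<^sup>2"
    using assms by (simp add: nrm_sq bilinear closed ip_commute[of y x])
  also have "\<dots> \<le> (nrm x + nrm y)\<^sup>2"
    using Cauchy_Schwarz[OF assms] by (simp add: power2_sum)
  finally show "(nrm (x + y))\<^sup>2 \<le> (nrm x + nrm y)\<^sup>2" .
qed (use assms nrm_nonneg in auto)

lemma nrm_scale: "x \<in> L \<Longrightarrow> nrm (r *\<^sub>R x) = \<bar>r\<bar> * nrm x"
  by (simp add: nrm_eq bilinear closed real_sqrt_mult flip: mult.assoc)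

lemma nrm_diff: "\<lbrakk>x \<in> L; y \<in> L\<rbrakk> \<Longrightarrow> nrm (x - y) \<le> nrm x + nrm y"
  using nrm_triangle[of x "(-1) *\<^sub>R y"] nrm_scale[of y "-1"] closed(3)[of y "-1"] by simp

lemma nrm_zero [simp]: "nrm 0 = 0"
  using nrm_scale[of 0 0] closed by simp

text \<open>The strong derivative with respect to the seminorm, in the shape of the difference
  quotient of \<open>C1_time\<close>.\<close>

definition vderiv :: "(real \<Rightarrow> 'a) \<Rightarrow> 'a \<Rightarrow> real \<Rightarrow> real set \<Rightarrow> bool" where
  "vderiv y dy t S \<longleftrightarrow> ((\<lambda>s. nrm ((1 / (s - t)) *\<^sub>R (y s - y t) - dy)) \<longlongrightarrow> 0) (at t within S)"

lemma vderiv_cont: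
  assumes "vderiv y dy t S" "\<And>s. s \<in> S \<Longrightarrow> y s \<in> L" "t \<in> S" "dy \<in> L"
  shows "((\<lambda>s. nrm (y s - y t)) \<longlongrightarrow> 0) (at t within S)"
proof -
  let ?q = "\<lambda>s. (1 / (s - t)) *\<^sub>R (y s - y t)"
  have "((\<lambda>s. \<bar>s - t\<bar> * (nrm (?q s - dy) + nrm dy)) \<longlongrightarrow> \<bar>t - t\<bar> * (0 + nrm dy)) (at t within S)"
    using assms(1) unfolding vderiv_def by (intro tendsto_intros)
  then have lim: "((\<lambda>s. \<bar>s - t\<bar> * (nrm (?q s - dy) + nrm dy)) \<longlongrightarrow> 0) (at t within S)" by simp
  have bd: "norm (nrm (y s - y t)) \<le> \<bar>s - t\<bar> * (nrm (?q s - dy) + nrm dy)" if "s \<in> S" "s \<noteq> t" for s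
  proof -
    have m: "y s \<in> L" "y t \<in> L" "?q s \<in> L" using assms that by (auto intro!: closed)
    have "nrm (y s - y t) = nrm ((s - t) *\<^sub>R ?q s)" using that by simp
    also have "\<dots> = \<bar>s - t\<bar> * nrm (?q s)" by (rule nrm_scale) (rule m)
    also have "\<dots> \<le> \<bar>s - t\<bar> * (nrm (?q s - dy) + nrm dy)"
      using nrm_triangle[of "?q s - dy" dy] m assms by (intro mult_left_mono) (auto simp: closed)
    finally show ?thesis using nrm_nonneg[of "y s - y t"] m by (simp add: closed)
  qed
  show ?thesis
    by (rule Lim_null_comparison[OF _ lim]) (use bd in \<open>auto simp: eventually_at_filter\<close>)
qed

lemma ip_has_derivative:
  assumes y: "vderiv y dy t S" "\<And>s. s \<in> S \<Longrightarrow> y s \<in> L" "dy \<in> L"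
    and z: "vderiv z dz t S" "\<And>s. s \<in> S \<Longrightarrow> z s \<in> L" "dz \<in> L" and t: "t \<in> S"
  shows "((\<lambda>s. ip (y s) (z s)) has_real_derivative (ip dy (z t) + ip (y t) dz)) (at t within S)"
  unfolding has_field_derivative_iff
proof (rule LIM_zero_cancel, rule Lim_null_comparison)
  let ?qy = "\<lambda>s. (1 / (s - t)) *\<^sub>R (y s - y t)" and ?qz = "\<lambda>s. (1 / (s - t)) *\<^sub>R (z s - z t)"
  \<comment> \<open>Product rule: the error of the scalar difference quotient splits into three
    terms, pairing \<open>?qy s - dy\<close> with \<open>z s\<close>, \<open>dy\<close> with
    \<open>z s - z t\<close>, and \<open>y t\<close> with \<open>?qz s - dz\<close>. Cauchy-Schwarz
    bounds them by the three summands of \<open>?B\<close>.\<close>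
  let ?B = "\<lambda>s. nrm (?qy s - dy) * (nrm (z s - z t) + nrm (z t)) + nrm dy * nrm (z s - z t) + nrm (y t) * nrm (?qz s - dz)"
  have "(?B \<longlongrightarrow> 0 * (0 + nrm (z t)) + nrm dy * 0 + nrm (y t) * 0) (at t within S)"
    using y(1) z(1) vderiv_cont[OF z(1,2) t z(3)] unfolding vderiv_def
    by (intro tendsto_intros)
  then show "(?B \<longlongrightarrow> 0) (at t within S)" by simp
  have "norm ((ip (y s) (z s) - ip (y t) (z t)) / (s - t) - (ip dy (z t) + ip (y t) dz)) \<le> ?B s"
    if s: "s \<in> S" "s \<noteq> t" for s
  proof -
    have m: "y s \<in> L" "y t \<in> L" "?qy s \<in> L" "z s \<in> L" "z t \<in> L" "?qz s \<in> L"
      using y z t s by (auto intro!: closed)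
    have "ip (?qy s) (z s) + ip (y t) (?qz s) = (ip (y s) (z s) - ip (y t) (z t)) / (s - t)"
    proof -
      have "ip (?qy s) (z s) = (ip (y s) (z s) - ip (y t) (z s)) / (s - t)"
        using m by (simp add: ip_diff ip_scale closed del: scaleR_diff_right)
      moreover have "ip (y t) (?qz s) = (ip (y t) (z s) - ip (y t) (z t)) / (s - t)"
        using m by (simp add: ip_diff_right ip_scale_right closed del: scaleR_diff_right)
      ultimately show ?thesis by (simp add: diff_divide_distrib)
    qed
    then have "(ip (y s) (z s) - ip (y t) (z t)) / (s - t) - (ip dy (z t) + ip (y t) dz)
        = ip (?qy s - dy) (z s) + ip dy (z s - z t) + ip (y t) (?qz s - dz)"
      using m y(3) z(3) by (simp add: ip_diff ip_diff_right closed del: scaleR_diff_right)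
    also have "norm \<dots> \<le> nrm (?qy s - dy) * nrm (z s) + nrm dy * nrm (z s - z t) + nrm (y t) * nrm (?qz s - dz)"
      using Cauchy_Schwarz[of "?qy s - dy" "z s"] Cauchy_Schwarz[of dy "z s - z t"]
        Cauchy_Schwarz[of "y t" "?qz s - dz"] m y(3) z(3)
      unfolding real_norm_def by (simp add: closed del: scaleR_diff_right)
    also have "nrm (?qy s - dy) * nrm (z s) \<le> nrm (?qy s - dy) * (nrm (z s - z t) + nrm (z t))"
      using nrm_triangle[of "z s - z t" "z t"] m y(3) nrm_nonneg
      by (intro mult_left_mono) (auto simp: closed)
    finally show ?thesis by simp
  qed
  then show "\<forall>\<^sub>F s in at t within S.
      norm ((ip (y s) (z s) - ip (y t) (z t)) / (s - t) - (ip dy (z t) + ip (y t) dz)) \<le> ?B s"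
    by (auto simp: eventually_at_filter)
qed

lemma vderiv_const: "dy \<in> L \<Longrightarrow> vderiv (\<lambda>s. x) 0 t S"
  by (simp add: vderiv_def)

lemma vderiv_diff:
  assumes y: "vderiv y dy t S" "\<And>s. s \<in> S \<Longrightarrow> y s \<in> L" "dy \<in> L"
    and z: "vderiv z dz t S" "\<And>s. s \<in> S \<Longrightarrow> z s \<in> L" "dz \<in> L" and t: "t \<in> S"
  shows "vderiv (\<lambda>s. y s - z s) (dy - dz) t S"
  unfolding vderiv_def
proof (rule Lim_null_comparison)
  let ?q = "\<lambda>y s. (1 / (s - t)) *\<^sub>R (y s - y t)"
  have "((\<lambda>s. nrm (?q y s - dy) + nrm (?q z s - dz)) \<longlongrightarrow> 0 + 0) (at t within S)"
    using y z unfolding vderiv_def by (intro tendsto_intros)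
  then show "((\<lambda>s. nrm (?q y s - dy) + nrm (?q z s - dz)) \<longlongrightarrow> 0) (at t within S)" by simp
  have "norm (nrm ((1 / (s - t)) *\<^sub>R (y s - z s - (y t - z t)) - (dy - dz)))
    \<le> nrm (?q y s - dy) + nrm (?q z s - dz)" if "s \<in> S" for s
  proof -
    have m: "?q y s - dy \<in> L" "?q z s - dz \<in> L" using y z t that by (auto intro!: closed)
    have eq: "(1 / (s - t)) *\<^sub>R (y s - z s - (y t - z t)) - (dy - dz) = (?q y s - dy) - (?q z s - dz)"
      by (simp add: scaleR_diff_right)
    show ?thesis unfolding eq real_norm_def
      using nrm_diff[OF m] nrm_nonneg[OF closed(2)[OF m]] by linarith
  qed
  then show "\<forall>\<^sub>F s in at t within S. norm (nrm ((1 / (s - t)) *\<^sub>R (y s - z s - (y t - z t)) - (dy - dz)))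
      \<le> nrm (?q y s - dy) + nrm (?q z s - dz)"
    by (auto simp: eventually_at_filter)
qed

text \<open>The vector mean value inequality, reduced to the scalar one by testing with the increment.\<close>

lemma nrm_increment_le:
  assumes ab: "a \<le> b" and y: "\<And>s. s \<in> {a..b} \<Longrightarrow> y s \<in> L" "\<And>s. s \<in> {a..b} \<Longrightarrow> dy s \<in> L"
    and d: "\<And>s. s \<in> {a..b} \<Longrightarrow> vderiv y (dy s) s {a..b}"
    and M: "\<And>s. s \<in> {a..b} \<Longrightarrow> nrm (dy s) \<le> M"
  shows "nrm (y b - y a) \<le> (b - a) * M"
proof (cases "a = b")
  case False
  define z where "z = y b - y a"
  have z: "z \<in> L" using y ab by (auto simp: z_def closed)
  have der: "((\<lambda>r. ip (y r) z) has_real_derivative ip (dy s) z) (at s within {a..b})" if "s \<in> {a..b}" for s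
    using ip_has_derivative[OF d[OF that] y(1) y(2)[OF that] vderiv_const[OF z, of z] _ _ that] z y(1)[OF that]
      bilinear(3)[of 0 "y s" 0] by (simp add: closed ip_commute)
  have "\<exists>x\<in>{a<..<b}. ip (y b) z - ip (y a) z = (\<lambda>h. h * ip (dy x) z) (b - a)"
    by (rule mvt_simple) (use ab False der in \<open>auto simp: has_field_derivative_def mult.commute[of _ "ip _ _"]\<close>)
  then obtain x where x: "x \<in> {a<..<b}" "ip (y b) z - ip (y a) z = (b - a) * ip (dy x) z" by blast
  have "nrm z * nrm z = ip (y b) z - ip (y a) z"
    using y ab z by (simp add: nrm_sq[symmetric] power2_eq_square[symmetric]) (simp add: nrm_sq z_def bilinear closed)
  also have "\<dots> \<le> (b - a) * (M * nrm z)"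
  proof -
    have "ip (dy x) z \<le> nrm (dy x) * nrm z" using Cauchy_Schwarz[of "dy x" z] y(2)[of x] x z by auto
    also have "\<dots> \<le> M * nrm z" using M[of x] x nrm_nonneg[OF z] by (intro mult_right_mono) auto
    finally show ?thesis using ab unfolding x(2) by (intro mult_left_mono) auto
  qed
  finally have "nrm z * nrm z \<le> ((b - a) * M) * nrm z" by simp
  moreover have "0 \<le> M" using M[of a] nrm_nonneg[OF y(2)[of a]] ab by auto
  ultimately show ?thesis
    using nrm_nonneg[OF z] ab unfolding z_def[symmetric]
    by (cases "nrm z = 0") (auto simp: mult_le_cancel_right)
qed (use ab in simp)

text \<open>Weak differentiability against a fixed test space, with an equicontinuous derivative,
  upgrades to strong differentiability by testing with the difference quotient itself.\<close>

lemma strong_derivative: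
  assumes X: "subspace X" "X \<subseteq> L" and c0: "0 < c0"
    and k: "\<And>x. x \<in> L \<Longrightarrow> \<kappa> x \<in> L" "\<And>x y. \<lbrakk>x \<in> L; y \<in> L\<rbrakk> \<Longrightarrow> \<kappa> (x - y) = \<kappa> x - \<kappa> y"
      "\<And>r x. x \<in> L \<Longrightarrow> \<kappa> (r *\<^sub>R x) = r *\<^sub>R \<kappa> x" "\<And>x. x \<in> L \<Longrightarrow> c0 * ip x x \<le> ip (\<kappa> x) x"
    and y: "\<And>s. s \<in> {a..b} \<Longrightarrow> y s \<in> X" "\<And>s. s \<in> {a..b} \<Longrightarrow> dy s \<in> X"
    and d: "\<And>s v. \<lbrakk>s \<in> {a..b}; v \<in> X\<rbrakk> \<Longrightarrow>
      ((\<lambda>r. ip (\<kappa> (y r)) v) has_real_derivative ip (\<kappa> (dy s)) v) (at s within {a..b})"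
    and t: "t \<in> {a..b}" and \<omega>: "(\<omega> \<longlongrightarrow> 0) (at t within {a..b})"
    and eq: "\<And>s v. \<lbrakk>s \<in> {a..b}; v \<in> X\<rbrakk> \<Longrightarrow> \<bar>ip (\<kappa> (dy s)) v - ip (\<kappa> (dy t)) v\<bar> \<le> \<omega> s * nrm v"
  shows "vderiv y (dy t) t {a..b}"
  unfolding vderiv_def
proof (rule tendstoI)
  fix e :: real assume e: "0 < e"
  \<comment> \<open>Coercivity will give \<open>c0 * nrm D \<le> \<epsilon>\<close> for the error
    \<open>D\<close> of the difference quotient, that is, at most half of \<open>e\<close>.\<close>
  define \<epsilon> where "\<epsilon> = c0 * e / 2"
  have \<epsilon>: "0 < \<epsilon>" using e c0 by (simp add: \<epsilon>_def)
  from tendstoD[OF \<omega> this] obtain \<delta> where \<delta>: "0 < \<delta>"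
    "\<And>s. \<lbrakk>s \<in> {a..b}; s \<noteq> t; dist s t < \<delta>\<rbrakk> \<Longrightarrow> \<bar>\<omega> s\<bar> < \<epsilon>"
    by (auto simp: eventually_at)
  have "nrm ((1 / (s - t)) *\<^sub>R (y s - y t) - dy t) < e"
    if s: "s \<in> {a..b}" "s \<noteq> t" "dist s t < \<delta>" for s
  proof -
    define D where "D = (1 / (s - t)) *\<^sub>R (y s - y t) - dy t"
    have DX: "D \<in> X" unfolding D_def using y s t by (intro subspace_diff[OF X(1)] subspace_scale[OF X(1)]) auto
    note mem = subsetD[OF X(2)]
    let ?f = "\<lambda>r. ip (\<kappa> (y r)) D"
    have mv: "\<exists>x\<in>{p<..<q}. ?f q - ?f p = (q - p) * ip (\<kappa> (dy x)) D"
      if "p < q" "{p..q} \<subseteq> {a..b}" for p q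
    proof -
      have "\<exists>x\<in>{p<..<q}. ?f q - ?f p = (\<lambda>h. h * ip (\<kappa> (dy x)) D) (q - p)"
      proof (rule mvt_simple[OF \<open>p < q\<close>])
        fix x assume "p \<le> x" "x \<le> q"
        then have "x \<in> {a..b}" using that by auto
        from has_field_derivative_subset[OF d[OF this DX] that(2)]
        show "(?f has_derivative (\<lambda>h. h * ip (\<kappa> (dy x)) D)) (at x within {p..q})"
          by (simp add: has_field_derivative_def mult.commute[of _ "ip _ _"])
      qed
      then show ?thesis by simp
    qed
    \<comment> \<open>The intermediate time of the mean value theorem depends on the test element
      \<open>D\<close>; this is harmless, because \<omega> bounds the variation of the derivative
      for all test elements at once.\<close>
    have "\<exists>x\<in>{a..b}. x \<noteq> t \<and> dist x t < \<delta> \<and> (?f s - ?f t) / (s - t) = ip (\<kappa> (dy x)) D"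
    proof (cases "s < t")
      case True
      then obtain x where "x \<in> {s<..<t}" "?f t - ?f s = (t - s) * ip (\<kappa> (dy x)) D"
        using mv[of s t] s t by auto
      with True s t show ?thesis
        by (intro bexI[of _ x]) (auto simp: dist_real_def divide_simps algebra_simps)
    next
      case False
      then obtain x where "x \<in> {t<..<s}" "?f s - ?f t = (s - t) * ip (\<kappa> (dy x)) D"
        using mv[of t s] s t by auto
      with False s t show ?thesis
        by (intro bexI[of _ x]) (auto simp: dist_real_def divide_simps algebra_simps)
    qed
    then obtain x where x: "x \<in> {a..b}" "x \<noteq> t" "dist x t < \<delta>"
      "(?f s - ?f t) / (s - t) = ip (\<kappa> (dy x)) D" by blast
    have m: "y s \<in> L" "y t \<in> L" "dy t \<in> L" "D \<in> L" using y s t DX mem by auto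
    have "c0 * (nrm D * nrm D) \<le> ip (\<kappa> D) D"
      using k(4)[OF m(4)] nrm_sq[OF m(4)] by (simp add: power2_eq_square)
    also have "\<kappa> D = (1 / (s - t)) *\<^sub>R (\<kappa> (y s) - \<kappa> (y t)) - \<kappa> (dy t)"
      unfolding D_def using m by (simp add: k closed)
    also have "ip \<dots> D = (?f s - ?f t) / (s - t) - ip (\<kappa> (dy t)) D"
      using m k(1) by (simp add: ip_diff ip_scale closed del: scaleR_diff_right)
    also have "\<dots> \<le> \<epsilon> * nrm D"
    proof -
      have "(?f s - ?f t) / (s - t) - ip (\<kappa> (dy t)) D \<le> \<omega> x * nrm D"
        using eq[OF x(1) DX] unfolding x(4) by linarith
      also have "\<dots> \<le> \<epsilon> * nrm D"
        using \<delta>(2)[OF x(1-3)] nrm_nonneg[OF m(4)] by (intro mult_right_mono) auto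
      finally show ?thesis .
    qed
    finally have "(c0 * nrm D) * nrm D \<le> \<epsilon> * nrm D" by simp
    then have "nrm D = 0 \<or> c0 * nrm D \<le> \<epsilon>"
      using nrm_nonneg[OF m(4)] by (auto simp: mult_le_cancel_right)
    then have "nrm D \<le> e / 2" using c0 e by (auto simp: \<epsilon>_def)
    then show ?thesis using e unfolding D_def by simp
  qed
  then show "\<forall>\<^sub>F s in at t within {a..b}. dist (nrm ((1 / (s - t)) *\<^sub>R (y s - y t) - dy t)) 0 < e"
    unfolding eventually_at
  proof (intro exI[of _ \<delta>] conjI ballI impI \<delta>(1), elim conjE)
    fix s assume s: "s \<in> {a..b}" "s \<noteq> t" "dist s t < \<delta>"
    have "(1 / (s - t)) *\<^sub>R (y s - y t) - dy t \<in> L"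
      using y s t X(2) by (intro closed) auto
    from nrm_nonneg[OF this]
      \<open>\<And>s. \<lbrakk>s \<in> {a..b}; s \<noteq> t; dist s t < \<delta>\<rbrakk> \<Longrightarrow> nrm ((1 / (s - t)) *\<^sub>R (y s - y t) - dy t) < e\<close>[OF s]
    show "dist (nrm ((1 / (s - t)) *\<^sub>R (y s - y t) - dy t)) 0 < e" by (simp add: dist_real_def)
  qed
qed

end

section \<open>Piecewise polynomials on a uniform mesh\<close>

locale edge_mesh =
  fixes r :: real and n :: nat
  assumes r: "0 < r" and n: "0 < n"
begin

definition h :: real where "h = r / real n"
definition node :: "nat \<Rightarrow> real" where "node i = real i * h"
abbreviation cell :: "nat \<Rightarrow> real set" where "cell i \<equiv> {node i..node (Suc i)}"

lemma h_pos: "0 < h" using r n by (simp add: h_def)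

lemma node_n: "node n = r" using n by (simp add: node_def h_def)

lemma node_0 [simp]: "node 0 = 0" by (simp add: node_def)

lemma node_Suc: "node (Suc i) = node i + h" by (simp add: node_def distrib_right)

lemma node_mono: "i \<le> j \<Longrightarrow> node i \<le> node j"
  using h_pos unfolding node_def by (intro mult_right_mono) auto

lemma node_bounds: "i < n \<Longrightarrow> 0 \<le> node i \<and> node i < node (Suc i) \<and> node (Suc i) \<le> r"
  using h_pos node_mono[of "Suc i" n] node_mono[of 0 i] node_n by (simp add: node_Suc)

lemma cell_subset: "i < n \<Longrightarrow> cell i \<subseteq> {0..r}"
  using node_bounds[of i] by (auto simp del: of_nat_Suc)

lemma cell_integrable:
  fixes f :: "real \<Rightarrow> real"
  assumes "integrable (lebesgue_on {0..r}) f" "i < n"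
  shows "integrable (lebesgue_on (cell i)) f" "f integrable_on cell i"
  using integrable_subinterval0[OF assms(1), of "node i" "node (Suc i)"] node_bounds[OF assms(2)] by blast+

lemma integral_split:
  fixes f :: "real \<Rightarrow> real"
  assumes f: "integrable (lebesgue_on {0..r}) f" and "k \<le> n"
  shows "integral {0..node k} f = (\<Sum>i<k. integral (cell i) f)"
  using \<open>k \<le> n\<close>
proof (induction k)
  case (Suc k)
  have "integral {0..node k} f + integral (cell k) f = integral {0..node (Suc k)} f"
  proof (rule Henstock_Kurzweil_Integration.integral_combine)
    show "0 \<le> node k" "node k \<le> node (Suc k)" using node_bounds[of k] Suc.prems by auto
    show "f integrable_on {0..node (Suc k)}"
      using node_bounds[of k] Suc.prems by (intro integrable_subinterval0(2)[OF f]) auto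
  qed
  with Suc show ?case by simp
qed simp

lemma LINT_split:
  fixes f :: "real \<Rightarrow> real"
  assumes "integrable (lebesgue_on {0..r}) f"
  shows "(LINT x|lebesgue_on {0..r}. f x) = (\<Sum>i<n. integral (cell i) f)"
  using integral_split[OF assms, of n] LINT_eq_integral[OF assms] node_n by simp

text \<open>Half-open cells are disjoint, so every point of (0, r] receives exactly one
  coefficient.\<close>

definition pcw :: "(nat \<Rightarrow> real) \<Rightarrow> real \<Rightarrow> real" where
  "pcw c x = (\<Sum>i<n. c i * indicator {node i<..node (Suc i)} x)"

lemma pcw_eq:
  assumes "i < n" "x \<in> {node i<..node (Suc i)}"
  shows "pcw c x = c i"
proof -
  have "x \<notin> {node j<..node (Suc j)}" if "j \<noteq> i" for j
  proof (cases "j < i")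
    case True
    then show ?thesis using node_mono[of "Suc j" i] assms(2) by auto
  next
    case False
    then show ?thesis using node_mono[of "Suc i" j] assms(2) that by auto
  qed
  then have "pcw c x = (\<Sum>j<n. if j = i then c i else 0)"
    unfolding pcw_def using assms(2) by (intro sum.cong) auto
  then show ?thesis using assms(1) by simp
qed

lemma in_some_cell:
  assumes "x \<in> {0<..r}"
  obtains i where "i < n" "x \<in> {node i<..node (Suc i)}"
proof -
  \<comment> \<open>The ceiling and not the floor, since cells are closed on the right.\<close>
  define i where "i = nat (\<lceil>x / h\<rceil> - 1)"
  have "0 < x / h" using assms h_pos by (intro divide_pos_pos) auto
  then have i: "real i = of_int \<lceil>x / h\<rceil> - 1" by (simp add: i_def)
  have "of_int \<lceil>x / h\<rceil> - 1 < x / h" "x / h \<le> of_int \<lceil>x / h\<rceil>" by linarith+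
  then have *: "real i < x / h" "x / h \<le> real (Suc i)" using i by auto
  then have x: "x \<in> {node i<..node (Suc i)}"
    using h_pos unfolding node_def pos_less_divide_eq[OF h_pos] pos_divide_le_eq[OF h_pos] by simp
  have "x / h \<le> n" using assms node_n by (simp add: pos_divide_le_eq h_pos node_def)
  with *(1) have "i < n" by linarith
  with x that show ?thesis by blast
qed

lemma AE_cells:
  assumes "\<And>i. i < n \<Longrightarrow> AE x in lebesgue_on (cell i). P x"
  shows "AE x in lebesgue_on {0..r}. P x"
proof -
  have "AE x in lebesgue. \<forall>i\<in>{..<n}. x \<in> cell i \<longrightarrow> P x"
    using assms by (subst AE_finite_all) (auto simp: AE_restrict_space_iff)
  moreover have "AE x in lebesgue. x \<noteq> (0::real)" by (rule AE_completion) (rule AE_lborel_singleton)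
  ultimately have "AE x in lebesgue. x \<in> {0..r} \<longrightarrow> P x"
  proof eventually_elim
    case (elim x)
    show ?case
    proof
      assume "x \<in> {0..r}"
      with elim have "x \<in> {0<..r}" by simp
      then obtain i where "i < n" "x \<in> {node i<..node (Suc i)}" by (rule in_some_cell)
      then show "P x" using elim(1) by auto
    qed
  qed
  then show ?thesis by (subst AE_restrict_space_iff) auto
qed

lemma AE_cell_open: "AE x in lebesgue_on (cell i). x \<in> {node i<..node (Suc i)}"
proof -
  have "AE x in lebesgue. x \<noteq> node i" by (rule AE_completion) (rule AE_lborel_singleton)
  then show ?thesis by (subst AE_restrict_space_iff) (auto elim!: eventually_mono)
qed

lemma AE_cell:
  assumes "AE x in lebesgue_on {0..r}. P x" "i < n"
  shows "AE x in lebesgue_on (cell i). P x"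
proof -
  have "AE x in lebesgue. x \<in> {0..r} \<longrightarrow> P x" using assms(1) by (subst (asm) AE_restrict_space_iff) auto
  then have "AE x in lebesgue. x \<in> cell i \<longrightarrow> P x"
    using cell_subset[OF assms(2)] by (auto elim!: eventually_mono)
  then show ?thesis by (subst AE_restrict_space_iff) auto
qed

lemma pcw_AE: "i < n \<Longrightarrow> AE x in lebesgue_on (cell i). pcw c x = c i"
  using AE_cell_open by eventually_elim (rule pcw_eq)

lemma pcw_measurable: "pcw c \<in> borel_measurable (lebesgue_on {0..r})"
proof -
  have "(\<lambda>x. \<Sum>i<n. c i * indicator {node i<..node (Suc i)} x) \<in> borel_measurable lebesgue"
    by (intro borel_measurable_sum borel_measurable_times borel_measurable_const borel_measurable_indicator) simp
  then show ?thesis unfolding pcw_def[abs_def] by (rule measurable_restrict_space1)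
qed

lemma pcw_L2: "pcw c \<in> L2_int r"
proof (rule L2_int_bounded[OF pcw_measurable])
  have "\<bar>pcw c x\<bar> \<le> (\<Sum>i<n. \<bar>c i\<bar>)" for x
    unfolding pcw_def by (rule order_trans[OF sum_abs sum_mono]) (auto simp: indicator_def)
  then show "AE x in lebesgue_on {0..r}. \<bar>pcw c x\<bar> \<le> (\<Sum>i<n. \<bar>c i\<bar>)" by simp
qed

definition Q0 :: "(real \<Rightarrow> real) set" where
  "Q0 = {q \<in> L2_int r. \<forall>i<n. \<exists>c. AE x in lebesgue_on (cell i). q x = c}"

lemma pcw_Q0: "pcw c \<in> Q0"
  unfolding Q0_def using pcw_L2 pcw_AE by blast

lemma Q0_pcw:
  assumes "q \<in> Q0"
  obtains c where "AE x in lebesgue_on {0..r}. q x = pcw c x"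
proof -
  obtain c where c: "\<And>i. i < n \<Longrightarrow> AE x in lebesgue_on (cell i). q x = c i"
    using assms unfolding Q0_def by (auto; metis)
  have "AE x in lebesgue_on {0..r}. q x = pcw c x"
  proof (rule AE_cells)
    fix i assume "i < n"
    from c[OF this] pcw_AE[OF this, of c] show "AE x in lebesgue_on (cell i). q x = pcw c x"
      by eventually_elim simp
  qed
  then show ?thesis by (rule that)
qed

lemma integral_cell_cong:
  fixes f g :: "real \<Rightarrow> real"
  assumes "AE x in lebesgue_on (cell i). f x = g x" "integrable (lebesgue_on (cell i)) f"
    "integrable (lebesgue_on (cell i)) g"
  shows "integral (cell i) f = integral (cell i) g"
proof -
  have "integral\<^sup>L (lebesgue_on (cell i)) f = integral\<^sup>L (lebesgue_on (cell i)) g"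
    by (rule integral_cong_AE) (use assms in auto)
  then show ?thesis using assms(2,3) by (simp add: lebesgue_integral_eq_integral)
qed

section \<open>Cell averages and their approximation errors\<close>

definition mean :: "(real \<Rightarrow> real) \<Rightarrow> nat \<Rightarrow> real" where
  "mean g i = integral (cell i) g / h"

definition pmean :: "(real \<Rightarrow> real) \<Rightarrow> real \<Rightarrow> real" where
  "pmean g = pcw (mean g)"

lemma pmean_Q0: "pmean g \<in> Q0" and pmean_L2: "pmean g \<in> L2_int r"
  unfolding pmean_def using pcw_Q0 pcw_L2 by auto

lemma integral_cell_pcw_mult:
  assumes g: "g \<in> L2_int r" and i: "i < n"
  shows "integral (cell i) (\<lambda>x. g x * pcw c x) = integral (cell i) g * c i"
proof -
  have "integral (cell i) (\<lambda>x. g x * pcw c x) = integral (cell i) (\<lambda>x. g x * c i)"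
  proof (rule integral_cell_cong)
    show "AE x in lebesgue_on (cell i). g x * pcw c x = g x * c i"
      using pcw_AE[OF i, of c] by eventually_elim simp
    show "integrable (lebesgue_on (cell i)) (\<lambda>x. g x * pcw c x)"
      by (intro cell_integrable i L2_int_mult_integrable g pcw_L2)
    show "integrable (lebesgue_on (cell i)) (\<lambda>x. g x * c i)"
      using cell_integrable(1)[OF L2_int_integrable[OF g] i] by simp
  qed
  then show ?thesis by simp
qed

lemma integral_cell_pmean:
  assumes i: "i < n"
  shows "integral (cell i) (pmean g) = integral (cell i) g"
  using integral_cell_pcw_mult[OF L2_int_const[of 1] i, of "mean g"] h_pos
  by (simp add: pmean_def[symmetric] mean_def[of g i] node_Suc)

text \<open>\<open>pmean\<close> is the orthogonal projection onto the piecewise constants: pairing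
  with such a function sees only cell integrals, and averaging preserves these.\<close>

lemma pmean_orth:
  assumes g: "g \<in> L2_int r" and q: "q \<in> Q0"
  shows "(LINT x|lebesgue_on {0..r}. pmean g x * q x) = (LINT x|lebesgue_on {0..r}. g x * q x)"
proof -
  obtain c where c: "AE x in lebesgue_on {0..r}. q x = pcw c x" using Q0_pcw[OF q] .
  have qL: "q \<in> L2_int r" using q by (simp add: Q0_def)
  have *: "(LINT x|lebesgue_on {0..r}. f x * q x) = (\<Sum>i<n. integral (cell i) f * c i)" if f: "f \<in> L2_int r" for f
  proof -
    have "(LINT x|lebesgue_on {0..r}. f x * q x) = (LINT x|lebesgue_on {0..r}. f x * pcw c x)"
    proof (rule integral_cong_AE)
      show "AE x in lebesgue_on {0..r}. f x * q x = f x * pcw c x" using c by eventually_elim simp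
    qed (use L2_int_mult_integrable[OF f qL] L2_int_mult_integrable[OF f pcw_L2] in auto)
    also have "\<dots> = (\<Sum>i<n. integral (cell i) (\<lambda>x. f x * pcw c x))"
      by (rule LINT_split[OF L2_int_mult_integrable[OF f pcw_L2]])
    also have "\<dots> = (\<Sum>i<n. integral (cell i) f * c i)"
      by (rule sum.cong) (auto simp: integral_cell_pcw_mult[OF f])
    finally show ?thesis .
  qed
  show ?thesis unfolding *[OF g] *[OF pmean_L2] by (rule sum.cong) (auto simp: integral_cell_pmean)
qed

text \<open>Up to a node the primitive is a sum of integrals over whole cells, which averaging
  preserves. Hence \<open>prim (pmean g)\<close> is the nodal interpolant of
  \<open>prim g\<close>.\<close>

lemma prim_pmean_node:
  assumes g: "g \<in> L2_int r" and "i \<le> n"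
  shows "prim (pmean g) (node i) = prim g (node i)"
proof -
  have "prim (pmean g) (node i) = (\<Sum>j<i. integral (cell j) (pmean g))"
    unfolding prim_def by (rule integral_split[OF L2_int_integrable[OF pmean_L2] assms(2)])
  also have "\<dots> = (\<Sum>j<i. integral (cell j) g)"
    using assms(2) by (intro sum.cong integral_cell_pmean) auto
  also have "\<dots> = prim g (node i)"
    unfolding prim_def by (rule integral_split[OF L2_int_integrable[OF g] assms(2), symmetric])
  finally show ?thesis .
qed

lemma prim_pcw:
  assumes i: "i < n" and x: "x \<in> cell i"
  shows "prim (pcw c) x = prim (pcw c) (node i) + c i * (x - node i)"
proof -
  have b: "0 \<le> node i" "node i \<le> x" "x \<le> r" using node_bounds[OF i] x by auto
  have "prim (pcw c) x - prim (pcw c) (node i) = integral {node i..x} (pcw c)"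
    by (rule prim_diff[OF L2_int_integrable[OF pcw_L2] b])
  also have "\<dots> = integral {node i..x} (\<lambda>x. c i)"
    by (rule integral_spike[of "{node i}"]) (use x in \<open>auto intro!: pcw_eq[OF i, symmetric]\<close>)
  finally show ?thesis using b by (simp add: mult.commute)
qed

text \<open>Pythagoras: by orthogonality the two sides differ by the squared norm of
  \<open>pmean g - q\<close>.\<close>

lemma pmean_best:
  assumes g: "g \<in> L2_int r" and q: "q \<in> Q0"
  shows "(LINT x|lebesgue_on {0..r}. (g x - pmean g x)\<^sup>2) \<le> (LINT x|lebesgue_on {0..r}. (g x - q x)\<^sup>2)"
proof -
  let ?M = "lebesgue_on {0..r}"
  have qL: "q \<in> L2_int r" using q by (simp add: Q0_def)
  note L = g qL pmean_L2[of g]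
  have i: "integrable ?M (\<lambda>x. f x * k x)" if "f \<in> L2_int r" "k \<in> L2_int r" for f k
    by (rule L2_int_mult_integrable[OF that])
  have d: "(LINT x|?M. (f x - k x)\<^sup>2) = (LINT x|?M. f x * f x) - 2 * (LINT x|?M. f x * k x) + (LINT x|?M. k x * k x)"
    if "f \<in> L2_int r" "k \<in> L2_int r" for f k
  proof -
    have "(LINT x|?M. (f x - k x)\<^sup>2) = (LINT x|?M. f x * f x - 2 * (f x * k x) + k x * k x)"
      by (rule Bochner_Integration.integral_cong) (auto simp: power2_eq_square algebra_simps)
    then show ?thesis using i that by simp
  qed
  have "0 \<le> (LINT x|?M. (pmean g x - q x)\<^sup>2)" by simp
  then show ?thesis
    using pmean_orth[OF g pmean_Q0[of g]] pmean_orth[OF g q]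
    by (simp add: d[OF g L(3)] d[OF g qL] d[OF L(3) qL])
qed

lemma Q0_zero: "(\<lambda>x. 0) \<in> Q0"
  by (auto simp: Q0_def)

lemma pmean_error_le: "g \<in> L2_int r \<Longrightarrow>
    (LINT x|lebesgue_on {0..r}. (g x - pmean g x)\<^sup>2) \<le> (LINT x|lebesgue_on {0..r}. (g x)\<^sup>2)"
  using pmean_best[OF _ Q0_zero, of g] by simp

lemma pmean_norm_le:
  assumes g: "g \<in> L2_int r"
  shows "(LINT x|lebesgue_on {0..r}. (pmean g x)\<^sup>2) \<le> (LINT x|lebesgue_on {0..r}. (g x)\<^sup>2)"
proof -
  let ?M = "lebesgue_on {0..r}"
  have "0 \<le> (LINT x|?M. (g x - pmean g x)\<^sup>2)" by simp
  also have "\<dots> = (LINT x|?M. (g x)\<^sup>2 - 2 * (g x * pmean g x) + (pmean g x)\<^sup>2)"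
    by (rule Bochner_Integration.integral_cong) (auto simp: power2_eq_square algebra_simps)
  also have "\<dots> = (LINT x|?M. (g x)\<^sup>2) - 2 * (LINT x|?M. g x * pmean g x) + (LINT x|?M. (pmean g x)\<^sup>2)"
    using g pmean_L2[of g] L2_int_mult_integrable[OF g pmean_L2[of g]] by (simp add: L2_int_def)
  also have "(LINT x|?M. g x * pmean g x) = (LINT x|?M. (pmean g x)\<^sup>2)"
    using pmean_orth[OF g pmean_Q0[of g]] by (simp add: power2_eq_square)
  finally show ?thesis by simp
qed

text \<open>On a cell the error is the integral of \<open>k\<close> over a piece of length at most
  \<open>h\<close>, so by Cauchy-Schwarz its square is at most \<open>h\<close> times the integral
  of the square of \<open>k\<close> over the cell. Integrating this constant over the cell yields
  the second factor \<open>h\<close>.\<close>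

lemma pcw_prim_error:
  assumes k: "k \<in> L2_int r"
  shows "(LINT x|lebesgue_on {0..r}. (prim k x - pcw (\<lambda>i. prim k (node i)) x)\<^sup>2)
    \<le> h\<^sup>2 * (LINT x|lebesgue_on {0..r}. (k x)\<^sup>2)"
proof -
  let ?M = "lebesgue_on {0..r}"
  let ?c = "\<lambda>i. prim k (node i)"
  have ki: "integrable ?M k" by (rule L2_int_integrable[OF k])
  have pk: "prim k \<in> L2_int r" by (rule L2_int_continuous[OF prim_continuous[OF ki]])
  have d: "integrable ?M (\<lambda>x. (prim k x - pcw ?c x)\<^sup>2)"
    using L2_int_diff[OF pk pcw_L2] by (simp add: L2_int_def)
  have k2: "integrable ?M (\<lambda>x. (k x)\<^sup>2)" using k by (simp add: L2_int_def)
  have cell: "integral (cell i) (\<lambda>x. (prim k x - pcw ?c x)\<^sup>2) \<le> h\<^sup>2 * integral (cell i) (\<lambda>x. (k x)\<^sup>2)"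
    if i: "i < n" for i
  proof -
    let ?K = "integral (cell i) (\<lambda>x. (k x)\<^sup>2)"
    have nb: "0 \<le> node i" "node i < node (Suc i)" "node (Suc i) \<le> r" using node_bounds[OF i] by auto
    have K0: "0 \<le> ?K" by (rule integral_nonneg) (use cell_integrable(2)[OF k2 i] in auto)
    have "integral (cell i) (\<lambda>x. (prim k x - pcw ?c x)\<^sup>2) = integral\<^sup>L (lebesgue_on (cell i)) (\<lambda>x. (prim k x - pcw ?c x)\<^sup>2)"
      using cell_integrable(1)[OF d i] by (simp add: lebesgue_integral_eq_integral)
    also have "\<dots> \<le> integral\<^sup>L (lebesgue_on (cell i)) (\<lambda>x. h * ?K)"
    proof (rule integral_mono_AE)
      show "integrable (lebesgue_on (cell i)) (\<lambda>x. (prim k x - pcw ?c x)\<^sup>2)" by (rule cell_integrable(1)[OF d i])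
      show "AE x in lebesgue_on (cell i). (prim k x - pcw ?c x)\<^sup>2 \<le> h * ?K"
        using AE_cell_open
      proof eventually_elim
        case (elim x)
        have x: "node i \<le> x" "x \<le> node (Suc i)" "x \<le> r" using elim nb by auto
        have "(prim k x - pcw ?c x)\<^sup>2 = (integral {node i..x} k)\<^sup>2"
          using prim_diff[OF ki nb(1) x(1,3)] pcw_eq[OF i elim, of ?c] by simp
        also have "\<dots> \<le> (x - node i) * integral {node i..x} (\<lambda>x. (k x)\<^sup>2)"
          by (rule integral_square_le[OF k nb(1) x(1,3)])
        also have "\<dots> \<le> h * ?K"
        proof (rule mult_mono)
          show "x - node i \<le> h" using x by (simp add: node_Suc)
          show "integral {node i..x} (\<lambda>x. (k x)\<^sup>2) \<le> ?K"
          proof (rule integral_subset_le)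
            show "(\<lambda>x. (k x)\<^sup>2) integrable_on {node i..x}"
              using integrable_subinterval0(2)[OF k2 nb(1) x(3)] .
          qed (use x cell_integrable(2)[OF k2 i] in auto)
          show "0 \<le> integral {node i..x} (\<lambda>x. (k x)\<^sup>2)"
            by (rule integral_nonneg) (use integrable_subinterval0(2)[OF k2 nb(1) x(3)] in auto)
        qed (use h_pos in simp)
        finally show ?case .
      qed
    qed simp
    also have "\<dots> = h\<^sup>2 * ?K"
    proof -
      have "integral\<^sup>L (lebesgue_on (cell i)) (\<lambda>x. h * ?K) = integral (cell i) (\<lambda>x. h * ?K)"
        by (rule lebesgue_integral_eq_integral) simp_all
      also have "\<dots> = h\<^sup>2 * ?K" using h_pos by (simp add: node_Suc power2_eq_square)
      finally show ?thesis .
    qed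
    finally show ?thesis .
  qed
  have "(LINT x|?M. (prim k x - pcw ?c x)\<^sup>2) = (\<Sum>i<n. integral (cell i) (\<lambda>x. (prim k x - pcw ?c x)\<^sup>2))"
    by (rule LINT_split[OF d])
  also have "\<dots> \<le> (\<Sum>i<n. h\<^sup>2 * integral (cell i) (\<lambda>x. (k x)\<^sup>2))"
    by (rule sum_mono) (use cell in simp)
  also have "\<dots> = h\<^sup>2 * (LINT x|?M. (k x)\<^sup>2)"
    by (simp add: LINT_split[OF k2] sum_distrib_left)
  finally show ?thesis .
qed

text \<open>Apply \<open>pcw_prim_error\<close> to \<open>g - pmean g\<close>: its primitive
  vanishes at the nodes, so the piecewise constant comparison function is zero.\<close>

lemma interpolation_error:
  assumes g: "g \<in> L2_int r"
  shows "(LINT x|lebesgue_on {0..r}. (prim g x - prim (pmean g) x)\<^sup>2) \<le> h\<^sup>2 * (LINT x|lebesgue_on {0..r}. (g x)\<^sup>2)"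
proof -
  let ?k = "\<lambda>x. g x + (-1) * pmean g x"
  have k: "?k \<in> L2_int r" by (intro L2_int_add L2_int_scale g pmean_L2)
  have e: "prim ?k x = prim g x - prim (pmean g) x" if "x \<in> {0..r}" for x
    using prim_lincomb[OF L2_int_integrable[OF g] L2_int_integrable[OF pmean_L2] that, of "-1" g] by simp
  have z: "prim ?k (node i) = 0" if "i < n" for i
    using e[of "node i"] prim_pmean_node[OF g, of i] node_bounds[OF that] that by simp
  have p: "pcw (\<lambda>i. prim ?k (node i)) x = 0" for x
    unfolding pcw_def by (rule sum.neutral) (use z in simp)
  have "(LINT x|lebesgue_on {0..r}. (prim g x - prim (pmean g) x)\<^sup>2)
      = (LINT x|lebesgue_on {0..r}. (prim ?k x - pcw (\<lambda>i. prim ?k (node i)) x)\<^sup>2)"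
    by (rule Bochner_Integration.integral_cong) (use e p in auto)
  also have "\<dots> \<le> h\<^sup>2 * (LINT x|lebesgue_on {0..r}. (?k x)\<^sup>2)" by (rule pcw_prim_error[OF k])
  also have "\<dots> \<le> h\<^sup>2 * (LINT x|lebesgue_on {0..r}. (g x)\<^sup>2)"
    using pmean_error_le[OF g] by (intro mult_left_mono) auto
  finally show ?thesis .
qed


text \<open>Since averages are best approximations, they may be replaced by the values at the left
  ends of the cells, for which \<open>pcw_prim_error\<close> applies.\<close>

lemma H1_pmean_error:
  assumes w: "w \<in> Hs_int 1 r"
  shows "(LINT x|lebesgue_on {0..r}. (w x - pmean w x)\<^sup>2) \<le> h\<^sup>2 * (LINT x|lebesgue_on {0..r}. (weak_deriv r w x)\<^sup>2)"
proof -
  let ?M = "lebesgue_on {0..r}" and ?k = "weak_deriv r w" and ?\<alpha> = "trace_at r w 0"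
  note W = H1_deriv[OF r w]
  let ?q = "pcw (\<lambda>i. ?\<alpha> + prim ?k (node i))" and ?q' = "pcw (\<lambda>i. prim ?k (node i))"
  have pk: "prim ?k \<in> L2_int r"
    by (rule L2_int_continuous[OF prim_continuous[OF L2_int_integrable[OF W(2)]]])
  have "(LINT x|?M. (w x - pmean w x)\<^sup>2) \<le> (LINT x|?M. (w x - ?q x)\<^sup>2)"
    by (rule pmean_best[OF W(3) pcw_Q0])
  also have "\<dots> = (LINT x|?M. (prim ?k x - ?q' x)\<^sup>2)"
  proof (rule integral_cong_AE)
    have "AE x in ?M. ?q x = ?\<alpha> + ?q' x"
    proof (rule AE_cells)
      fix i assume i: "i < n"
      show "AE x in lebesgue_on (cell i). ?q x = ?\<alpha> + ?q' x"
        using pcw_AE[OF i, of "\<lambda>i. ?\<alpha> + prim ?k (node i)"] pcw_AE[OF i, of "\<lambda>i. prim ?k (node i)"]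
        by eventually_elim simp
    qed
    with H1_prim(1)[OF r w] show "AE x in ?M. (w x - ?q x)\<^sup>2 = (prim ?k x - ?q' x)\<^sup>2"
      by eventually_elim simp
  qed (use L2_int_diff[OF W(3) pcw_L2] L2_int_diff[OF pk pcw_L2] in \<open>auto simp: L2_int_def\<close>)
  also have "\<dots> \<le> h\<^sup>2 * (LINT x|?M. (?k x)\<^sup>2)" by (rule pcw_prim_error[OF W(2)])
  finally show ?thesis .
qed

text \<open>By Cauchy-Schwarz, \<open>h * (p x - pmean p x)\<^sup>2\<close> is at most the integral
  of \<open>(p x - p y)\<^sup>2\<close> over all \<open>y\<close> in the cell of \<open>x\<close>.
  There \<open>\<bar>x - y\<bar>\<close> is below \<open>h\<close>, so the integrand is at most
  \<open>h powr (1 + 2 * \<sigma>)\<close> times the Gagliardo integrand. Integrating in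
  \<open>x\<close> and cancelling one \<open>h\<close> leaves the asserted power.\<close>

lemma slob_pmean_error:
  assumes \<sigma>: "0 < \<sigma>" and p: "p \<in> L2_int r" and S: "slob_integrable \<sigma> r p"
  shows "(LINT x|lebesgue_on {0..r}. (p x - pmean p x)\<^sup>2) \<le> (h powr \<sigma>)\<^sup>2 * slob_sq \<sigma> r p"
proof -
  let ?M = "lebesgue_on {0..r}"
  interpret M: finite_measure ?M
    by (rule finite_measure_lebesgue_on) simp
  interpret P: pair_sigma_finite ?M ?M ..
  \<comment> \<open>The ceiling of \<open>x / h\<close> numbers the half-open cells, so
    \<open>?F\<close> is the squared difference restricted to pairs of points from the same cell, in
    a jointly measurable form.\<close>
  let ?c = "\<lambda>x. \<lceil>x / h\<rceil>"
  let ?F = "\<lambda>x y. if ?c x = ?c y then (p x - p y)\<^sup>2 else 0"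
  define K where "K = h powr (1 + 2 * \<sigma>)"
  have [measurable]: "p \<in> borel_measurable ?M" by (rule L2_int_measurable[OF p])
  have [measurable]: "(\<lambda>x. x) \<in> borel_measurable ?M"
    by (rule continuous_imp_measurable_on_sets_lebesgue) auto
  have meas: "case_prod ?F \<in> borel_measurable (?M \<Otimes>\<^sub>M ?M)" by measurable
  have bd: "?F x y \<le> K * slob_integrand \<sigma> p (x, y)" for x y
  proof (cases "?c x = ?c y \<and> x \<noteq> y")
    case True
    then have "\<bar>x / h - y / h\<bar> < 1"
      using ceiling_correct[of "x / h"] ceiling_correct[of "y / h"] by linarith
    then have "\<bar>x - y\<bar> / h < 1" using h_pos by (simp add: diff_divide_distrib[symmetric])
    then have "\<bar>x - y\<bar> < h" using h_pos by simp
    then have le: "\<bar>x - y\<bar> powr (1 + 2 * \<sigma>) \<le> K" unfolding K_def using \<sigma> by (intro powr_mono2) auto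
    have pos: "0 < \<bar>x - y\<bar> powr (1 + 2 * \<sigma>)" using True by simp
    have "(p x - p y)\<^sup>2 * \<bar>x - y\<bar> powr (1 + 2 * \<sigma>) \<le> (p x - p y)\<^sup>2 * K"
      by (rule mult_left_mono[OF le]) simp
    with pos True show ?thesis by (simp add: slob_integrand_def pos_le_divide_eq mult.commute)
  next
    case False
    have "0 \<le> K * slob_integrand \<sigma> p (x, y)" by (simp add: slob_integrand_def K_def)
    with False show ?thesis by auto
  qed
  have Kint: "integrable (?M \<Otimes>\<^sub>M ?M) (\<lambda>z. K * slob_integrand \<sigma> p z)"
    using S by (simp add: slob_integrable_def)
  have int: "integrable (?M \<Otimes>\<^sub>M ?M) (case_prod ?F)"
  proof (rule Bochner_Integration.integrable_bound[OF Kint meas])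
    show "AE z in ?M \<Otimes>\<^sub>M ?M. norm (case z of (x, y) \<Rightarrow> ?F x y) \<le> norm (K * slob_integrand \<sigma> p z)"
    proof (rule AE_I2, clarify)
      fix x y
      have "0 \<le> ?F x y" by simp
      with bd[of x y] show "norm (?F x y) \<le> norm (K * slob_integrand \<sigma> p (x, y))"
        unfolding real_norm_def by linarith
    qed
  qed
  have inner: "h * (p x - pmean p x)\<^sup>2 \<le> (LINT y|?M. ?F x y)" if x: "x \<in> {0<..r}" for x
  proof -
    from x obtain i where i: "i < n" "x \<in> {node i<..node (Suc i)}" by (rule in_some_cell)
    have c: "?c y = int (Suc i) \<longleftrightarrow> y \<in> {node i<..node (Suc i)}" for y
      unfolding ceiling_eq_iff node_def using h_pos
      by (simp add: pos_less_divide_eq pos_divide_le_eq)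
    have cx: "?c x = int (Suc i)" using c i by blast
    have nb: "0 \<le> node i" "node i \<le> node (Suc i)" "node (Suc i) \<le> r" using node_bounds[OF i(1)] by auto
    let ?g = "\<lambda>y. p x - p y"
    have g: "?g \<in> L2_int r" by (intro L2_int_diff p L2_int_const)
    have g2: "integrable ?M (\<lambda>y. (?g y)\<^sup>2)" using g by (simp add: L2_int_def)
    have eq: "integral (cell i) ?g = h * (p x - pmean p x)"
    proof -
      have 1: "integral (cell i) ?g = integral (cell i) (\<lambda>y. p x) - integral (cell i) p"
        by (rule integral_diff) (use cell_integrable(2)[OF L2_int_integrable[OF p] i(1)] in auto)
      have 2: "integral (cell i) (\<lambda>y. p x) = h * p x" using h_pos by (simp add: node_Suc)
      have 3: "integral (cell i) p = h * pmean p x"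
        using h_pos by (simp only: pmean_def pcw_eq[OF i] mean_def) simp
      show ?thesis unfolding 1 2 3 by (rule right_diff_distrib[symmetric])
    qed
    have "(h * (p x - pmean p x))\<^sup>2 \<le> (node (Suc i) - node i) * integral (cell i) (\<lambda>y. (?g y)\<^sup>2)"
      using integral_square_le[OF g nb] unfolding eq .
    then have "h * (h * (p x - pmean p x)\<^sup>2) \<le> h * integral (cell i) (\<lambda>y. (?g y)\<^sup>2)"
      by (simp add: node_Suc power2_eq_square mult.left_commute mult.assoc)
    then have "h * (p x - pmean p x)\<^sup>2 \<le> integral (cell i) (\<lambda>y. (?g y)\<^sup>2)"
      using h_pos by simp
    also have "\<dots> = integral\<^sup>L (lebesgue_on (cell i)) (\<lambda>y. (?g y)\<^sup>2)"
      using cell_integrable(1)[OF g2 i(1)] by (simp add: lebesgue_integral_eq_integral)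
    also have "\<dots> = (LINT y|?M. (if y \<in> cell i then (?g y)\<^sup>2 else 0))"
      using cell_subset[OF i(1)] by (subst integral_restrict) auto
    also have "\<dots> = (LINT y|?M. ?F x y)"
    proof (rule integral_cong_AE)
      have "AE y in lebesgue. y \<noteq> node i" by (rule AE_completion) (rule AE_lborel_singleton)
      then show "AE y in ?M. (if y \<in> cell i then (?g y)\<^sup>2 else 0) = ?F x y"
        by (subst AE_restrict_space_iff) (auto simp: cx c eq_commute[of "int (Suc i)"] elim!: eventually_mono simp del: of_nat_Suc)
      show "(\<lambda>y. ?F x y) \<in> borel_measurable ?M" by measurable
      show "(\<lambda>y. if y \<in> cell i then (?g y)\<^sup>2 else 0) \<in> borel_measurable ?M" by measurable
    qed
    finally show ?thesis .
  qed
  have d: "integrable ?M (\<lambda>x. (p x - pmean p x)\<^sup>2)"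
    using L2_int_diff[OF p pmean_L2] by (simp add: L2_int_def)
  have "h * (LINT x|?M. (p x - pmean p x)\<^sup>2) = (LINT x|?M. h * (p x - pmean p x)\<^sup>2)" by simp
  also have "\<dots> \<le> (LINT x|?M. (LINT y|?M. ?F x y))"
  proof (rule integral_mono_AE)
    show "integrable ?M (\<lambda>x. h * (p x - pmean p x)\<^sup>2)" using d by simp
    show "integrable ?M (\<lambda>x. LINT y|?M. ?F x y)" using P.integrable_fst[OF int] .
    have "AE x in lebesgue. x \<noteq> (0::real)" by (rule AE_completion) (rule AE_lborel_singleton)
    then show "AE x in ?M. h * (p x - pmean p x)\<^sup>2 \<le> (LINT y|?M. ?F x y)"
      by (subst AE_restrict_space_iff) (auto intro!: inner elim!: eventually_mono)
  qed
  also have "\<dots> = integral\<^sup>L (?M \<Otimes>\<^sub>M ?M) (case_prod ?F)" by (rule P.integral_fst[OF int])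
  also have "\<dots> \<le> integral\<^sup>L (?M \<Otimes>\<^sub>M ?M) (\<lambda>z. K * slob_integrand \<sigma> p z)"
    by (rule integral_mono[OF int Kint]) (use bd in auto)
  also have "\<dots> = K * slob_sq \<sigma> r p" by (simp add: slob_sq_def)
  also have "K = h * (h powr \<sigma>)\<^sup>2"
  proof -
    have "h powr (1 + 2 * \<sigma>) = h powr 1 * (h powr \<sigma> * h powr \<sigma>)"
      unfolding powr_add[symmetric] by simp
    then show ?thesis using h_pos by (simp add: K_def power2_eq_square)
  qed
  finally show ?thesis using h_pos by simp
qed

section \<open>Piecewise linear functions and the inverse inequality\<close>

lemma linear_square_integral:
  fixes a b \<beta> \<gamma> :: real
  assumes "a \<le> b"
  shows "\<gamma>\<^sup>2 * (b - a) ^ 3 \<le> 12 * integral {a..b} (\<lambda>x. (\<beta> + \<gamma> * (x - a))\<^sup>2)"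
proof -
  let ?F = "\<lambda>x. \<beta>\<^sup>2 * (x - a) + \<beta> * \<gamma> * (x - a)\<^sup>2 + \<gamma>\<^sup>2 * (x - a) ^ 3 / 3"
  have "((\<lambda>x. (\<beta> + \<gamma> * (x - a))\<^sup>2) has_integral ?F b - ?F a) {a..b}"
  proof (rule fundamental_theorem_of_calculus[OF assms])
    fix x
    have "(?F has_real_derivative (\<beta> + \<gamma> * (x - a))\<^sup>2) (at x)"
      by (auto intro!: derivative_eq_intros simp: power2_eq_square field_simps)
    then show "(?F has_vector_derivative (\<beta> + \<gamma> * (x - a))\<^sup>2) (at x within {a..b})"
      by (simp add: has_real_derivative_iff_has_vector_derivative has_vector_derivative_at_within)
  qed
  then have 1: "integral {a..b} (\<lambda>x. (\<beta> + \<gamma> * (x - a))\<^sup>2) = ?F b" by (simp add: integral_unique)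
  \<comment> \<open>The slack is a square that vanishes exactly when the linear function has mean
    zero, so the factor 12 is sharp.\<close>
  have 2: "12 * ?F b - \<gamma>\<^sup>2 * (b - a) ^ 3 = 3 * (b - a) * (2 * \<beta> + \<gamma> * (b - a))\<^sup>2"
    by (simp add: power2_eq_square power3_eq_cube field_simps)
  have "0 \<le> 3 * (b - a) * (2 * \<beta> + \<gamma> * (b - a))\<^sup>2" using assms by simp
  then have "\<gamma>\<^sup>2 * (b - a) ^ 3 \<le> 12 * ?F b" unfolding 2[symmetric] by (rule diff_ge_0_iff_ge[THEN iffD1])
  then show ?thesis unfolding 1 .
qed

definition P1 :: "(real \<Rightarrow> real) set" where
  "P1 = {v \<in> L2_int r. \<forall>i<n. \<exists>\<beta> \<gamma>. AE x in lebesgue_on (cell i). v x = \<beta> + \<gamma> * x}"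

text \<open>The weak derivative is defined through the whole edge and has to be localised: the
  continuous representative agrees with the linear function on the cell, so the difference
  \<open>weak_deriv r v x - \<gamma>\<close>, extended by zero outside the cell, has a vanishing
  primitive on the edge.\<close>

lemma P1_cell:
  assumes v: "v \<in> Hs_int 1 r" and i: "i < n" and p: "AE x in lebesgue_on (cell i). v x = \<beta> + \<gamma> * x"
  shows "AE x in lebesgue_on (cell i). weak_deriv r v x = \<gamma>"
proof -
  let ?k = "weak_deriv r v" and ?\<alpha> = "trace_at r v 0"
  note V = H1_deriv[OF r v]
  have ki: "integrable (lebesgue_on {0..r}) ?k" by (rule L2_int_integrable[OF V(2)])
  have nb: "0 \<le> node i" "node i < node (Suc i)" "node (Suc i) \<le> r" using node_bounds[OF i] by auto
  have eq: "?\<alpha> + prim ?k x = \<beta> + \<gamma> * x" if "x \<in> cell i" for x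
  proof (rule AE_const_imp_eq_continuous[OF nb(2), of "\<lambda>x. ?\<alpha> + prim ?k x" "\<lambda>x. \<beta> + \<gamma> * x"])
    have "continuous_on {0..r} (\<lambda>x. ?\<alpha> + prim ?k x)"
      by (intro continuous_on_add continuous_on_const prim_continuous ki)
    then show "continuous_on (cell i) (\<lambda>x. ?\<alpha> + prim ?k x)"
      using cell_subset[OF i] by (rule continuous_on_subset)
    show "continuous_on (cell i) (\<lambda>x. \<beta> + \<gamma> * x)" by (intro continuous_intros)
    show "AE x in lebesgue_on (cell i). ?\<alpha> + prim ?k x = \<beta> + \<gamma> * x"
      using AE_cell[OF H1_prim(1)[OF r v] i] p by eventually_elim simp
  qed (rule that)
  let ?z = "\<lambda>x. if x \<in> cell i then ?k x - \<gamma> else 0"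
  have "AE x in lebesgue_on {0..r}. ?z x = 0"
  proof (rule AE_zero_if_integral_zero)
    have "integrable (lebesgue_on (cell i)) (\<lambda>x. ?k x - \<gamma>)"
      using cell_integrable(1)[OF ki i] by simp
    then have "integrable lebesgue ?z"
      by (subst Lebesgue_Measure.integrable_restrict_UNIV) simp_all
    then show "integrable (lebesgue_on {0..r}) ?z" 
      by (subst integrable_restrict_space) (simp_all del: real_scaleR_def add: integrable_mult_indicator)
  next
    fix x assume x: "x \<in> {0..r}"
    have "integral {0..x} ?z = integral (cell i \<inter> {0..x}) (\<lambda>x. ?k x - \<gamma>)" by (rule integral_restrict_Int)
    also have "\<dots> = 0"
    proof (cases "node i \<le> x")
      case True
      let ?y = "min x (node (Suc i))"
      have y: "node i \<le> ?y" "?y \<le> r" "?y \<in> cell i" using True nb x by auto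
      have "cell i \<inter> {0..x} = {node i..?y}" using nb by auto
      then have "integral (cell i \<inter> {0..x}) (\<lambda>x. ?k x - \<gamma>) = integral {node i..?y} (\<lambda>x. ?k x - \<gamma>)"
        by (simp only:)
      also have "\<dots> = integral {node i..?y} ?k - \<gamma> * (?y - node i)"
        using integrable_subinterval0(2)[OF ki nb(1) y(2)] y(1) by (subst integral_diff) auto
      also have "integral {node i..?y} ?k = prim ?k ?y - prim ?k (node i)"
        by (rule prim_diff[OF ki nb(1) y(1,2), symmetric])
      also have "prim ?k ?y - prim ?k (node i) - \<gamma> * (?y - node i) = 0"
        using eq[OF y(3)] eq[of "node i"] nb unfolding right_diff_distrib by simp
      finally show ?thesis .
    next
      case False
      then have "cell i \<inter> {0..x} = {}" by auto
      then show ?thesis by simp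
    qed
    finally show "integral {0..x} ?z = 0" .
  qed
  from AE_cell[OF this i] have "AE x in lebesgue_on (cell i). ?z x = 0" .
  moreover have "AE x in lebesgue_on (cell i). x \<in> cell i" by (rule AE_I2) simp
  ultimately show ?thesis by eventually_elim simp
qed

lemma P1_deriv_Q0:
  assumes v: "v \<in> Hs_int 1 r" "v \<in> P1"
  shows "weak_deriv r v \<in> Q0"
  using P1_cell[OF v(1)] v(2) H1_deriv(2)[OF r v(1)] unfolding P1_def Q0_def by blast

text \<open>On a cell where \<open>v\<close> has slope \<open>\<gamma>\<close> the left side is
  \<open>\<gamma>\<^sup>2 * h ^ 3\<close>, which \<open>linear_square_integral\<close> bounds by the
  integral of the square of \<open>v\<close>.\<close>

lemma inverse_inequality:
  assumes v: "v \<in> Hs_int 1 r" "v \<in> P1"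
  shows "h\<^sup>2 * (LINT x|lebesgue_on {0..r}. (weak_deriv r v x)\<^sup>2) \<le> 12 * (LINT x|lebesgue_on {0..r}. (v x)\<^sup>2)"
proof -
  let ?k = "weak_deriv r v"
  have v2: "integrable (lebesgue_on {0..r}) (\<lambda>x. (v x)\<^sup>2)" using H1_deriv(3)[OF r v(1)] by (simp add: L2_int_def)
  have k2: "integrable (lebesgue_on {0..r}) (\<lambda>x. (?k x)\<^sup>2)" using H1_deriv(2)[OF r v(1)] by (simp add: L2_int_def)
  have cell: "h\<^sup>2 * integral (cell i) (\<lambda>x. (?k x)\<^sup>2) \<le> 12 * integral (cell i) (\<lambda>x. (v x)\<^sup>2)" if i: "i < n" for i
  proof -
    obtain \<beta> \<gamma> where p: "AE x in lebesgue_on (cell i). v x = \<beta> + \<gamma> * x"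
      using v(2) i unfolding P1_def by blast
    have "integral (cell i) (\<lambda>x. (?k x)\<^sup>2) = integral (cell i) (\<lambda>x. \<gamma>\<^sup>2)"
    proof (rule integral_cell_cong)
      show "AE x in lebesgue_on (cell i). (?k x)\<^sup>2 = \<gamma>\<^sup>2"
        using P1_cell[OF v(1) i p] by eventually_elim simp
    qed (use cell_integrable(1)[OF k2 i] in auto)
    also have "\<dots> = h * \<gamma>\<^sup>2" using h_pos by (simp add: node_Suc)
    finally have 1: "h\<^sup>2 * integral (cell i) (\<lambda>x. (?k x)\<^sup>2) = \<gamma>\<^sup>2 * h ^ 3"
      by (simp add: power2_eq_square power3_eq_cube)
    let ?f = "\<lambda>x. ((\<beta> + \<gamma> * node i) + \<gamma> * (x - node i))\<^sup>2"
    have "integral (cell i) (\<lambda>x. (v x)\<^sup>2) = integral (cell i) ?f"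
    proof (rule integral_cell_cong)
      show "AE x in lebesgue_on (cell i). (v x)\<^sup>2 = ?f x"
        using p by eventually_elim (simp add: algebra_simps)
      show "integrable (lebesgue_on (cell i)) ?f"
        by (intro continuous_imp_integrable_real continuous_intros)
    qed (use cell_integrable(1)[OF v2 i] in auto)
    with 1 linear_square_integral[of "node i" "node (Suc i)" \<gamma> "\<beta> + \<gamma> * node i"] h_pos
    show ?thesis by (simp add: node_Suc)
  qed
  show ?thesis unfolding LINT_split[OF v2] LINT_split[OF k2] sum_distrib_left
    by (rule sum_mono) (use cell in simp)
qed

lemma prim_pcw_P1:
  assumes w: "AE x in lebesgue_on {0..r}. w x = \<alpha> + prim (pcw c) x"
  shows "w \<in> P1"
  unfolding P1_def
proof (intro CollectI conjI allI impI)
  show "w \<in> L2_int r" using prim_H1(1)[OF r pcw_L2 w] by (simp add: Hs_int_1)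
  fix i assume i: "i < n"
  have "AE x in lebesgue_on (cell i). w x = (\<alpha> + prim (pcw c) (node i) - c i * node i) + c i * x"
    using AE_cell[OF w i] AE_cell_open
  proof eventually_elim
    case (elim x)
    then show ?case using prim_pcw[OF i, of x c] by (simp add: algebra_simps)
  qed
  then show "\<exists>\<beta> \<gamma>. AE x in lebesgue_on (cell i). w x = \<beta> + \<gamma> * x" by blast
qed

end

section \<open>Networks and flows\<close>

lemma net_diff_eq: "net_diff w z = w - z"
  by (simp add: net_diff_def fun_eq_iff)

lemma net_scale_eq: "net_scale r w = r *\<^sub>R w"
  by (simp add: net_scale_def scaleR_fun_def fun_eq_iff)

lemma scaleR_net_apply [simp]: "(r *\<^sub>R w) e x = r * (w :: 'v netfun) e x"
  by (simp add: scaleR_fun_def)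

lemma net_add_scale: "(\<lambda>x. w e x + c * z e x) = (w + c *\<^sub>R z) e" for w z :: "'v netfun"
  by (simp add: fun_eq_iff)

lemma subspace_L2_net: "subspace (L2_net G l)"
  unfolding subspace_def L2_net_def
proof (intro conjI ballI allI CollectI)
  fix e show "(0 :: 'a netfun) e \<in> L2_int (l e)" by (simp add: zero_fun_def)
next
  fix x y e assume "x \<in> {w. \<forall>e\<in>parcs G. w e \<in> L2_int (l e)}" "y \<in> {w. \<forall>e\<in>parcs G. w e \<in> L2_int (l e)}" "e \<in> parcs G"
  then show "(x + y) e \<in> L2_int (l e)" using L2_int_add[of "x e" "l e" "y e"] by (simp add: plus_fun_def)
next
  fix c x e assume "x \<in> {w. \<forall>e\<in>parcs G. w e \<in> L2_int (l e)}" "e \<in> parcs G"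
  then show "(c *\<^sub>R x) e \<in> L2_int (l e)" using L2_int_scale[of "x e" "l e" c] by (simp add: scaleR_fun_def)
qed

lemma L2_netD: "w \<in> L2_net G l \<Longrightarrow> e \<in> parcs G \<Longrightarrow> w e \<in> L2_int (l e)"
  by (simp add: L2_net_def)

interpretation L2: semi_inner "L2_net G l" "ip_net G l" "L2_norm G l" for G :: "'v pair_pre_digraph" and l
proof
  show "subspace (L2_net G l)" by (rule subspace_L2_net)
  show "ip_net G l x y = ip_net G l y x" for x y by (simp add: ip_net_def mult.commute)
  show "ip_net G l (x + y) z = ip_net G l x z + ip_net G l y z"
    if "x \<in> L2_net G l" "y \<in> L2_net G l" "z \<in> L2_net G l" for x y z
    unfolding ip_net_def sum.distrib[symmetric]
    using that by (intro sum.cong) (auto simp: distrib_right L2_netD L2_int_mult_integrable)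
  show "ip_net G l (r *\<^sub>R x) z = r * ip_net G l x z" for r x z
    by (simp add: ip_net_def mult.assoc sum_distrib_left)
  show "0 \<le> ip_net G l x x" for x
    unfolding ip_net_def by (intro sum_nonneg) auto
  show "L2_norm G l x = sqrt (ip_net G l x x)" for x by (simp add: L2_norm_def)
qed

lemma L2_norm_sq: "(L2_norm G l w)\<^sup>2 = (\<Sum>e\<in>parcs G. LINT x|lebesgue_on {0..l e}. (w e x)\<^sup>2)"
  by (simp add: L2_norm_def ip_net_def sum_nonneg power2_eq_square)

lemma L2_norm_nonneg [simp]: "0 \<le> L2_norm G l w"
  by (simp add: L2_norm_def ip_net_def sum_nonneg)

lemma ip_net_cong:
  assumes "w \<in> L2_net G l" "z \<in> L2_net G l" "y \<in> L2_net G l" "net_eq G l w z"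
  shows "ip_net G l w y = ip_net G l z y"
  unfolding ip_net_def
proof (rule sum.cong[OF refl], rule integral_cong_AE)
  fix e assume e: "e \<in> parcs G"
  show "AE x in lebesgue_on {0..l e}. w e x * y e x = z e x * y e x"
    using assms(4) e unfolding net_eq_def by (auto elim!: eventually_mono)
  show "(\<lambda>x. w e x * y e x) \<in> borel_measurable (lebesgue_on {0..l e})"
    "(\<lambda>x. z e x * y e x) \<in> borel_measurable (lebesgue_on {0..l e})"
    using L2_int_mult_integrable[OF L2_netD[OF assms(1) e] L2_netD[OF assms(3) e]]
      L2_int_mult_integrable[OF L2_netD[OF assms(2) e] L2_netD[OF assms(3) e]] by auto
qed

lemma L2_norm_cong:
  assumes "w \<in> L2_net G l" "z \<in> L2_net G l" "net_eq G l w z"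
  shows "L2_norm G l w = L2_norm G l z"
  unfolding L2_norm_def
  using ip_net_cong[OF assms(1,2,1,3)] ip_net_cong[OF assms(1,2,2,3)]
  by (simp add: L2.ip_commute)

lemma L2_norm_le_edgewise:
  assumes "0 \<le> k" "\<And>e. e \<in> parcs G \<Longrightarrow>
    (LINT x|lebesgue_on {0..l e}. (w e x)\<^sup>2) \<le> k\<^sup>2 * (LINT x|lebesgue_on {0..l e}. (z e x)\<^sup>2)"
  shows "L2_norm G l w \<le> k * L2_norm G l z"
proof (rule power2_le_imp_le)
  have "(L2_norm G l w)\<^sup>2 \<le> (\<Sum>e\<in>parcs G. k\<^sup>2 * (LINT x|lebesgue_on {0..l e}. (z e x)\<^sup>2))"
    unfolding L2_norm_sq by (rule sum_mono) (rule assms(2))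
  also have "\<dots> = (k * L2_norm G l z)\<^sup>2"
    by (simp add: power_mult_distrib L2_norm_sq sum_distrib_left)
  finally show "(L2_norm G l w)\<^sup>2 \<le> (k * L2_norm G l z)\<^sup>2" .
qed (use assms(1) in simp)

lemma L2_norm_edge_le:
  assumes "finite (parcs G)" "e \<in> parcs G"
  shows "(LINT x|lebesgue_on {0..l e}. (w e x)\<^sup>2) \<le> (L2_norm G l w)\<^sup>2"
  unfolding L2_norm_sq using assms by (intro member_le_sum) auto

lemma L2_net_mult:
  assumes "bounded_coeff G l C0 C1 a" "0 < C0" "w \<in> L2_net G l"
  shows "net_mult a w \<in> L2_net G l"
  unfolding L2_net_def
proof (intro CollectI ballI)
  fix e assume e: "e \<in> parcs G"
  have "AE x in lebesgue_on {0..l e}. C0 \<le> a e x \<and> a e x \<le> C1"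
    using assms(1) e unfolding bounded_coeff_def by blast
  then have "AE x in lebesgue_on {0..l e}. \<bar>a e x\<bar> \<le> C1"
    by eventually_elim (use assms(2) in auto)
  moreover have "a e \<in> borel_measurable (lebesgue_on {0..l e})"
    using assms(1) e unfolding bounded_coeff_def by (auto dest: L2_netD L2_int_measurable)
  ultimately show "net_mult a w e \<in> L2_int (l e)"
    using L2_int_mult_bounded[OF L2_netD[OF assms(3) e]] by (simp add: net_mult_def)
qed

lemma net_mult_diff: "net_mult a (w - z) = net_mult a w - net_mult a z"
  by (simp add: net_mult_def fun_eq_iff right_diff_distrib)

lemma net_mult_add: "net_mult a (w + z) = net_mult a w + net_mult a z"
  by (simp add: net_mult_def fun_eq_iff distrib_left)

lemma net_mult_scale: "net_mult a (r *\<^sub>R w) = r *\<^sub>R net_mult a w"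
  by (simp add: net_mult_def fun_eq_iff)

lemma ip_net_mult_commute: "ip_net G l (net_mult a w) z = ip_net G l (net_mult a z) w"
  by (simp add: ip_net_def net_mult_def mult_ac)

lemma ip_net_mult_lower:
  assumes a: "bounded_coeff G l C0 C1 a" "0 < C0" and w: "w \<in> L2_net G l"
  shows "C0 * ip_net G l w w \<le> ip_net G l (net_mult a w) w"
  unfolding ip_net_def sum_distrib_left
proof (rule sum_mono)
  fix e assume e: "e \<in> parcs G"
  have "C0 * (LINT x|lebesgue_on {0..l e}. w e x * w e x) = (LINT x|lebesgue_on {0..l e}. C0 * (w e x * w e x))"
    by simp
  also have "\<dots> \<le> (LINT x|lebesgue_on {0..l e}. net_mult a w e x * w e x)"
  proof (rule integral_mono_AE)
    have "AE x in lebesgue_on {0..l e}. C0 \<le> a e x \<and> a e x \<le> C1"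
      using a e by (auto simp: bounded_coeff_def)
    then show "AE x in lebesgue_on {0..l e}. C0 * (w e x * w e x) \<le> net_mult a w e x * w e x"
      by eventually_elim (auto simp: net_mult_def mult.assoc intro!: mult_right_mono)
  qed (use L2_int_mult_integrable[OF L2_netD[OF w e] L2_netD[OF w e]]
      L2_int_mult_integrable[OF L2_netD[OF L2_net_mult[OF a w] e] L2_netD[OF w e]] in auto)
  finally show "C0 * (LINT x|lebesgue_on {0..l e}. w e x * w e x)
      \<le> (LINT x|lebesgue_on {0..l e}. net_mult a w e x * w e x)" .
qed

lemma L2_norm_mult_le:
  assumes a: "bounded_coeff G l C0 C1 a" "0 < C0" "0 < C1" and w: "w \<in> L2_net G l"
  shows "L2_norm G l (net_mult a w) \<le> C1 * L2_norm G l w"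
proof (rule L2_norm_le_edgewise)
  fix e assume e: "e \<in> parcs G"
  have "(LINT x|lebesgue_on {0..l e}. (net_mult a w e x)\<^sup>2) \<le> (LINT x|lebesgue_on {0..l e}. C1\<^sup>2 * (w e x)\<^sup>2)"
  proof (rule integral_mono_AE)
    have "AE x in lebesgue_on {0..l e}. C0 \<le> a e x \<and> a e x \<le> C1"
      using a e by (auto simp: bounded_coeff_def)
    then show "AE x in lebesgue_on {0..l e}. (net_mult a w e x)\<^sup>2 \<le> C1\<^sup>2 * (w e x)\<^sup>2"
    proof eventually_elim
      case (elim x)
      then have "(a e x)\<^sup>2 \<le> C1\<^sup>2" using a by (intro power_mono) auto
      then show ?case by (simp add: net_mult_def power_mult_distrib mult_right_mono)
    qed
  qed (use L2_netD[OF w e] L2_netD[OF L2_net_mult[OF a(1,2) w] e] in \<open>auto simp: L2_int_def\<close>)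
  then show "(LINT x|lebesgue_on {0..l e}. (net_mult a w e x)\<^sup>2) \<le> C1\<^sup>2 * (LINT x|lebesgue_on {0..l e}. (w e x)\<^sup>2)"
    by simp
qed (use a in simp)

section \<open>Flows on the graph and Green's formula\<close>

locale network =
  fixes G :: "'v pair_pre_digraph" and l :: "'v \<times> 'v \<Rightarrow> real"
  assumes metric_network: "metric_network G l"
begin

lemma finite_arcs: "finite (parcs G)" and finite_verts: "finite (pverts G)"
  and ends: "e \<in> parcs G \<Longrightarrow> fst e \<in> pverts G" "e \<in> parcs G \<Longrightarrow> snd e \<in> pverts G"
  and no_loop: "e \<in> parcs G \<Longrightarrow> fst e \<noteq> snd e"
  and length_pos: "e \<in> parcs G \<Longrightarrow> 0 < l e"
proof -
  interpret pair_digraph G using metric_network by (simp add: metric_network_def)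
  show "finite (parcs G)" "finite (pverts G)" by (auto simp: pair_finite_arcs pair_finite_verts)
  show "e \<in> parcs G \<Longrightarrow> fst e \<in> pverts G" "e \<in> parcs G \<Longrightarrow> snd e \<in> pverts G"
    by (auto dest: arc_fst_in_verts arc_snd_in_verts)
  show "e \<in> parcs G \<Longrightarrow> fst e \<noteq> snd e" by (rule pair_no_loops)
  show "e \<in> parcs G \<Longrightarrow> 0 < l e" using metric_network by (simp add: metric_network_def)
qed

lemma incident_sum: "(\<Sum>e\<in>incident_edges G v. incidence e v * F e) = (\<Sum>e\<in>parcs G. incidence e v * F e)"
  by (rule sum.mono_neutral_left) (auto simp: finite_arcs incident_edges_def incidence_def)

text \<open>After exchanging the sums, each edge contributes at exactly two distinct vertices: with
  sign 1 at its head and -1 at its tail.\<close>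

lemma divergence_theorem:
  "(\<Sum>v\<in>pverts G. \<Sum>e\<in>incident_edges G v. incidence e v * F e v)
    = (\<Sum>e\<in>parcs G. F e (snd e) - F e (fst e))"
proof -
  have "(\<Sum>v\<in>pverts G. \<Sum>e\<in>incident_edges G v. incidence e v * F e v)
      = (\<Sum>v\<in>pverts G. \<Sum>e\<in>parcs G. incidence e v * F e v)"
    by (rule sum.cong[OF refl]) (rule incident_sum)
  also have "\<dots> = (\<Sum>e\<in>parcs G. \<Sum>v\<in>pverts G. incidence e v * F e v)" by (rule sum.swap)
  also have "\<dots> = (\<Sum>e\<in>parcs G. F e (snd e) - F e (fst e))"
  proof (rule sum.cong[OF refl])
    fix e assume e: "e \<in> parcs G"
    have "(\<Sum>v\<in>pverts G. incidence e v * F e v)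
        = (\<Sum>v\<in>pverts G. (if v = snd e then F e v else 0) - (if v = fst e then F e v else 0))"
      by (rule sum.cong) (use no_loop[OF e] in \<open>auto simp: incidence_def\<close>)
    also have "\<dots> = F e (snd e) - F e (fst e)"
      using ends[OF e] finite_verts by (simp add: sum_subtractf)
    finally show "(\<Sum>v\<in>pverts G. incidence e v * F e v) = F e (snd e) - F e (fst e)" .
  qed
  finally show ?thesis .
qed

text \<open>Induction along an undirected path from \<open>u\<close>. Going from \<open>x\<close> on
  to \<open>y\<close> moves the unit deficit from \<open>x\<close> to \<open>y\<close>: subtract 1
  on the edge if it is traversed along its orientation and add 1 otherwise. The values are added up,
  as the path may use an edge repeatedly.\<close>

lemma unit_flow:
  assumes "u \<in> pverts G" "v \<in> pverts G"
  obtains \<phi> where "\<And>w. (\<Sum>e\<in>incident_edges G w. incidence e w * \<phi> e)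
    = (if w = u then 1 else 0) - (if w = v then 1 else 0)"
proof -
  let ?D = "\<lambda>\<phi> w. \<Sum>e\<in>parcs G. incidence e w * \<phi> e"
  have "u \<rightarrow>\<^sup>*\<^bsub>with_proj (mk_symmetric (with_proj G))\<^esub> v"
    using metric_network assms
    by (auto simp: metric_network_def Digraph_Component.connected_def strongly_connected_def)
  then have "(u, v) \<in> rtrancl_on (pverts G) (parcs (mk_symmetric (with_proj G)))"
    by (simp add: reachable_def)
  then have "\<exists>\<phi>. \<forall>w. ?D \<phi> w = (if w = u then 1 else 0) - (if w = v then 1 else 0)"
  proof (induction rule: rtrancl_on_induct)
    case base
    show ?case by (rule exI[of _ "\<lambda>e. 0"]) simp
  next
    case (step x y)
    then obtain \<phi> where \<phi>: "\<And>w. ?D \<phi> w = (if w = u then 1 else 0) - (if w = x then 1 else 0)" by auto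
    have upd: "?D (\<lambda>e. \<phi> e + c * (if e = d then 1 else 0)) w = ?D \<phi> w + c * incidence d w"
      if "d \<in> parcs G" for c d w
    proof -
      have "?D (\<lambda>e. \<phi> e + c * (if e = d then 1 else 0)) w
          = (\<Sum>e\<in>parcs G. incidence e w * \<phi> e + (if e = d then c * incidence e w else 0))"
        by (rule sum.cong) (auto simp: algebra_simps)
      then show ?thesis using that finite_arcs by (simp add: sum.distrib)
    qed
    from step(2) have "(x, y) \<in> parcs G \<or> (y, x) \<in> parcs G" by (auto simp: parcs_mk_symmetric)
    then show ?case
    proof
      assume d: "(x, y) \<in> parcs G"
      then have "x \<noteq> y" using no_loop by force
      then have "?D (\<lambda>e. \<phi> e + (- 1) * (if e = (x, y) then 1 else 0)) w
          = (if w = u then 1 else 0) - (if w = y then 1 else 0)" for w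
        unfolding upd[OF d] \<phi> by (simp add: incidence_def)
      then show ?thesis by (intro exI[of _ "\<lambda>e. \<phi> e + (- 1) * (if e = (x, y) then 1 else 0)"] allI)
    next
      assume d: "(y, x) \<in> parcs G"
      then have "x \<noteq> y" using no_loop by force
      then have "?D (\<lambda>e. \<phi> e + 1 * (if e = (y, x) then 1 else 0)) w
          = (if w = u then 1 else 0) - (if w = y then 1 else 0)" for w
        unfolding upd[OF d] \<phi> by (simp add: incidence_def)
      then show ?thesis by (intro exI[of _ "\<lambda>e. \<phi> e + 1 * (if e = (y, x) then 1 else 0)"] allI)
    qed
  qed
  then show ?thesis using that by (auto simp: incident_sum)
qed

text \<open>All flows have their other end at one fixed boundary vertex \<open>b\<close>, whose
  deficit does not show up in the balances at interior vertices. Here the existence of a boundary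
  vertex enters.\<close>

lemma interior_flows:
  assumes "boundary_vertices G \<noteq> {}"
  obtains \<Phi> where "\<And>v w. \<lbrakk>v \<in> interior_vertices G; w \<in> interior_vertices G\<rbrakk> \<Longrightarrow>
    (\<Sum>e\<in>incident_edges G w. incidence e w * \<Phi> v e) = (if w = v then 1 else 0)"
proof -
  obtain b where b: "b \<in> pverts G" "b \<notin> interior_vertices G"
    using assms by (auto simp: boundary_vertices_def)
  have "\<exists>\<phi>. \<forall>w\<in>interior_vertices G. (\<Sum>e\<in>incident_edges G w. incidence e w * \<phi> e) = (if w = v then 1 else 0)"
    if "v \<in> interior_vertices G" for v
  proof -
    have "v \<in> pverts G" using that by (simp add: interior_vertices_def)
    from unit_flow[OF this b(1)] obtain \<phi> where
      "\<And>w. (\<Sum>e\<in>incident_edges G w. incidence e w * \<phi> e) = (if w = v then 1 else 0) - (if w = b then 1 else 0)"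
      by blast
    with b(2) show ?thesis by (intro exI[of _ \<phi>]) auto
  qed
  then obtain \<Phi> where "\<And>v. v \<in> interior_vertices G \<Longrightarrow> \<forall>w\<in>interior_vertices G.
      (\<Sum>e\<in>incident_edges G w. incidence e w * \<Phi> v e) = (if w = v then 1 else 0)"
    by metis
  then show ?thesis using that by blast
qed

lemma H1_netD:
  assumes "w \<in> Hs_net 1 G l" "e \<in> parcs G"
  shows "w e \<in> Hs_int 1 (l e)"
  using assms by (simp add: Hs_net_def)

lemma H1_net_L2:
  assumes "w \<in> Hs_net 1 G l"
  shows "w \<in> L2_net G l" "net_deriv l w \<in> L2_net G l"
  using H1_deriv[OF length_pos H1_netD[OF assms]] by (auto simp: L2_net_def net_deriv_def)

lemma H1_net_lincomb:
  assumes "w \<in> Hs_net 1 G l" "z \<in> Hs_net 1 G l"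
  shows "w + c *\<^sub>R z \<in> Hs_net 1 G l"
    "net_eq G l (net_deriv l (w + c *\<^sub>R z)) (net_deriv l w + c *\<^sub>R net_deriv l z)"
    "\<lbrakk>e \<in> parcs G; v = fst e \<or> v = snd e\<rbrakk> \<Longrightarrow>
      end_value l (w + c *\<^sub>R z) e v = end_value l w e v + c * end_value l z e v"
proof -
  note * = H1_lincomb[OF length_pos H1_netD[OF assms(1)] H1_netD[OF assms(2)], where c = c]
  show "w + c *\<^sub>R z \<in> Hs_net 1 G l"
    using *(1) unfolding Hs_net_def net_add_scale by auto
  show "net_eq G l (net_deriv l (w + c *\<^sub>R z)) (net_deriv l w + c *\<^sub>R net_deriv l z)"
    using *(2) unfolding net_eq_def net_deriv_def net_add_scale by (auto simp: scaleR_fun_def)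
  show "end_value l (w + c *\<^sub>R z) e v = end_value l w e v + c * end_value l z e v"
    if "e \<in> parcs G" "v = fst e \<or> v = snd e"
    using *(3)[OF that(1) that(1) that(1)] length_pos[OF that(1)]
    unfolding end_value_def net_add_scale by auto
qed

lemma subspace_H1_net: "subspace (Hs_net 1 G l)"
proof -
  have z: "(0 :: 'v netfun) \<in> Hs_net 1 G l"
    unfolding Hs_net_def
  proof (intro CollectI ballI)
    fix e assume "e \<in> parcs G"
    then show "(0 :: 'v netfun) e \<in> Hs_int 1 (l e)"
      by (intro prim_H1(1)[OF length_pos L2_int_const[of 0], of _ _ 0]) (auto simp: prim_def zero_fun_def)
  qed
  show ?thesis unfolding subspace_def
    using z H1_net_lincomb(1)[of _ _ 1] H1_net_lincomb(1)[OF z] by auto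
qed

lemma net_deriv_lincomb_ip:
  assumes "w \<in> Hs_net 1 G l" "z \<in> Hs_net 1 G l" "y \<in> L2_net G l"
  shows "ip_net G l (net_deriv l (w + c *\<^sub>R z)) y = ip_net G l (net_deriv l w) y + c * ip_net G l (net_deriv l z) y"
proof -
  note m = H1_net_L2[OF assms(1)] H1_net_L2[OF assms(2)] H1_net_L2[OF H1_net_lincomb(1)[OF assms(1,2)]]
  have "ip_net G l (net_deriv l (w + c *\<^sub>R z)) y = ip_net G l (net_deriv l w + c *\<^sub>R net_deriv l z) y"
    using m assms(3) by (intro ip_net_cong H1_net_lincomb(2)[OF assms(1,2)] L2.closed)
  also have "\<dots> = ip_net G l (net_deriv l w) y + c * ip_net G l (net_deriv l z) y"
    using m assms(3) by (simp add: L2.bilinear L2.closed)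
  finally show ?thesis .
qed

lemma subspace_Hdiv_net: "subspace (Hdiv_net G l)"
proof -
  have lc: "w + c *\<^sub>R z \<in> Hdiv_net G l" if wz: "w \<in> Hdiv_net G l" "z \<in> Hdiv_net G l" for w z c
  proof -
    have H: "w \<in> Hs_net 1 G l" "z \<in> Hs_net 1 G l" using wz by (auto simp: Hdiv_net_def)
    have "(\<Sum>e\<in>incident_edges G v. incidence e v * end_value l (w + c *\<^sub>R z) e v) = 0"
      if "v \<in> interior_vertices G" for v
    proof -
      have "(\<Sum>e\<in>incident_edges G v. incidence e v * end_value l (w + c *\<^sub>R z) e v)
          = (\<Sum>e\<in>incident_edges G v. incidence e v * end_value l w e v + c * (incidence e v * end_value l z e v))"
        by (rule sum.cong) (auto simp: incident_edges_def H1_net_lincomb(3)[OF H] algebra_simps)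
      then show ?thesis using wz that by (simp add: sum.distrib Hdiv_net_def flip: sum_distrib_left)
    qed
    then show ?thesis using H1_net_lincomb(1)[OF H] by (simp add: Hdiv_net_def)
  qed
  have z: "(0 :: 'v netfun) \<in> Hdiv_net G l"
  proof -
    have "end_value l 0 e v = 0" if "e \<in> parcs G" for e v
    proof -
      have "trace_at (l e) (\<lambda>x. 0) x = 0" if "x \<in> {0..l e}" for x
        by (rule trace_at_eq[OF length_pos[OF \<open>e \<in> parcs G\<close>], of "\<lambda>x. 0"]) (use that in auto)
      then show ?thesis using length_pos[OF that] by (simp add: end_value_def zero_fun_def)
    qed
    then show ?thesis using subspace_0[OF subspace_H1_net]
      by (simp add: Hdiv_net_def incident_edges_def)
  qed
  show ?thesis unfolding subspace_def
    using z lc[of _ _ 1] lc[OF z] by auto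
qed

text \<open>Integrate by parts on every edge and collect the boundary terms by vertices. At a
  boundary vertex \<open>p\<close> vanishes; at an interior vertex the common value of
  \<open>p\<close> factors out of the flux balance of \<open>v\<close>.\<close>

lemma green:
  assumes p: "p \<in> H10_net G l" and v: "v \<in> Hdiv_net G l"
  shows "ip_net G l (net_deriv l p) v = - ip_net G l p (net_deriv l v)"
proof -
  have H: "p \<in> Hs_net 1 G l" "v \<in> Hs_net 1 G l" using p v by (auto simp: H10_net_def Hdiv_net_def)
  let ?F = "\<lambda>e w. end_value l p e w * end_value l v e w"
  have "ip_net G l (net_deriv l p) v + ip_net G l p (net_deriv l v) = (\<Sum>e\<in>parcs G. ?F e (snd e) - ?F e (fst e))"
    unfolding ip_net_def sum.distrib[symmetric]
  proof (rule sum.cong[OF refl])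
    fix e assume e: "e \<in> parcs G"
    show "(LINT x|lebesgue_on {0..l e}. net_deriv l p e x * v e x) + (LINT x|lebesgue_on {0..l e}. p e x * net_deriv l v e x)
        = ?F e (snd e) - ?F e (fst e)"
      using H1_ibp[OF length_pos[OF e] H1_netD[OF H(1) e] H1_netD[OF H(2) e]] no_loop[OF e]
      by (simp add: net_deriv_def end_value_def)
  qed
  also have "\<dots> = (\<Sum>w\<in>pverts G. \<Sum>e\<in>incident_edges G w. incidence e w * ?F e w)"
    by (rule divergence_theorem[symmetric])
  also have "\<dots> = 0"
  proof (rule sum.neutral, rule ballI)
    fix w assume w: "w \<in> pverts G"
    show "(\<Sum>e\<in>incident_edges G w. incidence e w * ?F e w) = 0"
    proof (cases "w \<in> interior_vertices G")
      case False
      then have "w \<in> boundary_vertices G" using w by (simp add: boundary_vertices_def)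
      then show ?thesis using p by (intro sum.neutral) (auto simp: H10_net_def)
    next
      case True
      show ?thesis
      proof (cases "incident_edges G w = {}")
        case False
        then obtain d where d: "d \<in> incident_edges G w" by blast
        have "(\<Sum>e\<in>incident_edges G w. incidence e w * ?F e w)
            = (\<Sum>e\<in>incident_edges G w. end_value l p d w * (incidence e w * end_value l v e w))"
        proof (rule sum.cong[OF refl])
          fix e assume "e \<in> incident_edges G w"
          then have "end_value l p e w = end_value l p d w"
            using p True d unfolding H10_net_def by blast
          then show "incidence e w * ?F e w = end_value l p d w * (incidence e w * end_value l v e w)" by simp
        qed
        also have "\<dots> = 0" using v True by (simp add: Hdiv_net_def flip: sum_distrib_left)
        finally show ?thesis .
      qed simp
    qed
  qed
  finally show ?thesis by simp
qed

end

section \<open>Mean-free primitives of cell averages\<close>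

context edge_mesh
begin

lemma mean_lincomb:
  assumes "g \<in> L2_int r" "k \<in> L2_int r" "i < n"
  shows "mean (\<lambda>x. g x + c * k x) i = mean g i + c * mean k i"
  using cell_integrable(2)[OF L2_int_integrable[OF assms(1)] assms(3)]
    cell_integrable(2)[OF L2_int_integrable[OF assms(2)] assms(3)]
  by (simp add: mean_def integral_add integrable_on_mult_right add_divide_distrib)

lemma pmean_lincomb:
  assumes "g \<in> L2_int r" "k \<in> L2_int r"
  shows "pmean (\<lambda>x. g x + c * k x) = (\<lambda>x. pmean g x + c * pmean k x)"
  unfolding pmean_def pcw_def sum_distrib_left sum.distrib[symmetric]
  by (intro ext sum.cong) (auto simp: mean_lincomb[OF assms] distrib_right)

lemma pmean_cong:
  assumes "g \<in> L2_int r" "k \<in> L2_int r" "AE x in lebesgue_on {0..r}. g x = k x"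
  shows "pmean g = pmean k"
proof -
  have "mean g i = mean k i" if "i < n" for i
    unfolding mean_def
    using integral_cell_cong[OF AE_cell[OF assms(3) that] cell_integrable(1)[OF L2_int_integrable[OF assms(1)] that]
        cell_integrable(1)[OF L2_int_integrable[OF assms(2)] that]] by simp
  then show ?thesis unfolding pmean_def pcw_def by (intro ext sum.cong) auto
qed

lemma prim_bound:
  assumes f: "f \<in> L2_int r" and x: "x \<in> {0..r}"
  shows "\<bar>prim f x\<bar> \<le> sqrt r * sqrt (LINT x|lebesgue_on {0..r}. (f x)\<^sup>2)"
proof -
  have f2: "integrable (lebesgue_on {0..r}) (\<lambda>x. (f x)\<^sup>2)" using f by (simp add: L2_int_def)
  have "(prim f x)\<^sup>2 \<le> (x - 0) * integral {0..x} (\<lambda>x. (f x)\<^sup>2)"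
    unfolding prim_def by (rule integral_square_le[OF f]) (use x in auto)
  also have "\<dots> \<le> r * integral {0..r} (\<lambda>x. (f x)\<^sup>2)"
  proof (rule mult_mono)
    show "integral {0..x} (\<lambda>x. (f x)\<^sup>2) \<le> integral {0..r} (\<lambda>x. (f x)\<^sup>2)"
      by (rule integral_subset_le) (use x integrable_subinterval0(2)[OF f2] in auto)
    show "0 \<le> integral {0..x} (\<lambda>x. (f x)\<^sup>2)"
      by (rule integral_nonneg) (use x integrable_subinterval0(2)[OF f2] in auto)
  qed (use x r in auto)
  also have "integral {0..r} (\<lambda>x. (f x)\<^sup>2) = (LINT x|lebesgue_on {0..r}. (f x)\<^sup>2)"
    by (rule LINT_eq_integral[OF f2, symmetric])
  finally have "sqrt ((prim f x)\<^sup>2) \<le> sqrt (r * (LINT x|lebesgue_on {0..r}. (f x)\<^sup>2))"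
    by (rule real_sqrt_le_mono)
  then show ?thesis by (simp add: real_sqrt_mult)
qed

definition avg :: "(real \<Rightarrow> real) \<Rightarrow> real" where
  "avg f = (LINT x|lebesgue_on {0..r}. f x) / r"

lemma measure_edge: "measure (lebesgue_on {0..r}) {0..r} = r"
  using r by (simp add: measure_restrict_space)

lemma avg_bound:
  assumes f: "f \<in> L2_int r" and M: "\<And>x. x \<in> {0..r} \<Longrightarrow> \<bar>f x\<bar> \<le> M"
  shows "\<bar>avg f\<bar> \<le> M"
proof -
  have "\<bar>LINT x|lebesgue_on {0..r}. f x\<bar> \<le> (LINT x|lebesgue_on {0..r}. \<bar>f x\<bar>)"
    by (rule integral_abs_bound)
  also have "\<dots> \<le> (LINT x|lebesgue_on {0..r}. M)"
    by (rule integral_mono) (use L2_int_integrable[OF f] M in auto)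
  also have "\<dots> = r * M" using measure_edge by simp
  finally show ?thesis using r by (simp add: avg_def pos_divide_le_eq abs_divide mult.commute)
qed

lemma avg_L2_bound:
  assumes f: "f \<in> L2_int r"
  shows "\<bar>avg f\<bar> \<le> sqrt (LINT x|lebesgue_on {0..r}. (f x)\<^sup>2) / sqrt r"
proof -
  have "\<bar>LINT x|lebesgue_on {0..r}. f x\<bar> \<le> sqrt r * sqrt (LINT x|lebesgue_on {0..r}. (f x)\<^sup>2)"
    using prim_bound[OF f, of r] r LINT_eq_integral[OF L2_int_integrable[OF f]] by (simp add: prim_def)
  then have "\<bar>avg f\<bar> \<le> sqrt r * sqrt (LINT x|lebesgue_on {0..r}. (f x)\<^sup>2) / r"
    unfolding avg_def abs_divide using r by (simp add: divide_right_mono)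
  also have "\<dots> = sqrt r * sqrt (LINT x|lebesgue_on {0..r}. (f x)\<^sup>2) / (sqrt r * sqrt r)"
    using r by simp
  also have "\<dots> = sqrt (LINT x|lebesgue_on {0..r}. (f x)\<^sup>2) / sqrt r"
    using r by (simp del: real_sqrt_mult_self)
  finally show ?thesis .
qed

text \<open>Normalising by the mean instead of the value at 0 is essential: applied to the
  derivative of a piecewise linear \<open>v\<close> it returns \<open>v\<close> minus its average,
  which the square integral of \<open>v\<close> controls independently of the mesh. A point value of
  \<open>v\<close> is not controlled in this way.\<close>

definition mprim :: "(real \<Rightarrow> real) \<Rightarrow> real \<Rightarrow> real" where
  "mprim g x = prim (pmean g) x - avg (prim (pmean g))"

lemma prim_L2: "g \<in> L2_int r \<Longrightarrow> prim g \<in> L2_int r"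
  by (rule L2_int_continuous[OF prim_continuous[OF L2_int_integrable]])

lemma mprim_lincomb:
  assumes "g \<in> L2_int r" "k \<in> L2_int r" "x \<in> {0..r}"
  shows "mprim (\<lambda>x. g x + c * k x) x = mprim g x + c * mprim k x"
proof -
  have *: "prim (pmean (\<lambda>x. g x + c * k x)) x = prim (pmean g) x + c * prim (pmean k) x" if "x \<in> {0..r}" for x
    unfolding pmean_lincomb[OF assms(1,2)]
    by (rule prim_lincomb) (use that L2_int_integrable[OF pmean_L2] in auto)
  have "(LINT x|lebesgue_on {0..r}. prim (pmean (\<lambda>x. g x + c * k x)) x)
      = (LINT x|lebesgue_on {0..r}. prim (pmean g) x + c * prim (pmean k) x)"
    by (rule Bochner_Integration.integral_cong) (use * in auto)
  also have "\<dots> = (LINT x|lebesgue_on {0..r}. prim (pmean g) x) + c * (LINT x|lebesgue_on {0..r}. prim (pmean k) x)"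
    using L2_int_integrable[OF prim_L2[OF pmean_L2]] by simp
  finally show ?thesis unfolding mprim_def avg_def *[OF assms(3)] by (simp add: add_divide_distrib algebra_simps)
qed

lemma mprim_bound:
  assumes "x \<in> {0..r}"
  shows "\<bar>mprim g x\<bar> \<le> 2 * (sqrt r * sqrt (LINT x|lebesgue_on {0..r}. (pmean g x)\<^sup>2))"
proof -
  have "\<bar>prim (pmean g) x\<bar> \<le> sqrt r * sqrt (LINT x|lebesgue_on {0..r}. (pmean g x)\<^sup>2)" if "x \<in> {0..r}" for x
    by (rule prim_bound[OF pmean_L2 that])
  from this[OF assms] avg_bound[OF prim_L2[OF pmean_L2] this] show ?thesis
    unfolding mprim_def by linarith
qed

lemma Q0_pmean_AE:
  assumes "q \<in> Q0"
  shows "AE x in lebesgue_on {0..r}. pmean q x = q x"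
proof (rule AE_cells)
  fix i assume i: "i < n"
  have qL: "q \<in> L2_int r" using assms by (simp add: Q0_def)
  obtain c where c: "AE x in lebesgue_on (cell i). q x = c" using assms i by (auto simp: Q0_def)
  have "integral (cell i) q = integral (cell i) (\<lambda>x. c)"
    by (rule integral_cell_cong[OF c]) (use cell_integrable(1)[OF L2_int_integrable[OF qL] i] in auto)
  then have "mean q i = c" using h_pos by (simp add: mean_def node_Suc)
  then show "AE x in lebesgue_on (cell i). pmean q x = q x"
    using c pcw_AE[OF i, of "mean q"] unfolding pmean_def by (auto elim: eventually_elim2)
qed

text \<open>The derivative of a piecewise linear function is piecewise constant, so averaging leaves
  it unchanged and its primitive is \<open>v\<close> up to a constant, which the mean
  removes.\<close>

lemma mprim_deriv:
  assumes v: "v \<in> Hs_int 1 r" "v \<in> P1" and x: "x \<in> {0..r}"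
  shows "mprim (weak_deriv r v) x = trace_at r v x - avg v"
proof -
  let ?k = "weak_deriv r v" and ?\<alpha> = "trace_at r v 0"
  note V = H1_deriv[OF r v(1)]
  have eq: "prim (pmean ?k) x = trace_at r v x - ?\<alpha>" if "x \<in> {0..r}" for x
  proof -
    have "prim (pmean ?k) x = prim ?k x"
      by (rule prim_cong_AE[OF L2_int_integrable[OF pmean_L2] L2_int_integrable[OF V(2)] Q0_pmean_AE[OF P1_deriv_Q0[OF v]] that])
    then show ?thesis using H1_prim(2)[OF r v(1) that] by simp
  qed
  have "(LINT x|lebesgue_on {0..r}. prim (pmean ?k) x) = (LINT x|lebesgue_on {0..r}. v x - ?\<alpha>)"
  proof (rule integral_cong_AE)
    have "AE x in lebesgue_on {0..r}. x \<in> {0..r}" by (rule AE_I2) simp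
    with H1_prim(1)[OF r v(1)] show "AE x in lebesgue_on {0..r}. prim (pmean ?k) x = v x - ?\<alpha>"
    proof eventually_elim
      case (elim x)
      then show ?case using eq[of x] H1_prim(2)[OF r v(1), of x] by linarith
    qed
  qed (use L2_int_measurable[OF prim_L2[OF pmean_L2]] L2_int_measurable[OF V(3)] in auto)
  also have "\<dots> = (LINT x|lebesgue_on {0..r}. v x) - r * ?\<alpha>"
    using L2_int_integrable[OF V(3)] measure_edge by simp
  finally have "avg (prim (pmean ?k)) = avg v - ?\<alpha>"
    using r by (simp add: avg_def diff_divide_distrib)
  then show ?thesis unfolding mprim_def eq[OF x] by simp
qed

end

section \<open>Finite element spaces on the network and their interpolation operators\<close>

locale meshed_network = network G l for G :: "'v pair_pre_digraph" and l +
  fixes N :: "'v \<times> 'v \<Rightarrow> nat"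
  assumes mesh: "network_mesh G N"
begin

lemma em: "e \<in> parcs G \<Longrightarrow> edge_mesh (l e) (N e)"
  using mesh length_pos by (simp add: edge_mesh_def network_mesh_def)

abbreviation "pm e \<equiv> edge_mesh.pmean (l e) (N e)"
abbreviation "mp e \<equiv> edge_mesh.mprim (l e) (N e)"

lemma h_eq: "e \<in> parcs G \<Longrightarrow> edge_mesh.h (l e) (N e) = edge_mesh_size l N e"
  using edge_mesh.h_def[OF em] by (simp add: edge_mesh_size_def)

lemma cell_eq: "e \<in> parcs G \<Longrightarrow>
    {real i * edge_mesh_size l N e .. real (Suc i) * edge_mesh_size l N e}
    = {edge_mesh.node (l e) (N e) i .. edge_mesh.node (l e) (N e) (Suc i)}"
  using edge_mesh.node_def[OF em] h_eq by simp

lemma Qh_iff: "w \<in> Qh G l N \<longleftrightarrow> (\<forall>e\<in>parcs G. w e \<in> edge_mesh.Q0 (l e) (N e))"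
proof -
  have "(\<exists>q :: real poly. degree q \<le> 0 \<and> (AE x in M. w e x = poly q x)) \<longleftrightarrow> (\<exists>c. AE x in M. w e x = c)" for e M
  proof
    assume "\<exists>q :: real poly. degree q \<le> 0 \<and> (AE x in M. w e x = poly q x)"
    then obtain q :: "real poly" where q: "degree q = 0" "AE x in M. w e x = poly q x" by auto
    obtain c where "q = [:c:]" using q(1) by (rule degree_eq_zeroE)
    with q(2) show "\<exists>c. AE x in M. w e x = c" by auto
  next
    assume "\<exists>c. AE x in M. w e x = c"
    then obtain c where "AE x in M. w e x = c" by blast
    then show "\<exists>q :: real poly. degree q \<le> 0 \<and> (AE x in M. w e x = poly q x)"
      by (intro exI[of _ "[:c:]"]) simp
  qed
  then have "w \<in> Qh G l N \<longleftrightarrow> (\<forall>e\<in>parcs G. w e \<in> L2_int (l e) \<and> (\<forall>i<N e. \<exists>c. AE x in lebesgue_on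
      {real i * edge_mesh_size l N e .. real (Suc i) * edge_mesh_size l N e}. w e x = c))"
    unfolding Qh_def Pk_mesh_def L2_net_def mem_Collect_eq by blast
  also have "\<dots> \<longleftrightarrow> (\<forall>e\<in>parcs G. w e \<in> edge_mesh.Q0 (l e) (N e))"
    by (rule ball_cong[OF refl]) (simp only: edge_mesh.Q0_def[OF em] cell_eq mem_Collect_eq)
  finally show ?thesis .
qed

lemma Pk1_iff: "w \<in> Pk_mesh 1 G l N \<longleftrightarrow> (\<forall>e\<in>parcs G. w e \<in> edge_mesh.P1 (l e) (N e))"
proof -
  have "(\<exists>q :: real poly. degree q \<le> 1 \<and> (AE x in M. w e x = poly q x))
      \<longleftrightarrow> (\<exists>\<beta> \<gamma>. AE x in M. w e x = \<beta> + \<gamma> * x)" for e M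
  proof
    assume "\<exists>q :: real poly. degree q \<le> 1 \<and> (AE x in M. w e x = poly q x)"
    then obtain q :: "real poly" where q: "degree q \<le> 1" "AE x in M. w e x = poly q x" by blast
    obtain \<beta> p where p: "q = pCons \<beta> p" by (rule pCons_cases)
    then have "degree p = 0" using q(1) by (cases "p = 0") auto
    then obtain \<gamma> where "p = [:\<gamma>:]" by (rule degree_eq_zeroE)
    with q(2) p show "\<exists>\<beta> \<gamma>. AE x in M. w e x = \<beta> + \<gamma> * x"
      by (intro exI[of _ \<beta>] exI[of _ \<gamma>]) (simp add: mult.commute)
  next
    assume "\<exists>\<beta> \<gamma>. AE x in M. w e x = \<beta> + \<gamma> * x"
    then obtain \<beta> \<gamma> where "AE x in M. w e x = \<beta> + \<gamma> * x" by blast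
    then show "\<exists>q :: real poly. degree q \<le> 1 \<and> (AE x in M. w e x = poly q x)"
      by (intro exI[of _ "[:\<beta>, \<gamma>:]"]) (simp add: mult.commute)
  qed
  then have "w \<in> Pk_mesh 1 G l N \<longleftrightarrow> (\<forall>e\<in>parcs G. w e \<in> L2_int (l e) \<and> (\<forall>i<N e. \<exists>\<beta> \<gamma>. AE x in lebesgue_on
      {real i * edge_mesh_size l N e .. real (Suc i) * edge_mesh_size l N e}. w e x = \<beta> + \<gamma> * x))"
    unfolding Pk_mesh_def L2_net_def mem_Collect_eq by blast
  also have "\<dots> \<longleftrightarrow> (\<forall>e\<in>parcs G. w e \<in> edge_mesh.P1 (l e) (N e))"
    by (rule ball_cong[OF refl]) (simp only: edge_mesh.P1_def[OF em] cell_eq mem_Collect_eq)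
  finally show ?thesis .
qed

lemma Qh_L2: "w \<in> Qh G l N \<Longrightarrow> w \<in> L2_net G l"
  by (simp add: Qh_def Pk_mesh_def)

lemma Vh_H1: "v \<in> Vh G l N \<Longrightarrow> v \<in> Hs_net 1 G l"
  and Vh_Hdiv: "v \<in> Vh G l N \<Longrightarrow> v \<in> Hdiv_net G l"
  and Vh_P1: "v \<in> Vh G l N \<Longrightarrow> e \<in> parcs G \<Longrightarrow> v e \<in> edge_mesh.P1 (l e) (N e)"
  using Pk1_iff by (auto simp: Vh_def Hdiv_net_def)

lemma Vh_L2: "v \<in> Vh G l N \<Longrightarrow> v \<in> L2_net G l"
  using H1_net_L2(1)[OF Vh_H1] .

lemma Vh_deriv_Qh: "v \<in> Vh G l N \<Longrightarrow> net_deriv l v \<in> Qh G l N"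
  unfolding Qh_iff net_deriv_def
  using edge_mesh.P1_deriv_Q0[OF em] H1_netD[OF Vh_H1] Vh_P1 by auto

lemma subspace_Pk: "subspace (Pk_mesh k G l N)"
  unfolding subspace_def
proof (intro conjI ballI allI)
  show "0 \<in> Pk_mesh k G l N"
    using subspace_0[OF subspace_L2_net] by (auto simp: Pk_mesh_def zero_fun_def intro!: exI[of _ 0])
next
  fix x y assume x: "x \<in> Pk_mesh k G l N" and y: "y \<in> Pk_mesh k G l N"
  show "x + y \<in> Pk_mesh k G l N" unfolding Pk_mesh_def
  proof (intro CollectI conjI ballI allI impI)
    show "x + y \<in> L2_net G l" using x y by (intro L2.closed) (auto simp: Pk_mesh_def)
    fix e i assume e: "e \<in> parcs G" "i < N e"
    let ?M = "lebesgue_on {real i * edge_mesh_size l N e .. real (Suc i) * edge_mesh_size l N e}"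
    obtain p q :: "real poly" where p: "degree p \<le> k" "AE t in ?M. x e t = poly p t"
      and q: "degree q \<le> k" "AE t in ?M. y e t = poly q t"
      using x y e unfolding Pk_mesh_def by blast
    have "AE t in ?M. (x + y) e t = poly (p + q) t"
      using p(2) q(2) by eventually_elim simp
    then show "\<exists>q. degree q \<le> k \<and> (AE t in ?M. (x + y) e t = poly q t)"
      using degree_add_le[OF p(1) q(1)] by blast
  qed
next
  fix c x assume x: "x \<in> Pk_mesh k G l N"
  show "c *\<^sub>R x \<in> Pk_mesh k G l N" unfolding Pk_mesh_def
  proof (intro CollectI conjI ballI allI impI)
    show "c *\<^sub>R x \<in> L2_net G l" using x by (intro L2.closed) (auto simp: Pk_mesh_def)
    fix e i assume e: "e \<in> parcs G" "i < N e"
    let ?M = "lebesgue_on {real i * edge_mesh_size l N e .. real (Suc i) * edge_mesh_size l N e}"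
    obtain p :: "real poly" where p: "degree p \<le> k" "AE t in ?M. x e t = poly p t"
      using x e unfolding Pk_mesh_def by blast
    have "AE t in ?M. (c *\<^sub>R x) e t = poly (smult c p) t"
      using p(2) by eventually_elim simp
    moreover have "degree (smult c p) \<le> k" using p(1) degree_smult_le order_trans by blast
    ultimately show "\<exists>q. degree q \<le> k \<and> (AE t in ?M. (c *\<^sub>R x) e t = poly q t)" by blast
  qed
qed

lemma subspace_Qh: "subspace (Qh G l N)"
  unfolding Qh_def by (rule subspace_Pk)

lemma subspace_Vh: "subspace (Vh G l N)"
  unfolding Vh_def by (intro subspace_inter subspace_Pk subspace_Hdiv_net)

definition P0 :: "'v netfun \<Rightarrow> 'v netfun" where
  "P0 p = (\<lambda>e x. if e \<in> parcs G then pm e (p e) x else 0)"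

lemma P0_Qh: "P0 p \<in> Qh G l N"
  unfolding Qh_iff P0_def using edge_mesh.pmean_Q0[OF em] by simp

lemma P0_orth:
  assumes "p \<in> L2_net G l" "q \<in> Qh G l N"
  shows "ip_net G l (P0 p) q = ip_net G l p q"
  unfolding ip_net_def P0_def
  using edge_mesh.pmean_orth[OF em L2_netD[OF assms(1)]] assms(2) by (auto simp: Qh_iff intro!: sum.cong)

lemma P0_lincomb:
  assumes "p \<in> L2_net G l" "q \<in> L2_net G l"
  shows "P0 (p + c *\<^sub>R q) = P0 p + c *\<^sub>R P0 q"
  using edge_mesh.pmean_lincomb[OF em L2_netD[OF assms(1)] L2_netD[OF assms(2)], where c = c]
  by (auto simp: P0_def fun_eq_iff net_add_scale)

lemma P0_norm_le:
  assumes p: "p \<in> L2_net G l"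
  shows "L2_norm G l (P0 p) \<le> L2_norm G l p"
proof -
  have "L2_norm G l (P0 p) \<le> 1 * L2_norm G l p"
  proof (rule L2_norm_le_edgewise)
    fix e assume e: "e \<in> parcs G"
    show "(LINT x|lebesgue_on {0..l e}. (P0 p e x)\<^sup>2) \<le> 1\<^sup>2 * (LINT x|lebesgue_on {0..l e}. (p e x)\<^sup>2)"
      using edge_mesh.pmean_norm_le[OF em[OF e] L2_netD[OF p e]] e by (simp add: P0_def)
  qed simp
  then show ?thesis by simp
qed

text \<open>The constant depends on the mesh and grows under refinement. It is used only
  qualitatively, for the regularity in time of the semi-discrete solution on a fixed mesh, and does
  not reach the error constant.\<close>

lemma inverse_ineq:
  obtains K where "0 \<le> K" "\<And>v. v \<in> Vh G l N \<Longrightarrow> L2_norm G l (net_deriv l v) \<le> K * L2_norm G l v"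
proof -
  define K where "K = (\<Sum>e\<in>parcs G. sqrt 12 / edge_mesh_size l N e)"
  have hp: "0 < edge_mesh_size l N e" if "e \<in> parcs G" for e
    using edge_mesh.h_pos[OF em[OF that]] h_eq[OF that] by simp
  have K0: "0 \<le> K" unfolding K_def using hp by (intro sum_nonneg) (auto intro: less_imp_le)
  have "L2_norm G l (net_deriv l v) \<le> K * L2_norm G l v" if v: "v \<in> Vh G l N" for v
  proof (rule L2_norm_le_edgewise[OF K0])
    fix e assume e: "e \<in> parcs G"
    let ?h = "edge_mesh_size l N e"
    let ?d = "LINT x|lebesgue_on {0..l e}. (net_deriv l v e x)\<^sup>2" and ?v = "LINT x|lebesgue_on {0..l e}. (v e x)\<^sup>2"
    have "?h\<^sup>2 * ?d \<le> 12 * ?v"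
      using edge_mesh.inverse_inequality[OF em[OF e] H1_netD[OF Vh_H1[OF v] e] Vh_P1[OF v e]] h_eq[OF e]
      by (simp add: net_deriv_def)
    then have "?d \<le> (sqrt 12 / ?h)\<^sup>2 * ?v"
      using hp[OF e] by (simp add: power_divide pos_le_divide_eq mult.commute)
    also have "\<dots> \<le> K\<^sup>2 * ?v"
    proof (intro mult_right_mono power_mono)
      show "sqrt 12 / ?h \<le> K" unfolding K_def
        using finite_arcs e hp by (intro member_le_sum[of e _ "\<lambda>e. sqrt 12 / edge_mesh_size l N e"]) (auto intro: less_imp_le)
    qed (use hp[OF e] in auto)
    finally show "?d \<le> K\<^sup>2 * ?v" .
  qed
  with K0 show ?thesis using that by blast
qed

text \<open>The nodal interpolant: replacing the derivative by its cell averages keeps the values at the nodes.\<close>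

definition I1 :: "'v netfun \<Rightarrow> 'v netfun" where
  "I1 u = (\<lambda>e x. if e \<in> parcs G \<and> x \<in> {0..l e}
     then trace_at (l e) (u e) 0 + prim (pm e (weak_deriv (l e) (u e))) x else 0)"

lemma I1_AE:
  assumes "e \<in> parcs G"
  shows "AE x in lebesgue_on {0..l e}. I1 u e x = trace_at (l e) (u e) 0 + prim (pm e (weak_deriv (l e) (u e))) x"
  using assms by (intro AE_I2) (simp add: I1_def)

lemma I1_H1: "I1 u \<in> Hs_net 1 G l"
  unfolding Hs_net_def
  using prim_H1(1)[OF length_pos edge_mesh.pmean_L2[OF em] I1_AE] by auto

lemma I1_deriv: "net_eq G l (net_deriv l (I1 u)) (P0 (net_deriv l u))"
  unfolding net_eq_def net_deriv_def P0_def
  using prim_H1(2)[OF length_pos edge_mesh.pmean_L2[OF em] I1_AE] by auto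

text \<open>Both end points of an edge are nodes, and cell averaging does not change primitives at
  nodes. Flux balances at vertices therefore carry over to the interpolant.\<close>

lemma I1_end_value:
  assumes u: "u \<in> Hs_net 1 G l" and e: "e \<in> parcs G"
  shows "end_value l (I1 u) e v = end_value l u e v"
proof -
  have r: "0 < l e" and n: "0 < N e" using length_pos e mesh by (auto simp: network_mesh_def)
  note E = em[OF e]
  let ?k = "weak_deriv (l e) (u e)"
  have k: "?k \<in> L2_int (l e)" by (rule H1_deriv(2)[OF r H1_netD[OF u e]])
  have 1: "trace_at (l e) (I1 u e) x = trace_at (l e) (u e) 0 + prim (pm e ?k) x" if "x \<in> {0..l e}" for x
    by (rule prim_H1(3)[OF r edge_mesh.pmean_L2[OF E] I1_AE[OF e] that])
  have 2: "prim (pm e ?k) (l e) = prim ?k (l e)"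
    using edge_mesh.prim_pmean_node[OF E k, of "N e"] edge_mesh.node_n[OF E] by simp
  have 3: "trace_at (l e) (u e) (l e) = trace_at (l e) (u e) 0 + prim ?k (l e)"
    by (rule H1_prim(2)[OF r H1_netD[OF u e]]) (use r in simp)
  show ?thesis unfolding end_value_def using 1[of 0] 1[of "l e"] 2 3 r by simp
qed

lemma I1_Vh:
  assumes u: "u \<in> Hdiv_net G l"
  shows "I1 u \<in> Vh G l N"
proof -
  have H: "u \<in> Hs_net 1 G l" using u by (simp add: Hdiv_net_def)
  have "I1 u \<in> Pk_mesh 1 G l N"
    unfolding Pk1_iff
  proof
    fix e assume e: "e \<in> parcs G"
    show "I1 u e \<in> edge_mesh.P1 (l e) (N e)"
      by (rule edge_mesh.prim_pcw_P1[OF em[OF e]])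
        (rule I1_AE[OF e, unfolded edge_mesh.pmean_def[OF em[OF e]]])
  qed
  moreover have "I1 u \<in> Hdiv_net G l"
    using u I1_H1 I1_end_value[OF H] by (simp add: Hdiv_net_def incident_edges_def)
  ultimately show ?thesis by (simp add: Vh_def)
qed

text \<open>An identity of functions and not only almost everywhere: \<open>weak_deriv\<close> is
  linear up to null sets, which its cell averages do not see, and off the edges \<open>I1\<close> is
  zero.\<close>

lemma I1_lincomb:
  assumes u: "u \<in> Hs_net 1 G l" and w: "w \<in> Hs_net 1 G l"
  shows "I1 (u + c *\<^sub>R w) = I1 u + c *\<^sub>R I1 w"
proof (intro ext)
  fix e x
  show "I1 (u + c *\<^sub>R w) e x = (I1 u + c *\<^sub>R I1 w) e x"
  proof (cases "e \<in> parcs G \<and> x \<in> {0..l e}")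
    case True
    then have e: "e \<in> parcs G" and x: "x \<in> {0..l e}" by auto
    note r = length_pos[OF e] and E = em[OF e]
    note uw = H1_netD[OF u e] H1_netD[OF w e]
    note * = H1_lincomb[OF r uw, where c = c]
    let ?k = "weak_deriv (l e)"
    have k: "?k (u e) \<in> L2_int (l e)" "?k (w e) \<in> L2_int (l e)" using H1_deriv(2)[OF r] uw by auto
    have a: "pm e (?k (\<lambda>x. u e x + c * w e x)) = pm e (\<lambda>x. ?k (u e) x + c * ?k (w e) x)"
      by (rule edge_mesh.pmean_cong[OF E H1_deriv(2)[OF r *(1)] _ *(2)]) (intro L2_int_add L2_int_scale k)
    have b: "pm e (\<lambda>x. ?k (u e) x + c * ?k (w e) x) = (\<lambda>x. pm e (?k (u e)) x + c * pm e (?k (w e)) x)"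
      by (rule edge_mesh.pmean_lincomb[OF E k])
    have 1: "prim (pm e (?k (\<lambda>x. u e x + c * w e x))) x
        = prim (pm e (?k (u e))) x + c * prim (pm e (?k (w e))) x"
      unfolding a b
      by (rule prim_lincomb[OF L2_int_integrable[OF edge_mesh.pmean_L2[OF E]] L2_int_integrable[OF edge_mesh.pmean_L2[OF E]] x])
    have 2: "trace_at (l e) (\<lambda>x. u e x + c * w e x) 0 = trace_at (l e) (u e) 0 + c * trace_at (l e) (w e) 0"
      by (rule *(3)) (use r in simp)
    have "I1 (u + c *\<^sub>R w) e x
        = trace_at (l e) (\<lambda>x. u e x + c * w e x) 0 + prim (pm e (?k (\<lambda>x. u e x + c * w e x))) x"
      unfolding I1_def net_add_scale using True by (simp only: if_True simp_thms)
    also have "\<dots> = I1 u e x + c * I1 w e x"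
      unfolding 1 2 unfolding I1_def using True by (simp only: if_True simp_thms) (simp add: distrib_left)
    finally show ?thesis by simp
  qed (auto simp: I1_def)
qed

lemma edge_mesh_size_le: "e \<in> parcs G \<Longrightarrow> edge_mesh_size l N e \<le> mesh_size G l N"
  unfolding mesh_size_def using finite_arcs by (intro Max_ge) auto

lemma edge_mesh_size_pos: "e \<in> parcs G \<Longrightarrow> 0 < edge_mesh_size l N e"
  using edge_mesh.h_pos[OF em] h_eq by simp

lemma edge_mesh_size_le_length: "e \<in> parcs G \<Longrightarrow> edge_mesh_size l N e \<le> l e"
  using mesh length_pos[of e] by (simp add: edge_mesh_size_def network_mesh_def divide_le_eq Suc_le_eq[symmetric])

lemma I1_error:
  assumes u: "u \<in> Hs_net 1 G l" and k: "0 \<le> k" "\<And>e. e \<in> parcs G \<Longrightarrow> edge_mesh_size l N e \<le> k"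
  shows "L2_norm G l (u - I1 u) \<le> k * L2_norm G l (net_deriv l u)"
proof (rule L2_norm_le_edgewise[OF k(1)])
  fix e assume e: "e \<in> parcs G"
  note r = length_pos[OF e] and E = em[OF e] and ue = H1_netD[OF u e]
  let ?k = "weak_deriv (l e) (u e)" and ?M = "lebesgue_on {0..l e}"
  have kL: "?k \<in> L2_int (l e)" by (rule H1_deriv(2)[OF r ue])
  have "(LINT x|?M. ((u - I1 u) e x)\<^sup>2) = (LINT x|?M. (prim ?k x - prim (pm e ?k) x)\<^sup>2)"
  proof (rule integral_cong_AE)
    show "AE x in ?M. ((u - I1 u) e x)\<^sup>2 = (prim ?k x - prim (pm e ?k) x)\<^sup>2"
      using H1_prim(1)[OF r ue] I1_AE[OF e, of u] by eventually_elim simp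
    show "(\<lambda>x. ((u - I1 u) e x)\<^sup>2) \<in> borel_measurable ?M"
      using L2_int_diff[OF L2_netD[OF H1_net_L2(1)[OF u] e] L2_netD[OF H1_net_L2(1)[OF I1_H1[of u]] e]]
      unfolding L2_int_def minus_apply by (rule CollectE) (elim conjE, rule borel_measurable_integrable)
    show "(\<lambda>x. (prim ?k x - prim (pm e ?k) x)\<^sup>2) \<in> borel_measurable ?M"
      using L2_int_diff[OF edge_mesh.prim_L2[OF E kL] edge_mesh.prim_L2[OF E edge_mesh.pmean_L2[OF E, of ?k]]]
      unfolding L2_int_def by (rule CollectE) (elim conjE, rule borel_measurable_integrable)
  qed
  also have "\<dots> \<le> (edge_mesh_size l N e)\<^sup>2 * (LINT x|?M. (?k x)\<^sup>2)"
    using edge_mesh.interpolation_error[OF E kL] h_eq[OF e] by simp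
  also have "\<dots> \<le> k\<^sup>2 * (LINT x|?M. (?k x)\<^sup>2)"
    using k(2)[OF e] edge_mesh_size_pos[OF e] by (intro mult_right_mono power_mono) auto
  finally show "(LINT x|?M. ((u - I1 u) e x)\<^sup>2) \<le> k\<^sup>2 * (LINT x|?M. (net_deriv l u e x)\<^sup>2)"
    by (simp add: net_deriv_def)
qed

end

section \<open>A bounded right inverse of the derivative\<close>

context meshed_network
begin

definition flux :: "'v netfun \<Rightarrow> 'v \<Rightarrow> real" where
  "flux g v = (\<Sum>e\<in>incident_edges G v. incidence e v * mp e (g e) (if v = fst e then 0 else l e))"

definition shift :: "('v \<Rightarrow> 'v \<times> 'v \<Rightarrow> real) \<Rightarrow> 'v netfun \<Rightarrow> 'v \<times> 'v \<Rightarrow> real" where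
  "shift \<Phi> g e = (\<Sum>v\<in>interior_vertices G. flux g v * \<Phi> v e)"

text \<open>A right inverse of the derivative: the mean-free primitive of the cell averages on each edge,
  with its vertex imbalances routed to the boundary along unit flows.\<close>

definition lift :: "('v \<Rightarrow> 'v \<times> 'v \<Rightarrow> real) \<Rightarrow> 'v netfun \<Rightarrow> 'v netfun" where
  "lift \<Phi> g = (\<lambda>e x. if e \<in> parcs G \<and> x \<in> {0..l e} then mp e (g e) x - shift \<Phi> g e else 0)"

lemma incident_arcs: "e \<in> incident_edges G v \<Longrightarrow> e \<in> parcs G"
  by (simp add: incident_edges_def)

lemma end_in: "e \<in> parcs G \<Longrightarrow> (if v = fst e then 0 else l e) \<in> {0..l e}"
  using length_pos[of e] by simp

lemma mp_lincomb:
  assumes "g \<in> L2_net G l" "k \<in> L2_net G l" "e \<in> parcs G" "x \<in> {0..l e}"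
  shows "mp e ((g + c *\<^sub>R k) e) x = mp e (g e) x + c * mp e (k e) x"
  unfolding net_add_scale[symmetric]
  using assms by (intro edge_mesh.mprim_lincomb[OF em] L2_netD) auto

lemma flux_lincomb:
  assumes "g \<in> L2_net G l" "k \<in> L2_net G l"
  shows "flux (g + c *\<^sub>R k) v = flux g v + c * flux k v"
  unfolding flux_def sum_distrib_left sum.distrib[symmetric]
proof (rule sum.cong[OF refl])
  fix e assume "e \<in> incident_edges G v"
  then have e: "e \<in> parcs G" by (rule incident_arcs)
  show "incidence e v * mp e ((g + c *\<^sub>R k) e) (if v = fst e then 0 else l e)
      = incidence e v * mp e (g e) (if v = fst e then 0 else l e)
        + c * (incidence e v * mp e (k e) (if v = fst e then 0 else l e))"
    unfolding mp_lincomb[OF assms e end_in[OF e]] by (simp add: distrib_left mult.left_commute)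
qed

lemma lift_lincomb:
  assumes "g \<in> L2_net G l" "k \<in> L2_net G l"
  shows "lift \<Phi> (g + c *\<^sub>R k) = lift \<Phi> g + c *\<^sub>R lift \<Phi> k"
proof (intro ext)
  fix e x
  have s: "shift \<Phi> (g + c *\<^sub>R k) e = shift \<Phi> g e + c * shift \<Phi> k e"
    unfolding shift_def flux_lincomb[OF assms] sum_distrib_left sum.distrib[symmetric]
    by (rule sum.cong[OF refl]) (simp add: distrib_right)
  have a: "(lift \<Phi> g + c *\<^sub>R lift \<Phi> k) e x = lift \<Phi> g e x + c * lift \<Phi> k e x" by simp
  show "lift \<Phi> (g + c *\<^sub>R k) e x = (lift \<Phi> g + c *\<^sub>R lift \<Phi> k) e x"
  proof (cases "e \<in> parcs G \<and> x \<in> {0..l e}")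
    case True
    then have e: "e \<in> parcs G" and x: "x \<in> {0..l e}" by auto
    show ?thesis unfolding a unfolding lift_def s mp_lincomb[OF assms e x]
      using True by (simp only: if_True simp_thms) (simp add: right_diff_distrib)
  next
    case False
    show ?thesis unfolding a unfolding lift_def using False by (simp only: if_False)
  qed
qed

lemma lift_AE:
  assumes "e \<in> parcs G"
  shows "AE x in lebesgue_on {0..l e}. lift \<Phi> g e x
    = (- edge_mesh.avg (l e) (prim (pm e (g e))) - shift \<Phi> g e) + prim (pm e (g e)) x"
  using assms by (intro AE_I2) (simp add: lift_def edge_mesh.mprim_def[OF em])

lemma lift_H1: "lift \<Phi> g \<in> Hs_net 1 G l"
  unfolding Hs_net_def
  using prim_H1(1)[OF length_pos edge_mesh.pmean_L2[OF em] lift_AE] by blast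

lemma lift_L2: "lift \<Phi> g \<in> L2_net G l"
  by (rule H1_net_L2(1)[OF lift_H1])

lemma lift_deriv: "net_eq G l (net_deriv l (lift \<Phi> g)) (P0 g)"
  unfolding net_eq_def net_deriv_def P0_def
  using prim_H1(2)[OF length_pos edge_mesh.pmean_L2[OF em] lift_AE] by auto

lemma lift_end_value:
  assumes e: "e \<in> parcs G"
  shows "end_value l (lift \<Phi> g) e v = mp e (g e) (if v = fst e then 0 else l e) - shift \<Phi> g e"
  unfolding end_value_def
  using prim_H1(3)[OF length_pos[OF e] edge_mesh.pmean_L2[OF em[OF e]] lift_AE[OF e] end_in[OF e]]
  by (simp add: edge_mesh.mprim_def[OF em[OF e]])

lemma finite_interior: "finite (interior_vertices G)"
  using finite_verts by (simp add: interior_vertices_def)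

text \<open>The flow \<open>\<Phi> v\<close> has imbalance 1 at \<open>v\<close> and 0 at the other
  interior vertices, so subtracting \<open>shift\<close> cancels the flux at every interior vertex.
  As \<open>shift\<close> is constant on each edge, the derivative is unaffected.\<close>

lemma lift_Vh:
  assumes \<Phi>: "\<And>v w. \<lbrakk>v \<in> interior_vertices G; w \<in> interior_vertices G\<rbrakk> \<Longrightarrow>
    (\<Sum>e\<in>incident_edges G w. incidence e w * \<Phi> v e) = (if w = v then 1 else 0)"
  shows "lift \<Phi> g \<in> Vh G l N"
proof -
  have "lift \<Phi> g \<in> Pk_mesh 1 G l N"
    unfolding Pk1_iff
  proof
    fix e assume e: "e \<in> parcs G"
    show "lift \<Phi> g e \<in> edge_mesh.P1 (l e) (N e)"
      by (rule edge_mesh.prim_pcw_P1[OF em[OF e]])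
        (rule lift_AE[OF e, unfolded edge_mesh.pmean_def[OF em[OF e]]])
  qed
  moreover have "(\<Sum>e\<in>incident_edges G w. incidence e w * end_value l (lift \<Phi> g) e w) = 0"
    if w: "w \<in> interior_vertices G" for w
  proof -
    have "(\<Sum>e\<in>incident_edges G w. incidence e w * shift \<Phi> g e)
        = (\<Sum>v\<in>interior_vertices G. flux g v * (\<Sum>e\<in>incident_edges G w. incidence e w * \<Phi> v e))"
      unfolding shift_def sum_distrib_left
      by (subst sum.swap) (intro sum.cong refl, simp add: mult.left_commute)
    also have "\<dots> = (\<Sum>v\<in>interior_vertices G. if v = w then flux g v else 0)"
      by (rule sum.cong) (use w \<Phi> in auto)
    also have "\<dots> = flux g w" using w finite_interior by simp
    finally have *: "(\<Sum>e\<in>incident_edges G w. incidence e w * shift \<Phi> g e) = flux g w" .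
    have "(\<Sum>e\<in>incident_edges G w. incidence e w * end_value l (lift \<Phi> g) e w)
        = (\<Sum>e\<in>incident_edges G w. incidence e w * mp e (g e) (if w = fst e then 0 else l e)
            - incidence e w * shift \<Phi> g e)"
      by (rule sum.cong) (auto simp: lift_end_value[OF incident_arcs] right_diff_distrib)
    also have "\<dots> = 0" unfolding sum_subtractf * by (simp add: flux_def)
    finally show ?thesis .
  qed
  ultimately show ?thesis using lift_H1 by (simp add: Vh_def Hdiv_net_def)
qed

lemma lift_ip:
  assumes "g \<in> L2_net G l" "q \<in> Qh G l N"
  shows "ip_net G l q (net_deriv l (lift \<Phi> g)) = ip_net G l q g"
proof -
  have "ip_net G l (net_deriv l (lift \<Phi> g)) q = ip_net G l (P0 g) q"
    by (rule ip_net_cong[OF H1_net_L2(2)[OF lift_H1] Qh_L2[OF P0_Qh] Qh_L2[OF assms(2)] lift_deriv])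
  also have "\<dots> = ip_net G l g q" by (rule P0_orth[OF assms])
  finally show ?thesis unfolding L2.ip_commute[of G l q] .
qed

lemma total_length_nonneg: "0 \<le> (\<Sum>e\<in>parcs G. l e)"
  by (rule sum_nonneg) (use length_pos in \<open>simp add: order_less_imp_le\<close>)

lemma L2_norm_sup:
  assumes w: "w \<in> L2_net G l" and M: "0 \<le> M" "\<And>e x. \<lbrakk>e \<in> parcs G; x \<in> {0..l e}\<rbrakk> \<Longrightarrow> \<bar>w e x\<bar> \<le> M"
  shows "L2_norm G l w \<le> sqrt (\<Sum>e\<in>parcs G. l e) * M"
proof (rule power2_le_imp_le)
  have "(L2_norm G l w)\<^sup>2 \<le> (\<Sum>e\<in>parcs G. l e * M\<^sup>2)"
    unfolding L2_norm_sq
  proof (rule sum_mono)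
    fix e assume e: "e \<in> parcs G"
    have "(LINT x|lebesgue_on {0..l e}. (w e x)\<^sup>2) \<le> (LINT x|lebesgue_on {0..l e}. M\<^sup>2)"
    proof (rule integral_mono)
      show "integrable (lebesgue_on {0..l e}) (\<lambda>x. (w e x)\<^sup>2)" using L2_netD[OF w e] by (simp add: L2_int_def)
      fix x assume "x \<in> space (lebesgue_on {0..l e})"
      then have "\<bar>w e x\<bar> \<le> \<bar>M\<bar>" using M(2)[OF e, of x] M(1) by simp
      then show "(w e x)\<^sup>2 \<le> M\<^sup>2" by (rule abs_le_square_iff[THEN iffD1])
    qed simp
    then show "(LINT x|lebesgue_on {0..l e}. (w e x)\<^sup>2) \<le> l e * M\<^sup>2"
      using edge_mesh.measure_edge[OF em[OF e]] by simp
  qed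
  also have "\<dots> = (sqrt (\<Sum>e\<in>parcs G. l e) * M)\<^sup>2"
    using total_length_nonneg by (simp add: power_mult_distrib sum_distrib_right)
  finally show "(L2_norm G l w)\<^sup>2 \<le> (sqrt (\<Sum>e\<in>parcs G. l e) * M)\<^sup>2" .
  show "0 \<le> sqrt (\<Sum>e\<in>parcs G. l e) * M"
    using M(1) total_length_nonneg by (intro mult_nonneg_nonneg real_sqrt_ge_zero)
qed

lemma incidence_le: "\<bar>incidence e v\<bar> \<le> 1"
  by (simp add: incidence_def)

lemma shift_bound:
  assumes F: "\<And>v. \<bar>flux g v\<bar> \<le> F" and e: "e \<in> parcs G"
  shows "\<bar>shift \<Phi> g e\<bar> \<le> F * (\<Sum>v\<in>interior_vertices G. \<Sum>e\<in>parcs G. \<bar>\<Phi> v e\<bar>)"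
proof -
  have F0: "0 \<le> F" using F[of undefined] by linarith
  have "\<bar>shift \<Phi> g e\<bar> \<le> (\<Sum>v\<in>interior_vertices G. \<bar>flux g v * \<Phi> v e\<bar>)"
    unfolding shift_def by (rule sum_abs)
  also have "\<dots> \<le> (\<Sum>v\<in>interior_vertices G. F * (\<Sum>e\<in>parcs G. \<bar>\<Phi> v e\<bar>))"
  proof (rule sum_mono)
    fix v
    have "\<bar>\<Phi> v e\<bar> \<le> (\<Sum>e\<in>parcs G. \<bar>\<Phi> v e\<bar>)" by (rule member_le_sum[OF e]) (use finite_arcs in auto)
    then show "\<bar>flux g v * \<Phi> v e\<bar> \<le> F * (\<Sum>e\<in>parcs G. \<bar>\<Phi> v e\<bar>)"
      unfolding abs_mult by (intro mult_mono F F0) auto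
  qed
  finally show ?thesis by (simp add: sum_distrib_left)
qed

lemma flux_bound:
  assumes B: "\<And>e. e \<in> parcs G \<Longrightarrow> \<bar>f e\<bar> \<le> B" and "0 \<le> B"
  shows "\<bar>\<Sum>e\<in>incident_edges G v. incidence e v * f e\<bar> \<le> real (card (parcs G)) * B"
proof -
  have "\<bar>\<Sum>e\<in>incident_edges G v. incidence e v * f e\<bar> \<le> (\<Sum>e\<in>parcs G. \<bar>incidence e v * f e\<bar>)"
    unfolding incident_sum by (rule sum_abs)
  also have "\<dots> \<le> (\<Sum>e\<in>parcs G. B)"
  proof (rule sum_mono)
    fix e assume "e \<in> parcs G"
    then have "\<bar>incidence e v\<bar> * \<bar>f e\<bar> \<le> 1 * B" by (intro mult_mono B incidence_le) auto
    then show "\<bar>incidence e v * f e\<bar> \<le> B" by (simp add: abs_mult)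
  qed
  finally show ?thesis by simp
qed

lemma mp_bound:
  assumes e: "e \<in> parcs G" and x: "x \<in> {0..l e}"
  shows "\<bar>mp e (g e) x\<bar> \<le> 2 * sqrt (\<Sum>e\<in>parcs G. l e) * L2_norm G l (P0 g)"
proof -
  have "(LINT x|lebesgue_on {0..l e}. (pm e (g e) x)\<^sup>2) \<le> (L2_norm G l (P0 g))\<^sup>2"
    using L2_norm_edge_le[OF finite_arcs e, of l "P0 g"] e by (simp add: P0_def)
  then have 1: "sqrt (LINT x|lebesgue_on {0..l e}. (pm e (g e) x)\<^sup>2) \<le> L2_norm G l (P0 g)"
    by (simp add: real_le_lsqrt)
  have "l e \<le> (\<Sum>e\<in>parcs G. l e)"
    by (rule member_le_sum[OF e]) (use finite_arcs length_pos in \<open>simp_all add: order_less_imp_le\<close>)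
  then have 2: "sqrt (l e) \<le> sqrt (\<Sum>e\<in>parcs G. l e)" by simp
  have "sqrt (l e) * sqrt (LINT x|lebesgue_on {0..l e}. (pm e (g e) x)\<^sup>2)
      \<le> sqrt (\<Sum>e\<in>parcs G. l e) * L2_norm G l (P0 g)"
    by (rule mult_mono[OF 2 1]) (use total_length_nonneg in simp_all)
  with edge_mesh.mprim_bound[OF em[OF e] x, of "g e"] show ?thesis by linarith
qed

text \<open>The mean-free primitives are bounded pointwise by \<open>?m\<close>, the flux at a
  vertex by the number of edges times that, and the shift by the flux times the total size
  \<open>?S\<close> of the flows. Bounding by \<open>P0 g\<close> instead of \<open>g\<close>
  records that the lift is null for functions orthogonal to \<open>Qh\<close>.\<close>

lemma lift_norm_P0:
  "L2_norm G l (lift \<Phi> g) \<le> 2 * (\<Sum>e\<in>parcs G. l e) *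
    (1 + real (card (parcs G)) * (\<Sum>v\<in>interior_vertices G. \<Sum>e\<in>parcs G. \<bar>\<Phi> v e\<bar>)) * L2_norm G l (P0 g)"
proof -
  let ?\<Lambda> = "\<Sum>e\<in>parcs G. l e" and ?S = "\<Sum>v\<in>interior_vertices G. \<Sum>e\<in>parcs G. \<bar>\<Phi> v e\<bar>"
  let ?m = "2 * sqrt ?\<Lambda> * L2_norm G l (P0 g)" and ?n = "real (card (parcs G))"
  have \<Lambda>: "0 \<le> ?\<Lambda>" by (rule total_length_nonneg)
  have m: "0 \<le> ?m" using \<Lambda> by simp
  have S: "0 \<le> ?S" by (intro sum_nonneg) auto
  have f: "\<bar>flux g v\<bar> \<le> ?n * ?m" for v
    unfolding flux_def by (rule flux_bound[OF mp_bound[OF _ end_in] m])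
  have "L2_norm G l (lift \<Phi> g) \<le> sqrt ?\<Lambda> * (?m + (?n * ?m) * ?S)"
  proof (rule L2_norm_sup[OF lift_L2])
    show "0 \<le> ?m + (?n * ?m) * ?S" using m S \<Lambda> by (intro add_nonneg_nonneg mult_nonneg_nonneg) auto
    fix e x assume e: "e \<in> parcs G" and x: "x \<in> {0..l e}"
    have "\<bar>lift \<Phi> g e x\<bar> \<le> \<bar>mp e (g e) x\<bar> + \<bar>shift \<Phi> g e\<bar>"
      using e x by (simp add: lift_def)
    with mp_bound[OF e x, of g] shift_bound[OF f e, of \<Phi>] show "\<bar>lift \<Phi> g e x\<bar> \<le> ?m + (?n * ?m) * ?S"
      by linarith
  qed
  also have "\<dots> = 2 * (sqrt ?\<Lambda> * sqrt ?\<Lambda>) * (1 + ?n * ?S) * L2_norm G l (P0 g)"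
    by (simp only: distrib_left distrib_right mult_ac mult_1_left mult_1_right)
  finally show ?thesis using \<Lambda> by simp
qed

text \<open>No power of the mesh size may be lost here. On each edge \<open>mp\<close> returns
  \<open>v\<close> minus its average. Since \<open>v\<close> itself is balanced at interior
  vertices, the fluxes involve only these averages, so the lift is \<open>v\<close> plus a constant
  on every edge, and all constants are controlled by averages of \<open>v\<close>. The factor
  \<open>R\<close> converts square integral norms into averages.\<close>

lemma lift_deriv_norm:
  fixes \<Phi> :: "'v \<Rightarrow> 'v \<times> 'v \<Rightarrow> real"
  assumes v: "v \<in> Vh G l N"
  defines "n \<equiv> real (card (parcs G))" and "S \<equiv> \<Sum>v\<in>interior_vertices G. \<Sum>e\<in>parcs G. \<bar>\<Phi> v e\<bar>"
    and "R \<equiv> \<Sum>e\<in>parcs G. 1 / sqrt (l e)"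
  shows "L2_norm G l (lift \<Phi> (net_deriv l v)) \<le> (1 + sqrt (\<Sum>e\<in>parcs G. l e) * (R + n * R * S)) * L2_norm G l v"
proof -
  let ?\<Lambda> = "\<Sum>e\<in>parcs G. l e" and ?g = "net_deriv l v" and ?v = "L2_norm G l v"
  note H = Vh_H1[OF v] and P = Vh_P1[OF v] and vL = Vh_L2[OF v]
  let ?a = "\<lambda>e. edge_mesh.avg (l e) (v e)"
  have R: "0 \<le> R" unfolding R_def by (intro sum_nonneg) (use length_pos in \<open>simp add: order_less_imp_le\<close>)
  have S: "0 \<le> S" unfolding S_def by (intro sum_nonneg) auto
  have avg: "\<bar>?a e\<bar> \<le> R * ?v" if e: "e \<in> parcs G" for e
  proof -
    have "\<bar>?a e\<bar> \<le> sqrt (LINT x|lebesgue_on {0..l e}. (v e x)\<^sup>2) / sqrt (l e)"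
      by (rule edge_mesh.avg_L2_bound[OF em[OF e] L2_netD[OF vL e]])
    also have "\<dots> \<le> ?v / sqrt (l e)"
      using L2_norm_edge_le[OF finite_arcs e, of l v] length_pos[OF e]
      by (intro divide_right_mono) (auto intro: real_le_lsqrt)
    also have "\<dots> = (1 / sqrt (l e)) * ?v" by simp
    also have "\<dots> \<le> R * ?v"
    proof (rule mult_right_mono)
      show "1 / sqrt (l e) \<le> R" unfolding R_def
        by (rule member_le_sum[OF e]) (use finite_arcs length_pos in \<open>simp_all add: order_less_imp_le\<close>)
    qed simp
    finally show ?thesis .
  qed
  have mp: "mp e (?g e) x = trace_at (l e) (v e) x - ?a e" if "e \<in> parcs G" "x \<in> {0..l e}" for e x
    unfolding net_deriv_def
    by (rule edge_mesh.mprim_deriv[OF em[OF that(1)] H1_netD[OF H that(1)] P[OF that(1)] that(2)])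
  have f: "\<bar>flux ?g w\<bar> \<le> n * (R * ?v)" if w: "w \<in> interior_vertices G" for w
  proof -
    have "flux ?g w = (\<Sum>e\<in>incident_edges G w. incidence e w * end_value l v e w) - (\<Sum>e\<in>incident_edges G w. incidence e w * ?a e)"
      unfolding flux_def sum_subtractf[symmetric]
    proof (rule sum.cong[OF refl])
      fix e assume "e \<in> incident_edges G w"
      then have e: "e \<in> parcs G" by (rule incident_arcs)
      show "incidence e w * mp e (?g e) (if w = fst e then 0 else l e)
          = incidence e w * end_value l v e w - incidence e w * ?a e"
        unfolding mp[OF e end_in[OF e]] end_value_def by (rule right_diff_distrib)
    qed
    also have "\<dots> = - (\<Sum>e\<in>incident_edges G w. incidence e w * ?a e)"
      using Vh_Hdiv[OF v] w by (simp add: Hdiv_net_def)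
    finally show ?thesis
      using flux_bound[of ?a "R * ?v" w] avg R unfolding n_def by simp
  qed
  have sh: "\<bar>shift \<Phi> ?g e\<bar> \<le> n * (R * ?v) * S" if e: "e \<in> parcs G" for e
  proof -
    have "\<bar>shift \<Phi> ?g e\<bar> \<le> (\<Sum>w\<in>interior_vertices G. \<bar>flux ?g w * \<Phi> w e\<bar>)"
      unfolding shift_def by (rule sum_abs)
    also have "\<dots> \<le> (\<Sum>w\<in>interior_vertices G. n * (R * ?v) * (\<Sum>e\<in>parcs G. \<bar>\<Phi> w e\<bar>))"
    proof (rule sum_mono)
      fix w assume w: "w \<in> interior_vertices G"
      have "\<bar>\<Phi> w e\<bar> \<le> (\<Sum>e\<in>parcs G. \<bar>\<Phi> w e\<bar>)" by (rule member_le_sum[OF e]) (use finite_arcs in auto)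
      then show "\<bar>flux ?g w * \<Phi> w e\<bar> \<le> n * (R * ?v) * (\<Sum>e\<in>parcs G. \<bar>\<Phi> w e\<bar>)"
        unfolding abs_mult using R by (intro mult_mono f[OF w]) (auto simp: n_def)
    qed
    finally show ?thesis by (simp add: S_def sum_distrib_left)
  qed
  \<comment> \<open>The edgewise constants by which the lift differs from \<open>v\<close>: minus
    the average and minus the shift.\<close>
  define k :: "'v netfun" where "k = (\<lambda>e x. - ?a e - shift \<Phi> ?g e)"
  have kL: "k \<in> L2_net G l" by (simp add: k_def L2_net_def)
  have "net_eq G l (lift \<Phi> ?g) (v + k)"
    unfolding net_eq_def
  proof
    fix e assume e: "e \<in> parcs G"
    have "AE x in lebesgue_on {0..l e}. x \<in> {0..l e}" by (rule AE_I2) simp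
    with H1_prim(1)[OF length_pos[OF e] H1_netD[OF H e]]
    show "AE x in lebesgue_on {0..l e}. lift \<Phi> ?g e x = (v + k) e x"
    proof eventually_elim
      case (elim x)
      have "trace_at (l e) (v e) x = v e x"
        using elim(1) H1_prim(2)[OF length_pos[OF e] H1_netD[OF H e] elim(2)] by linarith
      then show ?case using e elim(2) mp[OF e elim(2)] by (simp add: lift_def k_def)
    qed
  qed
  then have "L2_norm G l (lift \<Phi> ?g) = L2_norm G l (v + k)"
    by (intro L2_norm_cong lift_L2 L2.closed vL kL)
  also have "\<dots> \<le> ?v + L2_norm G l k" by (rule L2.nrm_triangle[OF vL kL])
  also have "L2_norm G l k \<le> sqrt ?\<Lambda> * (R * ?v + n * (R * ?v) * S)"
  proof (rule L2_norm_sup[OF kL])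
    show "0 \<le> R * ?v + n * (R * ?v) * S" using R S by (simp add: n_def)
    fix e x assume e: "e \<in> parcs G"
    show "\<bar>k e x\<bar> \<le> R * ?v + n * (R * ?v) * S"
      using avg[OF e] sh[OF e] unfolding k_def by linarith
  qed
  finally show ?thesis by (simp add: algebra_simps)
qed

end

context network
begin

text \<open>The flows are fixed before the mesh, so \<open>K\<close> depends on the network alone.
  The listed properties are all that the stability argument uses of the lift.\<close>

lemma lifting_operator:
  assumes "boundary_vertices G \<noteq> {}"
  obtains K where "0 < K" and "\<And>N. network_mesh G N \<Longrightarrow> \<exists>W.
    (\<forall>g\<in>L2_net G l. W g \<in> Vh G l N) \<and>
    (\<forall>g\<in>L2_net G l. \<forall>k\<in>L2_net G l. \<forall>c. W (g + c *\<^sub>R k) = W g + c *\<^sub>R W k) \<and>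
    (\<forall>g\<in>L2_net G l. \<forall>q\<in>Qh G l N. ip_net G l q (net_deriv l (W g)) = ip_net G l q g) \<and>
    (\<forall>g\<in>L2_net G l. L2_norm G l (W g) \<le> K * L2_norm G l g) \<and>
    (\<forall>v\<in>Vh G l N. L2_norm G l (W (net_deriv l v)) \<le> K * L2_norm G l v) \<and>
    (\<forall>g\<in>L2_net G l. (\<forall>q\<in>Qh G l N. ip_net G l g q = 0) \<longrightarrow> L2_norm G l (W g) = 0)"
proof -
  obtain \<Phi> where \<Phi>: "\<And>v w. \<lbrakk>v \<in> interior_vertices G; w \<in> interior_vertices G\<rbrakk> \<Longrightarrow>
    (\<Sum>e\<in>incident_edges G w. incidence e w * \<Phi> v e) = (if w = v then 1 else 0)"
    using interior_flows[OF assms] by blast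
  define n where "n = real (card (parcs G))"
  define S where "S = (\<Sum>v\<in>interior_vertices G. \<Sum>e\<in>parcs G. \<bar>\<Phi> v e\<bar>)"
  define R where "R = (\<Sum>e\<in>parcs G. 1 / sqrt (l e))"
  define \<Lambda> where "\<Lambda> = (\<Sum>e\<in>parcs G. l e)"
  define K1 where "K1 = 2 * \<Lambda> * (1 + n * S)"
  define K2 where "K2 = 1 + sqrt \<Lambda> * (R + n * R * S)"
  have pos: "0 \<le> n" "0 \<le> S" "0 \<le> R" "0 \<le> \<Lambda>"
    unfolding n_def S_def R_def \<Lambda>_def
    by (simp, intro sum_nonneg abs_ge_zero, (intro sum_nonneg, simp add: length_pos order_less_imp_le)+)
  have K12: "0 \<le> K1" "1 \<le> K2" unfolding K1_def K2_def using pos by auto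
  show ?thesis
  proof (rule that[of "K1 + K2"])
    show "0 < K1 + K2" using K12 by simp
    fix N assume "network_mesh G N"
    then interpret meshed_network G l N by unfold_locales
    have 1: "L2_norm G l (lift \<Phi> g) \<le> K1 * L2_norm G l (P0 g)" for g
      using lift_norm_P0[of \<Phi> g] by (simp add: K1_def n_def S_def \<Lambda>_def)
    have 2: "L2_norm G l (lift \<Phi> g) \<le> (K1 + K2) * L2_norm G l g" if "g \<in> L2_net G l" for g
    proof -
      have "K1 * L2_norm G l (P0 g) \<le> (K1 + K2) * L2_norm G l g"
        using P0_norm_le[OF that] K12 by (intro mult_mono) auto
      with 1[of g] show ?thesis by linarith
    qed
    have 3: "L2_norm G l (lift \<Phi> (net_deriv l v)) \<le> (K1 + K2) * L2_norm G l v" if "v \<in> Vh G l N" for v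
    proof -
      have "K2 * L2_norm G l v \<le> (K1 + K2) * L2_norm G l v" using K12 by (intro mult_right_mono) auto
      with lift_deriv_norm[OF that, of \<Phi>] show ?thesis
        by (simp add: K2_def n_def S_def R_def \<Lambda>_def)
    qed
    have 4: "L2_norm G l (lift \<Phi> g) = 0" if g: "g \<in> L2_net G l" and z: "\<forall>q\<in>Qh G l N. ip_net G l g q = 0" for g
    proof -
      have "ip_net G l (P0 g) (P0 g) = 0" using P0_orth[OF g P0_Qh[of g]] z P0_Qh[of g] by simp
      then have "L2_norm G l (P0 g) = 0" by (simp add: L2_norm_def)
      with 1[of g] show ?thesis using L2_norm_nonneg[of G l "lift \<Phi> g"] by simp
    qed
    show "\<exists>W. (\<forall>g\<in>L2_net G l. W g \<in> Vh G l N) \<and>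
      (\<forall>g\<in>L2_net G l. \<forall>k\<in>L2_net G l. \<forall>c. W (g + c *\<^sub>R k) = W g + c *\<^sub>R W k) \<and>
      (\<forall>g\<in>L2_net G l. \<forall>q\<in>Qh G l N. ip_net G l q (net_deriv l (W g)) = ip_net G l q g) \<and>
      (\<forall>g\<in>L2_net G l. L2_norm G l (W g) \<le> (K1 + K2) * L2_norm G l g) \<and>
      (\<forall>v\<in>Vh G l N. L2_norm G l (W (net_deriv l v)) \<le> (K1 + K2) * L2_norm G l v) \<and>
      (\<forall>g\<in>L2_net G l. (\<forall>q\<in>Qh G l N. ip_net G l g q = 0) \<longrightarrow> L2_norm G l (W g) = 0)"
    proof (intro exI[of _ "lift \<Phi>"] conjI ballI allI impI)
      fix g assume "g \<in> L2_net G l"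
      show "lift \<Phi> g \<in> Vh G l N" by (rule lift_Vh[OF \<Phi>])
    qed (simp_all add: lift_lincomb lift_ip 2 3 4)
  qed
qed

end

section \<open>Exponential stability of abstract damped systems\<close>

text \<open>Multiplying by \<open>exp (2 * \<gamma> * s)\<close> and bounding one square root factor by its maximum over the
  interval avoids differentiating the square root at zero.\<close>

lemma sqrt_gronwall:
  fixes \<Lambda> \<rho> :: "real \<Rightarrow> real"
  assumes t: "0 \<le> t" and \<gamma>: "0 < \<gamma>" and kab: "0 \<le> k" "0 \<le> a" "0 \<le> b"
    and cont: "continuous_on {0..t} \<Lambda>" and nn: "\<And>s. s \<in> {0..t} \<Longrightarrow> 0 \<le> \<Lambda> s"
    and der: "\<And>s. s \<in> {0<..<t} \<Longrightarrow>
      \<exists>D. (\<Lambda> has_real_derivative D) (at s) \<and> D \<le> - (2 * \<gamma>) * \<Lambda> s + k * \<rho> s * sqrt (\<Lambda> s)"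
    and \<rho>: "\<And>s. s \<in> {0<..<t} \<Longrightarrow> \<rho> s \<le> a + b * exp (\<gamma> * (t - s))"
  shows "sqrt (\<Lambda> t) \<le> exp (- \<gamma> * t) * sqrt (\<Lambda> 0) + k * (a / \<gamma> + b * t)"
proof -
  define E where "E s = exp (2 * \<gamma> * s) * \<Lambda> s" for s
  have contE: "continuous_on {0..t} E" unfolding E_def by (intro continuous_intros cont)
  obtain s0 where s0: "s0 \<in> {0..t}" "\<And>s. s \<in> {0..t} \<Longrightarrow> E s \<le> E s0"
    using continuous_attains_sup[OF _ _ contE] t by auto
  have E0: "0 \<le> E s" if "s \<in> {0..t}" for s using nn[OF that] by (simp add: E_def)
  define M where "M = sqrt (E s0)"
  have M: "0 \<le> M" "M * M = E s0" using E0[OF s0(1)] by (auto simp: M_def)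
  \<comment> \<open>Once \<open>sqrt (E s)\<close> is replaced by its maximum \<open>M\<close>, the
    bound for the derivative of \<open>E\<close> has an explicit primitive, so \<open>F\<close> is
    nonincreasing up to the point \<open>s0\<close> where the maximum is attained. In the second
    load term the growing weight and the decaying bound multiply to the constant
    \<open>exp (\<gamma> * t)\<close>.\<close>
  define F where "F s = E s - k * M * (a * exp (\<gamma> * s) / \<gamma> + b * exp (\<gamma> * t) * s)" for s
  have "F 0 \<ge> F s0"
  proof (rule DERIV_nonpos_imp_decreasing_open[of 0 s0 F])
    show "0 \<le> s0" using s0 by simp
    show "continuous_on {0..s0} F"
      unfolding F_def by (intro continuous_intros continuous_on_subset[OF contE]) (use \<gamma> s0 in auto)
    fix s assume s: "0 < s" "s < s0"
    then have s': "s \<in> {0<..<t}" "s \<in> {0..t}" using s0 by auto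
    obtain D where D: "(\<Lambda> has_real_derivative D) (at s)" "D \<le> - (2 * \<gamma>) * \<Lambda> s + k * \<rho> s * sqrt (\<Lambda> s)"
      using der[OF s'(1)] by blast
    let ?F' = "(2 * \<gamma> * exp (2 * \<gamma> * s)) * \<Lambda> s + exp (2 * \<gamma> * s) * D - k * M * (a * exp (\<gamma> * s) + b * exp (\<gamma> * t))"
    have 1: "(E has_real_derivative (2 * \<gamma> * exp (2 * \<gamma> * s)) * \<Lambda> s + D * exp (2 * \<gamma> * s)) (at s)"
      unfolding E_def using \<gamma> by (intro DERIV_mult D(1)) (auto intro!: derivative_eq_intros)
    have 2: "((\<lambda>s. a * exp (\<gamma> * s) / \<gamma> + b * exp (\<gamma> * t) * s) has_real_derivative a * exp (\<gamma> * s) + b * exp (\<gamma> * t)) (at s)"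
      using \<gamma> by (auto intro!: derivative_eq_intros)
    have "(F has_real_derivative ?F') (at s)"
      using DERIV_diff[OF 1 DERIV_cmult[OF 2, of "k * M"]] unfolding F_def mult.commute[of D] .
    moreover have "?F' \<le> 0"
    proof -
      have x2: "exp (2 * \<gamma> * s) = exp (\<gamma> * s) * exp (\<gamma> * s)" by (simp add: exp_add[symmetric])
      have sq: "exp (\<gamma> * s) * sqrt (\<Lambda> s) = sqrt (E s)"
        unfolding E_def x2 by (simp add: real_sqrt_mult)
      have "exp (2 * \<gamma> * s) * D \<le> exp (2 * \<gamma> * s) * (- (2 * \<gamma>) * \<Lambda> s + k * \<rho> s * sqrt (\<Lambda> s))"
        by (rule mult_left_mono[OF D(2)]) simp
      also have "\<dots> = - (2 * \<gamma> * exp (2 * \<gamma> * s)) * \<Lambda> s + k * (exp (\<gamma> * s) * \<rho> s) * (exp (\<gamma> * s) * sqrt (\<Lambda> s))"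
        unfolding x2 by (simp add: algebra_simps)
      also have "k * (exp (\<gamma> * s) * \<rho> s) * (exp (\<gamma> * s) * sqrt (\<Lambda> s))
          \<le> k * (a * exp (\<gamma> * s) + b * exp (\<gamma> * t)) * M"
      proof -
        have "exp (\<gamma> * s) * \<rho> s \<le> exp (\<gamma> * s) * (a + b * exp (\<gamma> * (t - s)))"
          by (rule mult_left_mono[OF \<rho>[OF s'(1)]]) simp
        also have "\<dots> = a * exp (\<gamma> * s) + b * (exp (\<gamma> * s) * exp (\<gamma> * (t - s)))"
          by (simp add: distrib_left mult_ac)
        also have "exp (\<gamma> * s) * exp (\<gamma> * (t - s)) = exp (\<gamma> * t)"
          unfolding exp_add[symmetric] by (simp add: algebra_simps)
        finally have r: "exp (\<gamma> * s) * \<rho> s \<le> a * exp (\<gamma> * s) + b * exp (\<gamma> * t)" .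
        have m: "sqrt (E s) \<le> M" unfolding M_def using s0(2)[OF s'(2)] by simp
        have "k * (exp (\<gamma> * s) * \<rho> s) * sqrt (E s) \<le> k * (a * exp (\<gamma> * s) + b * exp (\<gamma> * t)) * sqrt (E s)"
          using E0[OF s'(2)] by (intro mult_right_mono mult_left_mono r kab) auto
        also have "\<dots> \<le> k * (a * exp (\<gamma> * s) + b * exp (\<gamma> * t)) * M"
          using kab by (intro mult_left_mono m mult_nonneg_nonneg add_nonneg_nonneg) auto
        finally show ?thesis unfolding sq .
      qed
      finally show ?thesis by (simp add: mult_ac)
    qed
    ultimately show "\<exists>y. (F has_real_derivative y) (at s) \<and> y \<le> 0" by blast
  qed
  moreover have "F 0 \<le> E 0" using kab M \<gamma> by (simp add: F_def)
  moreover define X where "X = k * (exp (\<gamma> * t) * (a / \<gamma> + b * t))"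
  moreover have "k * M * (a * exp (\<gamma> * s0) / \<gamma> + b * exp (\<gamma> * t) * s0) \<le> M * X"
  proof -
    have e: "exp (\<gamma> * s0) \<le> exp (\<gamma> * t)" using s0 \<gamma> by simp
    have "a * exp (\<gamma> * s0) / \<gamma> + b * exp (\<gamma> * t) * s0 \<le> a * exp (\<gamma> * t) / \<gamma> + b * exp (\<gamma> * t) * t"
      using e s0 kab \<gamma> by (intro add_mono divide_right_mono mult_left_mono) auto
    then have "k * M * (a * exp (\<gamma> * s0) / \<gamma> + b * exp (\<gamma> * t) * s0) \<le> k * M * (a * exp (\<gamma> * t) / \<gamma> + b * exp (\<gamma> * t) * t)"
      using kab M by (intro mult_left_mono mult_nonneg_nonneg)
    then show ?thesis by (simp add: X_def algebra_simps)
  qed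
  \<comment> \<open>Together with \<open>E 0 \<le> sqrt (E 0) * M\<close> the factor
    \<open>M\<close> cancels, which gives a linear bound for the square root.\<close>
  ultimately have "M * M \<le> E 0 + M * X" unfolding M(2) F_def by linarith
  moreover have "E 0 \<le> sqrt (E 0) * M"
  proof -
    have "sqrt (E 0) \<le> M" unfolding M_def using s0(2)[of 0] t by simp
    then have "sqrt (E 0) * sqrt (E 0) \<le> sqrt (E 0) * M" using E0[of 0] t by (intro mult_left_mono) auto
    then show ?thesis using E0[of 0] t by simp
  qed
  ultimately have "M * M \<le> M * (sqrt (E 0) + X)" by (simp add: distrib_left mult.commute)
  moreover have "0 \<le> X" unfolding X_def using kab t \<gamma> by simp
  ultimately have "M \<le> sqrt (E 0) + X"
    using M(1) E0[of 0] t by (cases "M = 0") (auto simp: mult_le_cancel_left)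
  moreover have "sqrt (E t) \<le> M" unfolding M_def using s0(2)[of t] t by simp
  moreover have "sqrt (E t) = exp (\<gamma> * t) * sqrt (\<Lambda> t)"
  proof -
    have "exp (2 * \<gamma> * t) = exp (\<gamma> * t) * exp (\<gamma> * t)" by (simp add: exp_add[symmetric])
    then show ?thesis by (simp add: E_def real_sqrt_mult)
  qed
  moreover have "sqrt (E 0) = sqrt (\<Lambda> 0)" by (simp add: E_def)
  ultimately have "exp (\<gamma> * t) * sqrt (\<Lambda> t) \<le> sqrt (\<Lambda> 0) + X" by linarith
  then have "exp (- \<gamma> * t) * (exp (\<gamma> * t) * sqrt (\<Lambda> t)) \<le> exp (- \<gamma> * t) * (sqrt (\<Lambda> 0) + X)"
    by (intro mult_left_mono) auto
  moreover have ee: "exp (- \<gamma> * t) * (exp (\<gamma> * t) * y) = y" for y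
    unfolding mult.assoc[symmetric] exp_add[symmetric] by simp
  ultimately have "sqrt (\<Lambda> t) \<le> exp (- \<gamma> * t) * (sqrt (\<Lambda> 0) + X)" by (simp only: ee)
  also have "\<dots> = exp (- \<gamma> * t) * sqrt (\<Lambda> 0) + exp (- \<gamma> * t) * X" by (rule distrib_left)
  also have "exp (- \<gamma> * t) * X = k * (a / \<gamma> + b * t)"
    using ee[of "k * (a / \<gamma> + b * t)"] unfolding X_def mult.left_commute[of k] .
  finally show ?thesis .
qed

text \<open>The weight of the cross term in the Lyapunov functional: small enough for its coercivity and for
  absorbing the mixed terms of its derivative.\<close>

definition cross_weight :: "real \<Rightarrow> real \<Rightarrow> real \<Rightarrow> real" where
  "cross_weight c0 c1 K = Min {1, c0 / (2 * (c1 * K + (c1\<^sup>2 * K)\<^sup>2 / (2 * c0))), c0 / (2 * (c1\<^sup>2 * K))}"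

text \<open>Twice the rate is the dissipation coefficient \<open>\<delta> * c0 / 2\<close> divided
  by the upper equivalence constant \<open>c1 / 2 + c0 / 4\<close> of the Lyapunov functional, where
  \<delta> is the cross weight.\<close>

definition decay_rate :: "real \<Rightarrow> real \<Rightarrow> real \<Rightarrow> real" where
  "decay_rate c0 c1 K = cross_weight c0 c1 K * c0 / (4 * (c1 / 2 + c0 / 4))"

text \<open>The factor \<open>1 + c1 * K\<close> multiplies the load in the derivative of the
  Lyapunov functional; \<open>sqrt (8 / c0)\<close> converts the sum of the two norms into the
  square root of the functional.\<close>

definition load_gain :: "real \<Rightarrow> real \<Rightarrow> real \<Rightarrow> real" where
  "load_gain c0 c1 K = (1 + c1 * K) * sqrt (8 / c0)"

lemma cross_weight:
  assumes pos: "0 < c0" "0 < c1" "0 < (K :: real)"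
  defines "\<delta> \<equiv> cross_weight c0 c1 K"
  shows "0 < \<delta>" "\<delta> \<le> 1" "\<delta> * (c1 * K + (c1\<^sup>2 * K)\<^sup>2 / (2 * c0)) \<le> c0 / 2" "\<delta> * (c1\<^sup>2 * K) \<le> c0 / 2"
proof -
  let ?M = "c1 * K + (c1\<^sup>2 * K)\<^sup>2 / (2 * c0)" and ?M2 = "c1\<^sup>2 * K"
  have M: "0 < ?M" "0 < ?M2" using pos by (auto intro!: add_pos_pos)
  have *: "\<delta> * M \<le> c0 / 2" if "0 < M" "\<delta> \<le> c0 / (2 * M)" for M
    using that by (simp add: pos_le_divide_eq)
  show "0 < \<delta>" "\<delta> \<le> 1" unfolding \<delta>_def cross_weight_def using M pos by auto
  have "\<delta> \<le> c0 / (2 * ?M)" "\<delta> \<le> c0 / (2 * ?M2)" unfolding \<delta>_def cross_weight_def by auto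
  then show "\<delta> * ?M \<le> c0 / 2" "\<delta> * ?M2 \<le> c0 / 2"
    using M * by blast+
qed

lemma decay_rate_pos: "\<lbrakk>0 < c0; 0 < c1; 0 < K\<rbrakk> \<Longrightarrow> 0 < decay_rate c0 c1 K"
  using cross_weight(1)[of c0 c1 K] by (simp add: decay_rate_def add_pos_pos)

lemma load_gain_nonneg: "\<lbrakk>0 < c0; 0 < c1; 0 < K\<rbrakk> \<Longrightarrow> 0 \<le> load_gain c0 c1 K"
  by (simp add: load_gain_def)

section \<open>The Lyapunov functional of a damped system\<close>

locale damped_system = semi_inner L ip nrm for L :: "'a::real_vector set" and ip nrm +
  fixes V Q :: "'a set" and D W A B C :: "'a \<Rightarrow> 'a" and c0 c1 K :: real
  assumes pos: "0 < c0" "0 < c1" "0 < K"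
    and VL: "V \<subseteq> L" and QL: "Q \<subseteq> L" and DV: "v \<in> V \<Longrightarrow> D v \<in> Q"
    and A: "x \<in> L \<Longrightarrow> A x \<in> L" "x \<in> L \<Longrightarrow> c0 * ip x x \<le> ip (A x) x" "x \<in> L \<Longrightarrow> nrm (A x) \<le> c1 * nrm x"
    and B: "x \<in> L \<Longrightarrow> B x \<in> L" "x \<in> L \<Longrightarrow> c0 * ip x x \<le> ip (B x) x" "x \<in> L \<Longrightarrow> nrm (B x) \<le> c1 * nrm x"
    and C: "x \<in> L \<Longrightarrow> C x \<in> L" "x \<in> L \<Longrightarrow> c0 * ip x x \<le> ip (C x) x" "x \<in> L \<Longrightarrow> nrm (C x) \<le> c1 * nrm x"
    and WV: "x \<in> L \<Longrightarrow> W x \<in> V"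
    and W_lin: "\<lbrakk>x \<in> L; y \<in> L\<rbrakk> \<Longrightarrow> W (x + c *\<^sub>R y) = W x + c *\<^sub>R W y"
    and W_ip: "\<lbrakk>x \<in> L; q \<in> Q\<rbrakk> \<Longrightarrow> ip q (D (W x)) = ip q x"
    and W_norm: "x \<in> L \<Longrightarrow> nrm (W x) \<le> K * nrm x"
    and W_D: "v \<in> V \<Longrightarrow> nrm (W (D v)) \<le> K * nrm v"
    and W_null: "\<lbrakk>x \<in> L; \<And>q. q \<in> Q \<Longrightarrow> ip x q = 0\<rbrakk> \<Longrightarrow> nrm (W x) = 0"
begin

abbreviation \<delta> :: real where "\<delta> \<equiv> cross_weight c0 c1 K"
abbreviation rate :: real where "rate \<equiv> decay_rate c0 c1 K"
abbreviation gain :: real where "gain \<equiv> load_gain c0 c1 K"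

text \<open>The sign is chosen such that testing the first equation with \<open>W (B y)\<close>
  contributes \<open>- \<delta> * ip y (B y)\<close> to the derivative, the damping of
  \<open>y\<close> which the plain energy lacks.\<close>

definition lyap :: "'a \<Rightarrow> 'a \<Rightarrow> real" where
  "lyap x y = ip (C x) x / 2 + ip (B y) y / 2 - \<delta> * ip (C x) (W (B y))"

lemmas \<delta> = cross_weight[OF pos]

lemma cross:
  assumes "x \<in> L" "y \<in> L"
  shows "\<bar>ip (C x) (W (B y))\<bar> \<le> c1\<^sup>2 * K * (nrm x * nrm y)"
proof -
  have m: "C x \<in> L" "B y \<in> L" "W (B y) \<in> L" using assms A B C WV VL by auto
  have "\<bar>ip (C x) (W (B y))\<bar> \<le> nrm (C x) * nrm (W (B y))" by (rule Cauchy_Schwarz[OF m(1,3)])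
  also have "\<dots> \<le> (c1 * nrm x) * (K * (c1 * nrm y))"
  proof (rule mult_mono)
    show "nrm (C x) \<le> c1 * nrm x" by (rule C(3)[OF assms(1)])
    show "nrm (W (B y)) \<le> K * (c1 * nrm y)"
      using W_norm[OF m(2)] mult_left_mono[OF B(3)[OF assms(2)], of K] pos by linarith
    show "0 \<le> c1 * nrm x" using pos nrm_nonneg[OF assms(1)] by simp
    show "0 \<le> nrm (W (B y))" by (rule nrm_nonneg[OF m(3)])
  qed
  finally show ?thesis by (simp add: power2_eq_square mult_ac)
qed

text \<open>By the fourth bound on \<delta> the cross term is at most half of the lower bound of the
  energy.\<close>

lemma lyap_bounds:
  assumes "x \<in> L" "y \<in> L"
  shows "c0 / 4 * ((nrm x)\<^sup>2 + (nrm y)\<^sup>2) \<le> lyap x y"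
    "lyap x y \<le> (c1 / 2 + c0 / 4) * ((nrm x)\<^sup>2 + (nrm y)\<^sup>2)"
proof -
  let ?N = "nrm x" and ?P = "nrm y"
  have NP: "0 \<le> ?N" "0 \<le> ?P" using assms nrm_nonneg by auto
  have "\<bar>\<delta> * ip (C x) (W (B y))\<bar> = \<delta> * \<bar>ip (C x) (W (B y))\<bar>" using \<delta>(1) by (simp add: abs_mult)
  also have "\<dots> \<le> \<delta> * (c1\<^sup>2 * K * (?N * ?P))" using cross[OF assms] \<delta>(1) by (intro mult_left_mono) auto
  also have "\<dots> \<le> c0 / 2 * (?N * ?P)"
    using mult_right_mono[OF \<delta>(4), of "?N * ?P"] NP by (simp add: mult.assoc)
  also have "\<dots> \<le> c0 / 4 * (?N\<^sup>2 + ?P\<^sup>2)"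
    using sum_squares_bound[of ?N ?P] pos by (simp add: mult_left_mono)
  finally have cr: "\<bar>\<delta> * ip (C x) (W (B y))\<bar> \<le> c0 / 4 * (?N\<^sup>2 + ?P\<^sup>2)" .
  have lo: "c0 * ?N\<^sup>2 \<le> ip (C x) x" "c0 * ?P\<^sup>2 \<le> ip (B y) y"
    using C(2) B(2) assms by (simp_all add: nrm_sq)
  have up: "ip (C x) x \<le> c1 * ?N\<^sup>2" "ip (B y) y \<le> c1 * ?P\<^sup>2"
    using Cauchy_Schwarz[OF C(1)[OF assms(1)] assms(1)] Cauchy_Schwarz[OF B(1)[OF assms(2)] assms(2)]
      mult_right_mono[OF C(3)[OF assms(1)] NP(1)] mult_right_mono[OF B(3)[OF assms(2)] NP(2)]
    by (simp_all add: power2_eq_square mult.assoc)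
  show "c0 / 4 * (?N\<^sup>2 + ?P\<^sup>2) \<le> lyap x y"
    using cr lo unfolding lyap_def distrib_left by linarith
  show "lyap x y \<le> (c1 / 2 + c0 / 4) * (?N\<^sup>2 + ?P\<^sup>2)"
    using cr up unfolding lyap_def distrib_left distrib_right by linarith
qed

text \<open>The energy terms yield only the damping \<open>ip (A x) x\<close>. Testing the first
  equation with \<open>w = W (B y)\<close> turns the coupling \<open>ip y (D w)\<close> into
  \<open>ip y (B y)\<close>. In the remaining cross term, \<open>B dy\<close> is replaced by
  \<open>s - D x\<close>, and \<open>W (D x)\<close> is bounded by \<open>K * nrm x\<close>.\<close>

lemma lyap_derivative:
  assumes x: "x \<in> V" "dx \<in> L" and y: "y \<in> Q" "dy \<in> L" and s: "s \<in> L" "nrm s \<le> \<rho>"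
    and R: "\<And>v. v \<in> V \<Longrightarrow> \<bar>R v\<bar> \<le> \<rho> * nrm v"
    and eq1: "\<And>v. v \<in> V \<Longrightarrow> ip (C dx) v - ip y (D v) + ip (A x) v = R v"
    and eq2: "\<And>q. q \<in> Q \<Longrightarrow> ip (B dy) q + ip (D x) q = ip s q"
  shows "ip (C dx) x + ip (B dy) y - \<delta> * (ip (C dx) (W (B y)) + ip (C x) (W (B dy)))
    \<le> - (\<delta> * c0 / 2) * ((nrm x)\<^sup>2 + (nrm y)\<^sup>2) + (1 + c1 * K) * \<rho> * (nrm x + nrm y)"
proof -
  let ?N = "nrm x" and ?P = "nrm y"
  have m: "x \<in> L" "y \<in> L" "D x \<in> L" using x y VL QL DV by auto
  have NP: "0 \<le> ?N" "0 \<le> ?P" using m nrm_nonneg by auto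
  have \<rho>: "0 \<le> \<rho>" using nrm_nonneg[OF s(1)] s(2) by linarith
  define w where "w = W (B y)"
  have wV: "w \<in> V" unfolding w_def by (intro WV B m)
  then have wL: "w \<in> L" using VL by auto
  have w: "nrm w \<le> K * c1 * ?P"
    using W_norm[OF B(1)[OF m(2)]] mult_left_mono[OF B(3)[OF m(2)], of K] pos unfolding w_def by linarith
  have e1: "ip (C dx) x + ip (B dy) y = R x + ip s y - ip (A x) x"
    using eq1[OF x(1)] eq2[OF y(1)] ip_commute[of y "D x"] by linarith
  have e2: "ip (C dx) w = R w + ip y (B y) - ip (A x) w"
    using eq1[OF wV] W_ip[OF B(1)[OF m(2)] y(1)] unfolding w_def by linarith
  \<comment> \<open>The residual of the second equation, which vanishes only when tested with
    \<open>Q\<close>. Since \<open>W\<close> maps it to norm zero, \<open>W (B dy)\<close> may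
    nevertheless be replaced by \<open>W s - W (D x)\<close>.\<close>
  define z where "z = B dy + 1 *\<^sub>R (D x + (-1) *\<^sub>R s)"
  have zL: "z \<in> L" "D x + (-1) *\<^sub>R s \<in> L" unfolding z_def using m s B(1)[OF y(2)] by (auto intro!: closed)
  have "nrm (W z) = 0"
  proof (rule W_null[OF zL(1)])
    fix q assume q: "q \<in> Q"
    then have "q \<in> L" using QL by auto
    then show "ip z q = 0"
      unfolding z_def using eq2[OF q] m s B(1)[OF y(2)] by (simp add: bilinear closed)
  qed
  have Ws: "W s \<in> L" "W (D x) \<in> L" "W z \<in> L" "W (B dy) \<in> L" using WV VL s m zL B(1)[OF y(2)] by auto
  have "W z = W (B dy) + 1 *\<^sub>R W (D x + (-1) *\<^sub>R s)"
    unfolding z_def by (rule W_lin[OF B(1)[OF y(2)] zL(2)])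
  also have "W (D x + (-1) *\<^sub>R s) = W (D x) + (-1) *\<^sub>R W s" by (rule W_lin[OF m(3) s(1)])
  finally have "W (B dy) = W z - W (D x) + W s" by (simp add: algebra_simps)
  then have "ip (C x) (W (B dy)) = ip (C x) (W z) - ip (C x) (W (D x)) + ip (C x) (W s)"
    using Ws C(1)[OF m(1)] by (simp add: bilinear closed)
  moreover have CS: "\<bar>ip (C x) v\<bar> \<le> c1 * ?N * nrm v" if "v \<in> L" for v
    using Cauchy_Schwarz[OF C(1)[OF m(1)] that] mult_right_mono[OF C(3)[OF m(1)] nrm_nonneg[OF that]] by linarith
  moreover have "c1 * ?N * nrm (W z) = 0" using \<open>nrm (W z) = 0\<close> by simp
  moreover have "c1 * ?N * nrm (W (D x)) \<le> c1 * K * ?N\<^sup>2"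
    using mult_left_mono[OF W_D[OF x(1)], of "c1 * ?N"] pos NP by (simp add: power2_eq_square mult_ac)
  moreover have "c1 * ?N * nrm (W s) \<le> c1 * K * \<rho> * ?N"
  proof -
    have "nrm (W s) \<le> K * \<rho>" using W_norm[OF s(1)] mult_left_mono[OF s(2), of K] pos by linarith
    from mult_left_mono[OF this, of "c1 * ?N"] show ?thesis using pos NP by (simp add: mult_ac)
  qed
  ultimately have e3: "\<bar>ip (C x) (W (B dy))\<bar> \<le> c1 * K * ?N\<^sup>2 + c1 * K * \<rho> * ?N"
    using CS[OF Ws(3)] CS[OF Ws(2)] CS[OF Ws(1)] by linarith
  have a1: "c0 * ?N\<^sup>2 \<le> ip (A x) x" using A(2)[OF m(1)] by (simp add: nrm_sq m)
  have a2: "c0 * ?P\<^sup>2 \<le> ip y (B y)" using B(2)[OF m(2)] by (simp add: nrm_sq m ip_commute)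
  have a3: "R x \<le> \<rho> * ?N" using R[OF x(1)] by linarith
  have a4: "ip s y \<le> \<rho> * ?P"
    using Cauchy_Schwarz[OF s(1) m(2)] mult_right_mono[OF s(2) NP(2)] by linarith
  have a5: "\<bar>R w\<bar> \<le> c1 * K * \<rho> * ?P"
    using R[OF wV] mult_left_mono[OF w \<rho>] by (simp add: mult_ac)
  have a6: "\<bar>ip (A x) w\<bar> \<le> c1\<^sup>2 * K * (?N * ?P)"
  proof -
    have "\<bar>ip (A x) w\<bar> \<le> nrm (A x) * nrm w" by (rule Cauchy_Schwarz[OF A(1)[OF m(1)] wL])
    also have "\<dots> \<le> (c1 * ?N) * (K * c1 * ?P)"
      using A(3)[OF m(1)] w pos NP nrm_nonneg[OF wL] by (intro mult_mono) auto
    finally show ?thesis by (simp add: power2_eq_square mult_ac)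
  qed
  \<comment> \<open>Young's inequality, weighted such that exactly half of the new damping of
    \<open>y\<close> is spent; the coefficient of the square of \<open>?N\<close> is the one in the
    definition of \<open>cross_weight\<close>.\<close>
  have a7: "c1\<^sup>2 * K * (?N * ?P) \<le> c0 / 2 * ?P\<^sup>2 + (c1\<^sup>2 * K)\<^sup>2 / (2 * c0) * ?N\<^sup>2"
  proof -
    have "0 \<le> (c0 * ?P - c1\<^sup>2 * K * ?N)\<^sup>2 / (2 * c0)" using pos by simp
    also have "\<dots> = c0 / 2 * ?P\<^sup>2 + (c1\<^sup>2 * K)\<^sup>2 / (2 * c0) * ?N\<^sup>2 - c1\<^sup>2 * K * (?N * ?P)"
      using pos by (simp add: power2_diff power_mult_distrib divide_simps) (simp add: power2_eq_square algebra_simps)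
    finally show ?thesis by linarith
  qed
  define k where "k = c1 * K"
  define S where "S = (c1\<^sup>2 * K)\<^sup>2 / (2 * c0)"
  note e3 = e3[folded k_def] and a5 = a5[folded k_def] and a7 = a7[folded S_def]
  note \<delta>3 = \<delta>(3)[folded k_def S_def]
  have k: "0 \<le> k" using pos by (simp add: k_def)
  have "- (ip (C dx) w + ip (C x) (W (B dy)))
      \<le> - (c0 / 2) * ?P\<^sup>2 + (k + S) * ?N\<^sup>2 + k * \<rho> * (?N + ?P)"
    using e2 e3 a2 a5 a6 a7 unfolding distrib_left distrib_right by linarith
  from mult_left_mono[OF this less_imp_le[OF \<delta>(1)]]
  have "- (\<delta> * (ip (C dx) w + ip (C x) (W (B dy))))
      \<le> - (\<delta> * c0 / 2) * ?P\<^sup>2 + (\<delta> * (k + S)) * ?N\<^sup>2 + \<delta> * (k * \<rho> * (?N + ?P))"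
    by (simp add: algebra_simps)
  also have "\<dots> \<le> - (\<delta> * c0 / 2) * ?P\<^sup>2 + (c0 / 2) * ?N\<^sup>2 + k * \<rho> * (?N + ?P)"
  proof -
    have "(\<delta> * (k + S)) * ?N\<^sup>2 \<le> (c0 / 2) * ?N\<^sup>2" by (rule mult_right_mono[OF \<delta>3]) simp
    moreover have "\<delta> * (k * \<rho> * (?N + ?P)) \<le> 1 * (k * \<rho> * (?N + ?P))"
      using k \<rho> NP by (intro mult_right_mono \<delta>(2)) simp
    ultimately show ?thesis by linarith
  qed
  finally have f: "- (\<delta> * (ip (C dx) w + ip (C x) (W (B dy))))
      \<le> - (\<delta> * c0 / 2) * ?P\<^sup>2 + (c0 / 2) * ?N\<^sup>2 + k * \<rho> * (?N + ?P)" .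
  \<comment> \<open>Half of the damping of \<open>x\<close> survives; by
    \<open>\<delta> \<le> 1\<close> it has at least the coefficient of the surviving damping of
    \<open>y\<close>.\<close>
  have g: "\<delta> * c0 / 2 * ?N\<^sup>2 \<le> c0 / 2 * ?N\<^sup>2"
    using mult_right_mono[OF \<delta>(2), of "c0 / 2 * ?N\<^sup>2"] pos by simp
  have "ip (C dx) x + ip (B dy) y - \<delta> * (ip (C dx) w + ip (C x) (W (B dy)))
      \<le> \<rho> * ?N + \<rho> * ?P - c0 * ?N\<^sup>2 - (\<delta> * c0 / 2) * ?P\<^sup>2 + (c0 / 2) * ?N\<^sup>2 + k * \<rho> * (?N + ?P)"
    using f e1 a1 a3 a4 by linarith
  also have "\<dots> \<le> - (\<delta> * c0 / 2) * (?N\<^sup>2 + ?P\<^sup>2) + (1 + k) * \<rho> * (?N + ?P)"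
    using g unfolding distrib_left distrib_right by (simp add: algebra_simps)
  finally show ?thesis unfolding w_def k_def .
qed

lemmas rate_pos = decay_rate_pos[OF pos]

lemma lyap_nonneg: "\<lbrakk>x \<in> L; y \<in> L\<rbrakk> \<Longrightarrow> 0 \<le> lyap x y"
  using lyap_bounds(1)[of x y] pos by (smt (verit) divide_pos_pos mult_nonneg_nonneg zero_le_power2)

lemma norm_sum_le_lyap:
  assumes "x \<in> L" "y \<in> L"
  shows "nrm x + nrm y \<le> sqrt (8 / c0) * sqrt (lyap x y)"
proof -
  have NP: "0 \<le> nrm x" "0 \<le> nrm y" using assms nrm_nonneg by auto
  have "(nrm x + nrm y)\<^sup>2 \<le> 2 * ((nrm x)\<^sup>2 + (nrm y)\<^sup>2)"
    using sum_squares_bound[of "nrm x" "nrm y"] by (simp add: power2_sum)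
  also have "\<dots> = 8 / c0 * (c0 / 4 * ((nrm x)\<^sup>2 + (nrm y)\<^sup>2))" using pos by simp
  also have "\<dots> \<le> 8 / c0 * lyap x y"
    using lyap_bounds(1)[OF assms] pos by (intro mult_left_mono) auto
  finally have "nrm x + nrm y \<le> sqrt (8 / c0 * lyap x y)" by (rule real_le_rsqrt)
  then show ?thesis unfolding real_sqrt_mult .
qed

lemma lyap_derivative_rate:
  assumes x: "x \<in> V" "dx \<in> L" and y: "y \<in> Q" "dy \<in> L" and s: "s \<in> L" "nrm s \<le> \<rho>"
    and R: "\<And>v. v \<in> V \<Longrightarrow> \<bar>R v\<bar> \<le> \<rho> * nrm v"
    and eq1: "\<And>v. v \<in> V \<Longrightarrow> ip (C dx) v - ip y (D v) + ip (A x) v = R v"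
    and eq2: "\<And>q. q \<in> Q \<Longrightarrow> ip (B dy) q + ip (D x) q = ip s q"
  shows "ip (C dx) x + ip (B dy) y - \<delta> * (ip (C dx) (W (B y)) + ip (C x) (W (B dy)))
    \<le> - (2 * rate) * lyap x y + gain * \<rho> * sqrt (lyap x y)"
proof -
  have m: "x \<in> L" "y \<in> L" using x y VL QL by auto
  have \<rho>: "0 \<le> \<rho>" using nrm_nonneg[OF s(1)] s(2) by linarith
  let ?c = "c1 / 2 + c0 / 4"
  have c: "0 < ?c" using pos by simp
  have "2 * rate * lyap x y \<le> 2 * rate * (?c * ((nrm x)\<^sup>2 + (nrm y)\<^sup>2))"
    using lyap_bounds(2)[OF m] rate_pos by (intro mult_left_mono) auto
  also have "\<dots> = (2 * rate * ?c) * ((nrm x)\<^sup>2 + (nrm y)\<^sup>2)" by (simp only: mult.assoc)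
  also have "2 * rate * ?c = \<delta> * c0 / 2"
  proof -
    have "rate * (4 * ?c) = \<delta> * c0" unfolding decay_rate_def using c by simp
    then show ?thesis by linarith
  qed
  finally have 1: "2 * rate * lyap x y \<le> \<delta> * c0 / 2 * ((nrm x)\<^sup>2 + (nrm y)\<^sup>2)" .
  have "(1 + c1 * K) * \<rho> * (nrm x + nrm y) \<le> (1 + c1 * K) * \<rho> * (sqrt (8 / c0) * sqrt (lyap x y))"
    using pos \<rho> by (intro mult_left_mono norm_sum_le_lyap[OF m]) auto
  also have "\<dots> = gain * \<rho> * sqrt (lyap x y)" by (simp add: load_gain_def mult_ac)
  finally have 2: "(1 + c1 * K) * \<rho> * (nrm x + nrm y) \<le> gain * \<rho> * sqrt (lyap x y)" .
  show ?thesis using lyap_derivative[OF assms] 1 2 by linarith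
qed

end

section \<open>Fractional Sobolev norms\<close>

lemma slob_integrand_measurable:
  assumes "w \<in> borel_measurable (lebesgue_on {0..r})"
  shows "slob_integrand \<sigma> w \<in> borel_measurable (lebesgue_on {0..r} \<Otimes>\<^sub>M lebesgue_on {0..r})"
proof -
  have [measurable]: "w \<in> borel_measurable (lebesgue_on {0..r})" by (rule assms)
  have [measurable]: "(\<lambda>x. x) \<in> borel_measurable (lebesgue_on {0..r})"
    by (rule continuous_imp_measurable_on_sets_lebesgue) auto
  show ?thesis unfolding slob_integrand_def by measurable
qed

lemma slob_integrand_AE:
  assumes w: "w \<in> borel_measurable (lebesgue_on {0..r})" and ae: "AE x in lebesgue_on {0..r}. w x = z x"
  shows "AE p in lebesgue_on {0..r} \<Otimes>\<^sub>M lebesgue_on {0..r}. slob_integrand \<sigma> w p = slob_integrand \<sigma> z p"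
proof -
  let ?M = "lebesgue_on {0..r}"
  have z: "z \<in> borel_measurable ?M" by (rule measurable_lebesgue_on_cong_AE[OF w ae])
  interpret M: finite_measure ?M by (rule finite_measure_lebesgue_on) simp
  interpret P: pair_sigma_finite ?M ?M ..
  have [measurable]: "slob_integrand \<sigma> w \<in> borel_measurable (?M \<Otimes>\<^sub>M ?M)" "slob_integrand \<sigma> z \<in> borel_measurable (?M \<Otimes>\<^sub>M ?M)"
    using w z by (auto intro: slob_integrand_measurable)
  show ?thesis
  proof (rule P.AE_pair_measure)
    show "{p \<in> space (?M \<Otimes>\<^sub>M ?M). slob_integrand \<sigma> w p = slob_integrand \<sigma> z p} \<in> sets (?M \<Otimes>\<^sub>M ?M)"
      by measurable
    show "AE x in ?M. AE y in ?M. slob_integrand \<sigma> w (x, y) = slob_integrand \<sigma> z (x, y)"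
      using ae
    proof eventually_elim
      case (elim x)
      note x = elim
      show ?case using ae by eventually_elim (simp add: slob_integrand_def x)
    qed
  qed
qed

text \<open>Case distinction instead of induction: almost equal functions have literally the same
  chosen weak derivative, so one unfolding settles all orders.\<close>

lemma Hks_cong:
  assumes w: "w \<in> L2_int r" and z: "z \<in> L2_int r" and ae: "AE x in lebesgue_on {0..r}. w x = z x"
  shows "w \<in> Hks k \<sigma> r \<longleftrightarrow> z \<in> Hks k \<sigma> r" "Hks_sq k \<sigma> r w = Hks_sq k \<sigma> r z"
proof -
  let ?M = "lebesgue_on {0..r}"
  note wm = L2_int_measurable[OF w] and zm = L2_int_measurable[OF z]
  have sq: "(LINT x|?M. (w x)\<^sup>2) = (LINT x|?M. (z x)\<^sup>2)"
    by (rule integral_cong_AE) (use wm zm ae in \<open>auto elim: eventually_mono\<close>)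
  note sae = slob_integrand_AE[OF wm ae, of \<sigma>]
  have s1: "slob_integrable \<sigma> r w = slob_integrable \<sigma> r z"
    unfolding slob_integrable_def
    by (rule integrable_cong_AE) (use sae slob_integrand_measurable[OF wm] slob_integrand_measurable[OF zm] in auto)
  have s2: "slob_sq \<sigma> r w = slob_sq \<sigma> r z"
    unfolding slob_sq_def
    by (rule integral_cong_AE) (use sae slob_integrand_measurable[OF wm] slob_integrand_measurable[OF zm] in auto)
  note d = has_weak_deriv_cong_AE[OF wm ae] weak_deriv_cong_AE[OF wm ae]
  show "w \<in> Hks k \<sigma> r \<longleftrightarrow> z \<in> Hks k \<sigma> r" by (cases k) (simp_all add: w z s1 d)
  show "Hks_sq k \<sigma> r w = Hks_sq k \<sigma> r z" by (cases k) (simp_all add: sq s2 d)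
qed

lemma Hks_L2: "w \<in> Hks k \<sigma> r \<Longrightarrow> w \<in> L2_int r"
  by (cases k) auto

lemma slob_sq_nonneg: "0 \<le> slob_sq \<sigma> r w"
  unfolding slob_sq_def by (rule integral_nonneg_AE) (auto simp: slob_integrand_def)

lemma Hks_sq_nonneg: "0 \<le> Hks_sq k \<sigma> r w"
  by (induction k arbitrary: w) (auto simp: slob_sq_nonneg)

lemma Hks_sq_ge: "(LINT x|lebesgue_on {0..r}. (w x)\<^sup>2) \<le> Hks_sq k \<sigma> r w"
  using Hks_sq_nonneg by (cases k) (auto simp: slob_sq_nonneg)

lemma square_diff_le: "(a + b)\<^sup>2 \<le> 2 * a\<^sup>2 + 2 * (b :: real)\<^sup>2"
  using sum_squares_bound[of a b] by (simp add: power2_sum)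

lemma square_diff_le': "(a - b)\<^sup>2 \<le> 2 * a\<^sup>2 + 2 * (b :: real)\<^sup>2"
  using square_diff_le[of a "- b"] by simp

text \<open>A triangle inequality for squares, with factor 2. It follows pointwise under the
  integrals by induction on the order and suffices to bound continuous paths.\<close>

lemma Hks_diff:
  assumes r: "0 < r" and "w \<in> Hks k \<sigma> r" "z \<in> Hks k \<sigma> r"
  shows "(\<lambda>x. w x - z x) \<in> Hks k \<sigma> r \<and>
    Hks_sq k \<sigma> r w \<le> 2 * Hks_sq k \<sigma> r (\<lambda>x. w x - z x) + 2 * Hks_sq k \<sigma> r z"
  using assms(2,3)
proof (induction k arbitrary: w z)
  case base: 0
  let ?M = "lebesgue_on {0..r}" and ?d = "\<lambda>x. w x - z x"
  have L: "w \<in> L2_int r" "z \<in> L2_int r" "?d \<in> L2_int r" using base L2_int_diff Hks_L2 by blast+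
  have i: "integrable ?M (\<lambda>x. (f x)\<^sup>2)" if "f \<in> L2_int r" for f using that by (simp add: L2_int_def)
  have "(LINT x|?M. (w x)\<^sup>2) \<le> (LINT x|?M. 2 * (?d x)\<^sup>2 + 2 * (z x)\<^sup>2)"
  proof (rule integral_mono)
    show "(w x)\<^sup>2 \<le> 2 * (?d x)\<^sup>2 + 2 * (z x)\<^sup>2" for x
      using square_diff_le[of "?d x" "z x"] by simp
  qed (use i[OF L(1)] i[OF L(2)] i[OF L(3)] in auto)
  also have "\<dots> = 2 * (LINT x|?M. (?d x)\<^sup>2) + 2 * (LINT x|?M. (z x)\<^sup>2)"
    using i[OF L(2)] i[OF L(3)] by simp
  finally have 1: "(LINT x|?M. (w x)\<^sup>2) \<le> 2 * (LINT x|?M. (?d x)\<^sup>2) + 2 * (LINT x|?M. (z x)\<^sup>2)" .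
  \<comment> \<open>Both signs are covered, since the estimate is used for \<open>w\<close> as the
    sum of difference and \<open>z\<close>, and for the difference itself.\<close>
  have pt: "slob_integrand \<sigma> a p \<le> 2 * slob_integrand \<sigma> b p + 2 * slob_integrand \<sigma> c p"
    if "\<And>x y. a x - a y = (b x - b y) + (c x - c y) \<or> a x - a y = (b x - b y) - (c x - c y)" for a b c p
  proof (cases p)
    case (Pair x y)
    have "(a x - a y)\<^sup>2 \<le> 2 * (b x - b y)\<^sup>2 + 2 * (c x - c y)\<^sup>2"
      using that[of x y] square_diff_le[of "b x - b y" "c x - c y"] square_diff_le'[of "b x - b y" "c x - c y"]
      by metis
    then have "(a x - a y)\<^sup>2 / \<bar>x - y\<bar> powr (1 + 2 * \<sigma>) \<le> (2 * (b x - b y)\<^sup>2 + 2 * (c x - c y)\<^sup>2) / \<bar>x - y\<bar> powr (1 + 2 * \<sigma>)"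
      by (rule divide_right_mono) simp
    then show ?thesis by (simp add: Pair slob_integrand_def add_divide_distrib)
  qed
  show ?case
  proof (cases "0 < \<sigma>")
    case False
    then show ?thesis using L 1 by simp
  next
    case True
    let ?P = "?M \<Otimes>\<^sub>M ?M"
    have sw: "integrable ?P (slob_integrand \<sigma> w)" and sz: "integrable ?P (slob_integrand \<sigma> z)"
      using base True by (auto simp: slob_integrable_def)
    have sd: "integrable ?P (slob_integrand \<sigma> ?d)"
    proof (rule Bochner_Integration.integrable_bound)
      show "integrable ?P (\<lambda>p. 2 * slob_integrand \<sigma> w p + 2 * slob_integrand \<sigma> z p)" using sw sz by simp
      show "slob_integrand \<sigma> ?d \<in> borel_measurable ?P"
        by (rule slob_integrand_measurable[OF L2_int_measurable[OF L(3)]])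
      have "norm (slob_integrand \<sigma> ?d p) \<le> norm (2 * slob_integrand \<sigma> w p + 2 * slob_integrand \<sigma> z p)" for p
      proof -
        have "0 \<le> slob_integrand \<sigma> ?d p" by (cases p) (simp add: slob_integrand_def)
        moreover have "slob_integrand \<sigma> ?d p \<le> 2 * slob_integrand \<sigma> w p + 2 * slob_integrand \<sigma> z p"
          by (rule pt) auto
        ultimately show ?thesis by simp
      qed
      then show "AE p in ?P. norm (slob_integrand \<sigma> ?d p) \<le> norm (2 * slob_integrand \<sigma> w p + 2 * slob_integrand \<sigma> z p)"
        by simp
    qed
    have "slob_sq \<sigma> r w \<le> (LINT p|?P. 2 * slob_integrand \<sigma> ?d p + 2 * slob_integrand \<sigma> z p)"
      unfolding slob_sq_def
    proof (rule integral_mono)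
      show "slob_integrand \<sigma> w p \<le> 2 * slob_integrand \<sigma> ?d p + 2 * slob_integrand \<sigma> z p" for p
        by (rule pt) auto
    qed (use sw sd sz in auto)
    also have "\<dots> = 2 * slob_sq \<sigma> r ?d + 2 * slob_sq \<sigma> r z"
      using sd sz by (simp add: slob_sq_def)
    finally show ?thesis using 1 True L sd by (simp add: slob_integrable_def)
  qed
next
  case (Suc k)
  let ?M = "lebesgue_on {0..r}" and ?d = "\<lambda>x. w x - z x"
  have H: "w \<in> Hs_int 1 r" "z \<in> Hs_int 1 r" using Suc.prems by (auto simp: Hs_int_1)
  have L: "w \<in> L2_int r" "z \<in> L2_int r" "?d \<in> L2_int r" using Suc.prems L2_int_diff Hks_L2 by blast+
  have i: "integrable ?M (\<lambda>x. (f x)\<^sup>2)" if "f \<in> L2_int r" for f using that by (simp add: L2_int_def)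
  have "(LINT x|?M. (w x)\<^sup>2) \<le> (LINT x|?M. 2 * (?d x)\<^sup>2 + 2 * (z x)\<^sup>2)"
  proof (rule integral_mono)
    show "(w x)\<^sup>2 \<le> 2 * (?d x)\<^sup>2 + 2 * (z x)\<^sup>2" for x
      using square_diff_le[of "?d x" "z x"] by simp
  qed (use i[OF L(1)] i[OF L(2)] i[OF L(3)] in auto)
  also have "\<dots> = 2 * (LINT x|?M. (?d x)\<^sup>2) + 2 * (LINT x|?M. (z x)\<^sup>2)"
    using i[OF L(2)] i[OF L(3)] by simp
  finally have 1: "(LINT x|?M. (w x)\<^sup>2) \<le> 2 * (LINT x|?M. (?d x)\<^sup>2) + 2 * (LINT x|?M. (z x)\<^sup>2)" .
  note lc = H1_lincomb[OF r H, where c = "-1"]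
  have d1: "?d \<in> Hs_int 1 r" using lc(1) by simp
  have ae: "AE x in ?M. weak_deriv r ?d x = weak_deriv r w x - weak_deriv r z x" using lc(2) by simp
  have dL: "weak_deriv r ?d \<in> L2_int r" "(\<lambda>x. weak_deriv r w x - weak_deriv r z x) \<in> L2_int r"
    using H1_deriv(2)[OF r] H d1 by (auto intro: L2_int_diff)
  have IH: "(\<lambda>x. weak_deriv r w x - weak_deriv r z x) \<in> Hks k \<sigma> r \<and>
    Hks_sq k \<sigma> r (weak_deriv r w) \<le> 2 * Hks_sq k \<sigma> r (\<lambda>x. weak_deriv r w x - weak_deriv r z x) + 2 * Hks_sq k \<sigma> r (weak_deriv r z)"
    by (rule Suc.IH) (use Suc.prems in auto)
  show ?case
    using IH 1 L(3) d1 Hks_cong[OF dL ae, of k \<sigma>] by (auto simp: Hs_int_1)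
qed

text \<open>Makes the supremum in the claim meaningful. Continuity bounds the norm near each time,
  and the bisection principle \<open>Bolzano\<close> turns this into a bound on the whole
  interval.\<close>

lemma Hs_net_bounded:
  assumes l: "\<And>e. e \<in> parcs G \<Longrightarrow> 0 < l e" and w: "C0_time T (Hs_net s G l) (Hs_norm s G l) w" and T: "0 \<le> T"
  obtains B where "\<And>t. t \<in> {0..T} \<Longrightarrow> Hs_norm s G l (w t) \<le> B"
proof -
  let ?N = "Hs_norm s G l"
  have sq: "(?N z)\<^sup>2 = (\<Sum>e\<in>parcs G. Hs_int_sq s (l e) (z e))" for z
    unfolding Hs_norm_def Hs_int_sq_def by (simp add: sum_nonneg Hks_sq_nonneg)
  have N0: "0 \<le> ?N z" for z unfolding Hs_norm_def Hs_int_sq_def by (simp add: sum_nonneg Hks_sq_nonneg)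
  have q: "(?N x)\<^sup>2 \<le> 2 * (?N (net_diff x y))\<^sup>2 + 2 * (?N y)\<^sup>2" if "x \<in> Hs_net s G l" "y \<in> Hs_net s G l" for x y
    unfolding sq sum_distrib_left sum.distrib[symmetric] net_diff_def Hs_int_sq_def
    by (rule sum_mono) (use that Hks_diff[OF l] in \<open>auto simp: Hs_net_def Hs_int_def\<close>)
  have "\<exists>B. \<forall>t\<in>{0..T} \<inter> {0..T}. ?N (w t) \<le> B"
  proof (rule Bolzano[OF T, of "\<lambda>a b. \<exists>B. \<forall>t\<in>{a..b} \<inter> {0..T}. ?N (w t) \<le> B"])
    fix a b c assume "\<exists>B. \<forall>t\<in>{a..b} \<inter> {0..T}. ?N (w t) \<le> B" "\<exists>B. \<forall>t\<in>{b..c} \<inter> {0..T}. ?N (w t) \<le> B"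
    then obtain B1 B2 where "\<forall>t\<in>{a..b} \<inter> {0..T}. ?N (w t) \<le> B1" "\<forall>t\<in>{b..c} \<inter> {0..T}. ?N (w t) \<le> B2" by blast
    then show "\<exists>B. \<forall>t\<in>{a..c} \<inter> {0..T}. ?N (w t) \<le> B"
      by (intro exI[of _ "max B1 B2"] ballI) (metis IntD1 IntD2 IntI atLeastAtMost_iff le_max_iff_disj linear)
  next
    fix t assume t: "0 \<le> t" "t \<le> T"
    then have "((\<lambda>s. ?N (net_diff (w s) (w t))) \<longlongrightarrow> 0) (at t within {0..T})" and wt: "w t \<in> Hs_net s G l"
      using w by (auto simp: C0_time_def)
    from tendstoD[OF this(1), of 1] obtain d where d: "0 < d"
      "\<forall>s\<in>{0..T}. s \<noteq> t \<and> dist s t < d \<longrightarrow> dist (?N (net_diff (w s) (w t))) 0 < 1"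
      unfolding eventually_at by auto
    have "?N (w x) \<le> 2 + 2 * ?N (w t)" if x: "x \<in> {0..T}" "dist x t < d" for x
    proof (cases "x = t")
      case True
      then show ?thesis using N0[of "w t"] by simp
    next
      case False
      have "(?N (net_diff (w x) (w t)))\<^sup>2 \<le> 1"
        using bspec[OF d(2) x(1)] False x(2) N0 by (intro power_le_one) auto
      moreover have "w x \<in> Hs_net s G l" using w x by (auto simp: C0_time_def)
      ultimately have "(?N (w x))\<^sup>2 \<le> 2 + 2 * (?N (w t))\<^sup>2" using q[of "w x" "w t"] wt by linarith
      also have "\<dots> \<le> (2 + 2 * ?N (w t))\<^sup>2" using N0[of "w t"] by (simp add: power2_sum power_mult_distrib)
      finally show ?thesis by (rule power2_le_imp_le) (use N0[of "w t"] in simp)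
    qed
    then show "\<exists>d>0. \<forall>a b. a \<le> t \<and> t \<le> b \<and> b - a < d \<longrightarrow> (\<exists>B. \<forall>t\<in>{a..b} \<inter> {0..T}. ?N (w t) \<le> B)"
      using d(1) by (intro exI[of _ d] conjI allI impI exI[of _ "2 + 2 * ?N (w t)"] ballI) (auto simp: dist_real_def)
  qed
  then obtain B where "\<forall>t\<in>{0..T} \<inter> {0..T}. ?N (w t) \<le> B" by blast
  then show ?thesis by (intro that[of B]) auto
qed

lemma Hs_imp_L2: "w \<in> Hs_int m r \<Longrightarrow> w \<in> L2_int r"
  unfolding Hs_int_def by (rule Hks_L2)

lemma Hs_int_sq_ge: "(LINT x|lebesgue_on {0..r}. (w x)\<^sup>2) \<le> Hs_int_sq m r w"
  unfolding Hs_int_sq_def by (rule Hks_sq_ge)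

lemma Hs_int_Suc:
  assumes m: "0 \<le> m"
  shows "w \<in> Hs_int (m + 1) r \<Longrightarrow> w \<in> Hs_int 1 r"
    "(LINT x|lebesgue_on {0..r}. (w x)\<^sup>2) + (LINT x|lebesgue_on {0..r}. (weak_deriv r w x)\<^sup>2) \<le> Hs_int_sq (m + 1) r w"
proof -
  have "1 \<le> \<lfloor>m + 1\<rfloor>" using m by (simp add: le_floor_iff)
  then obtain k where k: "nat \<lfloor>m + 1\<rfloor> = Suc k" by (metis Suc_le_D One_nat_def nat_mono nat_one_as_int)
  show "w \<in> Hs_int 1 r" if "w \<in> Hs_int (m + 1) r"
  proof -
    have "w \<in> Hks (Suc k) (frac (m + 1)) r" using that unfolding Hs_int_def k .
    then show ?thesis by (auto simp: Hs_int_1)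
  qed
  show "(LINT x|lebesgue_on {0..r}. (w x)\<^sup>2) + (LINT x|lebesgue_on {0..r}. (weak_deriv r w x)\<^sup>2) \<le> Hs_int_sq (m + 1) r w"
    unfolding Hs_int_sq_def k using Hks_sq_ge by simp
qed

text \<open>Three regimes of the order: stability of averaging at 0, the Gagliardo seminorm strictly
  between 0 and 1, and the weak derivative at 1.\<close>

lemma (in edge_mesh) Hs_pmean_error:
  assumes m: "0 \<le> m" "m \<le> 1" and p: "p \<in> Hs_int m r"
  shows "(LINT x|lebesgue_on {0..r}. (p x - pmean p x)\<^sup>2) \<le> (h powr m)\<^sup>2 * Hs_int_sq m r p"
proof -
  have pL: "p \<in> L2_int r" by (rule Hs_imp_L2[OF p])
  have ge: "(LINT x|lebesgue_on {0..r}. (p x)\<^sup>2) \<le> Hs_int_sq m r p" by (rule Hs_int_sq_ge)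
  consider "m = 0" | "0 < m" "m < 1" | "m = 1" using m by linarith
  then show ?thesis
  proof cases
    case 1
    then show ?thesis using pmean_error_le[OF pL] ge h_pos by simp
  next
    case 2
    then have f: "\<lfloor>m\<rfloor> = 0" "frac m = m" by (simp_all add: floor_eq_iff frac_eq)
    then have "slob_integrable m r p" and "slob_sq m r p \<le> Hs_int_sq m r p"
      using p 2 by (auto simp: Hs_int_def Hs_int_sq_def)
    from slob_pmean_error[OF 2(1) pL this(1)] mult_left_mono[OF this(2), of "(h powr m)\<^sup>2"]
    show ?thesis by simp
  next
    case 3
    then have p1: "p \<in> Hs_int 1 r" using p by simp
    have "(LINT x|lebesgue_on {0..r}. (weak_deriv r p x)\<^sup>2) \<le> Hs_int_sq m r p"
      using 3 by (simp add: Hs_int_sq_def)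
    from order_trans[OF H1_pmean_error[OF p1] mult_left_mono[OF this]]
    have "(LINT x|lebesgue_on {0..r}. (p x - pmean p x)\<^sup>2) \<le> h\<^sup>2 * Hs_int_sq m r p" by simp
    then show ?thesis using 3 h_pos by simp
  qed
qed

section \<open>Time-dependent functions\<close>

text \<open>Testing an approximating sequence of simple functions with \<open>\<psi>\<close> turns the Bochner integral
  into a Lebesgue integral.\<close>

lemma has_time_integral_ip:
  assumes f: "has_time_integral T X (L2_norm G l) f I" and X: "X \<subseteq> L2_net G l" and \<psi>: "\<psi> \<in> L2_net G l"
    and meas: "(\<lambda>t. ip_net G l (f t) \<psi>) \<in> borel_measurable (lebesgue_on {0..T})"
  shows "(LINT t|lebesgue_on {0..T}. ip_net G l (f t) \<psi>) = ip_net G l I \<psi>"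
proof -
  let ?M = "lebesgue_on {0..T}" and ?N = "L2_norm G l" and ?ip = "ip_net G l"
  from f obtain n A w where I: "I \<in> X" and fX: "\<And>t. t \<in> {0..T} \<Longrightarrow> f t \<in> X"
    and Aw: "\<And>k i. i < n k \<Longrightarrow> A k i \<in> sets lebesgue \<and> A k i \<subseteq> {0..T} \<and> w k i \<in> X"
    and dm: "\<And>k. (\<lambda>t. ?N (net_diff (f t) (simple_time (n k) (A k) (w k) t))) \<in> borel_measurable ?M"
    and lim: "(\<lambda>k. \<integral>\<^sup>+t. ennreal (?N (net_diff (f t) (simple_time (n k) (A k) (w k) t))) \<partial>?M) \<longlonglongrightarrow> 0"
    and limI: "(\<lambda>k. ?N (net_diff (simple_time_integral (n k) (A k) (w k)) I)) \<longlonglongrightarrow> 0"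
    unfolding has_time_integral_def by blast
  define s where "s k = simple_time (n k) (A k) (w k)" for k
  define S where "S k = simple_time_integral (n k) (A k) (w k)" for k
  define d where "d k t = ?N (f t - s k t)" for k t
  have sum_mem: "(\<lambda>e x. \<Sum>i<n k. c i * w k i e x) \<in> L2_net G l"
    and sum_ip: "?ip (\<lambda>e x. \<Sum>i<n k. c i * w k i e x) \<psi> = (\<Sum>i<n k. c i * ?ip (w k i) \<psi>)" for k and c :: "nat \<Rightarrow> real"
  proof -
    have wL: "w k i \<in> L2_net G l" if "i < n k" for i using Aw[OF that] X by auto
    have eq: "(\<lambda>e x. \<Sum>i<n k. c i * w k i e x) = (\<Sum>i<n k. c i *\<^sub>R w k i)"
    proof (intro ext)
      fix e x
      have "(\<Sum>i<j. c i *\<^sub>R w k i) e x = (\<Sum>i<j. c i * w k i e x)" for j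
        by (induction j) (simp_all add: zero_fun_def)
      then show "(\<Sum>i<n k. c i * w k i e x) = (\<Sum>i<n k. c i *\<^sub>R w k i) e x" by simp
    qed
    have "(\<Sum>i<j. c i *\<^sub>R w k i) \<in> L2_net G l \<and> ?ip (\<Sum>i<j. c i *\<^sub>R w k i) \<psi> = (\<Sum>i<j. c i * ?ip (w k i) \<psi>)"
      if "j \<le> n k" for j
      using that
    proof (induction j)
      case 0
      have "?ip (0 *\<^sub>R \<psi>) \<psi> = 0" using L2.ip_scale[OF \<psi> \<psi>, of 0] by (simp only: mult_zero_left)
      then show ?case by (simp only: lessThan_0 sum.empty scale_zero_left L2.closed(4) simp_thms)
    next
      case (Suc j)
      then have wj: "w k j \<in> L2_net G l" by (intro wL) simp
      have IH: "(\<Sum>i<j. c i *\<^sub>R w k i) \<in> L2_net G l"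
        "?ip (\<Sum>i<j. c i *\<^sub>R w k i) \<psi> = (\<Sum>i<j. c i * ?ip (w k i) \<psi>)"
        using Suc.IH[OF Suc_leD[OF Suc.prems]] by blast+
      show ?case unfolding sum.lessThan_Suc L2.ip_add[OF IH(1) L2.closed(3)[OF wj] \<psi>] IH(2) L2.ip_scale[OF wj \<psi>]
        using L2.closed(1)[OF IH(1) L2.closed(3)[OF wj]] by blast
    qed
    from this[of "n k"] show "(\<lambda>e x. \<Sum>i<n k. c i * w k i e x) \<in> L2_net G l"
      "?ip (\<lambda>e x. \<Sum>i<n k. c i * w k i e x) \<psi> = (\<Sum>i<n k. c i * ?ip (w k i) \<psi>)"
      unfolding eq by auto
  qed
  have sL: "s k t \<in> L2_net G l" and SL: "S k \<in> L2_net G l" for k t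
    unfolding s_def S_def simple_time_def simple_time_integral_def by (rule sum_mem)+
  have fL: "f t \<in> L2_net G l" if "t \<in> {0..T}" for t using fX[OF that] X by auto
  have IL: "I \<in> L2_net G l" using I X by auto
  have ips: "?ip (s k t) \<psi> = (\<Sum>i<n k. indicat_real (A k i) t * ?ip (w k i) \<psi>)" for k t
    unfolding s_def simple_time_def by (rule sum_ip)
  have Aset: "A k i \<in> sets ?M" "emeasure ?M (A k i) < \<infinity>" "measure ?M (A k i) = measure lebesgue (A k i)" if "i < n k" for k i
  proof -
    have A: "A k i \<in> sets lebesgue" "A k i \<subseteq> {0..T}" using Aw[OF that] by auto
    then show "A k i \<in> sets ?M" by (auto simp: sets_restrict_space_iff)
    have "finite_measure ?M" by (rule finite_measure_lebesgue_on) simp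
    from finite_measure.emeasure_finite[OF this, of "A k i"]
    show "emeasure ?M (A k i) < \<infinity>" by (simp add: top.not_eq_extremum)
    show "measure ?M (A k i) = measure lebesgue (A k i)"
      by (rule measure_restrict_space) (use A in auto)
  qed
  have si: "integrable ?M (\<lambda>t. ?ip (s k t) \<psi>)" for k
    unfolding ips using Aset by (intro Bochner_Integration.integrable_sum integrable_mult_left integrable_real_indicator) auto
  have sI: "(LINT t|?M. ?ip (s k t) \<psi>) = ?ip (S k) \<psi>" for k
  proof -
    have "(LINT t|?M. ?ip (s k t) \<psi>) = (\<Sum>i<n k. (LINT t|?M. indicat_real (A k i) t * ?ip (w k i) \<psi>))"
      unfolding ips using Aset by (intro Bochner_Integration.integral_sum integrable_mult_left integrable_real_indicator) auto
    also have "\<dots> = (\<Sum>i<n k. measure lebesgue (A k i) * ?ip (w k i) \<psi>)"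
    proof (rule sum.cong[OF refl])
      fix i assume i: "i \<in> {..<n k}"
      then have "A k i \<subseteq> space ?M" using Aw by auto
      then have "A k i \<inter> space ?M = A k i" by blast
      then show "(LINT t|?M. indicat_real (A k i) t * ?ip (w k i) \<psi>) = measure lebesgue (A k i) * ?ip (w k i) \<psi>"
        using Aset[of i k] i by simp
    qed
    also have "\<dots> = ?ip (S k) \<psi>"
      unfolding S_def simple_time_integral_def by (rule sum_ip[symmetric])
    finally show ?thesis .
  qed
  have dm': "d k \<in> borel_measurable ?M" for k using dm[of k] unfolding d_def s_def net_diff_eq .
  have lim': "(\<lambda>k. \<integral>\<^sup>+t. ennreal (d k t) \<partial>?M) \<longlonglongrightarrow> 0" using lim unfolding d_def s_def net_diff_eq .
  have d0: "0 \<le> d k t" for k t by (simp add: d_def)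
  have bd: "\<bar>?ip (f t) \<psi> - ?ip (s k t) \<psi>\<bar> \<le> d k t * ?N \<psi>" if "t \<in> {0..T}" for k t
    using L2.Cauchy_Schwarz[of "f t - s k t" G l \<psi>] fL[OF that] sL \<psi>
    by (simp add: L2.bilinear L2.closed d_def)
  \<comment> \<open>Once the distance to an approximant is finite, integrability of the pairing with
    \<open>f\<close> follows from that of the simple function, so it is obtained together with the
    estimate.\<close>
  have ev: "\<forall>\<^sub>F k in sequentially. integrable ?M (d k) \<and> integrable ?M (\<lambda>t. ?ip (f t) \<psi>)
      \<and> \<bar>(LINT t|?M. ?ip (f t) \<psi>) - ?ip (S k) \<psi>\<bar> \<le> enn2real (\<integral>\<^sup>+t. ennreal (d k t) \<partial>?M) * ?N \<psi>"
  proof -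
    have "\<forall>\<^sub>F k in sequentially. (\<integral>\<^sup>+t. ennreal (d k t) \<partial>?M) < 1"
      by (rule order_tendstoD(2)[OF lim']) simp
    then show ?thesis
    proof eventually_elim
      case (elim k)
      have di: "integrable ?M (d k)"
      proof (rule integrableI_nonneg[OF dm'])
        show "AE x in ?M. 0 \<le> d k x" by (simp add: d0)
        show "(\<integral>\<^sup>+t. ennreal (d k t) \<partial>?M) < \<infinity>" using elim by (rule order_less_trans) simp
      qed
      have bd_int: "integrable ?M (\<lambda>t. d k t * ?N \<psi>)" by (rule integrable_mult_left) (rule di)
      have diff_i: "integrable ?M (\<lambda>t. ?ip (f t) \<psi> - ?ip (s k t) \<psi>)"
      proof (rule Bochner_Integration.integrable_bound[OF bd_int])
        show "(\<lambda>t. ?ip (f t) \<psi> - ?ip (s k t) \<psi>) \<in> borel_measurable ?M" 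
          by (intro borel_measurable_diff meas borel_measurable_integrable[OF si])
        show "AE t in ?M. norm (?ip (f t) \<psi> - ?ip (s k t) \<psi>) \<le> norm (d k t * ?N \<psi>)"
        proof (rule AE_I2)
          fix t assume "t \<in> space ?M"
          then have "t \<in> {0..T}" by simp
          from order_trans[OF bd[OF this] abs_ge_self]
          show "norm (?ip (f t) \<psi> - ?ip (s k t) \<psi>) \<le> norm (d k t * ?N \<psi>)" unfolding real_norm_def .
        qed
      qed
      have fi: "integrable ?M (\<lambda>t. ?ip (f t) \<psi>)"
        using Bochner_Integration.integrable_add[OF diff_i si[of k]] unfolding diff_add_cancel .
      have "\<bar>(LINT t|?M. ?ip (f t) \<psi>) - ?ip (S k) \<psi>\<bar> = \<bar>LINT t|?M. ?ip (f t) \<psi> - ?ip (s k t) \<psi>\<bar>"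
        unfolding Bochner_Integration.integral_diff[OF fi si[of k]] sI ..
      also have "\<dots> \<le> (LINT t|?M. \<bar>?ip (f t) \<psi> - ?ip (s k t) \<psi>\<bar>)" by (rule integral_abs_bound)
      also have "\<dots> \<le> (LINT t|?M. d k t * ?N \<psi>)"
      proof (rule integral_mono[OF integrable_abs[OF diff_i] bd_int])
        fix t assume "t \<in> space ?M"
        then have "t \<in> {0..T}" by simp
        then show "\<bar>?ip (f t) \<psi> - ?ip (s k t) \<psi>\<bar> \<le> d k t * ?N \<psi>" by (rule bd)
      qed
      also have "\<dots> = (LINT t|?M. d k t) * ?N \<psi>" by (rule integral_mult_left_zero)
      also have "(LINT t|?M. d k t) = enn2real (\<integral>\<^sup>+t. ennreal (d k t) \<partial>?M)"
        by (rule integral_eq_nn_integral) (use dm' d0 in auto)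
      finally show ?case using di fi by blast
    qed
  qed
  have "(\<lambda>k. enn2real (\<integral>\<^sup>+t. ennreal (d k t) \<partial>?M)) \<longlonglongrightarrow> 0"
    by (rule tendsto_enn2real) (use lim' in simp_all)
  then have "(\<lambda>k. enn2real (\<integral>\<^sup>+t. ennreal (d k t) \<partial>?M) * ?N \<psi>) \<longlonglongrightarrow> 0"
    by (rule tendsto_mult_left_zero)
  moreover have "\<forall>\<^sub>F k in sequentially. norm ((LINT t|?M. ?ip (f t) \<psi>) - ?ip (S k) \<psi>)
      \<le> enn2real (\<integral>\<^sup>+t. ennreal (d k t) \<partial>?M) * ?N \<psi>"
    using ev unfolding real_norm_def by (rule eventually_mono) blast
  ultimately have "(\<lambda>k. (LINT t|?M. ?ip (f t) \<psi>) - ?ip (S k) \<psi>) \<longlonglongrightarrow> 0"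
    by (rule Lim_null_comparison[rotated])
  from tendsto_diff[OF tendsto_const this, of "LINT t|?M. ?ip (f t) \<psi>"]
  have "(\<lambda>k. ?ip (S k) \<psi>) \<longlonglongrightarrow> (LINT t|?M. ?ip (f t) \<psi>)" by simp
  moreover have "(\<lambda>k. ?ip (S k) \<psi>) \<longlonglongrightarrow> ?ip I \<psi>"
  proof (rule LIM_zero_cancel, rule Lim_null_comparison)
    have "norm (?ip (S k) \<psi> - ?ip I \<psi>) \<le> ?N (net_diff (S k) I) * ?N \<psi>" for k
      using L2.Cauchy_Schwarz[of "S k - I" G l \<psi>] SL IL \<psi> by (simp add: L2.bilinear L2.closed net_diff_eq)
    then show "\<forall>\<^sub>F k in sequentially. norm (?ip (S k) \<psi> - ?ip I \<psi>) \<le> ?N (net_diff (S k) I) * ?N \<psi>" by simp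
    show "(\<lambda>k. ?N (net_diff (S k) I) * ?N \<psi>) \<longlonglongrightarrow> 0"
      using tendsto_mult_left_zero[OF limI] unfolding S_def .
  qed
  ultimately show ?thesis by (rule LIMSEQ_unique)
qed

lemma C0_time_ip_continuous:
  assumes y: "C0_time T X (L2_norm G l) y" and X: "X \<subseteq> L2_net G l" and \<psi>: "\<psi> \<in> L2_net G l"
  shows "continuous_on {0..T} (\<lambda>t. ip_net G l (y t) \<psi>)"
  unfolding continuous_on_def
proof (rule ballI, rule LIM_zero_cancel, rule Lim_null_comparison)
  fix t assume t: "t \<in> {0..T}"
  have L: "y s \<in> L2_net G l" if "s \<in> {0..T}" for s using y X that by (auto simp: C0_time_def)
  have "norm (ip_net G l (y s) \<psi> - ip_net G l (y t) \<psi>) \<le> L2_norm G l (net_diff (y s) (y t)) * L2_norm G l \<psi>"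
    if "s \<in> {0..T}" for s
    using L2.Cauchy_Schwarz[of "y s - y t" G l \<psi>] L[OF that] L[OF t] \<psi> by (simp add: L2.bilinear L2.closed net_diff_eq)
  then show "\<forall>\<^sub>F s in at t within {0..T}. norm (ip_net G l (y s) \<psi> - ip_net G l (y t) \<psi>)
      \<le> L2_norm G l (net_diff (y s) (y t)) * L2_norm G l \<psi>"
    by (auto simp: eventually_at_filter)
  have "((\<lambda>s. L2_norm G l (net_diff (y s) (y t))) \<longlongrightarrow> 0) (at t within {0..T})"
    using y t by (auto simp: C0_time_def)
  then show "((\<lambda>s. L2_norm G l (net_diff (y s) (y t)) * L2_norm G l \<psi>) \<longlongrightarrow> 0) (at t within {0..T})"
    by (rule tendsto_mult_left_zero)
qed

text \<open>Pairing with \<psi> produces a continuous scalar function with a weak derivative. It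
  equals a primitive of that derivative almost everywhere, hence everywhere by continuity, and as
  the weak derivative is assumed continuous, the primitive is differentiable in the classical sense,
  one-sidedly at the end points.\<close>

lemma W1q_time_ip_derivative:
  assumes T: "0 < T" and y: "W1q_time q T X (L2_norm G l) y dy" and X: "X \<subseteq> L2_net G l" and \<psi>: "\<psi> \<in> L2_net G l"
    and cont: "continuous_on {0..T} (\<lambda>t. ip_net G l (dy t) \<psi>)" and t: "t \<in> {0..T}"
  shows "((\<lambda>s. ip_net G l (y s) \<psi>) has_real_derivative ip_net G l (dy t) \<psi>) (at t within {0..T})"
proof -
  let ?g = "\<lambda>t. ip_net G l (y t) \<psi>" and ?z = "\<lambda>t. ip_net G l (dy t) \<psi>" and ?M = "lebesgue_on {0..T}"
  have gc: "continuous_on {0..T} ?g"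
    using y by (intro C0_time_ip_continuous[OF _ X \<psi>]) (simp add: W1q_time_def)
  have zL: "?z \<in> L2_int T" by (rule L2_int_continuous[OF cont])
  have wd: "has_weak_deriv T ?g ?z"
    unfolding has_weak_deriv_def
  proof (intro conjI allI impI zL)
    fix \<phi> \<phi>' assume test: "test_function T \<phi> \<phi>'"
    then obtain I where I: "has_time_integral T X (L2_norm G l) (\<lambda>t. net_scale (\<phi>' t) (y t)) I"
      "has_time_integral T X (L2_norm G l) (\<lambda>t. net_scale (\<phi> t) (dy t)) (net_scale (- 1) I)"
      using y unfolding W1q_time_def by blast
    have IL: "I \<in> L2_net G l" using I(1) X by (auto simp: has_time_integral_def)
    have s: "ip_net G l (net_scale c w) \<psi> = c * ip_net G l w \<psi>" for c w
      by (simp add: ip_net_def net_scale_def mult.assoc sum_distrib_left)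
    have c': "continuous_on {0..T} \<phi>'" using test_function_prim[OF test T] by simp
    have c: "continuous_on {0..T} \<phi>"
      using test unfolding test_function_def by (meson DERIV_isCont continuous_at_imp_continuous_on)
    have m1: "(\<lambda>t. \<phi>' t * ?g t) \<in> borel_measurable ?M"
      by (rule continuous_imp_measurable_on_sets_lebesgue[OF continuous_on_mult[OF c' gc]]) simp
    have m2: "(\<lambda>t. \<phi> t * ?z t) \<in> borel_measurable ?M"
      by (rule continuous_imp_measurable_on_sets_lebesgue[OF continuous_on_mult[OF c cont]]) simp
    have "(LINT t|?M. \<phi>' t * ?g t) = ip_net G l I \<psi>"
      using has_time_integral_ip[OF I(1) X \<psi>] m1 unfolding s by simp
    moreover have "(LINT t|?M. \<phi> t * ?z t) = - ip_net G l I \<psi>"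
      using has_time_integral_ip[OF I(2) X \<psi>] m2 unfolding s by simp
    ultimately show "(LINT t|?M. ?g t * \<phi>' t) = - (LINT t|?M. ?z t * \<phi> t)"
      by (simp add: mult.commute)
  qed
  obtain \<alpha> where \<alpha>: "AE t in ?M. ?g t = \<alpha> + prim ?z t"
    using has_weak_deriv_imp_prim[OF T continuous_imp_integrable_real[OF gc] wd] .
  have eq: "?g s = \<alpha> + prim ?z s" if "s \<in> {0..T}" for s
    by (rule AE_const_imp_eq_continuous[OF T gc _ \<alpha> that])
      (intro continuous_on_add continuous_on_const prim_continuous continuous_imp_integrable_real cont)
  have "((\<lambda>s. \<alpha> + prim ?z s) has_real_derivative 0 + ?z t) (at t within {0..T})"
    unfolding prim_def by (intro DERIV_add DERIV_const integral_has_real_derivative[OF cont t])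
  then have "((\<lambda>s. \<alpha> + prim ?z s) has_real_derivative ?z t) (at t within {0..T})" by simp
  then show ?thesis
    by (rule has_field_derivative_transform_within[OF _ zero_less_one t]) (use eq in auto)
qed

lemma lincomb_map:
  fixes f :: "'a::real_vector \<Rightarrow> 'b::real_vector"
  assumes X: "subspace X" and f: "\<And>x y c. \<lbrakk>x \<in> X; y \<in> X\<rbrakk> \<Longrightarrow> f (x + c *\<^sub>R y) = f x + c *\<^sub>R f y"
    and m: "x \<in> X" "y \<in> X" "z \<in> X"
  shows "f (x - y) = f x - f y" "f (c *\<^sub>R x) = c *\<^sub>R f x"
    "f (c *\<^sub>R (x - y) - z) = c *\<^sub>R (f x - f y) - f z"
proof -
  have 0: "0 \<in> X" by (rule subspace_0[OF X])
  have f0: "f 0 = 0" using f[OF 0 0, of 1] by simp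
  have d: "f (x - y) = f x - f y" if "x \<in> X" "y \<in> X" for x y using f[OF that, of "-1"] by simp
  have s: "f (c *\<^sub>R x) = c *\<^sub>R f x" if "x \<in> X" for c x using f[OF 0 that, of c] f0 by simp
  show "f (x - y) = f x - f y" "f (c *\<^sub>R x) = c *\<^sub>R f x" using m by (simp_all add: d s)
  show "f (c *\<^sub>R (x - y) - z) = c *\<^sub>R (f x - f y) - f z"
    using m by (simp add: d s subspace_diff[OF X] subspace_scale[OF X])
qed

lemma W1q_time_mem:
  assumes y: "W1q_time q T X nrm y dy" and t: "t \<in> {0..T}"
  shows "y t \<in> X" "dy t \<in> X"
proof -
  have "C0_time T X nrm y" and "Lq_time q T X nrm dy" using y by (simp_all add: W1q_time_def)
  then obtain I where "has_time_integral T X nrm dy I" by (auto simp: Lq_time_def)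
  then show "dy t \<in> X" using t by (simp add: has_time_integral_def)
  show "y t \<in> X" using \<open>C0_time T X nrm y\<close> t by (simp add: C0_time_def)
qed

context semi_inner
begin

text \<open>Transports derivatives: \<open>g\<close> is typically the norm of the same quotient
  before a bounded map is applied, or in a stronger norm.\<close>

lemma vderiv_comparison:
  assumes g: "(g \<longlongrightarrow> 0) (at t within S)"
    and L: "\<And>s. s \<in> S \<Longrightarrow> y s \<in> L" "dy \<in> L" "t \<in> S"
    and le: "\<And>s. s \<in> S \<Longrightarrow> nrm ((1 / (s - t)) *\<^sub>R (y s - y t) - dy) \<le> K * g s"
  shows "vderiv y dy t S"
  unfolding vderiv_def
proof (rule Lim_null_comparison)
  show "((\<lambda>s. K * g s) \<longlongrightarrow> 0) (at t within S)" by (rule tendsto_mult_right_zero[OF g])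
  have "norm (nrm ((1 / (s - t)) *\<^sub>R (y s - y t) - dy)) \<le> K * g s" if "s \<in> S" for s
    using le[OF that] nrm_nonneg[of "(1 / (s - t)) *\<^sub>R (y s - y t) - dy"] L that by (simp add: closed)
  then show "\<forall>\<^sub>F s in at t within S. norm (nrm ((1 / (s - t)) *\<^sub>R (y s - y t) - dy)) \<le> K * g s"
    by (auto simp: eventually_at_filter)
qed

lemma vderiv_linear:
  assumes y: "vderiv y dy t S" "\<And>s. s \<in> S \<Longrightarrow> y s \<in> L" "dy \<in> L" "t \<in> S"
    and f: "\<And>x y c. \<lbrakk>x \<in> L; y \<in> L\<rbrakk> \<Longrightarrow> f (x + c *\<^sub>R y) = f x + c *\<^sub>R f y"
      "\<And>x. x \<in> L \<Longrightarrow> f x \<in> L" "\<And>x. x \<in> L \<Longrightarrow> nrm (f x) \<le> K * nrm x"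
  shows "vderiv (\<lambda>s. f (y s)) (f dy) t S"
proof (rule vderiv_comparison)
  show "((\<lambda>s. nrm ((1 / (s - t)) *\<^sub>R (y s - y t) - dy)) \<longlongrightarrow> 0) (at t within S)"
    using y(1) by (simp add: vderiv_def)
  show "nrm ((1 / (s - t)) *\<^sub>R (f (y s) - f (y t)) - f dy) \<le> K * nrm ((1 / (s - t)) *\<^sub>R (y s - y t) - dy)"
    if s: "s \<in> S" for s
  proof -
    have "(1 / (s - t)) *\<^sub>R (f (y s) - f (y t)) - f dy = f ((1 / (s - t)) *\<^sub>R (y s - y t) - dy)"
      by (rule lincomb_map(3)[of L f, symmetric]) (use subspace f(1) y s in auto)
    moreover have "(1 / (s - t)) *\<^sub>R (y s - y t) - dy \<in> L" using y s by (intro closed) auto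
    ultimately show ?thesis using f(3) by metis
  qed
qed (use y f in auto)

end

lemma L2_norm_le_Hs_norm: "L2_norm G l z \<le> Hs_norm m G l z"
  unfolding Hs_norm_def L2_norm_def ip_net_def
  by (intro real_sqrt_le_mono sum_mono) (use Hs_int_sq_ge in \<open>simp add: power2_eq_square\<close>)

lemma deriv_norm_le_Hs_norm:
  assumes "0 \<le> m"
  shows "L2_norm G l (net_deriv l z) \<le> Hs_norm (m + 1) G l z"
  unfolding Hs_norm_def L2_norm_def ip_net_def net_deriv_def
proof (intro real_sqrt_le_mono sum_mono)
  fix e
  have "0 \<le> (LINT x|lebesgue_on {0..l e}. (z e x)\<^sup>2)" by simp
  with Hs_int_Suc(2)[OF assms, of "l e" "z e"]
  show "(LINT x|lebesgue_on {0..l e}. weak_deriv (l e) (z e) x * weak_deriv (l e) (z e) x) \<le> Hs_int_sq (m + 1) (l e) (z e)"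
    unfolding power2_eq_square by linarith
qed

lemma Hs_norm_nonneg: "0 \<le> Hs_norm m G l z"
  by (rule order_trans[OF L2_norm_nonneg L2_norm_le_Hs_norm])

lemma Hs_net_Suc: "0 \<le> m \<Longrightarrow> Hs_net (m + 1) G l \<subseteq> Hs_net 1 G l"
  unfolding Hs_net_def using Hs_int_Suc(1) by blast

lemma Hs_net_L2: "Hs_net m G l \<subseteq> L2_net G l"
  unfolding Hs_net_def L2_net_def using Hs_imp_L2 by blast

context network
begin

lemma net_deriv_quotient:
  assumes x: "x \<in> Hs_net 1 G l" and y: "y \<in> Hs_net 1 G l" and z: "z \<in> Hs_net 1 G l"
  shows "L2_norm G l (c *\<^sub>R (net_deriv l x - net_deriv l y) - net_deriv l z) = L2_norm G l (net_deriv l (c *\<^sub>R (x - y) - z))"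
proof (rule L2_norm_cong)
  let ?D = "net_deriv l"
  have 0: "0 \<in> Hs_net 1 G l" by (rule subspace_0[OF subspace_H1_net])
  have xy: "x - y \<in> Hs_net 1 G l" by (rule subspace_diff[OF subspace_H1_net x y])
  have cxy: "c *\<^sub>R (x - y) \<in> Hs_net 1 G l" by (rule subspace_scale[OF subspace_H1_net xy])
  have q: "c *\<^sub>R (x - y) - z \<in> Hs_net 1 G l" by (rule subspace_diff[OF subspace_H1_net cxy z])
  show "c *\<^sub>R (?D x - ?D y) - ?D z \<in> L2_net G l" using H1_net_L2(2) x y z by (intro L2.closed) auto
  show "?D (c *\<^sub>R (x - y) - z) \<in> L2_net G l" by (rule H1_net_L2(2)[OF q])
  \<comment> \<open>\<open>a0\<close> yields that the derivative of the zero function vanishes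
    almost everywhere: it equals twice itself. As \<open>weak_deriv\<close> is a choice, this is not
    true by computation.\<close>
  note a0 = H1_net_lincomb(2)[OF 0 0, of 1] and a1 = H1_net_lincomb(2)[OF x y, of "-1"]
    and a2 = H1_net_lincomb(2)[OF 0 xy, of c] and a3 = H1_net_lincomb(2)[OF cxy z, of "-1"]
  show "net_eq G l (c *\<^sub>R (?D x - ?D y) - ?D z) (?D (c *\<^sub>R (x - y) - z))"
    unfolding net_eq_def
  proof
    fix e assume e: "e \<in> parcs G"
    show "AE t in lebesgue_on {0..l e}. (c *\<^sub>R (?D x - ?D y) - ?D z) e t = ?D (c *\<^sub>R (x - y) - z) e t"
      using a0[unfolded net_eq_def, rule_format, OF e] a1[unfolded net_eq_def, rule_format, OF e]
        a2[unfolded net_eq_def, rule_format, OF e] a3[unfolded net_eq_def, rule_format, OF e]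
    proof eventually_elim
      case (elim t)
      have "?D (x - y) e t = ?D x e t - ?D y e t" using elim(2) by simp
      then show ?case using elim by (simp add: right_diff_distrib)
    qed
  qed
qed

lemma C1_time_H1:
  assumes m: "0 \<le> m" and u: "C1_time T (Hs_net (m + 1) G l) (Hs_norm (m + 1) G l) u du" and t: "t \<in> {0..T}"
  shows "u t \<in> Hs_net 1 G l" "du t \<in> Hs_net 1 G l"
    "L2.vderiv G l u (du t) t {0..T}"
    "L2.vderiv G l (\<lambda>s. net_deriv l (u s)) (net_deriv l (du t)) t {0..T}"
proof -
  have mem: "u s \<in> Hs_net 1 G l" "du s \<in> Hs_net 1 G l" if "s \<in> {0..T}" for s
    using u that Hs_net_Suc[OF m] unfolding C1_time_def C0_time_def by blast+
  then show "u t \<in> Hs_net 1 G l" "du t \<in> Hs_net 1 G l" using t by auto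
  let ?g = "\<lambda>s. Hs_norm (m + 1) G l ((1 / (s - t)) *\<^sub>R (u s - u t) - du t)"
  have g: "(?g \<longlongrightarrow> 0) (at t within {0..T})"
    using u t unfolding C1_time_def net_diff_eq net_scale_eq by blast
  show "L2.vderiv G l u (du t) t {0..T}"
  proof (rule L2.vderiv_comparison[OF g])
    show "L2_norm G l ((1 / (s - t)) *\<^sub>R (u s - u t) - du t) \<le> 1 * ?g s" for s
      using L2_norm_le_Hs_norm by simp
  qed (use mem t H1_net_L2 in auto)
  show "L2.vderiv G l (\<lambda>s. net_deriv l (u s)) (net_deriv l (du t)) t {0..T}"
  proof (rule L2.vderiv_comparison[OF g])
    show "L2_norm G l ((1 / (s - t)) *\<^sub>R (net_deriv l (u s) - net_deriv l (u t)) - net_deriv l (du t)) \<le> 1 * ?g s"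
      if "s \<in> {0..T}" for s
      unfolding net_deriv_quotient[OF mem(1)[OF that] mem(1)[OF t] mem(2)[OF t]]
      using deriv_norm_le_Hs_norm[OF m] by simp
  qed (use mem t H1_net_L2 in auto)
qed

lemma C1_time_L2:
  assumes p: "C1_time T (Hs_net m G l) (Hs_norm m G l) p dp" and t: "t \<in> {0..T}"
  shows "p t \<in> L2_net G l" "dp t \<in> L2_net G l" "L2.vderiv G l p (dp t) t {0..T}"
proof -
  have mem: "p s \<in> L2_net G l" "dp s \<in> L2_net G l" if "s \<in> {0..T}" for s
    using p that Hs_net_L2 unfolding C1_time_def C0_time_def by blast+
  then show "p t \<in> L2_net G l" "dp t \<in> L2_net G l" using t by auto
  let ?g = "\<lambda>s. Hs_norm m G l ((1 / (s - t)) *\<^sub>R (p s - p t) - dp t)"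
  have g: "(?g \<longlongrightarrow> 0) (at t within {0..T})"
    using p t unfolding C1_time_def net_diff_eq net_scale_eq by blast
  show "L2.vderiv G l p (dp t) t {0..T}"
  proof (rule L2.vderiv_comparison[OF g])
    show "L2_norm G l ((1 / (s - t)) *\<^sub>R (p s - p t) - dp t) \<le> 1 * ?g s" for s
      using L2_norm_le_Hs_norm by simp
  qed (use mem t in auto)
qed

end

section \<open>Regularity in time of the interpolants and of the semi-discrete solution\<close>

context meshed_network
begin

lemma I1_norm_le:
  assumes u: "u \<in> Hs_net 1 G l"
  shows "L2_norm G l (I1 u) \<le> L2_norm G l u + (\<Sum>e\<in>parcs G. l e) * L2_norm G l (net_deriv l u)"
proof -
  have le: "edge_mesh_size l N e \<le> (\<Sum>e\<in>parcs G. l e)" if "e \<in> parcs G" for e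
  proof -
    have "l e \<le> (\<Sum>e\<in>parcs G. l e)"
      by (rule member_le_sum[OF that]) (use finite_arcs length_pos in \<open>simp_all add: order_less_imp_le\<close>)
    with edge_mesh_size_le_length[OF that] show ?thesis by linarith
  qed
  have uL: "u \<in> L2_net G l" "I1 u \<in> L2_net G l" using H1_net_L2(1)[OF u] H1_net_L2(1)[OF I1_H1] by auto
  have "L2_norm G l (u - (u - I1 u)) \<le> L2_norm G l u + L2_norm G l (u - I1 u)"
    using uL by (intro L2.nrm_diff L2.closed)
  with I1_error[OF u total_length_nonneg le] show ?thesis by simp
qed

text \<open>The estimate \<open>I1_norm_le\<close> involves the derivative, so the difference
  quotients must converge in a norm of order at least one, as the smoothness assumption
  provides.\<close>

lemma I1_vderiv:
  assumes m: "0 \<le> m" and u: "C1_time T (Hs_net (m + 1) G l) (Hs_norm (m + 1) G l) u du" and t: "t \<in> {0..T}"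
  shows "L2.vderiv G l (\<lambda>s. I1 (u s)) (I1 (du t)) t {0..T}"
proof -
  have mem: "u s \<in> Hs_net 1 G l" "du s \<in> Hs_net 1 G l" if "s \<in> {0..T}" for s
    using C1_time_H1[OF m u that] by auto
  let ?g = "\<lambda>s. Hs_norm (m + 1) G l ((1 / (s - t)) *\<^sub>R (u s - u t) - du t)"
  have g: "(?g \<longlongrightarrow> 0) (at t within {0..T})"
    using u t unfolding C1_time_def net_diff_eq net_scale_eq by blast
  show ?thesis
  proof (rule L2.vderiv_comparison[OF g])
    fix s assume s: "s \<in> {0..T}"
    let ?q = "(1 / (s - t)) *\<^sub>R (u s - u t) - du t"
    have q: "?q \<in> Hs_net 1 G l"
      using mem s t by (intro subspace_diff[OF subspace_H1_net] subspace_scale[OF subspace_H1_net]) auto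
    have "(1 / (s - t)) *\<^sub>R (I1 (u s) - I1 (u t)) - I1 (du t) = I1 ?q"
      using lincomb_map(3)[of "Hs_net 1 G l" I1, OF subspace_H1_net I1_lincomb] mem s t by metis
    moreover have "L2_norm G l (I1 ?q) \<le> L2_norm G l ?q + (\<Sum>e\<in>parcs G. l e) * L2_norm G l (net_deriv l ?q)"
      by (rule I1_norm_le[OF q])
    moreover have "(\<Sum>e\<in>parcs G. l e) * L2_norm G l (net_deriv l ?q) \<le> (\<Sum>e\<in>parcs G. l e) * ?g s"
      by (intro mult_left_mono deriv_norm_le_Hs_norm m total_length_nonneg)
    moreover have "L2_norm G l ?q \<le> ?g s" by (rule L2_norm_le_Hs_norm)
    ultimately show "L2_norm G l ((1 / (s - t)) *\<^sub>R (I1 (u s) - I1 (u t)) - I1 (du t)) \<le> (1 + (\<Sum>e\<in>parcs G. l e)) * ?g s"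
      by (simp add: distrib_right)
  qed (use H1_net_L2(1)[OF I1_H1] t in auto)
qed

text \<open>The equations express the tested time derivatives through \<open>f\<close>,
  \<open>g\<close>, \<open>uh\<close> and \<open>ph\<close>, which are continuous in time, so the
  tested functions are classically differentiable. By the inverse estimate the modulus of continuity
  is uniform over test functions of unit norm. With the coercive multiplications by \<open>c\<close>
  and \<open>b\<close>, \<open>strong_derivative\<close> then applies.\<close>

lemma semidiscrete_vderiv:
  assumes C: "0 < C0" "0 < C1" and a: "bounded_coeff G l C0 C1 a" and b: "bounded_coeff G l C0 C1 b"
    and c: "bounded_coeff G l C0 C1 c" and T: "0 < T"
    and f: "C0_time T (L2_net G l) (L2_norm G l) f" and g: "C0_time T (L2_net G l) (L2_norm G l) g"
    and sol: "semidiscrete_solution G l N a b c T f g u0 p0 uh duh ph dph" and t: "t \<in> {0..T}"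
  shows "uh t \<in> Vh G l N" "duh t \<in> Vh G l N" "ph t \<in> Qh G l N" "dph t \<in> Qh G l N"
    "L2.vderiv G l uh (duh t) t {0..T}" "L2.vderiv G l ph (dph t) t {0..T}"
proof -
  let ?ip = "ip_net G l" and ?N = "L2_norm G l" and ?V = "Vh G l N" and ?Q = "Qh G l N" and ?D = "net_deriv l"
  have W: "W1q_time 2 T ?V ?N uh duh" "W1q_time 2 T ?Q ?N ph dph"
    and e1: "\<And>t v. \<lbrakk>t \<in> {0..T}; v \<in> ?V\<rbrakk> \<Longrightarrow> ?ip (net_mult c (duh t)) v - ?ip (ph t) (?D v) + ?ip (net_mult a (uh t)) v = ?ip (f t) v"
    and e2: "\<And>t q. \<lbrakk>t \<in> {0..T}; q \<in> ?Q\<rbrakk> \<Longrightarrow> ?ip (net_mult b (dph t)) q + ?ip (?D (uh t)) q = ?ip (g t) q"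
    using sol unfolding semidiscrete_solution_def by blast+
  have C0u: "C0_time T ?V ?N uh" and C0p: "C0_time T ?Q ?N ph" using W by (auto simp: W1q_time_def)
  have mem: "uh s \<in> ?V" "duh s \<in> ?V" "ph s \<in> ?Q" "dph s \<in> ?Q" if "s \<in> {0..T}" for s
    using W1q_time_mem[OF W(1) that] W1q_time_mem[OF W(2) that] by auto
  then show "uh t \<in> ?V" "duh t \<in> ?V" "ph t \<in> ?Q" "dph t \<in> ?Q" using t by auto
  have VL: "?V \<subseteq> L2_net G l" and QL: "?Q \<subseteq> L2_net G l" using Vh_L2 Qh_L2 by auto
  have fL: "f s \<in> L2_net G l" "g s \<in> L2_net G l" if "s \<in> {0..T}" for s using f g that by (auto simp: C0_time_def)
  obtain K where K: "0 \<le> K" "\<And>v. v \<in> ?V \<Longrightarrow> ?N (?D v) \<le> K * ?N v" using inverse_ineq by blast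
  note multL = L2_net_mult[OF _ C(1)]
  have Dd: "?N (?D x - ?D y) \<le> K * ?N (x - y)" if "x \<in> ?V" "y \<in> ?V" for x y
  proof -
    have "net_eq G l (?D (x + (-1) *\<^sub>R y)) (?D x + (-1) *\<^sub>R ?D y)"
      by (rule H1_net_lincomb(2)[OF Vh_H1[OF that(1)] Vh_H1[OF that(2)]])
    then have "?N (?D (x + (-1) *\<^sub>R y)) = ?N (?D x + (-1) *\<^sub>R ?D y)"
      using that by (intro L2_norm_cong H1_net_L2(2) H1_net_lincomb(1) Vh_H1 L2.closed)
    moreover have "x + (-1) *\<^sub>R y = x - y" "?D x + (-1) *\<^sub>R ?D y = ?D x - ?D y" by simp_all
    ultimately show ?thesis using K(2)[OF subspace_diff[OF subspace_Vh that]] by metis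
  qed
  have lim: "((\<lambda>s. ?N (x s - x t)) \<longlongrightarrow> 0) (at t within {0..T})" if "C0_time T X ?N x" for X and x :: "real \<Rightarrow> 'v netfun"
    using that t unfolding C0_time_def net_diff_eq by blast
  have CS: "\<bar>?ip x z - ?ip y z\<bar> \<le> ?N (x - y) * ?N z" if "x \<in> L2_net G l" "y \<in> L2_net G l" "z \<in> L2_net G l" for x y z
    using L2.Cauchy_Schwarz[OF L2.closed(2)[OF that(1,2)] that(3)] unfolding L2.ip_diff[OF that] .
  have cont_f: "continuous_on {0..T} (\<lambda>t. ?ip (x t) v)" if "C0_time T X ?N x" "X \<subseteq> L2_net G l" "v \<in> L2_net G l"
    for X v and x :: "real \<Rightarrow> 'v netfun"
    by (rule C0_time_ip_continuous[OF that])
  show "L2.vderiv G l uh (duh t) t {0..T}"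
  proof (rule L2.strong_derivative[where \<kappa> = "net_mult c" and ?c0.0 = C0])
    show "subspace ?V" by (rule subspace_Vh)
    show "((\<lambda>r. ?ip (net_mult c (uh r)) v) has_real_derivative ?ip (net_mult c (duh s)) v) (at s within {0..T})"
      if s: "s \<in> {0..T}" and v: "v \<in> ?V" for s v
    proof -
      have vL: "v \<in> L2_net G l" "?D v \<in> L2_net G l" using v Vh_L2 H1_net_L2(2)[OF Vh_H1] by auto
      have "continuous_on {0..T} (\<lambda>t. ?ip (f t) v + ?ip (ph t) (?D v) - ?ip (uh t) (net_mult a v))"
        by (intro continuous_on_add continuous_on_diff cont_f[OF f subset_refl] cont_f[OF C0p QL] cont_f[OF C0u VL] vL multL[OF a])
      then have "continuous_on {0..T} (\<lambda>t. ?ip (duh t) (net_mult c v))"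
      proof (rule continuous_on_eq)
        fix s assume "s \<in> {0..T}"
        from e1[OF this v]
        show "?ip (f s) v + ?ip (ph s) (?D v) - ?ip (uh s) (net_mult a v) = ?ip (duh s) (net_mult c v)"
          unfolding ip_net_mult_commute[of G l _ _ v] L2.ip_commute[of G l "net_mult _ v"] by linarith
      qed
      from W1q_time_ip_derivative[OF T W(1) VL multL[OF c vL(1)] this s]
      show ?thesis unfolding ip_net_mult_commute[of G l c _ v] L2.ip_commute[of G l "net_mult c v"] .
    qed
    have "((\<lambda>s. ?N (f s - f t) + K * ?N (v s - v t) + C1 * ?N (w s - w t)) \<longlongrightarrow> 0 + K * 0 + C1 * 0) (at t within {0..T})"
      if "C0_time T X ?N v" "C0_time T Y ?N w" for X Y and v w :: "real \<Rightarrow> 'v netfun"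
      by (intro tendsto_add tendsto_mult_left lim[OF f] lim[OF that(1)] lim[OF that(2)])
    from this[OF C0p C0u] show "((\<lambda>s. ?N (f s - f t) + K * ?N (ph s - ph t) + C1 * ?N (uh s - uh t)) \<longlongrightarrow> 0) (at t within {0..T})"
      by simp
    show "\<bar>?ip (net_mult c (duh s)) v - ?ip (net_mult c (duh t)) v\<bar>
        \<le> (?N (f s - f t) + K * ?N (ph s - ph t) + C1 * ?N (uh s - uh t)) * ?N v"
      if s: "s \<in> {0..T}" and v: "v \<in> ?V" for s v
    proof -
      have vL: "v \<in> L2_net G l" "?D v \<in> L2_net G l" using v Vh_L2 H1_net_L2(2)[OF Vh_H1] by auto
      have uL: "uh s \<in> L2_net G l" "uh t \<in> L2_net G l" "ph s \<in> L2_net G l" "ph t \<in> L2_net G l"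
        using mem s t VL QL by auto
      have "\<bar>?ip (ph s) (?D v) - ?ip (ph t) (?D v)\<bar> \<le> ?N (ph s - ph t) * (K * ?N v)"
        using order_trans[OF CS[OF uL(3,4) vL(2)] mult_left_mono[OF K(2)[OF v]]] by simp
      moreover have "\<bar>?ip (net_mult a (uh s)) v - ?ip (net_mult a (uh t)) v\<bar> \<le> C1 * ?N (uh s - uh t) * ?N v"
      proof -
        have "?N (net_mult a (uh s) - net_mult a (uh t)) \<le> C1 * ?N (uh s - uh t)"
          unfolding net_mult_diff[symmetric] by (rule L2_norm_mult_le[OF a C L2.closed(2)[OF uL(1,2)]])
        from order_trans[OF CS[OF multL[OF a uL(1)] multL[OF a uL(2)] vL(1)] mult_right_mono[OF this]]
        show ?thesis by simp
      qed
      moreover have "\<bar>?ip (f s) v - ?ip (f t) v\<bar> \<le> ?N (f s - f t) * ?N v"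
        using fL s t vL by (intro CS) auto
      ultimately show ?thesis
        using e1[OF s v] e1[OF t v] unfolding distrib_right mult.assoc mult.left_commute[of _ K] by linarith
    qed
  qed (use C VL mem t multL[OF c] net_mult_diff net_mult_scale ip_net_mult_lower[OF c C(1)] in \<open>auto simp: less_imp_le\<close>)
  show "L2.vderiv G l ph (dph t) t {0..T}"
  proof (rule L2.strong_derivative[where \<kappa> = "net_mult b" and ?c0.0 = C0])
    show "subspace ?Q" by (rule subspace_Qh)
    show "((\<lambda>r. ?ip (net_mult b (ph r)) v) has_real_derivative ?ip (net_mult b (dph s)) v) (at s within {0..T})"
      if s: "s \<in> {0..T}" and v: "v \<in> ?Q" for s v
    proof -
      have vL: "v \<in> L2_net G l" using v Qh_L2 by auto
      have cD: "continuous_on {0..T} (\<lambda>t. ?ip (?D (uh t)) v)"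
        unfolding continuous_on_def
      proof (rule ballI, rule LIM_zero_cancel, rule Lim_null_comparison)
        fix t assume t: "t \<in> {0..T}"
        have "((\<lambda>s. ?N (uh s - uh t)) \<longlongrightarrow> 0) (at t within {0..T})"
          using C0u t unfolding C0_time_def net_diff_eq by blast
        from tendsto_mult_left_zero[OF tendsto_mult_right_zero[OF this]]
        show "((\<lambda>s. K * ?N (uh s - uh t) * ?N v) \<longlongrightarrow> 0) (at t within {0..T})" .
        have "norm (?ip (?D (uh s)) v - ?ip (?D (uh t)) v) \<le> K * ?N (uh s - uh t) * ?N v" if "s \<in> {0..T}" for s
          using order_trans[OF CS[OF H1_net_L2(2)[OF Vh_H1[OF mem(1)[OF that]]] H1_net_L2(2)[OF Vh_H1[OF mem(1)[OF t]]] vL]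
              mult_right_mono[OF Dd[OF mem(1)[OF that] mem(1)[OF t]]]] by simp
        then show "\<forall>\<^sub>F s in at t within {0..T}. norm (?ip (?D (uh s)) v - ?ip (?D (uh t)) v) \<le> K * ?N (uh s - uh t) * ?N v"
          by (auto simp: eventually_at_filter)
      qed
      have "continuous_on {0..T} (\<lambda>t. ?ip (g t) v - ?ip (?D (uh t)) v)"
        by (intro continuous_on_diff cont_f[OF g subset_refl] cD vL)
      then have "continuous_on {0..T} (\<lambda>t. ?ip (dph t) (net_mult b v))"
      proof (rule continuous_on_eq)
        fix s assume "s \<in> {0..T}"
        from e2[OF this v]
        show "?ip (g s) v - ?ip (?D (uh s)) v = ?ip (dph s) (net_mult b v)"
          unfolding ip_net_mult_commute[of G l _ _ v] L2.ip_commute[of G l "net_mult _ v"] by linarith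
      qed
      from W1q_time_ip_derivative[OF T W(2) QL multL[OF b vL] this s]
      show ?thesis unfolding ip_net_mult_commute[of G l b _ v] L2.ip_commute[of G l "net_mult b v"] .
    qed
    have "((\<lambda>s. ?N (g s - g t) + K * ?N (uh s - uh t)) \<longlongrightarrow> 0 + K * 0) (at t within {0..T})"
      by (intro tendsto_add tendsto_mult_left lim[OF g] lim[OF C0u])
    then show "((\<lambda>s. ?N (g s - g t) + K * ?N (uh s - uh t)) \<longlongrightarrow> 0) (at t within {0..T})" by simp
    show "\<bar>?ip (net_mult b (dph s)) v - ?ip (net_mult b (dph t)) v\<bar> \<le> (?N (g s - g t) + K * ?N (uh s - uh t)) * ?N v"
      if s: "s \<in> {0..T}" and v: "v \<in> ?Q" for s v
    proof -
      have vL: "v \<in> L2_net G l" using v Qh_L2 by auto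
      have DL: "?D (uh s) \<in> L2_net G l" "?D (uh t) \<in> L2_net G l" using H1_net_L2(2)[OF Vh_H1] mem s t by auto
      have "\<bar>?ip (?D (uh s)) v - ?ip (?D (uh t)) v\<bar> \<le> K * ?N (uh s - uh t) * ?N v"
        using order_trans[OF CS[OF DL vL] mult_right_mono[OF Dd[OF mem(1)[OF s] mem(1)[OF t]]]] by simp
      moreover have "\<bar>?ip (g s) v - ?ip (g t) v\<bar> \<le> ?N (g s - g t) * ?N v"
        using fL s t vL by (intro CS) auto
      ultimately show ?thesis using e2[OF s v] e2[OF t v] unfolding distrib_right by linarith
    qed
  qed (use C QL mem t multL[OF b] net_mult_diff net_mult_scale ip_net_mult_lower[OF b C(1)] in \<open>auto simp: less_imp_le\<close>)
qed

end

section \<open>The error estimate\<close>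

locale wave_error = meshed_network G l N
  for G :: "'v pair_pre_digraph" and l :: "'v \<times> 'v \<Rightarrow> real" and N +
  fixes W :: "'v netfun \<Rightarrow> 'v netfun" and a b c :: "'v netfun" and C0 C1 K T m :: real
    and f g :: "real \<Rightarrow> 'v netfun" and u0 p0 :: "'v netfun" and u du p dp uh duh ph dph :: "real \<Rightarrow> 'v netfun"
  assumes pos: "0 < C0" "0 < C1" "0 < K" and T: "0 < T" and m: "0 \<le> m" "m \<le> 1"
    and a: "bounded_coeff G l C0 C1 a" and b: "bounded_coeff G l C0 C1 b" and c: "bounded_coeff G l C0 C1 c"
    and WV: "g' \<in> L2_net G l \<Longrightarrow> W g' \<in> Vh G l N"
    and W_lin: "\<lbrakk>g' \<in> L2_net G l; k \<in> L2_net G l\<rbrakk> \<Longrightarrow> W (g' + r *\<^sub>R k) = W g' + r *\<^sub>R W k"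
    and W_ip: "\<lbrakk>g' \<in> L2_net G l; q \<in> Qh G l N\<rbrakk> \<Longrightarrow> ip_net G l q (net_deriv l (W g')) = ip_net G l q g'"
    and W_norm: "g' \<in> L2_net G l \<Longrightarrow> L2_norm G l (W g') \<le> K * L2_norm G l g'"
    and W_D: "v \<in> Vh G l N \<Longrightarrow> L2_norm G l (W (net_deriv l v)) \<le> K * L2_norm G l v"
    and W_null: "\<lbrakk>g' \<in> L2_net G l; \<And>q. q \<in> Qh G l N \<Longrightarrow> ip_net G l g' q = 0\<rbrakk> \<Longrightarrow> L2_norm G l (W g') = 0"
    and u0: "u0 \<in> Hdiv_net G l" and p0: "p0 \<in> H10_net G l"
    and f: "C0_time T (L2_net G l) (L2_norm G l) f" and g: "C0_time T (L2_net G l) (L2_norm G l) g"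
    and wave: "wave_solution G l a b c T f g u0 p0 u du p dp"
    and semidiscrete: "semidiscrete_solution G l N a b c T f g u0 p0 uh duh ph dph"
    and uC1: "C1_time T (Hs_net (m + 1) G l) (Hs_norm (m + 1) G l) u du"
    and pC1: "C1_time T (Hs_net m G l) (Hs_norm m G l) p dp"
begin

abbreviation "ip \<equiv> ip_net G l"
abbreviation "nrm \<equiv> L2_norm G l"
abbreviation "D \<equiv> net_deriv l"
abbreviation "V \<equiv> Vh G l N"
abbreviation "Q \<equiv> Qh G l N"
abbreviation "L \<equiv> L2_net G l"

sublocale S: damped_system L ip nrm V Q D W "net_mult a" "net_mult b" "net_mult c" C0 C1 K
proof
  show "V \<subseteq> L" "Q \<subseteq> L" using Vh_L2 Qh_L2 by auto
  show "v \<in> V \<Longrightarrow> D v \<in> Q" for v by (rule Vh_deriv_Qh)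
  show "W (x + r *\<^sub>R y) = W x + r *\<^sub>R W y" if "x \<in> L" "y \<in> L" for x y r by (rule W_lin[OF that])
  show "\<lbrakk>x \<in> L; \<And>q. q \<in> Q \<Longrightarrow> ip x q = 0\<rbrakk> \<Longrightarrow> nrm (W x) = 0" for x by (rule W_null)
qed (use pos in \<open>simp_all add: L2_net_mult[OF a] L2_net_mult[OF b] L2_net_mult[OF c] ip_net_mult_lower[OF a]
    ip_net_mult_lower[OF b] ip_net_mult_lower[OF c] L2_norm_mult_le[OF a] L2_norm_mult_le[OF b] L2_norm_mult_le[OF c]
    WV W_ip W_norm W_D\<close>)

definition eu :: "real \<Rightarrow> 'v netfun" where "eu t = uh t - I1 (u t)"
definition ep :: "real \<Rightarrow> 'v netfun" where "ep t = ph t - P0 (p t)"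
definition deu :: "real \<Rightarrow> 'v netfun" where "deu t = duh t - I1 (du t)"
definition dep :: "real \<Rightarrow> 'v netfun" where "dep t = dph t - P0 (dp t)"

lemmas semi = semidiscrete_vderiv[OF pos(1,2) a b c T f g semidiscrete]
lemmas u_path = C1_time_H1[OF m(1) uC1]
lemmas p_path = C1_time_L2[OF pC1]

lemma P0_L: "P0 q \<in> L" by (rule Qh_L2[OF P0_Qh])
lemma I1_L: "I1 v \<in> L" by (rule H1_net_L2(1)[OF I1_H1])

lemma u_Hdiv: "t \<in> {0..T} \<Longrightarrow> u t \<in> Hdiv_net G l" and p_H10: "t \<in> {0..T} \<Longrightarrow> p t \<in> H10_net G l"
  using wave unfolding wave_solution_def C0_time_def by blast+

lemma e_mem:
  assumes "t \<in> {0..T}"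
  shows "eu t \<in> V" "ep t \<in> Q" "deu t \<in> L" "dep t \<in> L" "eu t \<in> L" "ep t \<in> L"
proof -
  show 1: "eu t \<in> V" unfolding eu_def
    by (rule subspace_diff[OF subspace_Vh semi(1)[OF assms] I1_Vh[OF u_Hdiv[OF assms]]])
  show 2: "ep t \<in> Q" unfolding ep_def
    by (rule subspace_diff[OF subspace_Qh semi(3)[OF assms] P0_Qh])
  show "deu t \<in> L" unfolding deu_def by (rule L2.closed(2)[OF Vh_L2[OF semi(2)[OF assms]] I1_L])
  show "dep t \<in> L" unfolding dep_def by (rule L2.closed(2)[OF Qh_L2[OF semi(4)[OF assms]] P0_L])
  show "eu t \<in> L" "ep t \<in> L" using Vh_L2[OF 1] Qh_L2[OF 2] by auto
qed

lemma e_vderiv: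
  assumes t: "t \<in> {0..T}"
  shows "L2.vderiv G l eu (deu t) t {0..T}" "L2.vderiv G l ep (dep t) t {0..T}"
proof -
  show "L2.vderiv G l eu (deu t) t {0..T}"
    unfolding eu_def[abs_def] deu_def
    by (rule L2.vderiv_diff[OF semi(5)[OF t] _ _ I1_vderiv[OF m(1) uC1 t] _ _ t])
      (use Vh_L2[OF semi(1)] Vh_L2[OF semi(2)[OF t]] I1_L in auto)
  have P: "L2.vderiv G l (\<lambda>s. P0 (p s)) (P0 (dp t)) t {0..T}"
  proof (rule L2.vderiv_linear[OF p_path(3)[OF t] _ _ t])
    show "nrm (P0 x) \<le> 1 * nrm x" if "x \<in> L" for x using P0_norm_le[OF that] by simp
  qed (use p_path(1) p_path(2)[OF t] P0_lincomb P0_L in blast)+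
  show "L2.vderiv G l ep (dep t) t {0..T}"
    unfolding ep_def[abs_def] dep_def
    by (rule L2.vderiv_diff[OF semi(6)[OF t] _ _ P _ _ t])
      (use Qh_L2[OF semi(3)] Qh_L2[OF semi(4)[OF t]] P0_L in auto)
qed

lemma mult_vderiv:
  assumes k: "bounded_coeff G l C0 C1 k" and y: "L2.vderiv G l y dy t {0..T}" "\<And>s. s \<in> {0..T} \<Longrightarrow> y s \<in> L" "dy \<in> L"
    and t: "t \<in> {0..T}"
  shows "L2.vderiv G l (\<lambda>s. net_mult k (y s)) (net_mult k dy) t {0..T}"
proof (rule L2.vderiv_linear[OF y t])
  show "net_mult k (x + r *\<^sub>R z) = net_mult k x + r *\<^sub>R net_mult k z" for x z r
    by (simp only: net_mult_add net_mult_scale)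
qed (use L2_net_mult[OF k pos(1)] L2_norm_mult_le[OF k pos(1,2)] in blast)+

lemma lyap_has_derivative:
  assumes t: "t \<in> {0..T}"
  shows "((\<lambda>s. S.lyap (eu s) (ep s)) has_real_derivative
    (ip (net_mult c (deu t)) (eu t) + ip (net_mult b (dep t)) (ep t)
      - S.\<delta> * (ip (net_mult c (deu t)) (W (net_mult b (ep t))) + ip (net_mult c (eu t)) (W (net_mult b (dep t))))))
    (at t within {0..T})"
proof -
  note M = e_mem[OF t]
  have cL: "\<And>x. x \<in> L \<Longrightarrow> net_mult c x \<in> L" and bL: "\<And>x. x \<in> L \<Longrightarrow> net_mult b x \<in> L"
    using L2_net_mult[OF c pos(1)] L2_net_mult[OF b pos(1)] by auto
  have WL: "\<And>x. x \<in> L \<Longrightarrow> W x \<in> L" using WV Vh_L2 by blast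
  have mc: "L2.vderiv G l (\<lambda>s. net_mult c (eu s)) (net_mult c (deu t)) t {0..T}"
    by (rule mult_vderiv[OF c e_vderiv(1)[OF t] e_mem(5) M(3) t])
  have mb: "L2.vderiv G l (\<lambda>s. net_mult b (ep s)) (net_mult b (dep t)) t {0..T}"
    by (rule mult_vderiv[OF b e_vderiv(2)[OF t] e_mem(6) M(4) t])
  have mw: "L2.vderiv G l (\<lambda>s. W (net_mult b (ep s))) (W (net_mult b (dep t))) t {0..T}"
    by (rule L2.vderiv_linear[OF mb bL[OF e_mem(6)] bL[OF M(4)] t W_lin WL W_norm])
  have "((\<lambda>s. ip (net_mult c (eu s)) (eu s)) has_real_derivative
      ip (net_mult c (deu t)) (eu t) + ip (net_mult c (eu t)) (deu t)) (at t within {0..T})"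
    by (rule L2.ip_has_derivative[OF mc cL[OF e_mem(5)] cL[OF M(3)] e_vderiv(1)[OF t] e_mem(5) M(3) t])
  then have 1: "((\<lambda>s. ip (net_mult c (eu s)) (eu s) / 2) has_real_derivative
      (ip (net_mult c (deu t)) (eu t) + ip (net_mult c (deu t)) (eu t)) / 2) (at t within {0..T})"
    unfolding ip_net_mult_commute[of G l c "eu t" "deu t"] by (rule DERIV_cdivide)
  have "((\<lambda>s. ip (net_mult b (ep s)) (ep s)) has_real_derivative
      ip (net_mult b (dep t)) (ep t) + ip (net_mult b (ep t)) (dep t)) (at t within {0..T})"
    by (rule L2.ip_has_derivative[OF mb bL[OF e_mem(6)] bL[OF M(4)] e_vderiv(2)[OF t] e_mem(6) M(4) t])
  then have 2: "((\<lambda>s. ip (net_mult b (ep s)) (ep s) / 2) has_real_derivative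
      (ip (net_mult b (dep t)) (ep t) + ip (net_mult b (dep t)) (ep t)) / 2) (at t within {0..T})"
    unfolding ip_net_mult_commute[of G l b "ep t" "dep t"] by (rule DERIV_cdivide)
  have 3: "((\<lambda>s. ip (net_mult c (eu s)) (W (net_mult b (ep s)))) has_real_derivative
      ip (net_mult c (deu t)) (W (net_mult b (ep t))) + ip (net_mult c (eu t)) (W (net_mult b (dep t)))) (at t within {0..T})"
    by (rule L2.ip_has_derivative[OF mc cL[OF e_mem(5)] cL[OF M(3)] mw WL[OF bL[OF e_mem(6)]] WL[OF bL[OF M(4)]] t])
  show ?thesis
    using DERIV_diff[OF DERIV_add[OF 1 2] DERIV_cmult[OF 3, of S.\<delta>]] unfolding S.lyap_def by simp
qed

text \<open>The approximation error of \<open>p\<close> itself is absent: \<open>p\<close> enters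
  only tested with derivatives of discrete functions, and there \<open>P0\<close> is exact.\<close>

definition residual :: "real \<Rightarrow> real" where
  "residual t = C1 * (nrm (du t - I1 (du t)) + nrm (u t - I1 (u t)) + nrm (dp t - P0 (dp t)))"

text \<open>The equations for the solution, tested with discrete functions after Green's formula,
  are subtracted from the semi-discrete ones. The contributions of \<open>p t - P0 (p t)\<close> and
  of the derivative of \<open>u t - I1 (u t)\<close> vanish, as they are tested with members of
  \<open>Qh\<close>. What remains are the loads \<open>?R\<close> and \<open>?s\<close>, both of
  size \<open>residual t\<close>.\<close>

lemma lyap_rate:
  assumes t: "t \<in> {0<..T}"
  shows "ip (net_mult c (deu t)) (eu t) + ip (net_mult b (dep t)) (ep t)
      - S.\<delta> * (ip (net_mult c (deu t)) (W (net_mult b (ep t))) + ip (net_mult c (eu t)) (W (net_mult b (dep t))))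
    \<le> - (2 * S.rate) * S.lyap (eu t) (ep t) + S.gain * residual t * sqrt (S.lyap (eu t) (ep t))"
proof -
  have t': "t \<in> {0..T}" using t by auto
  note M = e_mem[OF t'] and U = u_path(1,2)[OF t'] and P = p_path(1,2)[OF t']
  note UL = H1_net_L2[OF U(1)] H1_net_L2[OF U(2)]
  note H = semi(1-4)[OF t']
  note HL = Vh_L2[OF H(1)] Vh_L2[OF H(2)] Qh_L2[OF H(3)] Qh_L2[OF H(4)]
  have mL: "x \<in> L \<Longrightarrow> net_mult a x \<in> L" "x \<in> L \<Longrightarrow> net_mult b x \<in> L" "x \<in> L \<Longrightarrow> net_mult c x \<in> L" for x
    using L2_net_mult[OF a pos(1)] L2_net_mult[OF b pos(1)] L2_net_mult[OF c pos(1)] by auto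
  have pH1: "p t \<in> Hs_net 1 G l" using p_H10[OF t'] by (simp add: H10_net_def)
  have DpL: "D (p t) \<in> L" by (rule H1_net_L2(2)[OF pH1])
  have fgL: "f t \<in> L" "g t \<in> L" using f g t' by (auto simp: C0_time_def)
  let ?s = "net_mult b (dp t - P0 (dp t))"
  let ?R = "\<lambda>v. ip (net_mult c (du t - I1 (du t))) v + ip (net_mult a (u t - I1 (u t))) v"
  have dL: "du t - I1 (du t) \<in> L" "u t - I1 (u t) \<in> L" "dp t - P0 (dp t) \<in> L"
    using UL P I1_L P0_L by (auto intro: L2.closed)
  have weq: "net_eq G l (\<lambda>e x. c e x * du t e x + net_deriv l (p t) e x + a e x * u t e x) (f t)"
    "net_eq G l (\<lambda>e x. b e x * dp t e x + net_deriv l (u t) e x) (g t)"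
    using wave t unfolding wave_solution_def by blast+
  have rw: "(\<lambda>e x. c e x * du t e x + net_deriv l (p t) e x + a e x * u t e x) = net_mult c (du t) + D (p t) + net_mult a (u t)"
    "(\<lambda>e x. b e x * dp t e x + net_deriv l (u t) e x) = net_mult b (dp t) + D (u t)"
    by (simp_all add: fun_eq_iff net_mult_def)
  have semi1: "ip (net_mult c (duh t)) v - ip (ph t) (D v) + ip (net_mult a (uh t)) v = ip (f t) v" if "v \<in> V" for v
    using semidiscrete t' that unfolding semidiscrete_solution_def by blast
  have semi2: "ip (net_mult b (dph t)) q + ip (D (uh t)) q = ip (g t) q" if "q \<in> Q" for q
    using semidiscrete t' that unfolding semidiscrete_solution_def by blast
  show ?thesis
  proof (rule S.lyap_derivative_rate[OF M(1,3,2,4), of ?s _ ?R])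
    show "?s \<in> L" by (rule mL(2)[OF dL(3)])
    have n: "0 \<le> nrm x" for x by simp
    show "nrm ?s \<le> residual t"
    proof -
      have "nrm ?s \<le> C1 * nrm (dp t - P0 (dp t))" by (rule L2_norm_mult_le[OF b pos(1,2) dL(3)])
      also have "\<dots> \<le> residual t" unfolding residual_def using pos n by (intro mult_left_mono) auto
      finally show ?thesis .
    qed
    fix v assume v: "v \<in> V"
    have vL: "v \<in> L" "D v \<in> L" using Vh_L2[OF v] H1_net_L2(2)[OF Vh_H1[OF v]] by auto
    show "\<bar>?R v\<bar> \<le> residual t * nrm v"
    proof -
      have "\<bar>ip (net_mult c (du t - I1 (du t))) v\<bar> \<le> C1 * nrm (du t - I1 (du t)) * nrm v"
        by (rule order_trans[OF L2.Cauchy_Schwarz[OF mL(3)[OF dL(1)] vL(1)]])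
          (intro mult_right_mono L2_norm_mult_le[OF c pos(1,2) dL(1)] n)
      moreover have "\<bar>ip (net_mult a (u t - I1 (u t))) v\<bar> \<le> C1 * nrm (u t - I1 (u t)) * nrm v"
        by (rule order_trans[OF L2.Cauchy_Schwarz[OF mL(1)[OF dL(2)] vL(1)]])
          (intro mult_right_mono L2_norm_mult_le[OF a pos(1,2) dL(2)] n)
      moreover have "0 \<le> C1 * nrm (dp t - P0 (dp t)) * nrm v" using pos n by simp
      ultimately show ?thesis unfolding residual_def distrib_left distrib_right by linarith
    qed
    have "ip (f t) v = ip (net_mult c (du t) + D (p t) + net_mult a (u t)) v"
      by (rule ip_net_cong[symmetric]) (use weq(1) UL mL DpL fgL vL in \<open>auto simp: rw intro!: L2.closed\<close>)
    also have "\<dots> = ip (net_mult c (du t)) v + ip (D (p t)) v + ip (net_mult a (u t)) v"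
      using UL mL DpL vL by (simp add: L2.ip_add L2.closed)
    also have "ip (D (p t)) v = - ip (p t) (D v)" by (rule green[OF p_H10[OF t'] Vh_Hdiv[OF v]])
    finally have fv: "ip (f t) v = ip (net_mult c (du t)) v + - ip (p t) (D v) + ip (net_mult a (u t)) v" .
    have P: "ip (P0 (p t)) (D v) = ip (p t) (D v)" by (rule P0_orth[OF P(1) Vh_deriv_Qh[OF v]])
    have e1: "ip (net_mult c (deu t)) v = ip (net_mult c (duh t)) v - ip (net_mult c (I1 (du t))) v"
      unfolding deu_def net_mult_diff using HL mL I1_L vL by (simp add: L2.ip_diff)
    have e2: "ip (ep t) (D v) = ip (ph t) (D v) - ip (P0 (p t)) (D v)"
      unfolding ep_def using HL P0_L vL by (simp add: L2.ip_diff)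
    have e3: "ip (net_mult a (eu t)) v = ip (net_mult a (uh t)) v - ip (net_mult a (I1 (u t))) v"
      unfolding eu_def net_mult_diff using HL mL I1_L vL by (simp add: L2.ip_diff)
    have e4: "ip (net_mult c (du t - I1 (du t))) v = ip (net_mult c (du t)) v - ip (net_mult c (I1 (du t))) v"
      unfolding net_mult_diff using UL mL I1_L vL by (simp add: L2.ip_diff)
    have e5: "ip (net_mult a (u t - I1 (u t))) v = ip (net_mult a (u t)) v - ip (net_mult a (I1 (u t))) v"
      unfolding net_mult_diff using UL mL I1_L vL by (simp add: L2.ip_diff)
    show "ip (net_mult c (deu t)) v - ip (ep t) (D v) + ip (net_mult a (eu t)) v = ?R v"
      unfolding e1 e2 e3 e4 e5 P using semi1[OF v] fv by linarith
  next
    fix q assume q: "q \<in> Q"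
    have qL: "q \<in> L" by (rule Qh_L2[OF q])
    have "ip (g t) q = ip (net_mult b (dp t) + D (u t)) q"
      by (rule ip_net_cong[symmetric]) (use weq(2) UL P mL fgL qL in \<open>auto simp: rw intro!: L2.closed\<close>)
    also have "\<dots> = ip (net_mult b (dp t)) q + ip (D (u t)) q"
      using UL P mL qL by (simp add: L2.ip_add)
    finally have gq: "ip (g t) q = ip (net_mult b (dp t)) q + ip (D (u t)) q" .
    have "ip (D (I1 (u t))) q = ip (P0 (D (u t))) q"
      by (rule ip_net_cong[OF H1_net_L2(2)[OF I1_H1] P0_L qL I1_deriv])
    also have "\<dots> = ip (D (u t)) q" by (rule P0_orth[OF UL(2) q])
    finally have i: "ip (D (I1 (u t))) q = ip (D (u t)) q" .
    have e1: "ip (D (eu t)) q = ip (D (uh t)) q - ip (D (I1 (u t))) q"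
      using net_deriv_lincomb_ip[OF Vh_H1[OF H(1)] I1_H1[of "u t"] qL, of "-1"] by (simp add: eu_def)
    have e2: "ip (net_mult b (dep t)) q = ip (net_mult b (dph t)) q - ip (net_mult b (P0 (dp t))) q"
      unfolding dep_def net_mult_diff using HL mL P0_L qL by (simp add: L2.ip_diff)
    have e3: "ip ?s q = ip (net_mult b (dp t)) q - ip (net_mult b (P0 (dp t))) q"
      unfolding net_mult_diff using P mL P0_L qL by (simp add: L2.ip_diff)
    show "ip (net_mult b (dep t)) q + ip (D (eu t)) q = ip ?s q"
      unfolding e1 e2 e3 i using semi2[OF q] gq by linarith
  qed
qed

section \<open>The error at the initial time\<close>

lemma zero_mem: "0 \<in> {0..T}" using T by simp

text \<open>The initial data are attained only up to null sets, which the defining equations of the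
  projection do not see.\<close>

lemma projection_0: "elliptic_projection G l N a (u 0) (p 0) (uh 0) (ph 0)"
proof -
  have E: "elliptic_projection G l N a u0 p0 (uh 0) (ph 0)"
    using semidiscrete by (simp add: semidiscrete_solution_def)
  have eq: "net_eq G l (u 0) u0" "net_eq G l (p 0) p0" using wave by (auto simp: wave_solution_def)
  note U = u_path(1)[OF zero_mem] and P = p_path(1)[OF zero_mem]
  have U0: "u0 \<in> Hs_net 1 G l" and P0: "p0 \<in> L" using u0 p0 H1_net_L2(1) by (auto simp: Hdiv_net_def H10_net_def)
  have D: "net_eq G l (D (u 0)) (D u0)"
    unfolding net_eq_def net_deriv_def
  proof
    fix e assume e: "e \<in> parcs G"
    have "weak_deriv (l e) (u 0 e) = weak_deriv (l e) (u0 e)"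
      by (rule weak_deriv_cong_AE[OF L2_int_measurable[OF L2_netD[OF H1_net_L2(1)[OF U] e]]])
        (use eq(1) e in \<open>auto simp: net_eq_def\<close>)
    then show "AE x in lebesgue_on {0..l e}. weak_deriv (l e) (u 0 e) x = weak_deriv (l e) (u0 e) x" by simp
  qed
  have aU: "net_eq G l (net_mult a (u 0)) (net_mult a u0)"
    using eq(1) unfolding net_eq_def net_mult_def by (auto elim!: eventually_mono)
  have 1: "ip (net_mult a (u 0)) v = ip (net_mult a u0) v" if "v \<in> V" for v
    by (rule ip_net_cong[OF L2_net_mult[OF a pos(1) H1_net_L2(1)[OF U]] L2_net_mult[OF a pos(1) H1_net_L2(1)[OF U0]] Vh_L2[OF that] aU])
  have 2: "ip (p 0) (D v) = ip p0 (D v)" if "v \<in> V" for v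
    by (rule ip_net_cong[OF P P0 H1_net_L2(2)[OF Vh_H1[OF that]] eq(2)])
  have 3: "ip (D (u 0)) q = ip (D u0) q" if "q \<in> Q" for q
    by (rule ip_net_cong[OF H1_net_L2(2)[OF U] H1_net_L2(2)[OF U0] Qh_L2[OF that] D])
  show ?thesis using E 1 2 3 unfolding elliptic_projection_def by metis
qed

text \<open>The analysis of a mixed method: coercivity on the kernel of the derivative bounds
  \<open>eu 0\<close> and contributes \<open>C1 / C0\<close>; the right inverse \<open>W\<close>, in
  the role of an inf-sup condition, bounds \<open>ep 0\<close> and contributes the term with
  \<open>C1 * K\<close>.\<close>

lemma initial_error:
  "nrm (eu 0) + nrm (ep 0) \<le> (C1 / C0 + C1 * K * (C1 / C0 + 1)) * nrm (u 0 - I1 (u 0))"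
proof -
  note M = e_mem[OF zero_mem] and U = u_path(1)[OF zero_mem] and P = p_path(1)[OF zero_mem]
  note H = semi(1,3)[OF zero_mem]
  have UL: "u 0 \<in> L" "D (u 0) \<in> L" using H1_net_L2[OF U] by auto
  have HL: "uh 0 \<in> L" "ph 0 \<in> L" using Vh_L2[OF H(1)] Qh_L2[OF H(2)] by auto
  have mL: "x \<in> L \<Longrightarrow> net_mult a x \<in> L" for x by (rule L2_net_mult[OF a pos(1)])
  let ?\<eta> = "u 0 - I1 (u 0)"
  have \<eta>L: "?\<eta> \<in> L" by (rule L2.closed(2)[OF UL(1) I1_L])
  have E1: "ip (net_mult a (uh 0)) v - ip (ph 0) (D v) = ip (net_mult a (u 0)) v - ip (p 0) (D v)" if "v \<in> V" for v
    using projection_0 that unfolding elliptic_projection_def by blast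
  have E2: "ip (D (uh 0)) q = ip (D (u 0)) q" if "q \<in> Q" for q
    using projection_0 that unfolding elliptic_projection_def by blast
  have Dz: "ip (D (eu 0)) q = 0" if q: "q \<in> Q" for q
  proof -
    have qL: "q \<in> L" by (rule Qh_L2[OF q])
    have "ip (D (I1 (u 0))) q = ip (P0 (D (u 0))) q"
      by (rule ip_net_cong[OF H1_net_L2(2)[OF I1_H1] P0_L qL I1_deriv])
    also have "\<dots> = ip (D (u 0)) q" by (rule P0_orth[OF UL(2) q])
    finally have i: "ip (D (I1 (u 0))) q = ip (D (u 0)) q" .
    have "ip (D (eu 0)) q = ip (D (uh 0)) q - ip (D (I1 (u 0))) q"
      using net_deriv_lincomb_ip[OF Vh_H1[OF H(1)] I1_H1[of "u 0"] qL, of "-1"] by (simp add: eu_def)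
    then show ?thesis using i E2[OF q] by simp
  qed
  \<comment> \<open>The derivative of \<open>eu 0\<close> lies in \<open>Qh\<close> and is
    orthogonal to \<open>Qh\<close>, so it is null and the terms with \<open>p\<close> drop out when
    testing with \<open>eu 0\<close>.\<close>
  have "ip (D (eu 0)) (D (eu 0)) = 0" by (rule Dz[OF Vh_deriv_Qh[OF M(1)]])
  then have Dn: "nrm (D (eu 0)) = 0" by (simp add: L2_norm_def)
  have Dip: "ip x (D (eu 0)) = 0" if "x \<in> L" for x
    using L2.Cauchy_Schwarz[OF that H1_net_L2(2)[OF Vh_H1[OF M(1)]]] Dn by simp
  have "C0 * (nrm (eu 0) * nrm (eu 0)) \<le> ip (net_mult a (eu 0)) (eu 0)"
    using ip_net_mult_lower[OF a pos(1) M(5)] L2.nrm_sq[OF M(5)] by (simp add: power2_eq_square)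
  also have "\<dots> = ip (net_mult a ?\<eta>) (eu 0)"
  proof -
    have "ip (net_mult a (eu 0)) (eu 0) = ip (net_mult a (uh 0)) (eu 0) - ip (net_mult a (I1 (u 0))) (eu 0)"
      unfolding eu_def[of 0] net_mult_diff using HL mL I1_L by (intro L2.ip_diff L2.closed) auto
    moreover have "ip (net_mult a ?\<eta>) (eu 0) = ip (net_mult a (u 0)) (eu 0) - ip (net_mult a (I1 (u 0))) (eu 0)"
      unfolding net_mult_diff using UL mL I1_L M by (intro L2.ip_diff) auto
    ultimately show ?thesis using E1[OF M(1)] Dip[OF HL(2)] Dip[OF P] by simp
  qed
  also have "\<dots> \<le> C1 * nrm ?\<eta> * nrm (eu 0)"
    using order_trans[OF L2.Cauchy_Schwarz[OF mL[OF \<eta>L] M(5)] mult_right_mono[OF L2_norm_mult_le[OF a pos(1,2) \<eta>L]]] by simp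
  finally have "(C0 * nrm (eu 0)) * nrm (eu 0) \<le> (C1 * nrm ?\<eta>) * nrm (eu 0)" by simp
  then have "nrm (eu 0) = 0 \<or> C0 * nrm (eu 0) \<le> C1 * nrm ?\<eta>"
    using L2_norm_nonneg[of G l "eu 0"] mult_right_le_imp_le[of "C0 * nrm (eu 0)" "nrm (eu 0)" "C1 * nrm ?\<eta>"]
    by linarith
  then have 1: "nrm (eu 0) \<le> C1 / C0 * nrm ?\<eta>"
    using pos by (auto simp: pos_le_divide_eq mult.commute)
  \<comment> \<open>A test function whose derivative acts on \<open>Qh\<close> like
    \<open>ep 0\<close>, so that the pressure error becomes visible in the first equation of the
    projection.\<close>
  define w where "w = W (ep 0)"
  have w: "w \<in> V" "w \<in> L" "D w \<in> L" unfolding w_def using WV[OF M(6)] Vh_L2 H1_net_L2(2)[OF Vh_H1] by auto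
  have wn: "nrm w \<le> K * nrm (ep 0)" unfolding w_def by (rule W_norm[OF M(6)])
  have "nrm (ep 0) * nrm (ep 0) = ip (ep 0) (D w)"
    using W_ip[OF M(6,2)] L2.nrm_sq[OF M(6)] by (simp add: w_def power2_eq_square)
  also have "\<dots> = ip (ph 0) (D w) - ip (P0 (p 0)) (D w)"
    unfolding ep_def using HL P0_L w by (intro L2.ip_diff) auto
  also have "ip (P0 (p 0)) (D w) = ip (p 0) (D w)" by (rule P0_orth[OF P Vh_deriv_Qh[OF w(1)]])
  also have "ip (ph 0) (D w) - ip (p 0) (D w) = ip (net_mult a (uh 0 - u 0)) w"
    unfolding net_mult_diff using E1[OF w(1)] L2.ip_diff[OF mL[OF HL(1)] mL[OF UL(1)] w(2)] by linarith
  also have "\<dots> \<le> (C1 * (nrm (eu 0) + nrm ?\<eta>)) * (K * nrm (ep 0))"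
  proof -
    have dL: "uh 0 - u 0 \<in> L" by (rule L2.closed(2)[OF HL(1) UL(1)])
    have "uh 0 - u 0 = eu 0 - ?\<eta>" by (simp add: eu_def)
    then have "nrm (uh 0 - u 0) \<le> nrm (eu 0) + nrm ?\<eta>" using L2.nrm_diff[OF M(5) \<eta>L] by (simp only:)
    then have "nrm (net_mult a (uh 0 - u 0)) \<le> C1 * (nrm (eu 0) + nrm ?\<eta>)"
      using L2_norm_mult_le[OF a pos(1,2) dL] mult_left_mono[of _ _ C1] pos by (meson less_imp_le order_trans)
    then have "nrm (net_mult a (uh 0 - u 0)) * nrm w \<le> (C1 * (nrm (eu 0) + nrm ?\<eta>)) * (K * nrm (ep 0))"
      using wn pos by (intro mult_mono) auto
    then show ?thesis using L2.Cauchy_Schwarz[OF mL[OF dL] w(2)] by linarith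
  qed
  also have "\<dots> = (C1 * K * (nrm (eu 0) + nrm ?\<eta>)) * nrm (ep 0)" by simp
  finally have "nrm (ep 0) = 0 \<or> nrm (ep 0) \<le> C1 * K * (nrm (eu 0) + nrm ?\<eta>)"
    using L2_norm_nonneg[of G l "ep 0"]
      mult_right_le_imp_le[of "nrm (ep 0)" "nrm (ep 0)" "C1 * K * (nrm (eu 0) + nrm ?\<eta>)"] by linarith
  moreover have "0 \<le> C1 * K * (nrm (eu 0) + nrm ?\<eta>)" using pos by simp
  ultimately have "nrm (ep 0) \<le> C1 * K * (nrm (eu 0) + nrm ?\<eta>)" by auto
  also have "\<dots> \<le> C1 * K * (C1 / C0 * nrm ?\<eta> + nrm ?\<eta>)"
    using 1 pos by (intro mult_left_mono add_right_mono) auto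
  also have "\<dots> = C1 * K * (C1 / C0 + 1) * nrm ?\<eta>" by (simp only: distrib_right mult.assoc mult_1_left)
  finally show ?thesis using 1 by (simp only: distrib_right)
qed

section \<open>Approximation errors along the solution and the assembled estimate\<close>

definition \<kappa> :: real where "\<kappa> = (1 + (\<Sum>e\<in>parcs G. l e)) * mesh_size G l N powr m"

lemma \<kappa>_nonneg: "0 \<le> \<kappa>" using total_length_nonneg by (simp add: \<kappa>_def)

text \<open>Write \<open>h\<close> as the product of its powers with exponents \<open>1 - m\<close>
  and \<open>m\<close>; the first is at most 1 plus the total length, since cells are no longer than
  edges. Thus the interpolation of \<open>u\<close> always uses one full derivative, and fractional
  estimates are confined to \<open>p\<close>.\<close>

lemma edge_mesh_size_le_\<kappa>:
  assumes e: "e \<in> parcs G"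
  shows "edge_mesh_size l N e \<le> \<kappa>"
proof -
  let ?h = "edge_mesh_size l N e" and ?\<Lambda> = "1 + (\<Sum>e\<in>parcs G. l e)"
  note h = edge_mesh_size_pos[OF e]
  have "l e \<le> (\<Sum>e\<in>parcs G. l e)"
    by (rule member_le_sum[OF e]) (use finite_arcs length_pos in \<open>simp_all add: order_less_imp_le\<close>)
  then have le: "?h \<le> ?\<Lambda>" using edge_mesh_size_le_length[OF e] by linarith
  have "?h = ?h powr ((1 - m) + m)" using h by simp
  also have "\<dots> = ?h powr (1 - m) * ?h powr m" by (rule powr_add)
  also have "\<dots> \<le> ?\<Lambda> * mesh_size G l N powr m"
  proof (rule mult_mono)
    have "?h powr (1 - m) \<le> ?\<Lambda> powr (1 - m)" using le h m by (intro powr_mono2) auto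
    also have "\<dots> \<le> ?\<Lambda> powr 1" using m total_length_nonneg by (intro powr_mono) auto
    finally show "?h powr (1 - m) \<le> ?\<Lambda>" using total_length_nonneg by simp
    show "?h powr m \<le> mesh_size G l N powr m" using edge_mesh_size_le[OF e] h m by (intro powr_mono2) auto
  qed (use total_length_nonneg in auto)
  finally show ?thesis by (simp add: \<kappa>_def)
qed

lemma I1_error_\<kappa>: "v \<in> Hs_net 1 G l \<Longrightarrow> nrm (v - I1 v) \<le> \<kappa> * nrm (D v)"
  by (rule I1_error[OF _ \<kappa>_nonneg edge_mesh_size_le_\<kappa>])

lemma P0_error_\<kappa>:
  assumes q: "q \<in> Hs_net m G l"
  shows "nrm (q - P0 q) \<le> \<kappa> * Hs_norm m G l q"
proof -
  let ?H = "mesh_size G l N powr m"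
  have "(nrm (q - P0 q))\<^sup>2 \<le> (\<Sum>e\<in>parcs G. ?H\<^sup>2 * Hs_int_sq m (l e) (q e))"
    unfolding L2_norm_sq
  proof (rule sum_mono)
    fix e assume e: "e \<in> parcs G"
    have "q e \<in> Hs_int m (l e)" using q e by (simp add: Hs_net_def)
    from edge_mesh.Hs_pmean_error[OF em[OF e] m this]
    have "(LINT x|lebesgue_on {0..l e}. ((q - P0 q) e x)\<^sup>2) \<le> (edge_mesh_size l N e powr m)\<^sup>2 * Hs_int_sq m (l e) (q e)"
      using e h_eq[OF e] by (simp add: P0_def)
    also have "\<dots> \<le> ?H\<^sup>2 * Hs_int_sq m (l e) (q e)"
      using edge_mesh_size_le[OF e] edge_mesh_size_pos[OF e] m
      by (intro mult_right_mono power_mono powr_mono2) (auto simp: Hs_int_sq_def Hks_sq_nonneg)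
    finally show "(LINT x|lebesgue_on {0..l e}. ((q - P0 q) e x)\<^sup>2) \<le> ?H\<^sup>2 * Hs_int_sq m (l e) (q e)" .
  qed
  also have "\<dots> = (?H * Hs_norm m G l q)\<^sup>2"
    unfolding Hs_norm_def power_mult_distrib
    by (subst real_sqrt_pow2) (auto simp: sum_distrib_left Hs_int_sq_def Hks_sq_nonneg intro!: sum_nonneg)
  finally have "nrm (q - P0 q) \<le> ?H * Hs_norm m G l q"
    by (rule power2_le_imp_le) (simp add: Hs_norm_nonneg)
  also have "\<dots> \<le> \<kappa> * Hs_norm m G l q"
  proof (rule mult_right_mono[OF _ Hs_norm_nonneg])
    have "1 * ?H \<le> \<kappa>" unfolding \<kappa>_def using total_length_nonneg by (intro mult_right_mono) auto
    then show "?H \<le> \<kappa>" by simp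
  qed
  finally show ?thesis .
qed

definition X :: "real \<Rightarrow> real" where
  "X s = Hs_norm (m + 1) G l (du s) + Hs_norm m G l (dp s)"

lemma X_nonneg: "0 \<le> X s" by (simp add: X_def Hs_norm_nonneg)

definition sup_X :: "real \<Rightarrow> real" where
  "sup_X t = (SUP s\<in>{0..t}. exp (- S.rate * (t - s) / 2) * X s)"

text \<open>The paths are bounded in their norms, so each weighted value lies below the supremum;
  multiplying by the inverse weight gives the form needed.\<close>

lemma X_le_sup:
  assumes t: "t \<in> {0..T}" and s: "s \<in> {0..t}"
  shows "X s \<le> sup_X t * exp (S.rate * (t - s) / 2)"
proof -
  obtain B1 where B1: "\<And>t. t \<in> {0..T} \<Longrightarrow> Hs_norm (m + 1) G l (du t) \<le> B1"
  proof (rule Hs_net_bounded)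
    show "C0_time T (Hs_net (m + 1) G l) (Hs_norm (m + 1) G l) du" using uC1 unfolding C1_time_def by blast
  qed (use T length_pos in auto)
  obtain B2 where B2: "\<And>t. t \<in> {0..T} \<Longrightarrow> Hs_norm m G l (dp t) \<le> B2"
  proof (rule Hs_net_bounded)
    show "C0_time T (Hs_net m G l) (Hs_norm m G l) dp" using pC1 unfolding C1_time_def by blast
  qed (use T length_pos in auto)
  have "bdd_above ((\<lambda>s. exp (- S.rate * (t - s) / 2) * X s) ` {0..t})"
  proof (rule bdd_aboveI2)
    fix r assume r: "r \<in> {0..t}"
    have "X r \<le> B1 + B2" unfolding X_def using B1[of r] B2[of r] r t by auto
    moreover have "exp (- S.rate * (t - r) / 2) \<le> 1" using S.rate_pos r by simp
    ultimately show "exp (- S.rate * (t - r) / 2) * X r \<le> 1 * (B1 + B2)"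
      using X_nonneg by (intro mult_mono) auto
  qed
  then have "exp (- S.rate * (t - s) / 2) * X s \<le> sup_X t" unfolding sup_X_def by (rule cSUP_upper[OF s])
  then have "exp (- S.rate * (t - s) / 2) * X s * exp (S.rate * (t - s) / 2) \<le> sup_X t * exp (S.rate * (t - s) / 2)"
    by (rule mult_right_mono) simp
  moreover have "exp (- S.rate * (t - s) / 2) * exp (S.rate * (t - s) / 2) = 1"
    unfolding exp_add[symmetric] by simp
  then have "exp (- S.rate * (t - s) / 2) * X s * exp (S.rate * (t - s) / 2) = X s"
    by (metis mult.commute mult.left_commute mult.right_neutral)
  ultimately show ?thesis by linarith
qed

lemma sup_X_nonneg:
  assumes t: "t \<in> {0..T}"
  shows "0 \<le> sup_X t"
  using X_le_sup[OF t, of t] X_nonneg[of t] t by simp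

text \<open>The claim contains \<open>u\<close> only at the final time, so earlier values are
  reached backwards by the mean value inequality. At intermediate times the factor from
  \<open>X_le_sup\<close> is at most that at \<open>s\<close>.\<close>

lemma deriv_u_le:
  assumes t: "t \<in> {0..T}" and s: "s \<in> {0..t}"
  shows "nrm (D (u s)) \<le> Hs_norm (m + 1) G l (u t) + (t - s) * (sup_X t * exp (S.rate * (t - s) / 2))"
proof -
  have sub: "{s..t} \<subseteq> {0..T}" using s t by auto
  have sT: "s \<in> {0..T}" using s t by auto
  have "nrm (D (u t) - D (u s)) \<le> (t - s) * (sup_X t * exp (S.rate * (t - s) / 2))"
  proof (rule L2.nrm_increment_le)
    show "s \<le> t" using s by simp
    fix r assume r: "r \<in> {s..t}"
    then have r': "r \<in> {0..T}" "r \<in> {0..t}" using sub s by auto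
    show "D (u r) \<in> L" "D (du r) \<in> L" using H1_net_L2(2) u_path(1,2)[OF r'(1)] by auto
    show "L2.vderiv G l (\<lambda>s. D (u s)) (D (du r)) r {s..t}"
      using u_path(4)[OF r'(1)] sub unfolding L2.vderiv_def by (rule tendsto_within_subset)
    have "nrm (D (du r)) \<le> X r"
      using deriv_norm_le_Hs_norm[OF m(1), of G l "du r"] Hs_norm_nonneg[of m G l "dp r"] unfolding X_def by linarith
    also have "\<dots> \<le> sup_X t * exp (S.rate * (t - r) / 2)" by (rule X_le_sup[OF t r'(2)])
    also have "\<dots> \<le> sup_X t * exp (S.rate * (t - s) / 2)"
      using r S.rate_pos sup_X_nonneg[OF t] by (intro mult_left_mono) auto
    finally show "nrm (D (du r)) \<le> sup_X t * exp (S.rate * (t - s) / 2)" .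
  qed
  moreover have "nrm (D (u t) - (D (u t) - D (u s))) \<le> nrm (D (u t)) + nrm (D (u t) - D (u s))"
    using H1_net_L2(2) u_path(1)[OF t] u_path(1)[OF sT] by (intro L2.nrm_diff L2.closed) auto
  moreover have "nrm (D (u t)) \<le> Hs_norm (m + 1) G l (u t)" by (rule deriv_norm_le_Hs_norm[OF m(1)])
  ultimately show ?thesis by simp
qed

lemma residual_le:
  assumes t: "t \<in> {0..T}" and s: "s \<in> {0..t}"
  shows "residual s \<le> C1 * \<kappa> * Hs_norm (m + 1) G l (u t) + C1 * \<kappa> * (1 + 2 / S.rate) * sup_X t * exp (S.rate * (t - s))"
proof -
  let ?U = "Hs_norm (m + 1) G l (u t)" and ?S = "sup_X t" and ?E = "exp (S.rate * (t - s) / 2)"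
  have sT: "s \<in> {0..T}" using s t by auto
  have dpm: "dp s \<in> Hs_net m G l" using pC1 sT unfolding C1_time_def C0_time_def by blast
  have r: "0 < S.rate" by (rule S.rate_pos)
  have S: "0 \<le> ?S" by (rule sup_X_nonneg[OF t])
  have "nrm (du s - I1 (du s)) \<le> \<kappa> * Hs_norm (m + 1) G l (du s)"
    by (rule order_trans[OF I1_error_\<kappa>[OF u_path(2)[OF sT]] mult_left_mono[OF deriv_norm_le_Hs_norm[OF m(1)] \<kappa>_nonneg]])
  moreover have "nrm (dp s - P0 (dp s)) \<le> \<kappa> * Hs_norm m G l (dp s)" by (rule P0_error_\<kappa>[OF dpm])
  moreover have "nrm (u s - I1 (u s)) \<le> \<kappa> * (?U + (t - s) * (?S * ?E))"
    by (rule order_trans[OF I1_error_\<kappa>[OF u_path(1)[OF sT]] mult_left_mono[OF deriv_u_le[OF t s] \<kappa>_nonneg]])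
  ultimately have "nrm (du s - I1 (du s)) + nrm (u s - I1 (u s)) + nrm (dp s - P0 (dp s))
      \<le> \<kappa> * X s + \<kappa> * (?U + (t - s) * (?S * ?E))"
    unfolding X_def distrib_left by linarith
  also have "\<dots> = \<kappa> * (X s + ?U + (t - s) * (?S * ?E))" by (simp add: distrib_left)
  also have "\<dots> \<le> \<kappa> * (?U + (1 + 2 / S.rate) * ?S * exp (S.rate * (t - s)))"
  proof (rule mult_left_mono[OF _ \<kappa>_nonneg])
    have E2: "exp (S.rate * (t - s)) = ?E * ?E" unfolding exp_add[symmetric] by simp
    have E1: "1 \<le> ?E" using r s by simp
    have "S.rate * (t - s) / 2 \<le> ?E" using exp_ge_add_one_self[of "S.rate * (t - s) / 2"] by linarith
    then have "t - s \<le> 2 / S.rate * ?E" using r by (simp add: field_simps)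
    then have "(t - s) * (?S * ?E) \<le> (2 / S.rate * ?E) * (?S * ?E)" using S by (intro mult_right_mono) auto
    moreover have "?S * ?E \<le> ?S * ?E * ?E" using mult_left_mono[OF E1, of "?S * ?E"] S by simp
    moreover have "(2 / S.rate * ?E) * (?S * ?E) = 2 / S.rate * (?S * ?E * ?E)" by (simp only: mult_ac)
    moreover have "(1 + 2 / S.rate) * ?S * exp (S.rate * (t - s)) = ?S * ?E * ?E + 2 / S.rate * (?S * ?E * ?E)"
      unfolding E2 by (simp only: distrib_right mult_1_left mult.assoc)
    ultimately show "X s + ?U + (t - s) * (?S * ?E) \<le> ?U + (1 + 2 / S.rate) * ?S * exp (S.rate * (t - s))"
      using X_le_sup[OF t s] by linarith
  qed
  finally have "residual s \<le> C1 * (\<kappa> * (?U + (1 + 2 / S.rate) * ?S * exp (S.rate * (t - s))))"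
    unfolding residual_def using pos by (intro mult_left_mono) auto
  moreover have "C1 * (\<kappa> * (x + r * y * z)) = C1 * \<kappa> * x + C1 * \<kappa> * r * y * z" for x r y z
    by (simp add: algebra_simps)
  ultimately show ?thesis by (simp only:)
qed

text \<open>The first factor comes from \<open>\<kappa>\<close>. In the second, 1 stands for the
  interpolation errors, \<open>sqrt (8 / C0)\<close> converts the Lyapunov functional back to norms,
  the product with \<open>sqrt (C1 / 2 + C0 / 4)\<close> is its initial value, and
  \<open>1 + 3 / S.rate\<close> adds \<open>1 / S.rate\<close> from \<open>u t\<close> to
  \<open>1 + 2 / S.rate\<close> from the supremum.\<close>

lemma error_bound:
  assumes t: "t \<in> {0..T}"
  shows "nrm (net_diff (u t) (uh t)) + nrm (net_diff (p t) (ph t))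
    \<le> (1 + (\<Sum>e\<in>parcs G. l e)) * (1 + sqrt (8 / C0) * (sqrt (C1 / 2 + C0 / 4) * (C1 / C0 + C1 * K * (C1 / C0 + 1))
        + S.gain * C1 * (1 + 3 / S.rate))) * mesh_size G l N powr m *
      (Hs_norm (m + 1) G l (u t) + Hs_norm m G l (p t) + t * sup_X t)"
proof -
  let ?U = "Hs_norm (m + 1) G l (u t)" and ?P = "Hs_norm m G l (p t)" and ?S = "sup_X t" and ?r = "S.rate"
  let ?\<Lambda> = "\<lambda>s. S.lyap (eu s) (ep s)"
  define c2 where "c2 = C1 / 2 + C0 / 4"
  define k0 where "k0 = C1 / C0 + C1 * K * (C1 / C0 + 1)"
  define Z where "Z = ?U + t * ?S"
  have r: "0 < ?r" by (rule S.rate_pos)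
  have nn: "0 \<le> ?U" "0 \<le> ?P" "0 \<le> ?S" "0 \<le> t" "0 \<le> c2" "0 \<le> k0" "0 \<le> S.gain"
    using Hs_norm_nonneg sup_X_nonneg[OF t] t pos load_gain_nonneg[OF pos] by (auto simp: c2_def k0_def)
  have Z: "0 \<le> Z" "?U \<le> Z" "t * ?S \<le> Z" using nn by (auto simp: Z_def)
  have lnn: "0 \<le> ?\<Lambda> s" if "s \<in> {0..T}" for s using e_mem(5,6)[OF that] by (rule S.lyap_nonneg)
  have der: "(?\<Lambda> has_real_derivative
    (ip (net_mult c (deu s)) (eu s) + ip (net_mult b (dep s)) (ep s)
      - S.\<delta> * (ip (net_mult c (deu s)) (W (net_mult b (ep s))) + ip (net_mult c (eu s)) (W (net_mult b (dep s))))))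
    (at s)" if "s \<in> {0<..<t}" for s
  proof -
    have "at s within {0..T} = at s" by (rule at_within_Icc_at) (use that t in auto)
    then show ?thesis using lyap_has_derivative[of s] that t by auto
  qed
  have cont: "continuous_on {0..t} ?\<Lambda>"
  proof (rule continuous_on_subset)
    show "continuous_on {0..T} ?\<Lambda>"
      unfolding continuous_on_eq_continuous_within using lyap_has_derivative has_field_derivative_imp_has_derivative has_derivative_continuous by blast
    show "{0..t} \<subseteq> {0..T}" using t by auto
  qed
  have L: "sqrt (?\<Lambda> t) \<le> exp (- ?r * t) * sqrt (?\<Lambda> 0)
      + S.gain * (C1 * \<kappa> * ?U / ?r + C1 * \<kappa> * (1 + 2 / ?r) * ?S * t)"
  proof (rule sqrt_gronwall[OF nn(4) r nn(7) _ _ cont, where \<rho> = residual])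
    show "0 \<le> C1 * \<kappa> * ?U" "0 \<le> C1 * \<kappa> * (1 + 2 / ?r) * ?S"
      using pos \<kappa>_nonneg nn r by (auto intro!: mult_nonneg_nonneg add_nonneg_nonneg)
    show "0 \<le> ?\<Lambda> s" if "s \<in> {0..t}" for s using lnn[of s] that t by auto
    show "\<exists>D. (?\<Lambda> has_real_derivative D) (at s) \<and> D \<le> - (2 * ?r) * ?\<Lambda> s + S.gain * residual s * sqrt (?\<Lambda> s)"
      if "s \<in> {0<..<t}" for s
      using der[OF that] lyap_rate[of s] that t by auto
    show "residual s \<le> C1 * \<kappa> * ?U + C1 * \<kappa> * (1 + 2 / ?r) * ?S * exp (?r * (t - s))" if "s \<in> {0<..<t}" for s
      by (rule residual_le[OF t]) (use that in auto)
  qed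
  have init: "exp (- ?r * t) * sqrt (?\<Lambda> 0) \<le> \<kappa> * (sqrt c2 * k0 * Z)"
  proof -
    let ?E = "exp (?r * t / 2)"
    have "nrm (eu 0) + nrm (ep 0) \<le> k0 * nrm (u 0 - I1 (u 0))" unfolding k0_def by (rule initial_error)
    also have "\<dots> \<le> k0 * (\<kappa> * (?U + t * (?S * ?E)))"
      using order_trans[OF I1_error_\<kappa>[OF u_path(1)[OF zero_mem]] mult_left_mono[OF deriv_u_le[OF t, of 0] \<kappa>_nonneg]] nn
      by (intro mult_left_mono) auto
    finally have i: "nrm (eu 0) + nrm (ep 0) \<le> k0 * (\<kappa> * (?U + t * (?S * ?E)))" .
    have "?\<Lambda> 0 \<le> c2 * ((nrm (eu 0))\<^sup>2 + (nrm (ep 0))\<^sup>2)"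
      unfolding c2_def by (rule S.lyap_bounds(2)[OF e_mem(5,6)[OF zero_mem]])
    also have "\<dots> \<le> c2 * (nrm (eu 0) + nrm (ep 0))\<^sup>2"
      using nn by (intro mult_left_mono) (simp_all add: power2_sum)
    finally have "sqrt (?\<Lambda> 0) \<le> sqrt (c2 * (nrm (eu 0) + nrm (ep 0))\<^sup>2)" by (rule real_sqrt_le_mono)
    also have "\<dots> = sqrt c2 * (nrm (eu 0) + nrm (ep 0))" by (simp add: real_sqrt_mult)
    also have "\<dots> \<le> sqrt c2 * (k0 * (\<kappa> * (?U + t * (?S * ?E))))" using i nn by (intro mult_left_mono) auto
    finally have "exp (- ?r * t) * sqrt (?\<Lambda> 0) \<le> exp (- ?r * t) * (sqrt c2 * (k0 * (\<kappa> * (?U + t * (?S * ?E)))))"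
      by (intro mult_left_mono) auto
    also have "\<dots> = (\<kappa> * (sqrt c2 * k0)) * (exp (- ?r * t) * (?U + t * (?S * ?E)))" by (simp only: mult_ac)
    also have "\<dots> \<le> (\<kappa> * (sqrt c2 * k0)) * Z"
    proof (rule mult_left_mono)
      have a1: "exp (- ?r * t) * ?U \<le> 1 * ?U" using r nn by (intro mult_right_mono) auto
      \<comment> \<open>The decay of the initial error outweighs the exponential that arises from
        estimating \<open>u 0\<close> by \<open>u t\<close>.\<close>
      have "exp (- ?r * t) * ?E \<le> 1" unfolding exp_add[symmetric] using r nn by simp
      then have "(exp (- ?r * t) * ?E) * (t * ?S) \<le> 1 * (t * ?S)" using nn by (intro mult_right_mono) auto
      moreover have "exp (- ?r * t) * (?U + t * (?S * ?E)) = exp (- ?r * t) * ?U + (exp (- ?r * t) * ?E) * (t * ?S)"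
        by (simp add: distrib_left mult_ac)
      ultimately show "exp (- ?r * t) * (?U + t * (?S * ?E)) \<le> Z" using a1 unfolding Z_def by linarith
      show "0 \<le> \<kappa> * (sqrt c2 * k0)" using \<kappa>_nonneg nn by simp
    qed
    finally show ?thesis by (simp only: mult.assoc)
  qed
  have load: "C1 * \<kappa> * ?U / ?r + C1 * \<kappa> * (1 + 2 / ?r) * ?S * t \<le> \<kappa> * (C1 * (1 + 3 / ?r) * Z)"
  proof -
    have "C1 * \<kappa> * ?U / ?r + C1 * \<kappa> * (1 + 2 / ?r) * ?S * t = C1 * \<kappa> * (1 / ?r * ?U + (1 + 2 / ?r) * (t * ?S))"
      by (simp add: distrib_left distrib_right mult_ac)
    also have "\<dots> \<le> C1 * \<kappa> * (1 / ?r * Z + (1 + 2 / ?r) * Z)"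
      using Z r pos \<kappa>_nonneg by (intro mult_left_mono add_mono) auto
    also have "1 / ?r * Z + (1 + 2 / ?r) * Z = (1 + 3 / ?r) * Z" by (simp add: distrib_right)
    finally show ?thesis by (simp only: mult_ac)
  qed
  define B where "B = sqrt c2 * k0 + S.gain * C1 * (1 + 3 / ?r)"
  have "sqrt (?\<Lambda> t) \<le> \<kappa> * (sqrt c2 * k0 * Z) + S.gain * (\<kappa> * (C1 * (1 + 3 / ?r) * Z))"
    using L init mult_left_mono[OF load nn(7)] by linarith
  also have "\<dots> = \<kappa> * (B * Z)" by (simp only: B_def distrib_left distrib_right mult_ac)
  finally have "sqrt (8 / C0) * sqrt (?\<Lambda> t) \<le> sqrt (8 / C0) * (\<kappa> * (B * Z))" using pos by (intro mult_left_mono) auto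
  with S.norm_sum_le_lyap[OF e_mem(5,6)[OF t]]
  have e: "nrm (eu t) + nrm (ep t) \<le> sqrt (8 / C0) * (\<kappa> * (B * Z))" by linarith
  have mem: "u t \<in> L" "p t \<in> L" "uh t \<in> L" "ph t \<in> L"
    using H1_net_L2(1)[OF u_path(1)[OF t]] p_path(1)[OF t] Vh_L2[OF semi(1)[OF t]] Qh_L2[OF semi(3)[OF t]] by auto
  have "nrm (net_diff (u t) (uh t)) \<le> nrm (u t - I1 (u t)) + nrm (eu t)"
  proof -
    have "net_diff (u t) (uh t) = (u t - I1 (u t)) - eu t" by (simp add: net_diff_eq eu_def)
    then show ?thesis using L2.nrm_diff[OF L2.closed(2)[OF mem(1) I1_L] e_mem(5)[OF t]] by metis
  qed
  moreover have "nrm (net_diff (p t) (ph t)) \<le> nrm (p t - P0 (p t)) + nrm (ep t)"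
  proof -
    have "net_diff (p t) (ph t) = (p t - P0 (p t)) - ep t" by (simp add: net_diff_eq ep_def)
    then show ?thesis using L2.nrm_diff[OF L2.closed(2)[OF mem(2) P0_L] e_mem(6)[OF t]] by metis
  qed
  moreover have "nrm (u t - I1 (u t)) \<le> \<kappa> * ?U"
    by (rule order_trans[OF I1_error_\<kappa>[OF u_path(1)[OF t]] mult_left_mono[OF deriv_norm_le_Hs_norm[OF m(1)] \<kappa>_nonneg]])
  moreover have "nrm (p t - P0 (p t)) \<le> \<kappa> * ?P"
    by (rule P0_error_\<kappa>) (use pC1 t in \<open>auto simp: C1_time_def C0_time_def\<close>)
  ultimately have "nrm (net_diff (u t) (uh t)) + nrm (net_diff (p t) (ph t))
      \<le> \<kappa> * (?U + ?P) + sqrt (8 / C0) * (\<kappa> * (B * Z))"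
    using e unfolding distrib_left by linarith
  also have "\<dots> = \<kappa> * (?U + ?P) + \<kappa> * (sqrt (8 / C0) * B * Z)" by (simp only: mult_ac)
  also have "\<dots> = \<kappa> * (?U + ?P + sqrt (8 / C0) * B * Z)" by (simp only: distrib_left)
  also have "\<dots> \<le> \<kappa> * ((1 + sqrt (8 / C0) * B) * (?U + ?P + t * ?S))"
  proof (rule mult_left_mono[OF _ \<kappa>_nonneg])
    have B: "0 \<le> B" unfolding B_def using nn pos r by (intro add_nonneg_nonneg mult_nonneg_nonneg) auto
    have "sqrt (8 / C0) * B * Z \<le> sqrt (8 / C0) * B * (?U + ?P + t * ?S)"
      using B pos nn by (intro mult_left_mono) (auto simp: Z_def)
    moreover have "(1 + sqrt (8 / C0) * B) * (?U + ?P + t * ?S) = (?U + ?P + t * ?S) + sqrt (8 / C0) * B * (?U + ?P + t * ?S)"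
      by (simp only: distrib_right mult_1_left)
    moreover have "0 \<le> t * ?S" using nn by simp
    ultimately show "?U + ?P + sqrt (8 / C0) * B * Z \<le> (1 + sqrt (8 / C0) * B) * (?U + ?P + t * ?S)" by linarith
  qed
  also have "\<dots> = (1 + (\<Sum>e\<in>parcs G. l e)) * (1 + sqrt (8 / C0) * B) * mesh_size G l N powr m * (?U + ?P + t * ?S)"
    unfolding \<kappa>_def by (simp only: mult_ac)
  finally show ?thesis unfolding B_def c2_def k0_def .
qed

end

theorem theorem8p5:
  fixes G :: "'v pair_pre_digraph" and l :: "'v \<times> 'v \<Rightarrow> real" and C0 C1 :: real
  assumes "metric_network G l" and "boundary_vertices G \<noteq> {}" and "0 < C0" and "0 < C1"
  shows "\<exists>C>0. \<exists>\<gamma>>0. \<forall>a b c.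
    bounded_coeff G l C0 C1 a \<and> bounded_coeff G l C0 C1 b \<and> bounded_coeff G l C0 C1 c \<longrightarrow>
    (\<forall>T>0. \<forall>N f df g dg u0 p0 u du p dp uh duh ph dph.
       network_mesh G N \<and>
       u0 \<in> Hdiv_net G l \<and> p0 \<in> H10_net G l \<and>
       W1q_time 1 T (L2_net G l) (L2_norm G l) f df \<and>
       W1q_time 1 T (L2_net G l) (L2_norm G l) g dg \<and>
       wave_solution G l a b c T f g u0 p0 u du p dp \<and>
       semidiscrete_solution G l N a b c T f g u0 p0 uh duh ph dph \<longrightarrow>
       (\<forall>m. 0 \<le> m \<and> m \<le> 1 \<and>
            C1_time T (Hs_net (m + 1) G l) (Hs_norm (m + 1) G l) u du \<and>
            C1_time T (Hs_net m G l) (Hs_norm m G l) p dp \<longrightarrow>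
          (\<forall>t\<in>{0..T}.
             L2_norm G l (net_diff (u t) (uh t)) + L2_norm G l (net_diff (p t) (ph t))
             \<le> C * mesh_size G l N powr m *
                 (Hs_norm (m + 1) G l (u t) + Hs_norm m G l (p t) +
                  t * (SUP s\<in>{0..t}. exp (- \<gamma> * (t - s) / 2) *
                         (Hs_norm (m + 1) G l (du s) + Hs_norm m G l (dp s)))))))"
proof -
  interpret network G l by unfold_locales (rule assms(1))
  obtain K where K: "0 < K" and W: "\<And>N. network_mesh G N \<Longrightarrow> \<exists>W.
    (\<forall>g\<in>L2_net G l. W g \<in> Vh G l N) \<and>
    (\<forall>g\<in>L2_net G l. \<forall>k\<in>L2_net G l. \<forall>c. W (g + c *\<^sub>R k) = W g + c *\<^sub>R W k) \<and>
    (\<forall>g\<in>L2_net G l. \<forall>q\<in>Qh G l N. ip_net G l q (net_deriv l (W g)) = ip_net G l q g) \<and>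
    (\<forall>g\<in>L2_net G l. L2_norm G l (W g) \<le> K * L2_norm G l g) \<and>
    (\<forall>v\<in>Vh G l N. L2_norm G l (W (net_deriv l v)) \<le> K * L2_norm G l v) \<and>
    (\<forall>g\<in>L2_net G l. (\<forall>q\<in>Qh G l N. ip_net G l g q = 0) \<longrightarrow> L2_norm G l (W g) = 0)"
    using lifting_operator[OF assms(2)] by blast
  \<comment> \<open>\<open>K\<close> stems from the network alone and is fixed before coefficients,
    final time and mesh, so \<gamma> and \<open>C\<close> depend only on the network and the bounds
    \<open>C0\<close> and \<open>C1\<close>.\<close>
  define \<gamma> where "\<gamma> = decay_rate C0 C1 K"
  define C where "C = (1 + (\<Sum>e\<in>parcs G. l e)) * (1 + sqrt (8 / C0) * (sqrt (C1 / 2 + C0 / 4) * (C1 / C0 + C1 * K * (C1 / C0 + 1))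
        + load_gain C0 C1 K * C1 * (1 + 3 / \<gamma>)))"
  have \<gamma>: "0 < \<gamma>" unfolding \<gamma>_def by (rule decay_rate_pos[OF assms(3,4) K])
  have "0 \<le> (\<Sum>e\<in>parcs G. l e)" by (rule sum_nonneg) (use length_pos in \<open>simp add: order_less_imp_le\<close>)
  then have C: "0 < C" unfolding C_def
    using assms(3,4) K \<gamma> load_gain_nonneg[OF assms(3,4) K]
    by (intro mult_pos_pos add_pos_nonneg mult_nonneg_nonneg add_nonneg_nonneg) auto
  show ?thesis
  proof (rule exI[of _ C], rule conjI[OF C], rule exI[of _ \<gamma>], rule conjI[OF \<gamma>], intro allI impI ballI, elim conjE)
    fix a b c T N f df g dg u0 p0 u du p dp uh duh ph dph m t
    assume co: "bounded_coeff G l C0 C1 a" "bounded_coeff G l C0 C1 b" "bounded_coeff G l C0 C1 c"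
      and T: "0 < (T::real)" and N: "network_mesh G N" and init: "u0 \<in> Hdiv_net G l" "p0 \<in> H10_net G l"
      and fg: "W1q_time 1 T (L2_net G l) (L2_norm G l) f df" "W1q_time 1 T (L2_net G l) (L2_norm G l) g dg"
      and sol: "wave_solution G l a b c T f g u0 p0 u du p dp"
        "semidiscrete_solution G l N a b c T f g u0 p0 uh duh ph dph"
      and m: "0 \<le> m" "m \<le> 1" and reg: "C1_time T (Hs_net (m + 1) G l) (Hs_norm (m + 1) G l) u du"
        "C1_time T (Hs_net m G l) (Hs_norm m G l) p dp" and t: "t \<in> {0..T}"
    obtain W where Wp: "\<forall>g\<in>L2_net G l. W g \<in> Vh G l N"
      "\<forall>g\<in>L2_net G l. \<forall>k\<in>L2_net G l. \<forall>c. W (g + c *\<^sub>R k) = W g + c *\<^sub>R W k"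
      "\<forall>g\<in>L2_net G l. \<forall>q\<in>Qh G l N. ip_net G l q (net_deriv l (W g)) = ip_net G l q g"
      "\<forall>g\<in>L2_net G l. L2_norm G l (W g) \<le> K * L2_norm G l g"
      "\<forall>v\<in>Vh G l N. L2_norm G l (W (net_deriv l v)) \<le> K * L2_norm G l v"
      "\<forall>g\<in>L2_net G l. (\<forall>q\<in>Qh G l N. ip_net G l g q = 0) \<longrightarrow> L2_norm G l (W g) = 0"
      using W[OF N] by blast
    interpret wave_error G l N W a b c C0 C1 K T m f g u0 p0 u du p dp uh duh ph dph
      by unfold_locales (use assms(3,4) K co T N init fg sol m reg Wp in \<open>simp_all add: W1q_time_def\<close>)
    show "L2_norm G l (net_diff (u t) (uh t)) + L2_norm G l (net_diff (p t) (ph t))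
        \<le> C * mesh_size G l N powr m * (Hs_norm (m + 1) G l (u t) + Hs_norm m G l (p t) +
          t * (SUP s\<in>{0..t}. exp (- \<gamma> * (t - s) / 2) * (Hs_norm (m + 1) G l (du s) + Hs_norm m G l (dp s))))"
      using error_bound[OF t] unfolding C_def \<gamma>_def sup_X_def X_def .
  qed
qed

end
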